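(* Let $n\geq 2$ and let $\Sigma$ be a complete $n$-dimensional properly immersed mean convex self-expander in $\mathbb{R}^{n+1}$. Let $B_R$ denote the geodesic ball of $\Sigma$ of radius $R$ centered at a fixed point of $\Sigma$. Suppose that $h$ is a positive function on $[\delta,\infty)$, for some $\delta>0$, such that $\frac{t}{h(t)}$ is nonincreasing on $[\delta,\infty)$ and $$\int_{\delta}^{\infty}\frac{t}{h(t)}\,dt=+\infty.$$ If there exists a constant $C>0$ such that the squared norm $|A|^2$ of the second fundamental form of $\Sigma$ satisfies $$\int_{B_R}|A|^2e^{\frac{|x|^2}{4}}d\sigma<C\,h(R)$$ for all $R$ sufficiently large, then $\Sigma$ must be a hyperplane $\mathbb{R}^n$ through the origin.
   Context: Manifolds are connected. A self-expander hypersurface is a smooth $n$-dimensional hypersurface $\Sigma$ immersed in Euclidean space $\mathbb{R}^{n+1}$ whose mean curvature satisfies $H=-\frac12\langle x,{\bf n}\rangle$, where $x$ is the position vector, ${\bf n}$ is the unit normal field, and $H$ is defined by ${\bf H}=-H{\bf n}$ with ${\bf H}=\sum_{i=1}^n(\bar\nabla_{e_i}e_i)^\perp$ the mean curvature vector ($\{e_i\}$ a local orthonormal frame of $\Sigma$, $\bar\nabla$ the Euclidean connection). It is mean convex if $H\ge 0$ on $\Sigma$. Properly immersed means that the preimage in $\Sigma$ of every compact subset of $\mathbb{R}^{n+1}$ is compact. $d\sigma$ is the volume element of the induced metric on $\Sigma$. *)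

theory Defs
  imports "HOL-Analysis.Analysis"
begin

section \<open>Smooth maps and manifolds\<close>

text \<open>Used for open \<open>S\<close> only: all iterated directional derivatives up to order \<open>k\<close>
  exist and are continuous.\<close>

primrec Ck_on :: "nat \<Rightarrow> 'a::real_normed_vector set \<Rightarrow> ('a \<Rightarrow> 'b::real_normed_vector) \<Rightarrow> bool" where
  "Ck_on 0 S f \<longleftrightarrow> continuous_on S f"
| "Ck_on (Suc k) S f \<longleftrightarrow>
     (\<forall>x\<in>S. f differentiable at x) \<and> (\<forall>v. Ck_on k S (\<lambda>x. frechet_derivative f (at x) v))"

definition smooth_on :: "'a::real_normed_vector set \<Rightarrow> ('a \<Rightarrow> 'b::real_normed_vector) \<Rightarrow> bool" where
  "smooth_on S f \<longleftrightarrow> (\<forall>k. Ck_on k S f)"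

text \<open>An atlas is given by local parametrizations \<open>(V, f)\<close>, i.e. homeomorphisms \<open>f\<close> from an
  open \<open>V \<subseteq> \<real>\<^sup>n\<close> onto an open subset of the manifold (the inverses of the charts).
  The manifold is the whole type \<open>'p\<close>.\<close>

type_synonym ('n, 'p) atlas = "((real ^ 'n) set \<times> (real ^ 'n \<Rightarrow> 'p)) set"

definition smooth_atlas ::
    "('n::finite, 'p::{t2_space,second_countable_topology}) atlas \<Rightarrow> bool" where
  "smooth_atlas \<A> \<longleftrightarrow>
     (\<Union>(V, f)\<in>\<A>. f ` V) = UNIV \<and>
     (\<forall>(V, f)\<in>\<A>. open V \<and> open (f ` V) \<and> (\<exists>g. homeomorphism V (f ` V) f g)) \<and>
     (\<forall>(V, f)\<in>\<A>. \<forall>(W, g)\<in>\<A>. smooth_on (V \<inter> f -` (g ` W)) (inv_into W g \<circ> f))"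

definition connected_manifold ::
    "('n::finite, 'p::{t2_space,second_countable_topology}) atlas \<Rightarrow> bool" where
  "connected_manifold \<A> \<longleftrightarrow> smooth_atlas \<A> \<and> connected (UNIV :: 'p set)"

section \<open>Immersed hypersurfaces\<close>

definition immersion ::
    "('n::finite, 'p) atlas \<Rightarrow> ('p \<Rightarrow> real ^ 'm) \<Rightarrow> bool" where
  "immersion \<A> F \<longleftrightarrow>
     (\<forall>(V, f)\<in>\<A>. smooth_on V (F \<circ> f) \<and>
        (\<forall>u\<in>V. inj (frechet_derivative (F \<circ> f) (at u))))"

definition unit_normal_field ::
    "('n::finite, 'p) atlas \<Rightarrow> ('p \<Rightarrow> real ^ 'm) \<Rightarrow> ('p \<Rightarrow> real ^ 'm) \<Rightarrow> bool" where
  "unit_normal_field \<A> F \<nu> \<longleftrightarrow>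
     (\<forall>(V, f)\<in>\<A>. smooth_on V (\<nu> \<circ> f) \<and>
        (\<forall>u\<in>V. norm (\<nu> (f u)) = 1 \<and>
           (\<forall>a. \<nu> (f u) \<bullet> frechet_derivative (F \<circ> f) (at u) a = 0)))"

definition properly_immersed :: "('p::topological_space \<Rightarrow> real ^ 'm) \<Rightarrow> bool" where
  "properly_immersed F \<longleftrightarrow> (\<forall>K. compact K \<longrightarrow> compact (F -` K))"

section \<open>Curvature\<close>

text \<open>The tangent field \<open>e\<close> of the hypersurface whose coordinate expression in the
  parametrization \<open>f\<close> is \<open>E\<close>, as a map into Euclidean space.\<close>

definition tangent_field ::
    "('p \<Rightarrow> real ^ 'm) \<Rightarrow> (real ^ 'n \<Rightarrow> 'p) \<Rightarrow> (real ^ 'n \<Rightarrow> real ^ 'n) \<Rightarrow> real ^ 'n \<Rightarrow> real ^ 'm" where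
  "tangent_field F f E u = frechet_derivative (F \<circ> f) (at u) (E u)"

text \<open>\<open>(f, E, u)\<close> describes a local orthonormal frame around \<open>p = f u\<close>: the fields with
  coordinate expressions \<open>E i\<close> are smooth and orthonormal for the induced metric near \<open>u\<close>.\<close>

definition orthonormal_frame_at ::
    "('n::finite, 'p) atlas \<Rightarrow> ('p \<Rightarrow> real ^ 'm) \<Rightarrow> 'p \<Rightarrow>
     (real ^ 'n \<Rightarrow> 'p) \<Rightarrow> ('n \<Rightarrow> real ^ 'n \<Rightarrow> real ^ 'n) \<Rightarrow> real ^ 'n \<Rightarrow> bool" where
  "orthonormal_frame_at \<A> F p f E u \<longleftrightarrow> f u = p \<and>
     (\<exists>V W. (V, f) \<in> \<A> \<and> open W \<and> W \<subseteq> V \<and> u \<in> W \<and>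
        (\<forall>i. smooth_on W (E i)) \<and>
        (\<forall>w\<in>W. \<forall>i j. tangent_field F f (E i) w \<bullet> tangent_field F f (E j) w
                       = (if i = j then 1 else 0)))"

text \<open>The normal component at \<open>f u\<close> of the Euclidean covariant derivative of the tangent
  field of \<open>E'\<close> in the direction of the tangent field of \<open>E\<close>.\<close>

definition normal_derivative ::
    "('p \<Rightarrow> real ^ 'm) \<Rightarrow> ('p \<Rightarrow> real ^ 'm) \<Rightarrow> (real ^ 'n \<Rightarrow> 'p) \<Rightarrow>
     (real ^ 'n \<Rightarrow> real ^ 'n) \<Rightarrow> (real ^ 'n \<Rightarrow> real ^ 'n) \<Rightarrow> real ^ 'n \<Rightarrow> real ^ 'm" where
  "normal_derivative F \<nu> f E E' u =
     (frechet_derivative (tangent_field F f E') (at u) (E u) \<bullet> \<nu> (f u)) *\<^sub>R \<nu> (f u)"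

text \<open>The following two values do not depend on the choice of the local frame.\<close>

definition mean_curvature_vector ::
    "('n::finite, 'p) atlas \<Rightarrow> ('p \<Rightarrow> real ^ 'm) \<Rightarrow> ('p \<Rightarrow> real ^ 'm) \<Rightarrow> 'p \<Rightarrow> real ^ 'm" where
  "mean_curvature_vector \<A> F \<nu> p =
     (THE v. \<exists>f E u. orthonormal_frame_at \<A> F p f E u \<and>
        v = (\<Sum>i\<in>UNIV. normal_derivative F \<nu> f (E i) (E i) u))"

definition second_fundamental_form_norm2 ::
    "('n::finite, 'p) atlas \<Rightarrow> ('p \<Rightarrow> real ^ 'm) \<Rightarrow> ('p \<Rightarrow> real ^ 'm) \<Rightarrow> 'p \<Rightarrow> real" where
  "second_fundamental_form_norm2 \<A> F \<nu> p =
     (THE a. \<exists>f E u. orthonormal_frame_at \<A> F p f E u \<and>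
        a = (\<Sum>i\<in>UNIV. \<Sum>j\<in>UNIV. (norm (normal_derivative F \<nu> f (E i) (E j) u))\<^sup>2))"

text \<open>Sign convention: the mean curvature vector is \<open>- H \<nu>\<close>.\<close>

definition mean_curvature ::
    "('n::finite, 'p) atlas \<Rightarrow> ('p \<Rightarrow> real ^ 'm) \<Rightarrow> ('p \<Rightarrow> real ^ 'm) \<Rightarrow> 'p \<Rightarrow> real" where
  "mean_curvature \<A> F \<nu> p = - (mean_curvature_vector \<A> F \<nu> p \<bullet> \<nu> p)"

definition self_expander ::
    "('n::finite, 'p::{t2_space,second_countable_topology}) atlas \<Rightarrow>
     ('p \<Rightarrow> real ^ 'm) \<Rightarrow> ('p \<Rightarrow> real ^ 'm) \<Rightarrow> bool" where
  "self_expander \<A> F \<nu> \<longleftrightarrow>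
     CARD('m) = CARD('n) + 1 \<and> connected_manifold \<A> \<and> immersion \<A> F \<and>
     unit_normal_field \<A> F \<nu> \<and>
     (\<forall>p. mean_curvature \<A> F \<nu> p = - (1/2) * (F p \<bullet> \<nu> p))"

definition mean_convex ::
    "('n::finite, 'p) atlas \<Rightarrow> ('p \<Rightarrow> real ^ 'm) \<Rightarrow> ('p \<Rightarrow> real ^ 'm) \<Rightarrow> bool" where
  "mean_convex \<A> F \<nu> \<longleftrightarrow> (\<forall>p. mean_curvature \<A> F \<nu> p \<ge> 0)"

section \<open>Induced distance and volume\<close>

definition piecewise_C1_curve ::
    "('n::finite, 'p::topological_space) atlas \<Rightarrow> (real \<Rightarrow> 'p) \<Rightarrow> bool" where
  "piecewise_C1_curve \<A> \<gamma> \<longleftrightarrow> path \<gamma> \<and>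
     (\<forall>(V, f)\<in>\<A>. \<forall>a b. {a..b} \<subseteq> {0..1} \<and> \<gamma> ` {a..b} \<subseteq> f ` V \<longrightarrow>
        (inv_into V f \<circ> \<gamma>) piecewise_C1_differentiable_on {a..b})"

text \<open>The induced norm of the velocity of \<open>\<gamma>\<close> is the Euclidean norm of the velocity of
  \<open>F \<circ> \<gamma>\<close>. The integral is \<open>ennreal\<close>-valued because the library's notion of piecewise
  \<open>C\<^sup>1\<close> allows the derivative to be unbounded near the break points; a curve of infinite
  length must not be assigned the default value 0.\<close>

definition curve_length :: "('p \<Rightarrow> real ^ 'm) \<Rightarrow> (real \<Rightarrow> 'p) \<Rightarrow> ennreal" where
  "curve_length F \<gamma> = (\<integral>\<^sup>+t\<in>{0..1}. ennreal (norm (vector_derivative (F \<circ> \<gamma>) (at t))) \<partial>lborel)"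

definition geodesic_dist ::
    "('n::finite, 'p::topological_space) atlas \<Rightarrow> ('p \<Rightarrow> real ^ 'm) \<Rightarrow> 'p \<Rightarrow> 'p \<Rightarrow> real" where
  "geodesic_dist \<A> F p q =
     enn2real (INF \<gamma>\<in>{\<gamma>. piecewise_C1_curve \<A> \<gamma> \<and> pathstart \<gamma> = p \<and> pathfinish \<gamma> = q}.
                 curve_length F \<gamma>)"

definition geodesic_ball ::
    "('n::finite, 'p::topological_space) atlas \<Rightarrow> ('p \<Rightarrow> real ^ 'm) \<Rightarrow> 'p \<Rightarrow> real \<Rightarrow> 'p set" where
  "geodesic_ball \<A> F p R = {q. geodesic_dist \<A> F p q < R}"

definition complete_hypersurface ::
    "('n::finite, 'p::topological_space) atlas \<Rightarrow> ('p \<Rightarrow> real ^ 'm) \<Rightarrow> bool" where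
  "complete_hypersurface \<A> F \<longleftrightarrow> Metric_space.mcomplete UNIV (geodesic_dist \<A> F)"

definition induced_metric ::
    "('p \<Rightarrow> real ^ 'm) \<Rightarrow> (real ^ 'n \<Rightarrow> 'p) \<Rightarrow> real ^ 'n \<Rightarrow> real ^ 'n ^ 'n" where
  "induced_metric F f u =
     (\<chi> i j. frechet_derivative (F \<circ> f) (at u) (axis i 1) \<bullet>
             frechet_derivative (F \<circ> f) (at u) (axis j 1))"

text \<open>The unique Borel measure that is \<open>sqrt (det g) du\<close> in every parametrization.\<close>

definition volume_element ::
    "('n::finite, 'p::topological_space) atlas \<Rightarrow> ('p \<Rightarrow> real ^ 'm) \<Rightarrow> 'p measure" where
  "volume_element \<A> F =
     (THE \<sigma>. sets \<sigma> = sets borel \<and>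
        (\<forall>(V, f)\<in>\<A>. \<forall>S\<in>sets borel. S \<subseteq> V \<longrightarrow>
           emeasure \<sigma> (f ` S) = (\<integral>\<^sup>+u\<in>S. ennreal (sqrt (det (induced_metric F f u))) \<partial>lborel)))"

end

theory Submission imports Defs begin

text \<open>On a self-expander the drift Laplacian is symmetric with respect to the weight \<open>exp (\<bar>x\<bar>\<^sup>2 / 4)\<close>.
  With this weight the growth hypothesis is a parabolicity property: testing against a cutoff of the
  intrinsic distance that falls on dyadic shells with well-chosen slopes shows that a tangential field
  \<open>V\<close> with weighted divergence \<open>q \<ge> 0\<close> and \<open>\<bar>V\<bar>\<^sup>2 \<le> c q \<bar>A\<bar>\<^sup>2\<close> satisfies \<open>q = 0\<close>.

  By the strong maximum principle \<open>H\<close> is either positive or identically zero. If \<open>H > 0\<close>,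
  Simons' identity and parabolicity give \<open>\<nabla>(A / H) = 0\<close>, so that \<open>A\<close> has rank one and annihilates a
  constant tangent direction; in dimension at least 2, parabolicity applied to a field in that
  direction is contradictory. If \<open>H = 0\<close>, then \<open>A x = 0\<close> and \<open>x \<bullet> \<nabla>\<bar>A\<bar>\<^sup>2 = -2 \<bar>A\<bar>\<^sup>2\<close>; the maximum of
  \<open>(R\<^sup>2 - \<bar>x\<bar>\<^sup>2) \<bar>A\<bar>\<^sup>2\<close> on a compact piece forces \<open>A = 0\<close>. The normal is then constant and the immersion
  is a proper local homeomorphism onto a hyperplane, hence bijective.\<close>

section \<open>Functions of class \<open>C\<^sup>k\<close>\<close>

text \<open>The equation for \<open>H\<close> and Simons' identity carry the same zero-order
  coefficient \<open>1/2 + S\<close>, so it cancels in the quotient \<open>A / H\<close>. The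
  gradient of the squared length of \<open>A / H\<close>, multiplied by \<open>H^2 / 2\<close>, then
  has a pure square as weighted divergence, and by Cauchy-Schwarz its squared length is at most that
  square times \<open>S\<close>. This dictates both the shape of the parabolicity property and the
  density in the growth hypothesis. The analytic obstacle is that the intrinsic distance is only
  locally Lipschitz. It is never differentiated: cutoffs carry a pointwise bound on their local
  slope, and difference quotients in charts are shifted onto them. This loses a constant depending
  on the dimension, which is harmless because the resulting bound is divided by a divergent sum. The
  geometry is written with tangential derivatives in ambient components, so that tensor identities
  become sums over the coordinates of the ambient space in which every contraction with the normal
  is known.\<close>

lemma frechet_derivative_cong_open:
  assumes "open S" "x \<in> S" "\<And>y. y \<in> S \<Longrightarrow> f y = g y"
  shows "frechet_derivative f (at x) = frechet_derivative g (at x)"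
proof -
  have "(f has_derivative D) (at x) \<longleftrightarrow> (g has_derivative D) (at x)" for D
    using has_derivative_transform_within_open[OF _ assms(1,2)] assms(3) by metis
  then show ?thesis by (simp add: frechet_derivative_def)
qed

lemma differentiable_cong_open:
  assumes "open S" "x \<in> S" "\<And>y. y \<in> S \<Longrightarrow> f y = g y"
  shows "f differentiable at x \<longleftrightarrow> g differentiable at x"
  using has_derivative_transform_within_open[OF _ assms(1,2)] assms(3)
  unfolding differentiable_def by metis

text \<open>\<open>Ck_on\<close> differentiates with \<open>at x\<close> and not with
  \<open>at x within S\<close>, so agreement on an open set is what controls all iterated
  derivatives. Every passage between equal expressions goes through this.\<close>

lemma Ck_on_cong:
  assumes "open S" "\<And>y. y \<in> S \<Longrightarrow> f y = g y"
  shows "Ck_on k S f \<longleftrightarrow> Ck_on k S g"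
  using assms(2)
proof (induction k arbitrary: f g)
  case 0
  then show ?case by (simp cong: continuous_on_cong)
next
  case (Suc k)
  have "Ck_on k S (\<lambda>x. frechet_derivative f (at x) v)
      \<longleftrightarrow> Ck_on k S (\<lambda>x. frechet_derivative g (at x) v)" for v
    using frechet_derivative_cong_open[OF assms(1) _ Suc.prems]
    by (intro Suc.IH) simp
  moreover have "f differentiable at x \<longleftrightarrow> g differentiable at x" if "x \<in> S" for x
    using differentiable_cong_open[OF assms(1) that Suc.prems] .
  ultimately show ?case by simp
qed

lemma Ck_on_eqI:
  "open S \<Longrightarrow> Ck_on k S g \<Longrightarrow> (\<And>y. y \<in> S \<Longrightarrow> f y = g y) \<Longrightarrow> Ck_on k S f"
  using Ck_on_cong[of S f g k] by simp

lemma Ck_on_subset: "Ck_on k T f \<Longrightarrow> S \<subseteq> T \<Longrightarrow> Ck_on k S f"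
  by (induction k arbitrary: f) (auto intro: continuous_on_subset)

lemma Ck_on_SucD: "Ck_on (Suc k) S f \<Longrightarrow> Ck_on k S f"
proof (induction k arbitrary: f)
  case 0
  then show ?case
    by (auto intro!: continuous_at_imp_continuous_on differentiable_imp_continuous_within)
next
  case (Suc k)
  then show ?case by simp
qed

lemma Ck_on_le: "Ck_on k S f \<Longrightarrow> j \<le> k \<Longrightarrow> Ck_on j S f"
  by (induction k) (auto dest: Ck_on_SucD simp: le_Suc_eq simp del: Ck_on.simps)

lemma Ck_on_imp_continuous_on: "Ck_on k S f \<Longrightarrow> continuous_on S f"
  using Ck_on_le[of k S f 0] by simp

lemma Ck_on_imp_differentiable: "Ck_on (Suc k) S f \<Longrightarrow> x \<in> S \<Longrightarrow> f differentiable at x"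
  by simp

lemma Ck_on_has_derivative:
  "Ck_on (Suc k) S f \<Longrightarrow> x \<in> S \<Longrightarrow> (f has_derivative frechet_derivative f (at x)) (at x)"
  by (simp add: frechet_derivative_works)

text \<open>Continuity and differentiability are local. This lets regularity pass between
  overlapping charts and lets a compactly supported function be glued to zero.\<close>

lemma Ck_on_local:
  assumes "\<And>x. x \<in> S \<Longrightarrow> \<exists>U. open U \<and> x \<in> U \<and> Ck_on k (U \<inter> S) f"
  shows "Ck_on k S f"
  using assms
proof (induction k arbitrary: f)
  case 0
  show ?case
    unfolding Ck_on.simps continuous_on_eq_continuous_within
  proof
    fix x assume x: "x \<in> S"
    then obtain U where U: "open U" "x \<in> U" "continuous_on (U \<inter> S) f" using 0 by force
    then have "continuous (at x within (U \<inter> S)) f"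
      using x by (simp add: continuous_on_eq_continuous_within)
    moreover have "at x within (U \<inter> S) = at x within S"
      by (rule at_within_nhd[OF U(2,1)]) auto
    ultimately show "continuous (at x within S) f" by simp
  qed
next
  case (Suc k)
  have "f differentiable at x" if "x \<in> S" for x
    using Suc.prems[OF that] that by auto
  moreover have "Ck_on k S (\<lambda>x. frechet_derivative f (at x) v)" for v
    by (rule Suc.IH) (use Suc.prems in force)
  ultimately show ?case by simp
qed

lemma Ck_on_const [simp]: "Ck_on k S (\<lambda>_. c)"
  by (induction k arbitrary: c) (auto simp: frechet_derivative_const)

lemma Ck_on_bounded_linear: "bounded_linear L \<Longrightarrow> Ck_on k S L"
proof (cases k)
  case (Suc k)
  assume L: "bounded_linear L"
  then have "frechet_derivative L (at x) = L" for x
    using bounded_linear_imp_has_derivative frechet_derivative_at by metis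
  then show ?thesis using L Suc
    by (auto intro: bounded_linear_imp_differentiable)
qed (auto intro: linear_continuous_on)

text \<open>Replaces the abstract \<open>frechet_derivative\<close> by an explicit candidate; the
  closure rules below are inductions through this rule.\<close>

lemma Ck_on_SucI:
  assumes "open S" "\<And>x. x \<in> S \<Longrightarrow> (f has_derivative f' x) (at x)"
    and "\<And>v. Ck_on k S (\<lambda>x. f' x v)"
  shows "Ck_on (Suc k) S f"
proof -
  have "frechet_derivative f (at x) = f' x" if "x \<in> S" for x
    using frechet_derivative_at[OF assms(2)[OF that]] by simp
  then have "Ck_on k S (\<lambda>x. frechet_derivative f (at x) v)" for v
    using Ck_on_cong[OF assms(1), of "\<lambda>x. frechet_derivative f (at x) v" "\<lambda>x. f' x v" k] assms(3) by simp
  then show ?thesis using assms(2) by (auto simp: differentiable_def)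
qed

lemma Ck_on_add:
  assumes "open S"
  shows "Ck_on k S f \<Longrightarrow> Ck_on k S g \<Longrightarrow> Ck_on k S (\<lambda>x. f x + g x)"
proof (induction k arbitrary: f g)
  case (Suc k)
  note d = Ck_on_has_derivative[OF Suc.prems(1)] Ck_on_has_derivative[OF Suc.prems(2)]
  show ?case
    by (rule Ck_on_SucI[OF assms]) (auto intro: has_derivative_add d Suc.IH simp: Suc.prems[simplified])
qed (auto intro: continuous_intros)

text \<open>The Leibniz rule produces two terms of the same bilinear form with one argument of lower
  order, so the induction closes. One proof serves products, scalings and inner products.\<close>

lemma Ck_on_bilinear:
  assumes "open S" "bounded_bilinear B"
  shows "Ck_on k S f \<Longrightarrow> Ck_on k S g \<Longrightarrow> Ck_on k S (\<lambda>x. B (f x) (g x))"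
proof (induction k arbitrary: f g)
  case 0
  then show ?case by (auto intro: bounded_bilinear.continuous_on[OF assms(2)])
next
  case (Suc k)
  note d = Ck_on_has_derivative[OF Suc.prems(1)] Ck_on_has_derivative[OF Suc.prems(2)]
  show ?case
  proof (rule Ck_on_SucI[OF assms(1)])
    fix x assume "x \<in> S"
    then show "((\<lambda>x. B (f x) (g x)) has_derivative
       (\<lambda>v. B (f x) (frechet_derivative g (at x) v) + B (frechet_derivative f (at x) v) (g x))) (at x)"
      by (intro bounded_bilinear.FDERIV[OF assms(2)] d)
  next
    fix v
    show "Ck_on k S (\<lambda>x. B (f x) (frechet_derivative g (at x) v) + B (frechet_derivative f (at x) v) (g x))"
      using Suc.prems by (intro Ck_on_add assms Suc.IH) (auto dest: Ck_on_SucD simp del: Ck_on.simps, auto)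
  qed
qed

lemmas Ck_on_mult = Ck_on_bilinear[OF _ bounded_bilinear_mult]
lemmas Ck_on_scaleR = Ck_on_bilinear[OF _ bounded_bilinear_scaleR]
lemmas Ck_on_inner = Ck_on_bilinear[OF _ bounded_bilinear_inner]

lemma Ck_on_linear_comp:
  assumes "open S" "bounded_linear L"
  shows "Ck_on k S f \<Longrightarrow> Ck_on k S (\<lambda>x. L (f x))"
proof (induction k arbitrary: f)
  case 0
  then show ?case using assms by (auto intro: bounded_linear.continuous_on)
next
  case (Suc k)
  show ?case
    by (rule Ck_on_SucI[OF assms(1)])
      (use Ck_on_has_derivative[OF Suc.prems] Suc.prems in \<open>auto intro: bounded_linear.has_derivative[OF assms(2)] Suc.IH\<close>)
qed

lemma Ck_on_minus: "open S \<Longrightarrow> Ck_on k S f \<Longrightarrow> Ck_on k S (\<lambda>x. - f x)"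
  by (rule Ck_on_linear_comp) (auto intro: bounded_linear_minus bounded_linear_ident)

lemma Ck_on_diff:
  assumes "open S" "Ck_on k S f" "Ck_on k S g" shows "Ck_on k S (\<lambda>x. f x - g x)"
  using Ck_on_add[OF assms(1,2) Ck_on_minus[OF assms(1,3)]] by simp

lemma Ck_on_sum:
  assumes "open S"
  shows "(\<And>i. i \<in> I \<Longrightarrow> Ck_on k S (f i)) \<Longrightarrow> Ck_on k S (\<lambda>x. \<Sum>i\<in>I. f i x)"
  by (induction I rule: infinite_finite_induct) (auto intro: Ck_on_add assms)

lemma Ck_on_prod:
  fixes f :: "'i \<Rightarrow> 'a::real_normed_vector \<Rightarrow> real"
  assumes "open S"
  shows "(\<And>i. i \<in> I \<Longrightarrow> Ck_on k S (f i)) \<Longrightarrow> Ck_on k S (\<lambda>x. \<Prod>i\<in>I. f i x)"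
  by (induction I rule: infinite_finite_induct) (auto intro: Ck_on_mult assms)

lemma Ck_on_compose:
  fixes g :: "'b::euclidean_space \<Rightarrow> 'c::real_normed_vector" and f :: "'a::real_normed_vector \<Rightarrow> 'b"
  assumes S: "open S" and T: "open T"
  shows "Ck_on k S f \<Longrightarrow> Ck_on k T g \<Longrightarrow> f ` S \<subseteq> T \<Longrightarrow> Ck_on k S (\<lambda>x. g (f x))"
proof (induction k arbitrary: g)
  case 0
  then show ?case by (auto intro: continuous_on_compose2)
next
  case (Suc k)
  note d = Ck_on_has_derivative[OF Suc.prems(1)] Ck_on_has_derivative[OF Suc.prems(2)]
  define f' where "f' x = frechet_derivative f (at x)" for x
  define g' where "g' x = frechet_derivative g (at x)" for x
  show ?case
  proof (rule Ck_on_SucI[OF S])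
    fix x assume x: "x \<in> S"
    then have "f x \<in> T" using Suc.prems(3) by auto
    then have g: "(g has_derivative g' (f x)) (at (f x))" using d(2) g'_def by simp
    have "((\<lambda>x. g (f x)) has_derivative (\<lambda>v. g' (f x) (f' x v))) (at x)"
      using has_derivative_compose[OF d(1)[OF x] g] f'_def by simp
    \<comment> \<open>\<open>Ck_on\<close> controls the derivative of \<open>g\<close> in fixed
      directions only, whereas \<open>f' x v\<close> moves with \<open>x\<close>. Expanding in the
      basis leaves finitely many fixed directions with smooth coefficients.\<close>
    moreover have "g' (f x) (f' x v) = (\<Sum>b\<in>Basis. (f' x v \<bullet> b) *\<^sub>R g' (f x) b)" for v
    proof -
      have L: "linear (g' (f x))" using g has_derivative_linear by blast
      have "g' (f x) (\<Sum>b\<in>Basis. (f' x v \<bullet> b) *\<^sub>R b) = (\<Sum>b\<in>Basis. (f' x v \<bullet> b) *\<^sub>R g' (f x) b)"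
        using L by (simp add: linear_sum linear_cmul)
      then show ?thesis by (simp add: euclidean_representation)
    qed
    ultimately show "((\<lambda>x. g (f x)) has_derivative (\<lambda>v. \<Sum>b\<in>Basis. (f' x v \<bullet> b) *\<^sub>R g' (f x) b)) (at x)"
      by simp
  next
    fix v
    have "Ck_on k S (\<lambda>x. g' (f x) b)" for b
      using Suc.prems unfolding g'_def by (intro Suc.IH Ck_on_SucD[OF Suc.prems(1)]) auto
    moreover have "Ck_on k S (\<lambda>x. f' x v)" using Suc.prems f'_def by simp
    ultimately show "Ck_on k S (\<lambda>x. \<Sum>b\<in>Basis. (f' x v \<bullet> b) *\<^sub>R g' (f x) b)"
      by (intro Ck_on_sum Ck_on_scaleR Ck_on_inner S Ck_on_const)
  qed
qed

lemma Ck_on_real_deriv: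
  fixes g :: "real \<Rightarrow> real"
  assumes "open T" "\<And>x. x \<in> T \<Longrightarrow> (g has_real_derivative g' x) (at x)" "Ck_on k T g'"
  shows "Ck_on (Suc k) T g"
proof (rule Ck_on_SucI[OF assms(1)])
  show "(g has_derivative (\<lambda>v. g' x * v)) (at x)" if "x \<in> T" for x
    using assms(2)[OF that] by (simp add: has_field_derivative_def)
  show "Ck_on k T (\<lambda>x. g' x * v)" for v
    by (intro Ck_on_mult assms Ck_on_const)
qed

lemma Ck_on_inverse_pos: "Ck_on k {0<..} (inverse :: real \<Rightarrow> real)"
proof (induction k)
  case (Suc k)
  show ?case
  proof (rule Ck_on_real_deriv)
    show "(inverse has_real_derivative - (inverse x * inverse x)) (at x)" if "x \<in> {0<..}" for x :: real
      using that DERIV_inverse[of x] by (simp add: power2_eq_square)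
    show "Ck_on k {0<..} (\<lambda>x::real. - (inverse x * inverse x))"
      by (intro Ck_on_minus Ck_on_mult Suc open_greaterThan)
  qed simp
qed (auto intro!: continuous_intros)

lemma Ck_on_exp: "Ck_on k UNIV (exp :: real \<Rightarrow> real)"
proof (induction k)
  case (Suc k)
  show ?case
    by (rule Ck_on_real_deriv[where g' = exp]) (auto intro!: derivative_eq_intros Suc)
qed (auto intro!: continuous_intros)

text \<open>The derivative is minus one half times the cube of the function itself, so the induction
  closes. The square root has no such closed form and is recovered below as \<open>x\<close> times
  its reciprocal root.\<close>

lemma Ck_on_rsqrt: "Ck_on k {0<..} (\<lambda>x::real. inverse (sqrt x))"
proof (induction k)
  case (Suc k)
  show ?case
  proof (rule Ck_on_real_deriv)
    fix x :: real assume "x \<in> {0<..}"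
    then have x: "x > 0" by simp
    have "inverse (sqrt x ^ Suc (Suc 0)) = inverse x" using x by simp
    then show "((\<lambda>x. inverse (sqrt x)) has_real_derivative
        - (1/2) * (inverse (sqrt x) * (inverse (sqrt x) * inverse (sqrt x)))) (at x)"
      using x by (auto intro!: derivative_eq_intros simp: field_simps)
  next
    show "Ck_on k {0<..} (\<lambda>x::real. - (1/2) * (inverse (sqrt x) * (inverse (sqrt x) * inverse (sqrt x))))"
      by (intro Ck_on_mult Suc open_greaterThan Ck_on_const)
  qed simp
qed (auto intro!: continuous_intros)

lemma Ck_on_inverse:
  fixes f :: "'a::real_normed_vector \<Rightarrow> real"
  assumes "open S" "Ck_on k S f" "\<And>x. x \<in> S \<Longrightarrow> f x > 0"
  shows "Ck_on k S (\<lambda>x. inverse (f x))"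
  using Ck_on_compose[OF assms(1) _ assms(2) Ck_on_inverse_pos] assms(3) by auto

lemma Ck_on_exp_comp:
  fixes f :: "'a::real_normed_vector \<Rightarrow> real"
  assumes "open S" "Ck_on k S f"
  shows "Ck_on k S (\<lambda>x. exp (f x))"
  using Ck_on_compose[OF assms(1) _ assms(2) Ck_on_exp] by auto

lemma Ck_on_rsqrt_comp:
  fixes f :: "'a::real_normed_vector \<Rightarrow> real"
  assumes "open S" "Ck_on k S f" "\<And>x. x \<in> S \<Longrightarrow> f x > 0"
  shows "Ck_on k S (\<lambda>x. inverse (sqrt (f x)))"
  using Ck_on_compose[OF assms(1) _ assms(2) Ck_on_rsqrt] assms(3) by auto

lemma Ck_on_sqrt_comp:
  fixes f :: "'a::real_normed_vector \<Rightarrow> real"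
  assumes "open S" "Ck_on k S f" "\<And>x. x \<in> S \<Longrightarrow> f x > 0"
  shows "Ck_on k S (\<lambda>x. sqrt (f x))"
proof -
  have "Ck_on k S (\<lambda>x. f x * inverse (sqrt (f x)))"
    by (intro Ck_on_mult Ck_on_rsqrt_comp assms)
  then show ?thesis
    by (rule Ck_on_eqI[OF assms(1)])
      (use assms(3) in \<open>auto simp: divide_inverse[symmetric] real_div_sqrt less_imp_le\<close>)
qed

lemma Ck_on_vec_nth: "open S \<Longrightarrow> Ck_on k S f \<Longrightarrow> Ck_on k S (\<lambda>x. f x $ i)"
  by (rule Ck_on_linear_comp[OF _ bounded_linear_vec_nth])

lemma Ck_on_vec_lambda:
  fixes f :: "'i::finite \<Rightarrow> 'a::real_normed_vector \<Rightarrow> real"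
  assumes "open S" "\<And>i. Ck_on k S (f i)"
  shows "Ck_on k S (\<lambda>x. \<chi> i. f i x)"
proof -
  have "Ck_on k S (\<lambda>x. \<Sum>i\<in>UNIV. f i x *\<^sub>R axis i (1::real))"
    by (intro Ck_on_sum Ck_on_scaleR assms Ck_on_const)
  moreover have "(\<Sum>i\<in>UNIV. f i x *\<^sub>R axis i (1::real)) = (\<chi> i. f i x)" for x
    by (simp add: vec_eq_iff axis_def if_distrib cong: if_cong)
  ultimately show ?thesis by simp
qed

text \<open>The second difference is symmetric in \<open>a\<close> and \<open>b\<close>, hence so is its limit.\<close>

lemma second_difference:
  fixes u :: "'a::real_normed_vector \<Rightarrow> real"
  assumes "Ck_on (Suc (Suc 0)) (ball x r) u" and s: "0 < s" "s * (norm a + norm b) < r"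
  shows "\<exists>y. dist x y \<le> s * (norm a + norm b) \<and>
    u (x + s *\<^sub>R a + s *\<^sub>R b) - u (x + s *\<^sub>R a) - u (x + s *\<^sub>R b) + u x
      = s * s * frechet_derivative (\<lambda>z. frechet_derivative u (at z) a) (at y) b"
proof -
  define D where "D z = frechet_derivative u (at z)" for z
  define D2 where "D2 z = frechet_derivative (\<lambda>z. D z a) (at z)" for z
  have in_ball: "x + t *\<^sub>R a + t' *\<^sub>R b \<in> ball x r" and
    dist_le: "dist x (x + t *\<^sub>R a + t' *\<^sub>R b) \<le> s * (norm a + norm b)"
    if "0 \<le> t" "t \<le> s" "0 \<le> t'" "t' \<le> s" for t t'
  proof -
    have "norm (t *\<^sub>R a + t' *\<^sub>R b) \<le> t * norm a + t' * norm b"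
      using that norm_triangle_ineq[of "t *\<^sub>R a" "t' *\<^sub>R b"] by simp
    also have "\<dots> \<le> s * norm a + s * norm b"
      using that by (intro add_mono mult_right_mono) auto
    finally show *: "dist x (x + t *\<^sub>R a + t' *\<^sub>R b) \<le> s * (norm a + norm b)"
      by (simp add: dist_norm norm_minus_commute algebra_simps)
    then show "x + t *\<^sub>R a + t' *\<^sub>R b \<in> ball x r" using s by simp
  qed
  have dD: "(u has_derivative D z) (at z)" if "z \<in> ball x r" for z
    using Ck_on_has_derivative[OF assms(1) that] by (simp add: D_def)
  have dD2: "((\<lambda>z. D z a) has_derivative D2 z) (at z)" if "z \<in> ball x r" for z
    using Ck_on_has_derivative[of 0 "ball x r" "\<lambda>z. D z a"] assms(1) that by (simp add: D_def D2_def)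
  \<comment> \<open>The mean value theorem is applied first along \<open>a\<close> to the increment
    in direction \<open>b\<close>, then along \<open>b\<close> to the resulting difference of
    derivatives. The term with factor 0 stays unsimplified so that one derivative rule covers both
    ends of the increment.\<close>
  define g where "g t = u (x + t *\<^sub>R a + s *\<^sub>R b) - u (x + t *\<^sub>R a + 0 *\<^sub>R b)" for t
  have "\<exists>\<theta>. 0 < \<theta> \<and> \<theta> < s \<and> g s - g 0 = (s - 0) * (D (x + \<theta> *\<^sub>R a + s *\<^sub>R b) a - D (x + \<theta> *\<^sub>R a + 0 *\<^sub>R b) a)"
  proof (rule MVT2[OF s(1)])
    fix t assume t: "0 \<le> t" "t \<le> s"
    have *: "((\<lambda>t. u (x + t *\<^sub>R a + c *\<^sub>R b)) has_derivative (\<lambda>r. D (x + t *\<^sub>R a + c *\<^sub>R b) (r *\<^sub>R a))) (at t)"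
      if "0 \<le> c" "c \<le> s" for c
      by (rule has_derivative_compose[of "\<lambda>t. x + t *\<^sub>R a + c *\<^sub>R b"])
        (auto intro!: derivative_eq_intros dD in_ball t that)
    have lin: "D (x + t *\<^sub>R a + c *\<^sub>R b) (r *\<^sub>R a) = r * D (x + t *\<^sub>R a + c *\<^sub>R b) a"
      if "0 \<le> c" "c \<le> s" for c r
      using has_derivative_linear[OF dD[OF in_ball[OF t that]]] by (simp add: linear_cmul)
    show "(g has_real_derivative D (x + t *\<^sub>R a + s *\<^sub>R b) a - D (x + t *\<^sub>R a + 0 *\<^sub>R b) a) (at t)"
      unfolding has_field_derivative_def g_def
      by (rule has_derivative_eq_rhs[OF has_derivative_diff[OF *[of s] *[of 0]]])
        (use s(1) in \<open>auto simp: lin right_diff_distrib mult.commute fun_eq_iff simp del: scaleR_zero_left\<close>)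
  qed
  then obtain \<theta> where \<theta>: "0 < \<theta>" "\<theta> < s"
    and g: "g s - g 0 = s * (D (x + \<theta> *\<^sub>R a + s *\<^sub>R b) a - D (x + \<theta> *\<^sub>R a + 0 *\<^sub>R b) a)" by auto
  have "\<exists>\<theta>'. 0 < \<theta>' \<and> \<theta>' < s \<and> D (x + \<theta> *\<^sub>R a + s *\<^sub>R b) a - D (x + \<theta> *\<^sub>R a + 0 *\<^sub>R b) a
      = (s - 0) * D2 (x + \<theta> *\<^sub>R a + \<theta>' *\<^sub>R b) b"
  proof (rule MVT2[OF s(1)])
    fix t assume t: "0 \<le> t" "t \<le> s"
    have in_b: "x + \<theta> *\<^sub>R a + t *\<^sub>R b \<in> ball x r" using in_ball \<theta> t by simp
    have "((\<lambda>t. D (x + \<theta> *\<^sub>R a + t *\<^sub>R b) a) has_derivative (\<lambda>r. D2 (x + \<theta> *\<^sub>R a + t *\<^sub>R b) (r *\<^sub>R b))) (at t)"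
      by (rule has_derivative_compose[of "\<lambda>t. x + \<theta> *\<^sub>R a + t *\<^sub>R b" _ t UNIV "\<lambda>z. D z a"])
        (auto intro!: derivative_eq_intros dD2 in_b)
    moreover have "D2 (x + \<theta> *\<^sub>R a + t *\<^sub>R b) (r *\<^sub>R b) = D2 (x + \<theta> *\<^sub>R a + t *\<^sub>R b) b * r" for r
      using has_derivative_linear[OF dD2[OF in_b]] by (simp add: linear_cmul)
    ultimately show "((\<lambda>t. D (x + \<theta> *\<^sub>R a + t *\<^sub>R b) a) has_real_derivative D2 (x + \<theta> *\<^sub>R a + t *\<^sub>R b) b) (at t)"
      by (simp add: has_field_derivative_def)
  qed
  then obtain \<theta>' where \<theta>': "0 < \<theta>'" "\<theta>' < s"
    and g': "D (x + \<theta> *\<^sub>R a + s *\<^sub>R b) a - D (x + \<theta> *\<^sub>R a + 0 *\<^sub>R b) a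
      = s * D2 (x + \<theta> *\<^sub>R a + \<theta>' *\<^sub>R b) b" by auto
  have "g s - g 0 = s * (s * D2 (x + \<theta> *\<^sub>R a + \<theta>' *\<^sub>R b) b)"
    using g g' by simp
  then have "u (x + s *\<^sub>R a + s *\<^sub>R b) - u (x + s *\<^sub>R a) - u (x + s *\<^sub>R b) + u x
      = s * s * D2 (x + \<theta> *\<^sub>R a + \<theta>' *\<^sub>R b) b" by (simp add: g_def)
  then show ?thesis
    using dist_le[of \<theta> \<theta>'] \<theta> \<theta>' unfolding D2_def D_def by (auto simp del: scaleR_left.zero intro!: exI[of _ "x + \<theta> *\<^sub>R a + \<theta>' *\<^sub>R b"])
qed

lemma second_derivative_symmetric:
  fixes u :: "'a::real_normed_vector \<Rightarrow> real"
  assumes "open S" "Ck_on (Suc (Suc 0)) S u" "x \<in> S"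
  shows "frechet_derivative (\<lambda>z. frechet_derivative u (at z) a) (at x) b
       = frechet_derivative (\<lambda>z. frechet_derivative u (at z) b) (at x) a"
proof (rule ccontr)
  define P where "P a b z = frechet_derivative (\<lambda>z. frechet_derivative u (at z) a) (at z) b" for a b z
  assume "\<not> ?thesis"
  then have ne: "\<bar>P a b x - P b a x\<bar> > 0" (is "?e > 0") by (simp add: P_def)
  obtain r where r: "r > 0" "ball x r \<subseteq> S" using assms openE by blast
  have u: "Ck_on (Suc (Suc 0)) (ball x r) u" using Ck_on_subset[OF assms(2) r(2)] .
  have "continuous_on S (P c d)" for c d
    using assms(2) by (simp add: P_def)
  then have cont: "isCont (P c d) x" for c d
    using assms continuous_on_eq_continuous_at by blast
  have "\<exists>\<eta>>0. \<forall>y. dist x y < \<eta> \<longrightarrow> \<bar>P c d y - P c d x\<bar> < ?e / 2" for c d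
    using cont[of c d] ne unfolding continuous_at_eps_delta dist_real_def
    by (metis half_gt_zero dist_commute)
  then obtain \<eta>1 \<eta>2 where \<eta>: "\<eta>1 > 0" "\<eta>2 > 0"
    "\<And>y. dist x y < \<eta>1 \<Longrightarrow> \<bar>P a b y - P a b x\<bar> < ?e / 2"
    "\<And>y. dist x y < \<eta>2 \<Longrightarrow> \<bar>P b a y - P b a x\<bar> < ?e / 2" by meson
  define m where "m = Min {r, \<eta>1, \<eta>2}"
  have m: "m > 0" "m \<le> r" "m \<le> \<eta>1" "m \<le> \<eta>2" using r \<eta> by (auto simp: m_def)
  \<comment> \<open>With this \<open>s\<close> both sample points lie where each mixed derivative
    differs from its value at \<open>x\<close> by less than half the assumed gap. The summand 1
    keeps the denominator positive when both directions vanish.\<close>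
  define s where "s = m / (norm a + norm b + 1)"
  have s: "s > 0" using m by (simp add: s_def add_nonneg_pos)
  have sm: "s * (norm a + norm b) < m"
  proof -
    have "s * (norm a + norm b + 1) = m"
      unfolding s_def by (simp add: add_nonneg_eq_0_iff)
    then show ?thesis using s by (simp add: algebra_simps)
  qed
  have sr: "s * (norm a + norm b) < r" "s * (norm b + norm a) < r"
    using sm m by (auto simp: add.commute)
  obtain y where y: "dist x y \<le> s * (norm a + norm b)"
    "u (x + s *\<^sub>R a + s *\<^sub>R b) - u (x + s *\<^sub>R a) - u (x + s *\<^sub>R b) + u x = s * s * P a b y"
    using second_difference[OF u s sr(1)] unfolding P_def by blast
  obtain y' where y': "dist x y' \<le> s * (norm b + norm a)"
    "u (x + s *\<^sub>R b + s *\<^sub>R a) - u (x + s *\<^sub>R b) - u (x + s *\<^sub>R a) + u x = s * s * P b a y'"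
    using second_difference[OF u s sr(2)] unfolding P_def by blast
  have "s * s * P b a y' = s * s * P a b y"
    unfolding y(2)[symmetric] y'(2)[symmetric] by (simp add: add_ac)
  then have "P a b y = P b a y'" using s by simp
  moreover have "\<bar>P a b y - P a b x\<bar> < ?e / 2" "\<bar>P b a y' - P b a x\<bar> < ?e / 2"
    using y y' sm m \<eta> by (simp_all add: add.commute)
  ultimately show False by (smt (verit) field_sum_of_halves)
qed

section \<open>Tangential calculus on a hypersurface\<close>

lemma Ck_on_inverse_nonzero:
  fixes f :: "'a::real_normed_vector \<Rightarrow> real"
  assumes "open S" "Ck_on k S f" "\<And>x. x \<in> S \<Longrightarrow> f x \<noteq> 0"
  shows "Ck_on k S (\<lambda>x. inverse (f x))"
proof -
  have "Ck_on k S (\<lambda>x. f x * inverse (f x * f x))"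
    by (intro Ck_on_mult Ck_on_inverse assms) (use assms(3) in \<open>force simp: zero_less_mult_iff linorder_neq_iff\<close>)
  then show ?thesis
    by (rule Ck_on_eqI[OF assms(1)]) (use assms(3) in auto)
qed

lemma Ck_on_det:
  fixes M :: "'a::real_normed_vector \<Rightarrow> real^'n^'n"
  assumes "open S" "\<And>i j. Ck_on k S (\<lambda>x. M x $ i $ j)"
  shows "Ck_on k S (\<lambda>x. det (M x))"
  unfolding det_def by (intro Ck_on_sum Ck_on_mult Ck_on_prod assms Ck_on_const)

lemma matrix_inv_inverse:
  fixes A :: "real^'n^'n"
  assumes "det A \<noteq> 0"
  shows "A ** matrix_inv A = mat 1" "matrix_inv A ** A = mat 1"
proof -
  have "\<exists>A'. A ** A' = mat 1 \<and> A' ** A = mat 1"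
    using assms invertible_det_nz unfolding invertible_def by blast
  then have "A ** matrix_inv A = mat 1 \<and> matrix_inv A ** A = mat 1"
    unfolding matrix_inv_def by (rule someI_ex)
  then show "A ** matrix_inv A = mat 1" "matrix_inv A ** A = mat 1" by auto
qed

text \<open>Cramer's rule: each entry is a quotient of two determinants, and these are polynomials
  in the entries of \<open>M\<close>.\<close>

lemma Ck_on_matrix_inv:
  fixes M :: "'a::real_normed_vector \<Rightarrow> real^'n^'n"
  assumes S: "open S" and M: "\<And>i j. Ck_on k S (\<lambda>x. M x $ i $ j)"
    and det: "\<And>x. x \<in> S \<Longrightarrow> det (M x) \<noteq> 0"
  shows "Ck_on k S (\<lambda>x. matrix_inv (M x) $ a $ b)"
proof (rule Ck_on_eqI[OF S])
  show "Ck_on k S (\<lambda>x. det (\<chi> i j. if j = a then axis b 1 $ i else M x $ i $ j) * inverse (det (M x)))"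
  proof (intro Ck_on_mult Ck_on_det Ck_on_inverse_nonzero S M det)
    show "Ck_on k S (\<lambda>x. (\<chi> i j. if j = a then axis b 1 $ i else M x $ i $ j) $ i $ j)" for i j
      using M[of i j] by (cases "j = a") auto
  qed auto
  fix x assume "x \<in> S"
  then have d: "det (M x) \<noteq> 0" using det by simp
  then have "M x ** matrix_inv (M x) = mat 1"
    by (rule matrix_inv_inverse)
  then have "M x *v (matrix_inv (M x) *v axis b 1) = axis b 1"
    by (simp add: matrix_vector_mul_assoc)
  then have "(matrix_inv (M x) *v axis b 1) $ a
      = det (\<chi> i j. if j = a then axis b 1 $ i else M x $ i $ j) / det (M x)"
    unfolding cramer[OF d] by simp
  then show "matrix_inv (M x) $ a $ b
      = det (\<chi> i j. if j = a then axis b 1 $ i else M x $ i $ j) * inverse (det (M x))"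
    by (simp add: matrix_vector_mult_basis column_def divide_inverse)
qed

lemma frechet_derivative_eqI:
  "(g has_derivative D) (at x) \<Longrightarrow> frechet_derivative g (at x) v = D v"
  using frechet_derivative_at by metis

lemma frechet_derivative_compose':
  assumes "f differentiable at x" "g differentiable at (f x)"
  shows "frechet_derivative (g \<circ> f) (at x) v = frechet_derivative g (at (f x)) (frechet_derivative f (at x) v)"
  using frechet_derivative_compose[OF assms] by simp

lemma vec_eq_sum_axis: "(x::real^'n) = (\<Sum>i\<in>UNIV. x $ i *\<^sub>R axis i 1)"
  by (simp add: vec_eq_iff axis_def if_distrib cong: if_cong)

lemma linear_eq_sum_axis:
  fixes L :: "real^'n \<Rightarrow> 'b::real_vector"
  assumes "linear L" shows "L x = (\<Sum>i\<in>UNIV. x $ i *\<^sub>R L (axis i 1))"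
  using arg_cong[OF vec_eq_sum_axis[of x], of L] by (simp add: linear_sum[OF assms] linear_cmul[OF assms])

section \<open>Charts and the regularity of functions on the hypersurface\<close>

locale hypersurface =
  fixes \<A> :: "('n::finite, 'p::{t2_space,second_countable_topology}) atlas"
    and F \<nu> :: "'p \<Rightarrow> real ^ 'm"
  assumes card_m: "CARD('m) = CARD('n) + 1"
    and manifold: "connected_manifold \<A>"
    and immersion: "immersion \<A> F"
    and normal_field: "unit_normal_field \<A> F \<nu>"
begin

abbreviation dF :: "(real^'n \<Rightarrow> 'p) \<Rightarrow> real^'n \<Rightarrow> real^'n \<Rightarrow> real^'m" where
  "dF f w \<equiv> frechet_derivative (F \<circ> f) (at w)"

lemma atlas_cover: obtains V f w where "(V, f) \<in> \<A>" "w \<in> V" "f w = p"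
proof -
  have "p \<in> (\<Union>(V, f)\<in>\<A>. f ` V)" using manifold by (simp add: connected_manifold_def smooth_atlas_def)
  then show ?thesis using that by auto
qed

lemma chart:
  assumes "(V, f) \<in> \<A>"
  shows chart_open: "open V" and chart_open_image: "open (f ` V)"
    and chart_inj: "inj_on f V" and chart_cont: "continuous_on V f"
    and chart_inv_cont: "continuous_on (f ` V) (inv_into V f)"
proof -
  have *: "open V \<and> open (f ` V) \<and> (\<exists>g. homeomorphism V (f ` V) f g)"
    using manifold assms by (auto simp: connected_manifold_def smooth_atlas_def)
  then obtain g where g: "homeomorphism V (f ` V) f g" by blast
  show "open V" "open (f ` V)" using * by auto
  show inj: "inj_on f V" using g by (auto simp: homeomorphism_def intro!: inj_on_inverseI[of V g f])
  show "continuous_on V f" using g by (simp add: homeomorphism_def)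
  have "continuous_on (f ` V) g" using g by (simp add: homeomorphism_def)
  moreover have "inv_into V f y = g y" if "y \<in> f ` V" for y
    using g inj that by (auto simp: homeomorphism_def)
  ultimately show "continuous_on (f ` V) (inv_into V f)"
    by (simp cong: continuous_on_cong)
qed

lemma chart_image_open:
  assumes "(V, f) \<in> \<A>" "open U" "U \<subseteq> V"
  shows "open (f ` U)"
proof -
  have "f ` U = f ` V \<inter> inv_into V f -` U"
    using assms(3) chart_inj[OF assms(1)] by (auto simp: inj_on_image_mem_iff subset_iff)
  then show ?thesis
    using continuous_open_preimage[OF chart_inv_cont[OF assms(1)] chart_open_image[OF assms(1)] assms(2)] by simp
qed

lemma transition:
  assumes "(V, f) \<in> \<A>" "(W, g) \<in> \<A>"
  defines "D \<equiv> W \<inter> g -` (f ` V)" and "\<psi> \<equiv> inv_into V f \<circ> g"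
  shows transition_open: "open D" and transition_smooth: "Ck_on k D \<psi>"
    and transition_into: "z \<in> D \<Longrightarrow> \<psi> z \<in> V" and transition_eq: "z \<in> D \<Longrightarrow> f (\<psi> z) = g z"
proof -
  show "open D" unfolding D_def
    by (rule continuous_open_preimage[OF chart_cont[OF assms(2)] chart_open[OF assms(2)] chart_open_image[OF assms(1)]])
  have "\<forall>(V, f)\<in>\<A>. \<forall>(W, g)\<in>\<A>. smooth_on (V \<inter> f -` (g ` W)) (inv_into W g \<circ> f)"
    using manifold by (simp add: connected_manifold_def smooth_atlas_def)
  then have "smooth_on D \<psi>" using assms by blast
  then show "Ck_on k D \<psi>" by (simp add: smooth_on_def)
  show "\<psi> z \<in> V" "f (\<psi> z) = g z" if "z \<in> D"
    using that by (auto simp: D_def \<psi>_def inv_into_into f_inv_into_f)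
qed

text \<open>Regularity on the manifold is regularity of all coordinate expressions. The order is
  kept as a parameter because the bump functions of the later partition of unity are only once
  continuously differentiable.\<close>

definition smk :: "nat \<Rightarrow> ('p \<Rightarrow> real) \<Rightarrow> bool" where
  "smk k u \<longleftrightarrow> (\<forall>(V, f)\<in>\<A>. Ck_on k V (\<lambda>w. u (f w)))"

abbreviation "sm u \<equiv> (\<forall>k. smk k u)"

lemma smkD: "smk k u \<Longrightarrow> (V, f) \<in> \<A> \<Longrightarrow> Ck_on k V (\<lambda>w. u (f w))"
  by (auto simp: smk_def)

text \<open>One chart around each point is enough because transition maps are smooth. This is for
  functions described in a single chart, such as bump functions.\<close>

lemma smk_local:
  assumes "\<And>p. \<exists>V f U. (V, f) \<in> \<A> \<and> open U \<and> U \<subseteq> V \<and> p \<in> f ` U \<and> Ck_on k U (\<lambda>w. u (f w))"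
  shows "smk k u"
  unfolding smk_def
proof safe
  fix W g assume g: "(W, g) \<in> \<A>"
  show "Ck_on k W (\<lambda>w. u (g w))"
  proof (rule Ck_on_local)
    fix z assume z: "z \<in> W"
    obtain V f U where f: "(V, f) \<in> \<A>" "open U" "U \<subseteq> V" "g z \<in> f ` U" "Ck_on k U (\<lambda>w. u (f w))"
      using assms[of "g z"] by blast
    define D \<psi> where "D = W \<inter> g -` (f ` V)" and "\<psi> = inv_into V f \<circ> g"
    note tr = transition[OF f(1) g, folded D_def \<psi>_def]
    define Z where "Z = D \<inter> \<psi> -` U"
    have "continuous_on D \<psi>" using tr(2) Ck_on_imp_continuous_on by blast
    then have oZ: "open Z" unfolding Z_def
      using continuous_open_preimage tr(1) f(2) by blast
    have zZ: "z \<in> Z"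
      using z f chart_inj[OF f(1)] by (auto simp: Z_def D_def \<psi>_def subset_iff)
    have "Ck_on k Z (\<lambda>y. u (f (\<psi> y)))"
      by (rule Ck_on_compose[OF oZ f(2) Ck_on_subset[OF tr(2)] f(5)]) (auto simp: Z_def)
    then have "Ck_on k Z (\<lambda>w. u (g w))"
      by (rule Ck_on_eqI[OF oZ]) (auto simp: Z_def tr)
    then show "\<exists>U. open U \<and> z \<in> U \<and> Ck_on k (U \<inter> W) (\<lambda>w. u (g w))"
      using oZ zZ by (auto intro!: exI[of _ Z] intro: Ck_on_subset)
  qed
qed

lemma smk_SucD: "smk (Suc k) u \<Longrightarrow> smk k u"
  unfolding smk_def using Ck_on_SucD by (fastforce simp del: Ck_on.simps)

lemma smk_le: "smk k u \<Longrightarrow> j \<le> k \<Longrightarrow> smk j u"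
  unfolding smk_def using Ck_on_le by (fastforce simp del: Ck_on.simps)

lemma smk_const: "smk k (\<lambda>_. c)" by (auto simp: smk_def)

lemma smk_add: "smk k u \<Longrightarrow> smk k v \<Longrightarrow> smk k (\<lambda>p. u p + v p)"
  unfolding smk_def by (auto intro!: Ck_on_add chart_open)

lemma smk_diff: "smk k u \<Longrightarrow> smk k v \<Longrightarrow> smk k (\<lambda>p. u p - v p)"
  unfolding smk_def by (auto intro!: Ck_on_diff chart_open)

lemma smk_minus: "smk k u \<Longrightarrow> smk k (\<lambda>p. - u p)"
  unfolding smk_def by (auto intro!: Ck_on_minus chart_open)

lemma smk_mult: "smk k u \<Longrightarrow> smk k v \<Longrightarrow> smk k (\<lambda>p. u p * v p)"
  unfolding smk_def by (auto intro!: Ck_on_mult chart_open)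

lemma smk_sum: "(\<And>i. i \<in> I \<Longrightarrow> smk k (u i)) \<Longrightarrow> smk k (\<lambda>p. \<Sum>i\<in>I. u i p)"
  unfolding smk_def by (auto intro!: Ck_on_sum chart_open)

lemma smk_exp: "smk k u \<Longrightarrow> smk k (\<lambda>p. exp (u p))"
  unfolding smk_def by (auto intro!: Ck_on_exp_comp chart_open)

lemma smk_divide: "smk k u \<Longrightarrow> smk k v \<Longrightarrow> (\<And>p. v p \<noteq> 0) \<Longrightarrow> smk k (\<lambda>p. u p / v p)"
  unfolding smk_def divide_inverse by (auto intro!: Ck_on_mult Ck_on_inverse_nonzero chart_open)

lemma smk_continuous:
  assumes "smk k u" shows "continuous_on UNIV u"
proof -
  have "continuous (at p) u" for p
  proof -
    obtain V f w where f: "(V, f) \<in> \<A>" "w \<in> V" "f w = p" using atlas_cover .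
    have "continuous_on V (\<lambda>w. u (f w))"
      using smkD[OF assms f(1)] Ck_on_imp_continuous_on by blast
    then have "continuous_on (f ` V) (\<lambda>q. u (f (inv_into V f q)))"
      by (rule continuous_on_compose2[OF _ chart_inv_cont[OF f(1)]]) (auto intro: inv_into_into)
    then have "continuous_on (f ` V) u"
      by (rule continuous_on_eq) (simp add: f_inv_into_f)
    then show ?thesis
      using f chart_open_image[OF f(1)] continuous_on_eq_continuous_at by blast
  qed
  then show ?thesis by (simp add: continuous_at_imp_continuous_on)
qed

lemma F_smooth: "(V, f) \<in> \<A> \<Longrightarrow> Ck_on k V (F \<circ> f)"
  using immersion by (auto simp: immersion_def smooth_on_def)

lemma \<nu>_smooth: "(V, f) \<in> \<A> \<Longrightarrow> Ck_on k V (\<nu> \<circ> f)"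
  using normal_field by (auto simp: unit_normal_field_def smooth_on_def)

lemma smk_F: "smk k (\<lambda>p. F p $ i)"
  unfolding smk_def using Ck_on_vec_nth[OF chart_open F_smooth] by (auto simp: o_def)

lemma smk_\<nu>: "smk k (\<lambda>p. \<nu> p $ i)"
  unfolding smk_def using Ck_on_vec_nth[OF chart_open \<nu>_smooth] by (auto simp: o_def)

lemma continuous_on_F: "continuous_on UNIV F"
proof -
  have "continuous_on UNIV (\<lambda>p. \<Sum>i\<in>UNIV. F p $ i *\<^sub>R axis i (1::real))"
    by (intro continuous_intros smk_continuous[OF smk_F])
  then show ?thesis by (simp flip: vec_eq_sum_axis)
qed

lemma dF_has_derivative: "(V, f) \<in> \<A> \<Longrightarrow> w \<in> V \<Longrightarrow> ((F \<circ> f) has_derivative dF f w) (at w)"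
  using Ck_on_has_derivative[OF F_smooth] .

lemma dF_linear: "(V, f) \<in> \<A> \<Longrightarrow> w \<in> V \<Longrightarrow> linear (dF f w)"
  using dF_has_derivative has_derivative_linear by blast

lemma dF_smooth: "(V, f) \<in> \<A> \<Longrightarrow> Ck_on k V (\<lambda>w. dF f w a)"
  using F_smooth[of V f "Suc k"] by simp

lemma dF_inj: "(V, f) \<in> \<A> \<Longrightarrow> w \<in> V \<Longrightarrow> inj (dF f w)"
  using immersion by (auto simp: immersion_def)

lemma normal_orth: "(V, f) \<in> \<A> \<Longrightarrow> w \<in> V \<Longrightarrow> \<nu> (f w) \<bullet> dF f w a = 0"
  using normal_field by (auto simp: unit_normal_field_def)

lemma norm_normal [simp]: "norm (\<nu> p) = 1"
proof -
  obtain V f w where f: "(V, f) \<in> \<A>" "w \<in> V" "f w = p" using atlas_cover .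
  then show ?thesis using normal_field by (auto simp: unit_normal_field_def)
qed

lemma normal_normal [simp]: "\<nu> p \<bullet> \<nu> p = 1"
  by (simp add: norm_eq_1[symmetric])

text \<open>Dimension count: the image of the injective differential lies in the hyperplane
  orthogonal to the normal and has the same dimension. Codimension one enters through
  \<open>card_m\<close>.\<close>

lemma tangent_range:
  assumes f: "(V, f) \<in> \<A>" "w \<in> V" and v: "v \<bullet> \<nu> (f w) = 0"
  obtains a where "v = dF f w a"
proof -
  note L = dF_linear[OF f]
  let ?T = "{x. \<nu> (f w) \<bullet> x = 0}"
  have sub: "range (dF f w) \<subseteq> ?T" using normal_orth[OF f] by auto
  have "\<nu> (f w) \<noteq> 0" using norm_normal[of "f w"] by force
  then have "dim ?T = DIM(real^'m) - 1" by (rule dim_hyperplane)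
  moreover have "dim (range (dF f w)) = DIM(real^'n)"
    using dim_image_eq[OF L] dF_inj[OF f] by (simp add: inj_on_subset dim_UNIV)
  ultimately have "dim ?T \<le> dim (range (dF f w))" using card_m by simp
  then have "range (dF f w) = ?T"
    using subspace_dim_equal[OF _ _ sub] linear_subspace_image[OF L subspace_UNIV] subspace_hyperplane by blast
  then show ?thesis using v that by (auto simp: inner_commute)
qed

text \<open>The tangential gradient as the Riesz representative of the differential inside the
  ambient space: tangency and the pairing with chart directions determine it without reference to
  the inverse metric.\<close>

definition is_grad :: "('p \<Rightarrow> real) \<Rightarrow> 'p \<Rightarrow> real^'m \<Rightarrow> bool" where
  "is_grad u p G \<longleftrightarrow> G \<bullet> \<nu> p = 0 \<and> (\<forall>V f w. (V, f) \<in> \<A> \<longrightarrow> w \<in> V \<longrightarrow> f w = p \<longrightarrow>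
     (\<forall>a. G \<bullet> dF f w a = frechet_derivative (\<lambda>w. u (f w)) (at w) a))"

definition grad :: "('p \<Rightarrow> real) \<Rightarrow> 'p \<Rightarrow> real^'m" where
  "grad u p = (THE G. is_grad u p G)"

text \<open>Under a change of chart both sides are composed with the same derivative of the
  transition map, so checking one chart at the point suffices.\<close>

lemma is_gradI:
  assumes u: "smk (Suc 0) u" and f: "(V, f) \<in> \<A>" "w \<in> V" "f w = p" and \<nu>: "G \<bullet> \<nu> p = 0"
    and G: "\<And>a. G \<bullet> dF f w a = frechet_derivative (\<lambda>w. u (f w)) (at w) a"
  shows "is_grad u p G"
  unfolding is_grad_def
proof (intro conjI allI impI \<nu>)
  fix W g z a assume g: "(W, g) \<in> \<A>" "z \<in> W" "g z = p"
  define D \<psi> where "D = W \<inter> g -` (f ` V)" and "\<psi> = inv_into V f \<circ> g"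
  note tr = transition[OF f(1) g(1), folded D_def \<psi>_def]
  have zD: "z \<in> D" using g f by (auto simp: D_def intro!: image_eqI[of _ f w])
  have \<psi>z: "\<psi> z = w"
    using g f inv_into_f_f[OF chart_inj[OF f(1)] f(2)] by (simp add: \<psi>_def)
  have d\<psi>: "\<psi> differentiable at z" using Ck_on_imp_differentiable[OF tr(2) zD] .
  have "dF g z a = frechet_derivative ((F \<circ> f) \<circ> \<psi>) (at z) a"
    by (rule frechet_derivative_cong_open[OF tr(1) zD, THEN fun_cong]) (simp add: tr)
  also have "\<dots> = dF f w (frechet_derivative \<psi> (at z) a)"
    using frechet_derivative_compose'[OF d\<psi>, of "F \<circ> f" a] \<psi>z dF_has_derivative[OF f(1,2)]
    by (auto simp: differentiable_def)
  finally have 1: "dF g z a = dF f w (frechet_derivative \<psi> (at z) a)" .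
  have "frechet_derivative (\<lambda>w. u (g w)) (at z) a = frechet_derivative ((\<lambda>w. u (f w)) \<circ> \<psi>) (at z) a"
    by (rule frechet_derivative_cong_open[OF tr(1) zD, THEN fun_cong]) (simp add: tr)
  also have "\<dots> = frechet_derivative (\<lambda>w. u (f w)) (at w) (frechet_derivative \<psi> (at z) a)"
    using frechet_derivative_compose'[OF d\<psi>, of "\<lambda>w. u (f w)" a] \<psi>z
      Ck_on_imp_differentiable[OF smkD[OF u f(1)] f(2)] by simp
  finally show "G \<bullet> dF g z a = frechet_derivative (\<lambda>w. u (g w)) (at z) a"
    using 1 G by simp
qed

lemma is_grad_unique:
  assumes "is_grad u p G" "is_grad u p G'" shows "G = G'"
proof -
  obtain V f w where f: "(V, f) \<in> \<A>" "w \<in> V" "f w = p" using atlas_cover .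
  have "(G - G') \<bullet> \<nu> (f w) = 0" using assms f by (simp add: is_grad_def inner_diff_left)
  then obtain a where a: "G - G' = dF f w a" using tangent_range[OF f(1,2)] by blast
  have "(G - G') \<bullet> dF f w a = 0" using assms f by (simp add: is_grad_def inner_diff_left)
  then show ?thesis using a by simp
qed

text \<open>A vector in the kernel of the Gram matrix has an image of length zero, which injectivity
  of the differential excludes.\<close>

lemma metric_det_nonzero:
  assumes f: "(V, f) \<in> \<A>" "w \<in> V" shows "det (induced_metric F f w) \<noteq> 0"
proof -
  note L = dF_linear[OF f]
  have "x = 0" if "induced_metric F f w *v x = 0" for x
  proof -
    have "(induced_metric F f w *v x) $ i = dF f w (axis i 1) \<bullet> dF f w x" for i
      unfolding linear_eq_sum_axis[OF L, of x]
      by (simp add: induced_metric_def matrix_vector_mult_def inner_sum_right mult.commute)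
    then have "dF f w (axis i 1) \<bullet> dF f w x = 0" for i using that by (metis zero_index)
    moreover have "dF f w x \<bullet> dF f w x = (\<Sum>i\<in>UNIV. x $ i * (dF f w (axis i 1) \<bullet> dF f w x))"
      using arg_cong[OF linear_eq_sum_axis[OF L, of x], of "\<lambda>v. v \<bullet> dF f w x"] by (simp add: inner_sum_left)
    ultimately have "dF f w x = 0" by simp
    then show "x = 0" using dF_inj[OF f] linear_0[OF L] by (metis injD)
  qed
  then show ?thesis
    by (metis invertible_det_nz invertible_left_inverse matrix_left_invertible_ker)
qed

definition metric_inv :: "(real^'n \<Rightarrow> 'p) \<Rightarrow> real^'n \<Rightarrow> real^'n^'n" where
  "metric_inv f w = matrix_inv (induced_metric F f w)"

lemma metric_smooth: "(V, f) \<in> \<A> \<Longrightarrow> Ck_on k V (\<lambda>w. induced_metric F f w $ a $ b)"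
  unfolding induced_metric_def by (simp add: Ck_on_inner chart_open dF_smooth del: Ck_on.simps)

lemma metric_inv_smooth: "(V, f) \<in> \<A> \<Longrightarrow> Ck_on k V (\<lambda>w. metric_inv f w $ a $ b)"
  unfolding metric_inv_def
  by (intro Ck_on_matrix_inv metric_smooth chart_open metric_det_nonzero)

lemma metric_inv_mult:
  assumes "(V, f) \<in> \<A>" "w \<in> V"
  shows "metric_inv f w ** induced_metric F f w = mat 1"
  unfolding metric_inv_def by (rule matrix_inv_inverse[OF metric_det_nonzero[OF assms]])

text \<open>The coordinate expression of the gradient, the differential with its index raised by
  \<open>metric_inv\<close>. It supplies existence and makes smoothness of the gradient visible,
  which the description by \<open>is_grad\<close> does not.\<close>

definition grad_formula :: "('p \<Rightarrow> real) \<Rightarrow> (real^'n \<Rightarrow> 'p) \<Rightarrow> real^'n \<Rightarrow> real^'m" where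
  "grad_formula u f w = (\<Sum>a\<in>UNIV. \<Sum>b\<in>UNIV.
     (frechet_derivative (\<lambda>w. u (f w)) (at w) (axis a 1) * metric_inv f w $ a $ b) *\<^sub>R dF f w (axis b 1))"

lemma is_grad_formula:
  assumes u: "smk (Suc 0) u" and f: "(V, f) \<in> \<A>" "w \<in> V"
  shows "is_grad u (f w) (grad_formula u f w)"
proof (rule is_gradI[OF u f refl])
  note L = dF_linear[OF f]
  let ?d = "frechet_derivative (\<lambda>w. u (f w)) (at w)"
  have dL: "linear ?d"
    using Ck_on_has_derivative[OF smkD[OF u f(1)] f(2)] has_derivative_linear by blast
  show "grad_formula u f w \<bullet> \<nu> (f w) = 0"
    using normal_orth[OF f] by (simp add: grad_formula_def inner_sum_left inner_commute[of _ "\<nu> (f w)"] inner_sum_right)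
  have *: "grad_formula u f w \<bullet> dF f w (axis c 1) = ?d (axis c 1)" for c
  proof -
    have "grad_formula u f w \<bullet> dF f w (axis c 1)
        = (\<Sum>a\<in>UNIV. ?d (axis a 1) * (\<Sum>b\<in>UNIV. metric_inv f w $ a $ b * induced_metric F f w $ b $ c))"
      by (simp add: grad_formula_def inner_sum_left sum_distrib_left induced_metric_def mult.assoc)
    also have "\<dots> = (\<Sum>a\<in>UNIV. ?d (axis a 1) * (mat 1 :: real^'n^'n) $ a $ c)"
      using metric_inv_mult[OF f] by (simp add: matrix_matrix_mult_def vec_eq_iff)
    also have "\<dots> = ?d (axis c 1)" by (simp add: mat_def if_distrib cong: if_cong)
    finally show ?thesis .
  qed
  show "grad_formula u f w \<bullet> dF f w a = ?d a" for a
    unfolding linear_eq_sum_axis[OF L, of a] linear_eq_sum_axis[OF dL, of a]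
    by (simp add: inner_sum_right *)
qed

lemma grad_is_grad: "smk (Suc 0) u \<Longrightarrow> is_grad u p (grad u p)"
proof -
  assume u: "smk (Suc 0) u"
  obtain V f w where "(V, f) \<in> \<A>" "w \<in> V" "f w = p" using atlas_cover .
  then have "\<exists>!G. is_grad u p G" using is_grad_formula[OF u] is_grad_unique by blast
  then show ?thesis unfolding grad_def by (rule theI')
qed

lemma grad_eqI: "smk (Suc 0) u \<Longrightarrow> is_grad u p G \<Longrightarrow> grad u p = G"
  using grad_is_grad is_grad_unique by blast

lemma grad_chart:
  "smk (Suc 0) u \<Longrightarrow> (V, f) \<in> \<A> \<Longrightarrow> w \<in> V
    \<Longrightarrow> grad u (f w) \<bullet> dF f w a = frechet_derivative (\<lambda>w. u (f w)) (at w) a"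
  using grad_is_grad[of u "f w"] by (auto simp: is_grad_def)

lemma grad_normal: "smk (Suc 0) u \<Longrightarrow> grad u p \<bullet> \<nu> p = 0"
  using grad_is_grad by (auto simp: is_grad_def)

lemma has_derivative_chart:
  assumes "smk (Suc 0) u" "(V, f) \<in> \<A>" "w \<in> V"
  shows "((\<lambda>w. u (f w)) has_derivative (\<lambda>a. grad u (f w) \<bullet> dF f w a)) (at w)"
  using Ck_on_has_derivative[OF smkD[OF assms(1,2)] assms(3)] grad_chart[OF assms] by simp

lemma grad_eqI':
  assumes "smk (Suc 0) u" "G \<bullet> \<nu> p = 0"
    and "\<And>V f w. (V, f) \<in> \<A> \<Longrightarrow> w \<in> V \<Longrightarrow> f w = p \<Longrightarrow>
      ((\<lambda>w. u (f w)) has_derivative (\<lambda>a. G \<bullet> dF f w a)) (at w)"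
  shows "grad u p = G"
proof (rule grad_eqI[OF assms(1)])
  show "is_grad u p G" unfolding is_grad_def
    using assms(2,3) frechet_derivative_at by metis
qed

text \<open>The hypersurface is studied through the derivations \<open>\<delta> i\<close>, the ambient components of the
  tangential gradient, so that no connection or tensor bundle is needed.\<close>

definition \<delta> :: "'m \<Rightarrow> ('p \<Rightarrow> real) \<Rightarrow> 'p \<Rightarrow> real" where
  "\<delta> i u p = grad u p $ i"

lemma smk_\<delta>:
  assumes u: "smk (Suc k) u" shows "smk k (\<delta> i u)"
  unfolding smk_def
proof safe
  fix V f assume f: "(V, f) \<in> \<A>"
  have u1: "smk (Suc 0) u" using smk_le[OF u] by simp
  have "Ck_on k V (\<lambda>w. grad_formula u f w $ i)"
    unfolding grad_formula_def using smkD[OF u f]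
    by (intro Ck_on_vec_nth Ck_on_sum Ck_on_scaleR Ck_on_mult chart_open[OF f] metric_inv_smooth[OF f] dF_smooth[OF f]) simp
  then show "Ck_on k V (\<lambda>w. \<delta> i u (f w))"
    by (rule Ck_on_eqI[OF chart_open[OF f]])
      (simp add: \<delta>_def grad_eqI[OF u1 is_grad_formula[OF u1 f]])
qed

section \<open>Calculus rules for the tangential gradient and its components\<close>

lemma grad_const [simp]: "grad (\<lambda>_. c) p = 0"
  by (rule grad_eqI') (auto simp: smk_const)

lemma grad_add:
  assumes "smk (Suc 0) u" "smk (Suc 0) v"
  shows "grad (\<lambda>p. u p + v p) p = grad u p + grad v p"
  by (rule grad_eqI') (auto simp: assms smk_add grad_normal inner_add_left
      intro!: has_derivative_eq_rhs[OF has_derivative_add[OF has_derivative_chart has_derivative_chart]])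

lemma grad_mult:
  assumes "smk (Suc 0) u" "smk (Suc 0) v"
  shows "grad (\<lambda>p. u p * v p) p = v p *\<^sub>R grad u p + u p *\<^sub>R grad v p"
  by (rule grad_eqI') (auto simp: assms smk_mult grad_normal inner_add_left
      intro!: has_derivative_eq_rhs[OF has_derivative_mult[OF has_derivative_chart has_derivative_chart]])

lemma grad_chain:
  assumes "smk (Suc 0) u" "smk (Suc 0) (\<lambda>p. \<phi> (u p))" "(\<phi> has_real_derivative d) (at (u p))"
  shows "grad (\<lambda>p. \<phi> (u p)) p = d *\<^sub>R grad u p"
proof (rule grad_eqI'[OF assms(2)])
  fix V f w assume f: "(V, f) \<in> \<A>" "w \<in> V" "f w = p"
  show "((\<lambda>w. \<phi> (u (f w))) has_derivative (\<lambda>a. (d *\<^sub>R grad u p) \<bullet> dF f w a)) (at w)"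
    using has_derivative_compose[OF has_derivative_chart[OF assms(1) f(1,2)], of \<phi> "(*) d"] assms(3) f(3)
    by (simp add: has_field_derivative_def)
qed (simp add: grad_normal assms)

lemma grad_F: "grad (\<lambda>p. F p $ i) p = axis i 1 - \<nu> p $ i *\<^sub>R \<nu> p"
proof (rule grad_eqI'[OF smk_F])
  show "(axis i 1 - \<nu> p $ i *\<^sub>R \<nu> p) \<bullet> \<nu> p = 0"
    by (simp add: inner_diff_left inner_axis inner_commute[of "axis i 1"])
  fix V f w assume f: "(V, f) \<in> \<A>" "w \<in> V" "f w = p"
  show "((\<lambda>w. F (f w) $ i) has_derivative (\<lambda>a. (axis i 1 - \<nu> p $ i *\<^sub>R \<nu> p) \<bullet> dF f w a)) (at w)"
    using bounded_linear.has_derivative[OF bounded_linear_vec_nth dF_has_derivative[OF f(1,2)], of i] normal_orth[OF f(1,2)] f(3)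
    by (simp add: inner_diff_left inner_axis inner_commute[of "axis i 1"] o_def)
qed

lemma grad_cong_open:
  assumes "smk (Suc 0) u" "smk (Suc 0) v" "open U" "p \<in> U" "\<And>q. q \<in> U \<Longrightarrow> u q = v q"
  shows "grad u p = grad v p"
proof (rule grad_eqI'[OF assms(1)])
  fix V f w assume f: "(V, f) \<in> \<A>" "w \<in> V" "f w = p"
  have "open (V \<inter> f -` U)"
    by (rule continuous_open_preimage[OF chart_cont[OF f(1)] chart_open[OF f(1)] assms(3)])
  then show "((\<lambda>w. u (f w)) has_derivative (\<lambda>a. grad v p \<bullet> dF f w a)) (at w)"
    using has_derivative_transform_within_open[OF has_derivative_chart[OF assms(2) f(1,2)], of "V \<inter> f -` U" "\<lambda>w. u (f w)"]
      f assms(4,5) by auto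
qed (simp add: grad_normal assms)

text \<open>The shape operator, as the differential of the Gauss map, written as a matrix over
  ambient indices that annihilates the normal. Its ambient trace and squared norm therefore agree
  with those taken in a tangent frame.\<close>

definition A :: "'m \<Rightarrow> 'm \<Rightarrow> 'p \<Rightarrow> real" where
  "A i j = \<delta> i (\<lambda>p. \<nu> p $ j)"

lemma smk_A: "smk k (A i j)"
  unfolding A_def by (intro smk_\<delta> smk_\<nu>)

lemma normal_\<delta>: "smk (Suc 0) u \<Longrightarrow> (\<Sum>i\<in>UNIV. \<nu> p $ i * \<delta> i u p) = 0"
  using grad_normal[of u p] by (simp add: \<delta>_def inner_vec_def mult.commute)

lemma normal_A_left: "(\<Sum>i\<in>UNIV. \<nu> p $ i * A i j p) = 0"
  unfolding A_def by (rule normal_\<delta>[OF smk_\<nu>])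

lemma \<delta>_const [simp]: "\<delta> i (\<lambda>_. c) p = 0" by (simp add: \<delta>_def)

lemma \<delta>_add: "smk (Suc 0) u \<Longrightarrow> smk (Suc 0) v \<Longrightarrow> \<delta> i (\<lambda>p. u p + v p) p = \<delta> i u p + \<delta> i v p"
  by (simp add: \<delta>_def grad_add)

lemma \<delta>_mult: "smk (Suc 0) u \<Longrightarrow> smk (Suc 0) v
    \<Longrightarrow> \<delta> i (\<lambda>p. u p * v p) p = \<delta> i u p * v p + u p * \<delta> i v p"
  by (simp add: \<delta>_def grad_mult)

lemma \<delta>_cmult: "smk (Suc 0) u \<Longrightarrow> \<delta> i (\<lambda>p. c * u p) p = c * \<delta> i u p"
  using \<delta>_mult[OF smk_const] by simp

lemma \<delta>_minus: "smk (Suc 0) u \<Longrightarrow> \<delta> i (\<lambda>p. - u p) p = - \<delta> i u p"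
  using \<delta>_cmult[of u i "-1"] by simp

lemma \<delta>_diff: "smk (Suc 0) u \<Longrightarrow> smk (Suc 0) v \<Longrightarrow> \<delta> i (\<lambda>p. u p - v p) p = \<delta> i u p - \<delta> i v p"
  using \<delta>_add[OF _ smk_minus, of u v i p] by (simp add: \<delta>_minus)

lemma \<delta>_sum: "(\<And>j. j \<in> I \<Longrightarrow> smk (Suc 0) (u j)) \<Longrightarrow> \<delta> i (\<lambda>p. \<Sum>j\<in>I. u j p) p = (\<Sum>j\<in>I. \<delta> i (u j) p)"
proof (induction I rule: infinite_finite_induct)
  case (insert j I)
  then show ?case by (simp add: \<delta>_add smk_sum)
qed auto

lemma \<delta>_F: "\<delta> i (\<lambda>p. F p $ j) p = (if i = j then 1 else 0) - \<nu> p $ i * \<nu> p $ j"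
  by (simp add: \<delta>_def grad_F axis_def)

lemma normal_sq: "(\<Sum>i\<in>UNIV. \<nu> p $ i * \<nu> p $ i) = 1"
  using normal_normal[of p] by (simp add: inner_vec_def)

text \<open>Differentiate \<open>normal_sq\<close>.\<close>

lemma normal_A_right: "(\<Sum>j\<in>UNIV. A i j p * \<nu> p $ j) = 0"
proof -
  have "\<delta> i (\<lambda>p. \<Sum>j\<in>UNIV. \<nu> p $ j * \<nu> p $ j) p = 2 * (\<Sum>j\<in>UNIV. A i j p * \<nu> p $ j)"
    by (simp add: \<delta>_sum \<delta>_mult smk_mult smk_\<nu> A_def sum_distrib_left mult.commute)
  then show ?thesis by (simp add: normal_sq)
qed

section \<open>Symmetry of the shape operator and commutation of the derivations\<close>

lemma frechet_grad: "smk (Suc 0) u \<Longrightarrow> (V, f) \<in> \<A> \<Longrightarrow> w \<in> V \<Longrightarrow>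
    frechet_derivative (\<lambda>w. u (f w)) (at w) b = (\<Sum>i\<in>UNIV. dF f w b $ i * \<delta> i u (f w))"
  by (simp add: grad_chart[symmetric] inner_vec_def \<delta>_def mult.commute)

text \<open>Split each coordinate vector into tangential and normal part. The tangential block is
  symmetric, the left contraction with the normal vanishes and the right one is
  \<open>- r i\<close>, so \<open>r\<close> accounts for the whole asymmetry of \<open>M\<close>.
  The shape operator is the case \<open>r = 0\<close>; second derivatives of a function are the case
  with a correction.\<close>

lemma tangential_symmetric:
  fixes M :: "'m \<Rightarrow> 'm \<Rightarrow> real"
  assumes f: "(V, f) \<in> \<A>" "w \<in> V"
    and sym: "\<And>a b. (\<Sum>i\<in>UNIV. \<Sum>j\<in>UNIV. M i j * dF f w b $ i * dF f w a $ j)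
      = (\<Sum>i\<in>UNIV. \<Sum>j\<in>UNIV. M i j * dF f w a $ i * dF f w b $ j)"
    and left: "\<And>j. (\<Sum>i\<in>UNIV. \<nu> (f w) $ i * M i j) = 0"
    and right: "\<And>i. (\<Sum>j\<in>UNIV. M i j * \<nu> (f w) $ j) = - r i"
  shows "M i j + \<nu> (f w) $ j * r i = M j i + \<nu> (f w) $ i * r j"
proof -
  define B where "B x y = (\<Sum>i\<in>UNIV. \<Sum>j\<in>UNIV. M i j * x $ i * y $ j)" for x y :: "real^'m"
  let ?n = "\<nu> (f w)"
  have B_axis: "B (axis i 1) (axis j 1) = M i j" for i j
  proof -
    have "B (axis i 1) (axis j 1) = (\<Sum>i'\<in>UNIV. \<Sum>j'\<in>UNIV. if j' = j then (if i' = i then M i' j' else 0) else 0)"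
      unfolding B_def by (intro sum.cong refl) (simp add: axis_def)
    then show ?thesis by simp
  qed
  have Badd: "B (x + x') y = B x y + B x' y" "B x (y + y') = B x y + B x y'"
    "B (c *\<^sub>R x) y = c * B x y" "B x (c *\<^sub>R y) = c * B x y" for x x' y y' c
    by (simp_all add: B_def algebra_simps sum.distrib sum_distrib_left)
  have Bn: "B ?n y = 0" for y
  proof -
    have "B ?n y = (\<Sum>j\<in>UNIV. (\<Sum>i\<in>UNIV. ?n $ i * M i j) * y $ j)"
      unfolding B_def by (subst sum.swap) (simp add: sum_distrib_left mult_ac)
    then show ?thesis using left by simp
  qed
  have Br: "B (axis i 1) ?n = - r i" for i
  proof -
    have "B (axis i 1) ?n = (\<Sum>i'\<in>UNIV. if i' = i then (\<Sum>j\<in>UNIV. M i' j * ?n $ j) else 0)"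
      unfolding B_def by (intro sum.cong refl) (auto simp: axis_def)
    then show ?thesis using right by simp
  qed
  define P where "P i = axis i 1 - ?n $ i *\<^sub>R ?n" for i
  have "\<exists>a. P i = dF f w a" for i
    by (rule tangent_range[OF f, of "P i"]) (auto simp: P_def inner_diff_left inner_axis inner_commute[of "axis i 1"])
  then obtain a where a: "\<And>i. P i = dF f w (a i)" by metis
  have symP: "B (P i) (P j) = B (P j) (P i)" for i j
    unfolding a B_def by (rule sym)
  have "M i j = B (P i + ?n $ i *\<^sub>R ?n) (P j + ?n $ j *\<^sub>R ?n)" for i j
    using B_axis by (simp add: P_def)
  moreover have "B (P i) ?n = - r i" for i
  proof -
    have "axis i 1 = P i + ?n $ i *\<^sub>R ?n" by (simp add: P_def)
    then have "B (axis i 1) ?n = B (P i) ?n" using Badd Bn by simp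
    then show ?thesis using Br by simp
  qed
  ultimately have "M i j = B (P i) (P j) - ?n $ j * r i" for i j
    by (simp add: Badd Bn)
  then show ?thesis using symP by simp
qed

lemma dF_derivative_symmetric:
  assumes f: "(V, f) \<in> \<A>" "w \<in> V"
  shows "frechet_derivative (\<lambda>w. dF f w a) (at w) b = frechet_derivative (\<lambda>w. dF f w b) (at w) a"
proof -
  have 1: "frechet_derivative (\<lambda>w. F (f w) $ k) (at z) a = dF f z a $ k" if "z \<in> V" for z a k
    using frechet_derivative_eqI[OF bounded_linear.has_derivative[OF bounded_linear_vec_nth dF_has_derivative[OF f(1) that]]]
    by (simp add: o_def)
  have 2: "frechet_derivative (\<lambda>w. frechet_derivative (\<lambda>w. F (f w) $ k) (at w) a) (at w) b
      = frechet_derivative (\<lambda>w. dF f w a) (at w) b $ k" for a b k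
  proof -
    have "frechet_derivative (\<lambda>w. frechet_derivative (\<lambda>w. F (f w) $ k) (at w) a) (at w) b
      = frechet_derivative (\<lambda>w. dF f w a $ k) (at w) b"
      by (rule frechet_derivative_cong_open[OF chart_open[OF f(1)] f(2), THEN fun_cong]) (simp add: 1)
    also have "\<dots> = frechet_derivative (\<lambda>w. dF f w a) (at w) b $ k"
      by (rule frechet_derivative_eqI[OF bounded_linear.has_derivative[OF bounded_linear_vec_nth
            Ck_on_has_derivative[OF dF_smooth[OF f(1)] f(2)]]])
    finally show ?thesis .
  qed
  show ?thesis
    using second_derivative_symmetric[OF chart_open[OF f(1)] smkD[OF smk_F f(1)] f(2)]
    by (simp add: vec_eq_iff 2[symmetric])
qed

text \<open>Differentiating the orthogonality of normal and coordinate vectors moves the derivative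
  from the normal to the second derivatives of the immersion, and these are symmetric.\<close>

lemma A_symmetric: "A i j p = A j i p"
proof -
  obtain V f w where f: "(V, f) \<in> \<A>" "w \<in> V" "f w = p" using atlas_cover .
  have eq: "(\<Sum>i\<in>UNIV. \<Sum>j\<in>UNIV. A i j p * dF f w b $ i * dF f w a $ j)
      = - (\<nu> p \<bullet> frechet_derivative (\<lambda>w. dF f w a) (at w) b)" for a b
  proof -
    have d\<nu>: "((\<nu> \<circ> f) has_derivative frechet_derivative (\<nu> \<circ> f) (at w)) (at w)"
      using Ck_on_has_derivative[OF \<nu>_smooth[OF f(1)] f(2)] .
    have ddF: "((\<lambda>w. dF f w a) has_derivative frechet_derivative (\<lambda>w. dF f w a) (at w)) (at w)"
      using Ck_on_has_derivative[OF dF_smooth[OF f(1)] f(2)] .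
    have "((\<lambda>z. (\<nu> \<circ> f) z \<bullet> dF f z a) has_derivative (\<lambda>_. 0)) (at w)"
      by (rule has_derivative_transform_within_open[OF _ chart_open[OF f(1)] f(2), of "\<lambda>_. 0"])
        (auto simp: normal_orth[OF f(1)])
    moreover have "((\<lambda>z. (\<nu> \<circ> f) z \<bullet> dF f z a) has_derivative
        (\<lambda>b. (\<nu> \<circ> f) w \<bullet> frechet_derivative (\<lambda>w. dF f w a) (at w) b + frechet_derivative (\<nu> \<circ> f) (at w) b \<bullet> dF f w a)) (at w)"
      by (rule has_derivative_inner[OF d\<nu> ddF])
    ultimately have "\<nu> p \<bullet> frechet_derivative (\<lambda>w. dF f w a) (at w) b + frechet_derivative (\<nu> \<circ> f) (at w) b \<bullet> dF f w a = 0"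
      using f(3) by (auto dest: has_derivative_unique simp: fun_eq_iff)
    moreover have "frechet_derivative (\<nu> \<circ> f) (at w) b $ j = (\<Sum>i\<in>UNIV. dF f w b $ i * A i j p)" for j
    proof -
      have "((\<lambda>w. \<nu> (f w) $ j) has_derivative (\<lambda>b. frechet_derivative (\<nu> \<circ> f) (at w) b $ j)) (at w)"
        using bounded_linear.has_derivative[OF bounded_linear_vec_nth d\<nu>, of j] by (simp add: o_def)
      then have "frechet_derivative (\<lambda>w. \<nu> (f w) $ j) (at w) b = frechet_derivative (\<nu> \<circ> f) (at w) b $ j"
        using frechet_derivative_at by metis
      then show ?thesis using frechet_grad[OF smk_\<nu> f(1,2)] f(3) by (simp add: A_def)
    qed
    ultimately show ?thesis
      by (subst sum.swap) (simp add: inner_vec_def[of "frechet_derivative (\<nu> \<circ> f) (at w) b"] sum_distrib_left sum_distrib_right mult_ac eq_neg_iff_add_eq_0 add.commute)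
  qed
  have "A i j p + \<nu> (f w) $ j * 0 = A j i p + \<nu> (f w) $ i * 0"
    by (rule tangential_symmetric[OF f(1,2)])
      (use f(3) normal_A_left normal_A_right in \<open>auto simp: eq dF_derivative_symmetric[OF f(1,2)]\<close>)
  then show ?thesis by simp
qed

text \<open>Differentiate the chart expression of the first derivative. The subtracted term comes
  from the variation of the coordinate vectors; both terms are symmetric in the two directions,
  which is what the commutation rule uses.\<close>

lemma hessian_chart:
  assumes u: "smk (Suc (Suc 0)) u" and f: "(V, f) \<in> \<A>" "w \<in> V"
  shows "(\<Sum>i\<in>UNIV. \<Sum>j\<in>UNIV. \<delta> i (\<delta> j u) (f w) * dF f w b $ i * dF f w a $ j)
      = frechet_derivative (\<lambda>w. frechet_derivative (\<lambda>w. u (f w)) (at w) a) (at w) b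
        - grad u (f w) \<bullet> frechet_derivative (\<lambda>w. dF f w a) (at w) b"
proof -
  have u1: "smk (Suc 0) u" and du: "smk (Suc 0) (\<delta> j u)" for j
    using smk_SucD[OF u] smk_\<delta>[OF u] by auto
  have ddF: "((\<lambda>w. dF f w a) has_derivative frechet_derivative (\<lambda>w. dF f w a) (at w)) (at w)"
    using Ck_on_has_derivative[OF dF_smooth[OF f(1)] f(2)] .
  have ddF: "((\<lambda>w. dF f w a $ j) has_derivative (\<lambda>b. frechet_derivative (\<lambda>w. dF f w a) (at w) b $ j)) (at w)" for j
    using bounded_linear.has_derivative[OF bounded_linear_vec_nth ddF] .
  have dd: "((\<lambda>w. \<delta> j u (f w)) has_derivative (\<lambda>b. \<Sum>i\<in>UNIV. dF f w b $ i * \<delta> i (\<delta> j u) (f w))) (at w)" for j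
    using has_derivative_chart[OF du f] by (simp add: inner_vec_def \<delta>_def mult.commute)
  have "((\<lambda>z. \<Sum>j\<in>UNIV. dF f z a $ j * \<delta> j u (f z)) has_derivative
     (\<lambda>b. \<Sum>j\<in>UNIV. dF f w a $ j * (\<Sum>i\<in>UNIV. dF f w b $ i * \<delta> i (\<delta> j u) (f w))
         + frechet_derivative (\<lambda>w. dF f w a) (at w) b $ j * \<delta> j u (f w))) (at w)"
    by (intro has_derivative_sum has_derivative_eq_rhs[OF has_derivative_mult[OF ddF dd]]) auto
  then have "frechet_derivative (\<lambda>z. \<Sum>j\<in>UNIV. dF f z a $ j * \<delta> j u (f z)) (at w) b
     = (\<Sum>j\<in>UNIV. dF f w a $ j * (\<Sum>i\<in>UNIV. dF f w b $ i * \<delta> i (\<delta> j u) (f w))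
         + frechet_derivative (\<lambda>w. dF f w a) (at w) b $ j * \<delta> j u (f w))"
    by (rule frechet_derivative_eqI)
  moreover have "frechet_derivative (\<lambda>w. frechet_derivative (\<lambda>w. u (f w)) (at w) a) (at w) b
     = frechet_derivative (\<lambda>z. \<Sum>j\<in>UNIV. dF f z a $ j * \<delta> j u (f z)) (at w) b"
    by (rule frechet_derivative_cong_open[OF chart_open[OF f(1)] f(2), THEN fun_cong])
      (simp add: frechet_grad[OF u1 f(1)])
  ultimately show ?thesis
    by (subst sum.swap) (simp add: inner_vec_def[of "grad u (f w)"] sum.distrib sum_distrib_left \<delta>_def mult_ac)
qed

text \<open>The gradient is tangential at every point, but its derivative is not: differentiating
  its orthogonality to the normal gives a normal component expressed by \<open>A\<close>. Up to this
  component the second derivatives are symmetric.\<close>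

lemma \<delta>_commute:
  assumes u: "smk (Suc (Suc 0)) u"
  shows "\<delta> i (\<delta> j u) p + \<nu> p $ j * (\<Sum>k\<in>UNIV. A i k p * \<delta> k u p)
       = \<delta> j (\<delta> i u) p + \<nu> p $ i * (\<Sum>k\<in>UNIV. A j k p * \<delta> k u p)"
proof -
  obtain V f w where f: "(V, f) \<in> \<A>" "w \<in> V" "f w = p" using atlas_cover .
  have u1: "smk (Suc 0) u" and du: "smk (Suc 0) (\<delta> j u)" for j
    using smk_SucD[OF u] smk_\<delta>[OF u] by auto
  have right: "(\<Sum>j\<in>UNIV. \<delta> i (\<delta> j u) p * \<nu> p $ j) = - (\<Sum>k\<in>UNIV. A i k p * \<delta> k u p)" for i
  proof -
    have "\<delta> i (\<lambda>p. \<Sum>j\<in>UNIV. \<nu> p $ j * \<delta> j u p) p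
      = (\<Sum>k\<in>UNIV. A i k p * \<delta> k u p) + (\<Sum>j\<in>UNIV. \<delta> i (\<delta> j u) p * \<nu> p $ j)"
      by (simp add: \<delta>_sum \<delta>_mult smk_mult smk_\<nu> du A_def sum.distrib mult.commute)
    then show ?thesis using normal_\<delta>[OF u1] by simp
  qed
  show ?thesis
    unfolding f(3)[symmetric]
  proof (rule tangential_symmetric[OF f(1,2)])
    show "(\<Sum>i\<in>UNIV. \<nu> (f w) $ i * \<delta> i (\<delta> j u) (f w)) = 0" for j by (rule normal_\<delta>[OF du])
    show "(\<Sum>i\<in>UNIV. \<Sum>j\<in>UNIV. \<delta> i (\<delta> j u) (f w) * dF f w b $ i * dF f w a $ j)
      = (\<Sum>i\<in>UNIV. \<Sum>j\<in>UNIV. \<delta> i (\<delta> j u) (f w) * dF f w a $ i * dF f w b $ j)" for a b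
      unfolding hessian_chart[OF u f(1,2)] dF_derivative_symmetric[OF f(1,2), of a b]
      using second_derivative_symmetric[OF chart_open[OF f(1)] smkD[OF u f(1)] f(2)] by simp
    show "(\<Sum>j\<in>UNIV. \<delta> i (\<delta> j u) (f w) * \<nu> (f w) $ j) = - (\<Sum>k\<in>UNIV. A i k (f w) * \<delta> k u (f w))" for i
      using right f(3) by simp
  qed
qed

end

section \<open>Curvature identities on a self-expander\<close>

lemma sum_swap3:
  fixes g :: "'i::finite \<Rightarrow> 'j::finite \<Rightarrow> 'k::finite \<Rightarrow> real"
  shows "(\<Sum>k\<in>UNIV. \<Sum>i\<in>UNIV. \<Sum>j\<in>UNIV. g k i j) = (\<Sum>i\<in>UNIV. \<Sum>j\<in>UNIV. \<Sum>k\<in>UNIV. g k i j)"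
proof -
  have "(\<Sum>k\<in>UNIV. \<Sum>i\<in>UNIV. \<Sum>j\<in>UNIV. g k i j) = (\<Sum>i\<in>UNIV. \<Sum>k\<in>UNIV. \<Sum>j\<in>UNIV. g k i j)"
    by (rule sum.swap)
  also have "\<dots> = (\<Sum>i\<in>UNIV. \<Sum>j\<in>UNIV. \<Sum>k\<in>UNIV. g k i j)"
    by (intro sum.cong refl sum.swap)
  finally show ?thesis .
qed

lemma sum3_zero_middle:
  fixes g :: "'i::finite \<Rightarrow> 'j::finite \<Rightarrow> 'k::finite \<Rightarrow> real"
  assumes "\<And>k j. (\<Sum>i\<in>UNIV. g k i j) = 0"
  shows "(\<Sum>k\<in>UNIV. \<Sum>i\<in>UNIV. \<Sum>j\<in>UNIV. g k i j) = 0"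
proof -
  have "(\<Sum>k\<in>UNIV. \<Sum>i\<in>UNIV. \<Sum>j\<in>UNIV. g k i j) = (\<Sum>k\<in>UNIV. \<Sum>j\<in>UNIV. \<Sum>i\<in>UNIV. g k i j)"
    by (intro sum.cong refl sum.swap)
  then show ?thesis by (simp add: assms)
qed

lemma sum_projection:
  fixes Z n :: "'i::finite \<Rightarrow> real"
  shows "(\<Sum>i\<in>UNIV. ((if k = i then 1 else 0) - c * n i) * Z i) = Z k - c * (\<Sum>i\<in>UNIV. n i * Z i)"
proof -
  have "(\<Sum>i\<in>UNIV. (if k = i then 1 else 0) * Z i) = (\<Sum>i\<in>UNIV. if k = i then Z i else 0)"
    by (intro sum.cong) auto
  then show ?thesis by (simp add: left_diff_distrib sum_subtractf sum_distrib_left mult.assoc)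
qed

lemma sum3_zero_first:
  fixes g :: "'i::finite \<Rightarrow> 'j::finite \<Rightarrow> 'k::finite \<Rightarrow> real"
  assumes "\<And>i j. (\<Sum>k\<in>UNIV. g k i j) = 0"
  shows "(\<Sum>k\<in>UNIV. \<Sum>i\<in>UNIV. \<Sum>j\<in>UNIV. g k i j) = 0"
  by (subst sum_swap3) (simp add: assms)

text \<open>The equation is imposed on the trace of \<open>A\<close>; that this trace is the mean
  curvature defined by frames is proved in \<open>mean_curvature_eq\<close>, before the locale is
  interpreted.\<close>

locale expander = hypersurface \<A> F \<nu>
  for \<A> :: "('n::finite, 'p::{t2_space,second_countable_topology}) atlas"
    and F \<nu> :: "'p \<Rightarrow> real ^ 'm" +
  assumes trace_A: "(\<Sum>i\<in>UNIV. A i i p) = - (1/2) * (F p \<bullet> \<nu> p)"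
begin

definition H :: "'p \<Rightarrow> real" where "H p = (\<Sum>i\<in>UNIV. A i i p)"

definition S :: "'p \<Rightarrow> real" where "S p = (\<Sum>i\<in>UNIV. \<Sum>j\<in>UNIV. A i j p * A i j p)"

definition A2 :: "'m \<Rightarrow> 'm \<Rightarrow> 'p \<Rightarrow> real" where "A2 i j p = (\<Sum>k\<in>UNIV. A i k p * A k j p)"

text \<open>The ambient components of \<open>\<nabla>A\<close>; the last two terms remove the normal part of \<open>\<delta> k (A i j)\<close>.\<close>

definition C :: "'m \<Rightarrow> 'm \<Rightarrow> 'm \<Rightarrow> 'p \<Rightarrow> real" where
  "C k i j p = \<delta> k (A i j) p + \<nu> p $ i * A2 k j p + \<nu> p $ j * A2 k i p"

definition h :: "'m \<Rightarrow> 'p \<Rightarrow> real" where "h k = \<delta> k H"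

text \<open>Half of the gradient of \<open>S\<close>, by \<open>\<delta>_S\<close>.\<close>

definition \<sigma> :: "'m \<Rightarrow> 'p \<Rightarrow> real" where
  "\<sigma> k p = (\<Sum>i\<in>UNIV. \<Sum>j\<in>UNIV. A i j p * C k i j p)"

lemma smk_A2: "smk k (A2 i j)"
  unfolding A2_def by (intro smk_sum smk_mult smk_A)

lemma smk_C: "smk l (C k i j)"
  unfolding C_def by (intro smk_add smk_mult smk_A2 smk_\<nu> smk_\<delta> smk_A)

lemma smk_H: "smk k H"
  unfolding H_def by (intro smk_sum smk_A)

lemma smk_S: "smk k S"
  unfolding S_def by (intro smk_sum smk_mult smk_A)

lemma smk_h: "smk k (h i)"
  unfolding h_def by (intro smk_\<delta> smk_H)

lemma smk_\<sigma>: "smk k (\<sigma> i)"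
  unfolding \<sigma>_def by (intro smk_sum smk_mult smk_A smk_C)

section \<open>Codazzi symmetry and first-order identities\<close>

lemma A_sym_fun: "A i j = A j i"
  using A_symmetric by blast

lemma A2_sym: "A2 i j p = A2 j i p"
  unfolding A2_def by (simp add: A_symmetric mult.commute)

lemma normal_A: "(\<Sum>i\<in>UNIV. \<nu> p $ i * A i j p) = 0" "(\<Sum>i\<in>UNIV. \<nu> p $ i * A j i p) = 0"
  using normal_A_left[of p j] by (simp_all add: A_symmetric[of j])

lemma normal_A2: "(\<Sum>i\<in>UNIV. \<nu> p $ i * A2 i j p) = 0" "(\<Sum>i\<in>UNIV. \<nu> p $ i * A2 j i p) = 0"
proof -
  have "(\<Sum>i\<in>UNIV. \<nu> p $ i * A2 i j p) = (\<Sum>k\<in>UNIV. (\<Sum>i\<in>UNIV. \<nu> p $ i * A i k p) * A k j p)"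
    unfolding A2_def sum_distrib_left sum_distrib_right by (subst sum.swap) (simp add: mult_ac)
  then show "(\<Sum>i\<in>UNIV. \<nu> p $ i * A2 i j p) = 0" by (simp add: normal_A)
  then show "(\<Sum>i\<in>UNIV. \<nu> p $ i * A2 j i p) = 0" by (simp add: A2_sym[of j])
qed

text \<open>The commutation rule applied to a component of the normal. Together with the symmetry of
  \<open>A\<close> it makes the corrected derivative \<open>C\<close> totally symmetric.\<close>

lemma codazzi: "\<delta> k (A i j) p + \<nu> p $ i * A2 k j p = \<delta> i (A k j) p + \<nu> p $ k * A2 i j p"
  using \<delta>_commute[OF smk_\<nu>, of k i j p] unfolding A2_def A_def .

lemma C_sym12: "C k i j p = C i k j p"
  using codazzi[of k i j p] A2_sym[of k i p] by (simp add: C_def)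

lemma C_sym23: "C k i j p = C k j i p"
  by (simp add: C_def A_sym_fun[of i j])

lemma normal_\<delta>A: "(\<Sum>i\<in>UNIV. \<nu> p $ i * \<delta> k (A i j) p) = - A2 k j p"
proof -
  have "\<delta> k (\<lambda>p. \<Sum>i\<in>UNIV. \<nu> p $ i * A i j p) p
      = A2 k j p + (\<Sum>i\<in>UNIV. \<nu> p $ i * \<delta> k (A i j) p)"
    by (simp add: \<delta>_sum \<delta>_mult smk_mult smk_\<nu> smk_A sum.distrib A2_def A_def[symmetric])
  then show ?thesis by (simp add: normal_A)
qed

text \<open>The two correction terms of \<open>C\<close> compensate exactly the normal part found in
  \<open>normal_\<delta>A\<close>. By total symmetry \<open>C\<close> is then tangential in all
  three indices.\<close>

lemma normal_C: "(\<Sum>i\<in>UNIV. \<nu> p $ i * C k i j p) = 0"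
proof -
  have "(\<Sum>i\<in>UNIV. \<nu> p $ i * C k i j p) = (\<Sum>i\<in>UNIV. \<nu> p $ i * \<delta> k (A i j) p)
      + (\<Sum>i\<in>UNIV. \<nu> p $ i * \<nu> p $ i) * A2 k j p + \<nu> p $ j * (\<Sum>i\<in>UNIV. \<nu> p $ i * A2 k i p)"
    by (simp add: C_def algebra_simps sum.distrib sum_distrib_left)
  then show ?thesis by (simp add: normal_\<delta>A normal_sq normal_A2)
qed

lemma normal_C': "(\<Sum>j\<in>UNIV. \<nu> p $ j * C k i j p) = 0" "(\<Sum>k\<in>UNIV. \<nu> p $ k * C k i j p) = 0"
  using normal_C[of p k i] normal_C[of p i j] unfolding C_sym23[of k _ i] C_sym12[of i] by simp_all

lemma h_trace: "h k p = (\<Sum>i\<in>UNIV. C k i i p)"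
proof -
  have "h k p = (\<Sum>i\<in>UNIV. \<delta> k (A i i) p)"
    unfolding h_def H_def by (simp add: \<delta>_sum smk_A)
  then show ?thesis
    using normal_A2(2)[of p k] by (simp add: C_def sum.distrib sum_distrib_left[symmetric])
qed

lemma H_eq: "H p = - (1/2) * (\<Sum>i\<in>UNIV. F p $ i * \<nu> p $ i)"
  using trace_A[of p] by (simp add: H_def inner_vec_def)

text \<open>Differentiate the expander equation. The derivative of the position is the tangential
  projection, which kills the normal, so only the derivative of the normal contributes.\<close>

lemma h_eq: "h k p = - (1/2) * (\<Sum>j\<in>UNIV. A k j p * F p $ j)"
proof -
  have "h k p = \<delta> k (\<lambda>p. - (1/2) * (\<Sum>i\<in>UNIV. F p $ i * \<nu> p $ i)) p"
    unfolding h_def using H_eq by presburger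
  also have "\<dots> = - (1/2) * (\<Sum>i\<in>UNIV. ((if k = i then 1 else 0) - \<nu> p $ k * \<nu> p $ i) * \<nu> p $ i + F p $ i * A k i p)"
    by (subst \<delta>_cmult) (simp_all add: \<delta>_sum \<delta>_mult smk_mult smk_sum smk_\<nu> smk_F \<delta>_F A_def)
  also have "\<dots> = - (1/2) * (\<nu> p $ k - \<nu> p $ k * (\<Sum>i\<in>UNIV. \<nu> p $ i * \<nu> p $ i) + (\<Sum>i\<in>UNIV. F p $ i * A k i p))"
    by (simp only: sum.distrib sum_projection)
  finally show ?thesis by (simp add: normal_sq mult.commute)
qed

lemma normal_h: "(\<Sum>k\<in>UNIV. \<nu> p $ k * h k p) = 0"
  unfolding h_def by (rule normal_\<delta>[OF smk_H])

lemma A2_trace: "(\<Sum>i\<in>UNIV. A2 i i p) = S p"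
  unfolding A2_def S_def by (simp add: A_symmetric)

text \<open>Contracted Codazzi equation: total symmetry turns the trace over the derivative index
  into the gradient of \<open>H\<close>. The normal term is what the corrections in \<open>C\<close>
  leave after contraction.\<close>

lemma divergence_A: "(\<Sum>k\<in>UNIV. \<delta> k (A k j) p) = h j p - \<nu> p $ j * S p"
proof -
  have "h j p = (\<Sum>k\<in>UNIV. C k k j p)"
    unfolding h_trace by (intro sum.cong refl) (metis C_sym12 C_sym23)
  also have "\<dots> = (\<Sum>k\<in>UNIV. \<delta> k (A k j) p) + (\<Sum>k\<in>UNIV. \<nu> p $ k * A2 k j p) + \<nu> p $ j * (\<Sum>k\<in>UNIV. A2 k k p)"
    by (simp add: C_def sum.distrib sum_distrib_left)
  finally show ?thesis by (simp add: normal_A2 A2_trace)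
qed

lemma \<delta>_h: "\<delta> i (h j) p = - (1/2) * ((\<Sum>l\<in>UNIV. F p $ l * \<delta> i (A j l) p) + A i j p)"
proof -
  have "\<delta> i (h j) p = \<delta> i (\<lambda>p. - (1/2) * (\<Sum>l\<in>UNIV. A j l p * F p $ l)) p"
    using h_eq by presburger
  also have "\<dots> = - (1/2) * (\<Sum>l\<in>UNIV. F p $ l * \<delta> i (A j l) p + ((if i = l then 1 else 0) - \<nu> p $ i * \<nu> p $ l) * A j l p)"
    by (subst \<delta>_cmult) (simp_all add: \<delta>_sum \<delta>_mult smk_mult smk_sum smk_A smk_F \<delta>_F mult.commute add.commute)
  also have "\<dots> = - (1/2) * ((\<Sum>l\<in>UNIV. F p $ l * \<delta> i (A j l) p) + (A j i p - \<nu> p $ i * (\<Sum>l\<in>UNIV. \<nu> p $ l * A j l p)))"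
    by (simp only: sum.distrib sum_projection)
  finally show ?thesis by (simp add: normal_A A_symmetric[of j i])
qed

text \<open>Trace of \<open>\<delta>_h\<close>, evaluated with \<open>divergence_A\<close>. The
  normal component of the position is \<open>- 2 * H\<close>, and this produces the reaction term
  with \<open>S\<close>; the tangential component is the drift on the left.\<close>

lemma laplacian_H: "(\<Sum>k\<in>UNIV. \<delta> k (h k) p) + (1/2) * (\<Sum>k\<in>UNIV. F p $ k * h k p) = - (1/2 + S p) * H p"
proof -
  have "(\<Sum>k\<in>UNIV. \<Sum>l\<in>UNIV. F p $ l * \<delta> k (A k l) p) = (\<Sum>l\<in>UNIV. F p $ l * (\<Sum>k\<in>UNIV. \<delta> k (A k l) p))"
    by (subst sum.swap) (simp add: sum_distrib_left)
  also have "\<dots> = (\<Sum>l\<in>UNIV. F p $ l * h l p) - S p * (\<Sum>l\<in>UNIV. F p $ l * \<nu> p $ l)"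
    by (simp add: divergence_A right_diff_distrib sum_subtractf sum_distrib_left mult_ac)
  also have "(\<Sum>l\<in>UNIV. F p $ l * \<nu> p $ l) = - 2 * H p"
    by (simp add: H_eq)
  finally have "(\<Sum>k\<in>UNIV. \<Sum>l\<in>UNIV. F p $ l * \<delta> k (A k l) p) = (\<Sum>l\<in>UNIV. F p $ l * h l p) + 2 * S p * H p" by simp
  moreover have "(\<Sum>k\<in>UNIV. \<delta> k (h k) p) = - (1/2) * ((\<Sum>k\<in>UNIV. \<Sum>l\<in>UNIV. F p $ l * \<delta> k (A k l) p) + H p)"
    by (simp only: \<delta>_h sum_distrib_left[symmetric] sum.distrib H_def)
  ultimately show ?thesis by (simp add: algebra_simps)
qed

lemma \<delta>_S: "\<delta> k S p = 2 * \<sigma> k p"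
proof -
  have "\<delta> k S p = (\<Sum>i\<in>UNIV. \<Sum>j\<in>UNIV. 2 * (A i j p * \<delta> k (A i j) p))"
    unfolding S_def by (simp add: \<delta>_sum \<delta>_mult smk_mult smk_sum smk_A mult.commute)
  also have "\<dots> = (\<Sum>i\<in>UNIV. \<Sum>j\<in>UNIV. 2 * (A i j p * C k i j p)
      - 2 * A2 k j p * (\<nu> p $ i * A i j p) - 2 * A2 k i p * (\<nu> p $ j * A i j p))"
    by (intro sum.cong refl) (simp add: C_def algebra_simps)
  also have "\<dots> = 2 * \<sigma> k p - (\<Sum>i\<in>UNIV. \<Sum>j\<in>UNIV. 2 * A2 k j p * (\<nu> p $ i * A i j p))
      - (\<Sum>i\<in>UNIV. \<Sum>j\<in>UNIV. 2 * A2 k i p * (\<nu> p $ j * A i j p))"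
    by (simp add: sum_subtractf \<sigma>_def sum_distrib_left)
  also have "(\<Sum>i\<in>UNIV. \<Sum>j\<in>UNIV. 2 * A2 k j p * (\<nu> p $ i * A i j p)) = 0"
    by (subst sum.swap) (simp add: sum_distrib_left[symmetric] normal_A)
  also have "(\<Sum>i\<in>UNIV. \<Sum>j\<in>UNIV. 2 * A2 k i p * (\<nu> p $ j * A i j p)) = 0"
    by (simp add: sum_distrib_left[symmetric] normal_A)
  finally show ?thesis by simp
qed

lemma normal_\<sigma>: "(\<Sum>k\<in>UNIV. \<nu> p $ k * \<sigma> k p) = 0"
  using normal_\<delta>[OF smk_S, of p] by (simp add: \<delta>_S sum_distrib_left[symmetric] mult.left_commute)

text \<open>The trace of the cube of \<open>A\<close>. It enters \<open>A_\<delta>_h\<close> and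
  \<open>A_\<delta>_C\<close> with opposite signs and cancels in Simons' identity.\<close>

definition trA3 :: "'p \<Rightarrow> real" where "trA3 p = (\<Sum>i\<in>UNIV. \<Sum>j\<in>UNIV. A i j p * A2 i j p)"

text \<open>Contract \<open>\<delta>_h\<close> with \<open>A\<close>. Total symmetry of
  \<open>C\<close> moves the derivative to the index paired with the position, which turns the
  leading term into the drift of \<open>\<sigma>\<close>.\<close>

lemma A_\<delta>_h: "(\<Sum>i\<in>UNIV. \<Sum>j\<in>UNIV. A i j p * \<delta> i (h j) p)
    = - (1/2) * (\<Sum>l\<in>UNIV. F p $ l * \<sigma> l p) - H p * trA3 p - (1/2) * S p"
proof -
  have "(\<Sum>i\<in>UNIV. \<Sum>j\<in>UNIV. A i j p * \<delta> i (h j) p)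
     = - (1/2) * (\<Sum>i\<in>UNIV. \<Sum>j\<in>UNIV. \<Sum>l\<in>UNIV. A i j p * F p $ l * \<delta> i (A j l) p) - (1/2) * S p"
    by (simp add: \<delta>_h S_def sum_distrib_left sum.distrib sum_subtractf sum_negf algebra_simps flip: sum_divide_distrib)
  also have "(\<Sum>i\<in>UNIV. \<Sum>j\<in>UNIV. \<Sum>l\<in>UNIV. A i j p * F p $ l * \<delta> i (A j l) p)
     = (\<Sum>i\<in>UNIV. \<Sum>j\<in>UNIV. \<Sum>l\<in>UNIV. F p $ l * (A i j p * C l i j p)
        - A2 i l p * F p $ l * (\<nu> p $ j * A i j p) - A i j p * A2 i j p * (F p $ l * \<nu> p $ l))"
  proof (intro sum.cong refl)
    fix i j l
    have "C l i j p = \<delta> i (A j l) p + \<nu> p $ j * A2 i l p + \<nu> p $ l * A2 i j p"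
      using C_sym12[of l i j p] C_sym23[of i l j p] C_def[of i j l p] by simp
    then show "A i j p * F p $ l * \<delta> i (A j l) p = F p $ l * (A i j p * C l i j p)
        - A2 i l p * F p $ l * (\<nu> p $ j * A i j p) - A i j p * A2 i j p * (F p $ l * \<nu> p $ l)"
      by (simp add: algebra_simps)
  qed
  also have "\<dots> = (\<Sum>i\<in>UNIV. \<Sum>j\<in>UNIV. \<Sum>l\<in>UNIV. F p $ l * (A i j p * C l i j p))
        - (\<Sum>i\<in>UNIV. \<Sum>j\<in>UNIV. \<Sum>l\<in>UNIV. A2 i l p * F p $ l * (\<nu> p $ j * A i j p))
        - (\<Sum>i\<in>UNIV. \<Sum>j\<in>UNIV. \<Sum>l\<in>UNIV. A i j p * A2 i j p * (F p $ l * \<nu> p $ l))"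
    by (simp add: sum_subtractf)
  also have "(\<Sum>i\<in>UNIV. \<Sum>j\<in>UNIV. \<Sum>l\<in>UNIV. A2 i l p * F p $ l * (\<nu> p $ j * A i j p)) = 0"
    by (rule sum3_zero_middle) (simp add: sum_distrib_left[symmetric] normal_A)
  also have "(\<Sum>i\<in>UNIV. \<Sum>j\<in>UNIV. \<Sum>l\<in>UNIV. A i j p * A2 i j p * (F p $ l * \<nu> p $ l)) = trA3 p * (- 2 * H p)"
    by (simp add: sum_distrib_left[symmetric] H_eq trA3_def sum_distrib_right sum_negf)
  also have "(\<Sum>i\<in>UNIV. \<Sum>j\<in>UNIV. \<Sum>l\<in>UNIV. F p $ l * (A i j p * C l i j p)) = (\<Sum>l\<in>UNIV. F p $ l * \<sigma> l p)"
    by (subst sum_swap3[symmetric]) (simp add: \<sigma>_def sum_distrib_left)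
  finally show ?thesis by (simp add: algebra_simps)
qed

text \<open>The commutation step behind Simons' identity. After the derivatives of \<open>A\<close>
  are exchanged, terms contracted with the normal vanish, the quartic terms \<open>b\<close> and
  \<open>f\<close> cancel, \<open>a\<close> leaves the Hessian of \<open>H\<close> and the square of
  \<open>S\<close>, and \<open>d\<close> leaves the cubic trace.\<close>

lemma A_\<delta>_C: "(\<Sum>k\<in>UNIV. \<Sum>i\<in>UNIV. \<Sum>j\<in>UNIV. A i j p * \<delta> k (C k i j) p)
    = (\<Sum>i\<in>UNIV. \<Sum>j\<in>UNIV. A i j p * \<delta> i (h j) p) - S p * S p + H p * trA3 p"
proof -
  let ?n = "\<lambda>i. \<nu> p $ i"
  have C_fun: "C k i j = (\<lambda>p. \<delta> i (A k j) p + \<nu> p $ k * A2 i j p + \<nu> p $ j * A2 i k p)" for k i j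
    using C_sym12 by (auto simp: C_def)
  have comm: "\<delta> k (\<delta> i (A k j)) p = \<delta> i (\<delta> k (A k j)) p
      + ?n k * (\<Sum>l\<in>UNIV. A i l p * \<delta> l (A k j) p) - ?n i * (\<Sum>l\<in>UNIV. A k l p * \<delta> l (A k j) p)" for k i j
    using \<delta>_commute[OF smk_A, of k i k j p] by simp
  have eq: "A i j p * \<delta> k (C k i j) p = A i j p * \<delta> i (\<delta> k (A k j)) p
     + A i j p * (\<Sum>l\<in>UNIV. A i l p * (?n k * \<delta> l (A k j) p))
     - (\<Sum>l\<in>UNIV. A k l p * \<delta> l (A k j) p) * (?n i * A i j p)
     + A i j p * A2 i j p * A k k p + A i j p * (?n k * \<delta> k (A2 i j) p)
     + A i j p * (A2 i k p * A k j p) + \<delta> k (A2 i k) p * (?n j * A i j p)" for k i j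
    unfolding C_fun
    by (simp add: \<delta>_add \<delta>_mult smk_add smk_mult smk_\<delta> smk_A smk_A2 smk_\<nu> comm A_def[symmetric] sum_distrib_left algebra_simps)
  have a: "(\<Sum>k\<in>UNIV. \<Sum>i\<in>UNIV. \<Sum>j\<in>UNIV. A i j p * \<delta> i (\<delta> k (A k j)) p)
     = (\<Sum>i\<in>UNIV. \<Sum>j\<in>UNIV. A i j p * \<delta> i (h j) p) - S p * S p"
  proof -
    have "(\<Sum>k\<in>UNIV. \<delta> i (\<delta> k (A k j)) p) = \<delta> i (h j) p - A i j p * S p - ?n j * \<delta> i S p" for i j
    proof -
      have "(\<Sum>k\<in>UNIV. \<delta> i (\<delta> k (A k j)) p) = \<delta> i (\<lambda>p. \<Sum>k\<in>UNIV. \<delta> k (A k j) p) p"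
        by (simp add: \<delta>_sum smk_\<delta> smk_A)
      also have "\<dots> = \<delta> i (\<lambda>p. h j p - \<nu> p $ j * S p) p"
        by (simp add: divergence_A)
      also have "\<dots> = \<delta> i (h j) p - A i j p * S p - ?n j * \<delta> i S p"
        by (simp add: \<delta>_diff \<delta>_mult smk_mult smk_\<nu> smk_S smk_h A_def)
      finally show ?thesis .
    qed
    then have "(\<Sum>k\<in>UNIV. \<Sum>i\<in>UNIV. \<Sum>j\<in>UNIV. A i j p * \<delta> i (\<delta> k (A k j)) p)
       = (\<Sum>i\<in>UNIV. \<Sum>j\<in>UNIV. A i j p * \<delta> i (h j) p - S p * (A i j p * A i j p) - \<delta> i S p * (?n j * A i j p))"
      by (subst sum_swap3, intro sum.cong refl) (simp only: sum_distrib_left[symmetric], simp add: right_diff_distrib mult_ac)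
    also have "\<dots> = (\<Sum>i\<in>UNIV. \<Sum>j\<in>UNIV. A i j p * \<delta> i (h j) p) - S p * S p
        - (\<Sum>i\<in>UNIV. \<delta> i S p * (\<Sum>j\<in>UNIV. ?n j * A i j p))"
      by (simp add: sum_subtractf S_def sum_distrib_left)
    finally show ?thesis by (simp add: normal_A)
  qed
  have b: "(\<Sum>k\<in>UNIV. \<Sum>i\<in>UNIV. \<Sum>j\<in>UNIV. A i j p * (\<Sum>l\<in>UNIV. A i l p * (?n k * \<delta> l (A k j) p)))
     = - (\<Sum>i\<in>UNIV. \<Sum>j\<in>UNIV. A i j p * (\<Sum>l\<in>UNIV. A i l p * A2 l j p))"
  proof -
    have "(\<Sum>k\<in>UNIV. A i j p * (\<Sum>l\<in>UNIV. A i l p * (?n k * \<delta> l (A k j) p)))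
       = A i j p * (\<Sum>l\<in>UNIV. A i l p * (\<Sum>k\<in>UNIV. ?n k * \<delta> l (A k j) p))" for i j
      unfolding sum_distrib_left by (rule sum.swap)
    then show ?thesis by (subst sum_swap3) (simp add: normal_\<delta>A sum_negf)
  qed
  have c: "(\<Sum>k\<in>UNIV. \<Sum>i\<in>UNIV. \<Sum>j\<in>UNIV. (\<Sum>l\<in>UNIV. A k l p * \<delta> l (A k j) p) * (?n i * A i j p)) = 0"
    by (rule sum3_zero_middle) (simp add: sum_distrib_left[symmetric] normal_A)
  have d: "(\<Sum>k\<in>UNIV. \<Sum>i\<in>UNIV. \<Sum>j\<in>UNIV. A i j p * A2 i j p * A k k p) = H p * trA3 p"
    unfolding H_def trA3_def by (simp only: sum_distrib_right[symmetric] sum_distrib_left[symmetric]) (simp add: mult.commute)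
  have e: "(\<Sum>k\<in>UNIV. \<Sum>i\<in>UNIV. \<Sum>j\<in>UNIV. A i j p * (?n k * \<delta> k (A2 i j) p)) = 0"
    by (rule sum3_zero_first) (simp add: sum_distrib_left[symmetric] normal_\<delta>[OF smk_A2])
  have f: "(\<Sum>k\<in>UNIV. \<Sum>i\<in>UNIV. \<Sum>j\<in>UNIV. A i j p * (A2 i k p * A k j p))
     = (\<Sum>i\<in>UNIV. \<Sum>j\<in>UNIV. A i j p * (\<Sum>l\<in>UNIV. A i l p * A2 l j p))"
  proof -
    have "(\<Sum>k\<in>UNIV. A2 i k p * A k j p) = (\<Sum>l\<in>UNIV. A i l p * A2 l j p)" for i j
      unfolding A2_def sum_distrib_left sum_distrib_right by (subst sum.swap) (simp add: mult.assoc)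
    then show ?thesis by (subst sum_swap3) (simp add: sum_distrib_left[symmetric])
  qed
  have g: "(\<Sum>k\<in>UNIV. \<Sum>i\<in>UNIV. \<Sum>j\<in>UNIV. \<delta> k (A2 i k) p * (?n j * A i j p)) = 0"
    by (simp add: sum_distrib_left[symmetric] normal_A)
  show ?thesis
    unfolding eq sum.distrib sum_subtractf a b c d e f g by simp
qed

text \<open>Product rule for the divergence of \<open>\<sigma>\<close>, with
  \<open>A_\<delta>_C\<close> and \<open>A_\<delta>_h\<close> for the second derivatives. The
  coefficient \<open>1/2 + S\<close> is the one of \<open>laplacian_H\<close>; this coincidence is
  why dividing by \<open>H\<close> pays.\<close>

lemma simons: "(\<Sum>k\<in>UNIV. \<delta> k (\<sigma> k) p) + (1/2) * (\<Sum>k\<in>UNIV. F p $ k * \<sigma> k p)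
    = (\<Sum>k\<in>UNIV. \<Sum>i\<in>UNIV. \<Sum>j\<in>UNIV. C k i j p * C k i j p) - (1/2 + S p) * S p"
proof -
  have "\<delta> k (\<sigma> k) p = (\<Sum>i\<in>UNIV. \<Sum>j\<in>UNIV. \<delta> k (A i j) p * C k i j p) + (\<Sum>i\<in>UNIV. \<Sum>j\<in>UNIV. A i j p * \<delta> k (C k i j) p)" for k
    unfolding \<sigma>_def by (simp add: \<delta>_sum \<delta>_mult smk_mult smk_sum smk_A smk_C sum.distrib)
  then have 1: "(\<Sum>k\<in>UNIV. \<delta> k (\<sigma> k) p) = (\<Sum>k\<in>UNIV. \<Sum>i\<in>UNIV. \<Sum>j\<in>UNIV. \<delta> k (A i j) p * C k i j p)
      + (\<Sum>k\<in>UNIV. \<Sum>i\<in>UNIV. \<Sum>j\<in>UNIV. A i j p * \<delta> k (C k i j) p)"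
    by (simp add: sum.distrib)
  have "(\<Sum>k\<in>UNIV. \<Sum>i\<in>UNIV. \<Sum>j\<in>UNIV. \<delta> k (A i j) p * C k i j p)
     = (\<Sum>k\<in>UNIV. \<Sum>i\<in>UNIV. \<Sum>j\<in>UNIV. C k i j p * C k i j p
          - A2 k j p * (\<nu> p $ i * C k i j p) - A2 k i p * (\<nu> p $ j * C k i j p))"
    by (intro sum.cong refl) (simp add: C_def algebra_simps)
  also have "\<dots> = (\<Sum>k\<in>UNIV. \<Sum>i\<in>UNIV. \<Sum>j\<in>UNIV. C k i j p * C k i j p)
      - (\<Sum>k\<in>UNIV. \<Sum>i\<in>UNIV. \<Sum>j\<in>UNIV. A2 k j p * (\<nu> p $ i * C k i j p))
      - (\<Sum>k\<in>UNIV. \<Sum>i\<in>UNIV. \<Sum>j\<in>UNIV. A2 k i p * (\<nu> p $ j * C k i j p))"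
    by (simp add: sum_subtractf)
  also have "(\<Sum>k\<in>UNIV. \<Sum>i\<in>UNIV. \<Sum>j\<in>UNIV. A2 k j p * (\<nu> p $ i * C k i j p)) = 0"
    by (rule sum3_zero_middle) (simp add: sum_distrib_left[symmetric] normal_C)
  also have "(\<Sum>k\<in>UNIV. \<Sum>i\<in>UNIV. \<Sum>j\<in>UNIV. A2 k i p * (\<nu> p $ j * C k i j p)) = 0"
    by (simp add: sum_distrib_left[symmetric] normal_C')
  finally show ?thesis
    unfolding 1 A_\<delta>_C A_\<delta>_h by (simp add: algebra_simps)
qed

section \<open>The weight and the weighted divergence\<close>

definition e :: "'p \<Rightarrow> real" where "e p = exp ((norm (F p))\<^sup>2 / 4)"

lemma e_pos [simp]: "e p > 0" by (simp add: e_def)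

lemma e_eq: "e p = exp ((\<Sum>i\<in>UNIV. F p $ i * F p $ i) * (1/4))"
  by (simp add: e_def power2_norm_eq_inner inner_vec_def)

lemma smk_e: "smk k e"
  unfolding e_eq by (intro smk_exp smk_mult smk_sum smk_F smk_const)

text \<open>By the expander equation the tangential part of the position vector is
  \<open>F + 2 * H * \<nu>\<close>.\<close>

lemma \<delta>_e: "\<delta> k e p = e p * (1/2) * (F p $ k + 2 * H p * \<nu> p $ k)"
proof -
  let ?u = "\<lambda>p. (1/4) * (\<Sum>i\<in>UNIV. F p $ i * F p $ i)"
  have u: "smk (Suc 0) ?u" by (intro smk_mult smk_sum smk_F smk_const)
  have eq: "e = (\<lambda>p. exp (?u p))" by (auto simp: e_eq)
  have "\<delta> k e p = e p * \<delta> k ?u p"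
    unfolding \<delta>_def eq using grad_chain[OF u smk_exp[OF u] DERIV_exp] by simp
  also have "\<delta> k ?u p = (1/4) * (2 * (\<Sum>i\<in>UNIV. ((if k = i then 1 else 0) - \<nu> p $ k * \<nu> p $ i) * F p $ i))"
    by (subst \<delta>_cmult) (simp_all add: \<delta>_sum \<delta>_mult smk_mult smk_sum smk_F \<delta>_F sum_distrib_left mult.commute)
  also have "\<dots> = (1/2) * (F p $ k - \<nu> p $ k * (\<Sum>i\<in>UNIV. \<nu> p $ i * F p $ i))"
    by (simp only: sum_projection)
  finally show ?thesis by (simp add: H_eq mult.commute)
qed

text \<open>A tangential field sees only the tangential part of the position in the derivative of
  the weight, so the normal term of \<open>\<delta>_e\<close> drops out and the drift
  remains.\<close>

lemma divergence_weighted: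
  assumes "\<And>k. smk (Suc 0) (V k)" "(\<Sum>k\<in>UNIV. \<nu> p $ k * V k p) = 0"
  shows "(\<Sum>k\<in>UNIV. \<delta> k (\<lambda>p. e p * V k p) p)
    = e p * ((\<Sum>k\<in>UNIV. \<delta> k (V k) p) + (1/2) * (\<Sum>k\<in>UNIV. F p $ k * V k p))"
proof -
  have "(\<Sum>k\<in>UNIV. \<delta> k (\<lambda>p. e p * V k p) p)
     = e p * ((\<Sum>k\<in>UNIV. \<delta> k (V k) p) + (1/2) * (\<Sum>k\<in>UNIV. F p $ k * V k p))
       + e p * H p * (\<Sum>k\<in>UNIV. \<nu> p $ k * V k p)"
    by (simp add: \<delta>_mult smk_e assms \<delta>_e algebra_simps sum.distrib sum_distrib_left sum_divide_distrib)
  then show ?thesis using assms(2) by simp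
qed

end

section \<open>Rigidity under parabolicity\<close>

lemma Cauchy_Schwarz_double_sum:
  fixes a b :: "'i::finite \<Rightarrow> 'j::finite \<Rightarrow> real"
  shows "(\<Sum>i\<in>UNIV. \<Sum>j\<in>UNIV. a i j * b i j)\<^sup>2
     \<le> (\<Sum>i\<in>UNIV. \<Sum>j\<in>UNIV. a i j * a i j) * (\<Sum>i\<in>UNIV. \<Sum>j\<in>UNIV. b i j * b i j)"
  using Cauchy_Schwarz_ineq[of "\<chi> i j. a i j" "\<chi> i j. b i j"] by (simp add: inner_vec_def)

context hypersurface
begin

lemma \<delta>_zero_imp_const:
  assumes u: "smk (Suc 0) u" and z: "\<And>i p. \<delta> i u p = 0"
  shows "u p = u q"
proof -
  let ?T = "{p. u p = u q}"
  have g0: "grad u p = 0" for p using z by (simp add: \<delta>_def vec_eq_iff)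
  have "open ?T"
  proof (subst open_subopen, safe)
    fix p assume p: "u p = u q"
    obtain V f w where f: "(V, f) \<in> \<A>" "w \<in> V" "f w = p" using atlas_cover .
    obtain r where r: "r > 0" "ball w r \<subseteq> V" using chart_open[OF f(1)] f(2) openE by blast
    have "u (f z) = u (f w)" if "z \<in> ball w r" for z
    proof (rule has_derivative_zero_unique[of "ball w r" "\<lambda>z. u (f z)"])
      show "((\<lambda>z. u (f z)) has_derivative (\<lambda>h. 0)) (at y within ball w r)" if "y \<in> ball w r" for y
        using has_derivative_chart[OF u f(1), of y] subsetD[OF r(2) that] g0
        by (auto intro: has_derivative_at_withinI)
    qed (use that r in auto)
    then have "f ` ball w r \<subseteq> ?T" using p f(3) by auto
    moreover have "open (f ` ball w r)" by (rule chart_image_open[OF f(1) open_ball r(2)])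
    moreover have "p \<in> f ` ball w r" using f(3) r(1) by auto
    ultimately show "\<exists>T. open T \<and> p \<in> T \<and> T \<subseteq> ?T" by blast
  qed
  moreover have "closed ?T"
    using smk_continuous[OF u] by (intro closed_Collect_eq) auto
  moreover have "connected (UNIV :: 'p set)" using manifold by (simp add: connected_manifold_def)
  ultimately have "?T = {} \<or> ?T = UNIV"
    by (metis (no_types, lifting) closed_closedin connected_clopen open_openin subtopology_UNIV)
  then show ?thesis by auto
qed

lemma \<delta>_zero_at_local_max:
  assumes u: "smk (Suc 0) u" and U: "open U" "p \<in> U" "\<And>q. q \<in> U \<Longrightarrow> u q \<le> u p"
  shows "\<delta> i u p = 0"
proof -
  obtain V f w where f: "(V, f) \<in> \<A>" "w \<in> V" "f w = p" using atlas_cover .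
  have "open (V \<inter> f -` U)"
    by (rule continuous_open_preimage[OF chart_cont[OF f(1)] chart_open[OF f(1)] U(1)])
  then have "(\<lambda>a. grad u (f w) \<bullet> dF f w a) = (\<lambda>v. 0)"
    by (rule differential_zero_maxmin[rotated, OF _ has_derivative_chart[OF u f(1,2)]])
      (use U f in auto)
  then have "is_grad u p 0"
    using is_gradI[OF u f, of 0] grad_chart[OF u f(1,2)] by (simp add: fun_eq_iff)
  then show ?thesis using grad_eqI[OF u] by (simp add: \<delta>_def)
qed

lemma \<delta>_divide:
  assumes "smk (Suc 0) u" "smk (Suc 0) v" "\<And>p. v p \<noteq> 0"
  shows "\<delta> i (\<lambda>p. u p / v p) p = \<delta> i u p / v p - u p * \<delta> i v p / (v p * v p)"
proof -
  have "\<delta> i u p = \<delta> i (\<lambda>p. (u p / v p) * v p) p" using assms(3) by simp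
  also have "\<dots> = \<delta> i (\<lambda>p. u p / v p) p * v p + (u p / v p) * \<delta> i v p"
    by (intro \<delta>_mult smk_divide assms)
  finally show ?thesis using assms(3)[of p] by (simp add: field_simps)
qed

lemma \<delta>_zero_on_open:
  assumes "smk (Suc 0) u" "open U" "p \<in> U" "\<And>q. q \<in> U \<Longrightarrow> u q = 0"
  shows "\<delta> i u p = 0"
  using grad_cong_open[OF assms(1) smk_const[of _ 0] assms(2,3)] assms(4) by (simp add: \<delta>_def)

end

context expander
begin

text \<open>The only consequence of the growth hypothesis that enters the rigidity argument.\<close>

definition parabolic :: bool where
  "parabolic \<longleftrightarrow> (\<forall>V q c. (\<forall>k. smk (Suc 0) (V k)) \<longrightarrow> (\<forall>p. (\<Sum>k\<in>UNIV. \<nu> p $ k * V k p) = 0) \<longrightarrow>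
     continuous_on UNIV q \<longrightarrow> (\<forall>p. q p \<ge> 0) \<longrightarrow>
     (\<forall>p. (\<Sum>k\<in>UNIV. \<delta> k (V k) p) + (1/2) * (\<Sum>k\<in>UNIV. F p $ k * V k p) = q p) \<longrightarrow>
     (\<forall>p. (\<Sum>k\<in>UNIV. (V k p)\<^sup>2) \<le> c * q p * S p) \<longrightarrow> (\<forall>p. q p = 0))"

lemma parabolicD:
  assumes "parabolic" "\<And>k. smk (Suc 0) (V k)" "\<And>p. (\<Sum>k\<in>UNIV. \<nu> p $ k * V k p) = 0"
    "continuous_on UNIV q" "\<And>p. q p \<ge> 0"
    "\<And>p. (\<Sum>k\<in>UNIV. \<delta> k (V k) p) + (1/2) * (\<Sum>k\<in>UNIV. F p $ k * V k p) = q p"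
    "\<And>p. (\<Sum>k\<in>UNIV. (V k p)\<^sup>2) \<le> c * q p * S p"
  shows "q p = 0"
  using assms unfolding parabolic_def by blast

lemma S_nonneg: "S p \<ge> 0" unfolding S_def by (intro sum_nonneg) auto

lemma \<sigma>_h_sum: "(\<Sum>k\<in>UNIV. \<sigma> k p * h k p) = (\<Sum>k\<in>UNIV. \<Sum>i\<in>UNIV. \<Sum>j\<in>UNIV. C k i j p * A i j p * h k p)"
  unfolding \<sigma>_def sum_distrib_left sum_distrib_right by (intro sum.cong refl) (simp add: mult_ac)

text \<open>\<open>q\<close> is the weighted divergence of \<open>H\<^sup>2 \<nabla>(\<bar>A\<bar>\<^sup>2 / (2 H\<^sup>2))\<close>; it equals \<open>H\<^sup>2 \<bar>\<nabla>(A/H)\<bar>\<^sup>2\<close>.\<close>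

lemma parabolic_codazzi:
  assumes par: parabolic and pos: "\<And>p. H p > 0"
  shows "C k i j p * H p = A i j p * h k p"
proof -
  \<comment> \<open>\<open>D\<close> is \<open>H\<close> times the covariant derivative of
    \<open>A / H\<close>.\<close>
  define D where "D k i j p = C k i j p - A i j p * h k p / H p" for k i j p
  define q where "q p = (\<Sum>k\<in>UNIV. \<Sum>i\<in>UNIV. \<Sum>j\<in>UNIV. D k i j p * D k i j p)" for p
  define V where "V k p = \<sigma> k p - S p * h k p / H p" for k p
  have H0: "H p \<noteq> 0" for p using pos[of p] by simp
  have smD: "smk l (D k i j)" for l k i j
    unfolding D_def by (intro smk_diff smk_C smk_divide smk_mult smk_A smk_h smk_H H0)
  have "smk 0 q" unfolding q_def by (intro smk_sum smk_mult smD)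
  then have "continuous_on UNIV q" by (rule smk_continuous)
  have smV: "smk l (V k)" for l k
    unfolding V_def by (intro smk_diff smk_\<sigma> smk_divide smk_mult smk_S smk_h smk_H H0)
  have q_eq: "q p = (\<Sum>k\<in>UNIV. \<Sum>i\<in>UNIV. \<Sum>j\<in>UNIV. C k i j p * C k i j p)
      - 2 / H p * (\<Sum>k\<in>UNIV. \<sigma> k p * h k p) + S p / (H p * H p) * (\<Sum>k\<in>UNIV. h k p * h k p)" for p
  proof -
    have "q p = (\<Sum>k\<in>UNIV. \<Sum>i\<in>UNIV. \<Sum>j\<in>UNIV. C k i j p * C k i j p
       - 2 / H p * (C k i j p * A i j p * h k p) + (1 / (H p * H p)) * ((h k p * h k p) * (A i j p * A i j p)))"
      unfolding q_def D_def using H0[of p] by (intro sum.cong refl) (simp add: field_simps)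
    also have "\<dots> = (\<Sum>k\<in>UNIV. \<Sum>i\<in>UNIV. \<Sum>j\<in>UNIV. C k i j p * C k i j p)
      - 2 / H p * (\<Sum>k\<in>UNIV. \<Sum>i\<in>UNIV. \<Sum>j\<in>UNIV. C k i j p * A i j p * h k p)
      + (1 / (H p * H p)) * (\<Sum>k\<in>UNIV. (h k p * h k p) * S p)"
      by (simp only: sum.distrib sum_subtractf sum_distrib_left[symmetric] S_def)
    finally show ?thesis by (simp add: \<sigma>_h_sum sum_distrib_left[symmetric] sum_distrib_right[symmetric])
  qed
  have "q p = 0" for p
  proof (rule parabolicD[OF par smV, where c = 1])
    show "continuous_on UNIV q" by fact
    show "q p \<ge> 0" for p unfolding q_def by (intro sum_nonneg) auto
    show "(\<Sum>k\<in>UNIV. \<nu> p $ k * V k p) = 0" for p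
    proof -
      have "(\<Sum>k\<in>UNIV. \<nu> p $ k * V k p) = (\<Sum>k\<in>UNIV. \<nu> p $ k * \<sigma> k p) - S p / H p * (\<Sum>k\<in>UNIV. \<nu> p $ k * h k p)"
        by (simp add: V_def right_diff_distrib sum_subtractf sum_distrib_left mult_ac)
      then show ?thesis by (simp add: normal_\<sigma> normal_h)
    qed
    show "(\<Sum>k\<in>UNIV. \<delta> k (V k) p) + (1/2) * (\<Sum>k\<in>UNIV. F p $ k * V k p) = q p" for p
    proof -
      have dV: "\<delta> k (V k) p = \<delta> k (\<sigma> k) p - (2 / H p) * (\<sigma> k p * h k p) - (S p / H p) * \<delta> k (h k) p
          + (S p / (H p * H p)) * (h k p * h k p)" for k
      proof -
        have "\<delta> k (V k) p = \<delta> k (\<sigma> k) p - \<delta> k (\<lambda>p. S p * h k p / H p) p"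
          unfolding V_def by (intro \<delta>_diff smk_\<sigma> smk_divide smk_mult smk_S smk_h smk_H H0)
        also have "\<delta> k (\<lambda>p. S p * h k p / H p) p
          = (2 * \<sigma> k p * h k p + S p * \<delta> k (h k) p) / H p - S p * h k p * h k p / (H p * H p)"
          by (subst \<delta>_divide) (auto simp: \<delta>_mult \<delta>_S smk_mult smk_S smk_h smk_H H0 h_def[symmetric])
        finally show ?thesis by (simp add: add_divide_distrib)
      qed
      have "(\<Sum>k\<in>UNIV. \<delta> k (V k) p) = (\<Sum>k\<in>UNIV. \<delta> k (\<sigma> k) p) - 2 / H p * (\<Sum>k\<in>UNIV. \<sigma> k p * h k p)
          - S p / H p * (\<Sum>k\<in>UNIV. \<delta> k (h k) p) + S p / (H p * H p) * (\<Sum>k\<in>UNIV. h k p * h k p)"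
        by (simp only: dV sum.distrib sum_subtractf sum_distrib_left[symmetric])
      moreover have "(\<Sum>k\<in>UNIV. F p $ k * V k p) = (\<Sum>k\<in>UNIV. F p $ k * \<sigma> k p) - S p / H p * (\<Sum>k\<in>UNIV. F p $ k * h k p)"
        by (simp add: V_def right_diff_distrib sum_subtractf sum_distrib_left mult_ac)
      moreover have "S p / H p * (\<Sum>k\<in>UNIV. \<delta> k (h k) p) = S p / H p * (- (1/2 + S p) * H p - (1/2) * (\<Sum>k\<in>UNIV. F p $ k * h k p))"
        using laplacian_H[of p] by (simp add: eq_diff_eq)
      \<comment> \<open>The zero-order term of the equation for \<open>H\<close>, multiplied by
        \<open>S / H\<close>, is exactly the one subtracted in \<open>simons\<close>; only the
        square \<open>q\<close> is left.\<close>
      moreover have "S p / H p * ((1/2 + S p) * H p) = (1/2 + S p) * S p" using H0[of p] by simp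
      ultimately show ?thesis unfolding q_eq using simons[of p] by (simp add: algebra_simps)
    qed
    show "(\<Sum>k\<in>UNIV. (V k p)\<^sup>2) \<le> 1 * q p * S p" for p
    proof -
      \<comment> \<open>The field is the contraction of \<open>D\<close> with \<open>A\<close>.
        Cauchy-Schwarz then gives the bound demanded by \<open>parabolic\<close>, with constant
        1.\<close>
      have "V k p = (\<Sum>i\<in>UNIV. \<Sum>j\<in>UNIV. A i j p * D k i j p)" for k
      proof -
        have "(\<Sum>i\<in>UNIV. \<Sum>j\<in>UNIV. A i j p * D k i j p)
          = (\<Sum>i\<in>UNIV. \<Sum>j\<in>UNIV. A i j p * C k i j p - (h k p / H p) * (A i j p * A i j p))"
          by (intro sum.cong refl) (simp add: D_def right_diff_distrib)
        also have "\<dots> = \<sigma> k p - (h k p / H p) * S p"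
          by (simp only: sum_subtractf sum_distrib_left[symmetric] \<sigma>_def S_def)
        finally show ?thesis by (simp add: V_def)
      qed
      then have "(V k p)\<^sup>2 \<le> S p * (\<Sum>i\<in>UNIV. \<Sum>j\<in>UNIV. D k i j p * D k i j p)" for k
        using Cauchy_Schwarz_double_sum[of "\<lambda>i j. A i j p" "\<lambda>i j. D k i j p"] by (simp add: S_def)
      then have "(\<Sum>k\<in>UNIV. (V k p)\<^sup>2) \<le> (\<Sum>k\<in>UNIV. S p * (\<Sum>i\<in>UNIV. \<Sum>j\<in>UNIV. D k i j p * D k i j p))"
        by (intro sum_mono)
      then show ?thesis by (simp add: q_def sum_distrib_left mult.commute)
    qed
  qed
  then have "D k i j p * D k i j p = 0"
    unfolding q_def by (simp add: sum_nonneg_eq_0_iff sum_nonneg del: mult_eq_0_iff)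
  then have "D k i j p = 0" by simp
  then show ?thesis using H0[of p] by (simp add: D_def field_simps)
qed

text \<open>Symmetry of \<open>C\<close> turns the codazzi relation into
  \<open>h k * A i j = h i * A k j\<close>. Where the gradient of \<open>H\<close> is nonzero this
  makes \<open>A\<close> a multiple of its tensor square, hence of rank one, and the claim follows.
  If the claim failed at a point, it would fail on an open set on which that gradient vanishes, and
  \<open>laplacian_H\<close> would force \<open>H\<close> to be zero there.\<close>

lemma parabolic_A2:
  assumes par: parabolic and pos: "\<And>p. H p > 0"
  shows "A2 i j p = H p * A i j p"
proof (rule ccontr)
  assume ne: "A2 i j p \<noteq> H p * A i j p"
  have swap: "h k p * A i j p = h i p * A k j p" for i j k p
    using parabolic_codazzi[OF assms, of k i j p] parabolic_codazzi[OF assms, of i k j p] C_sym12[of k i j p]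
    by (simp add: mult.commute)
  have Ah: "(\<Sum>i\<in>UNIV. h i p * A k i p) = h k p * H p" for k p
    unfolding H_def sum_distrib_left using swap by (simp add: swap[of k])
  define N where "N p = (\<Sum>k\<in>UNIV. h k p * h k p)" for p
  have NA: "N p * A i j p = H p * (h i p * h j p)" for i j p
  proof -
    have "N p * A i j p = (\<Sum>k\<in>UNIV. h k p * (h k p * A i j p))"
      by (simp add: N_def sum_distrib_right mult.assoc)
    also have "\<dots> = (\<Sum>k\<in>UNIV. h k p * (h i p * A k j p))" by (simp only: swap[of _ p i])
    also have "\<dots> = h i p * (\<Sum>k\<in>UNIV. h k p * A j k p)"
      by (simp add: sum_distrib_left A_symmetric[of _ j] mult_ac)
    finally show ?thesis by (simp add: Ah mult_ac)
  qed
  have NA2: "N p * A2 i j p = N p * (H p * A i j p)" for i j p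
  proof -
    have "N p * A2 i j p = (\<Sum>k\<in>UNIV. (N p * A i k p) * A k j p)"
      by (simp add: A2_def sum_distrib_left mult.assoc)
    also have "\<dots> = H p * h i p * (\<Sum>k\<in>UNIV. h k p * A j k p)"
      by (simp add: NA sum_distrib_left A_symmetric[of _ j] mult_ac)
    also have "\<dots> = H p * (N p * A i j p)" by (simp add: Ah NA)
    finally show ?thesis by simp
  qed
  let ?U = "{p. A2 i j p \<noteq> H p * A i j p}"
  have "continuous_on UNIV (A2 i j)" "continuous_on UNIV (\<lambda>p. H p * A i j p)"
    using smk_continuous[OF smk_A2] smk_continuous[OF smk_mult[OF smk_H smk_A]] by auto
  then have U: "open ?U" by (rule open_Collect_neq)
  have h0: "h k q = 0" if "q \<in> ?U" for q k
  proof -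
    have "N q = 0" using NA2[of q i j] that by auto
    then show ?thesis unfolding N_def by (simp add: sum_nonneg_eq_0_iff)
  qed
  have "\<delta> k (h k) p = 0" for k
    by (rule \<delta>_zero_on_open[OF smk_h U]) (use ne h0 in auto)
  then have "- (1/2 + S p) * H p = 0" using laplacian_H[of p] h0[of p] ne by (simp del: mult_eq_0_iff)
  then show False using S_nonneg[of p] pos[of p] by auto
qed

text \<open>The tangent directions annihilated by \<open>A\<close> form a constant subspace, because
  \<open>A/H + \<nu> \<nu>\<^sup>T\<close> is a constant projection of rank two.\<close>

lemma parabolic_flat_direction:
  assumes card: "CARD('n) \<ge> 2" and par: parabolic and pos: "\<And>p. H p > 0"
  obtains a :: "'m \<Rightarrow> real" where "\<exists>i. a i \<noteq> 0" "\<And>p k. (\<Sum>i\<in>UNIV. A k i p * a i) = 0"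
    "\<And>p. (\<Sum>i\<in>UNIV. \<nu> p $ i * a i) = 0"
proof -
  define Q where "Q i j p = A i j p / H p + \<nu> p $ i * \<nu> p $ j" for i j p
  have H0: "H p \<noteq> 0" for p using pos[of p] by simp
  have smQ: "smk l (Q i j)" for l i j
    unfolding Q_def by (intro smk_add smk_divide smk_A smk_H smk_mult smk_\<nu> H0)
  have "\<delta> k (Q i j) p = 0" for k i j p
  proof -
    have "\<delta> k (A i j) p = A i j p * h k p / H p - \<nu> p $ i * (H p * A k j p) - \<nu> p $ j * (H p * A k i p)"
      using parabolic_codazzi[OF par pos, of k i j p] H0[of p]
      by (simp add: C_def parabolic_A2[OF par pos] field_simps)
    then have "\<delta> k (\<lambda>p. A i j p / H p) p = - \<nu> p $ i * A k j p - \<nu> p $ j * A k i p"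
      using H0[of p] by (subst \<delta>_divide) (auto simp: smk_A smk_H H0 h_def[symmetric] field_simps)
    then show ?thesis
      unfolding Q_def using H0
      by (subst \<delta>_add) (auto simp: \<delta>_mult smk_divide smk_mult smk_A smk_H smk_\<nu> A_def[symmetric])
  qed
  then have const: "Q i j p = Q i j q" for i j p q
    by (rule \<delta>_zero_imp_const[OF smQ])
  fix p0 :: 'p
  \<comment> \<open>The trace of \<open>Q\<close> is 2, while the ambient dimension is at least 3 by
    the bound on \<open>n\<close>; so \<open>Q\<close> is not the identity.\<close>
  have "\<exists>i j. Q i j p0 \<noteq> (if i = j then 1 else 0)"
  proof (rule ccontr)
    assume "\<not> ?thesis"
    then have "(\<Sum>i\<in>UNIV. Q i i p0) = real CARD('m)" by simp
    moreover have "(\<Sum>i\<in>UNIV. Q i i p0) = (\<Sum>i\<in>UNIV. A i i p0) / H p0 + 1"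
      by (simp add: Q_def sum.distrib normal_sq sum_divide_distrib)
    ultimately have "real CARD('m) = 2" using H0[of p0] by (simp add: H_def[symmetric])
    then show False using card card_m by simp
  qed
  then obtain i0 j where ij: "Q i0 j p0 \<noteq> (if i0 = j then 1 else 0)" by blast
  \<comment> \<open>A nonzero column of the complementary projection, hence annihilated by
    \<open>A\<close> and orthogonal to the normal at every point, since \<open>Q\<close> is
    constant.\<close>
  define a where "a i = (if j = i then 1 else 0) - Q i j p0" for i
  have a_eq: "a i = (if j = i then 1 else 0) - \<nu> p $ j * \<nu> p $ i - A i j p / H p" for i p
    using const[of i j p0 p] by (simp add: a_def Q_def)
  have contr: "(\<Sum>i\<in>UNIV. Z i * a i) = Z j - \<nu> p $ j * (\<Sum>i\<in>UNIV. \<nu> p $ i * Z i) - (\<Sum>i\<in>UNIV. Z i * A i j p) / H p" for Z p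
  proof -
    have "(\<Sum>i\<in>UNIV. Z i * a i) = (\<Sum>i\<in>UNIV. ((if j = i then 1 else 0) - \<nu> p $ j * \<nu> p $ i) * Z i - (Z i * A i j p) / H p)"
      by (intro sum.cong refl) (simp add: a_eq[of _ p] algebra_simps)
    then show ?thesis by (simp only: sum_subtractf sum_projection sum_divide_distrib[symmetric])
  qed
  show ?thesis
  proof
    show "\<exists>i. a i \<noteq> 0" using ij by (auto simp: a_def split: if_splits)
    show "(\<Sum>i\<in>UNIV. A k i p * a i) = 0" for p k
      using H0[of p] parabolic_A2[OF par pos, of k j p] by (simp add: contr[of _ p] normal_A A2_def)
    show "(\<Sum>i\<in>UNIV. \<nu> p $ i * a i) = 0" for p
      by (simp add: contr[of _ p] normal_A normal_sq)
  qed
qed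

text \<open>With \<open>y = x \<bullet> a\<close>, the field below is \<open>H\<^sup>2 \<nabla>u\<close> for the bounded strictly subharmonic function
  \<open>u = - exp (- s y\<^sup>2)\<close>.\<close>

lemma parabolic_not_pos:
  assumes card: "CARD('n) \<ge> 2" and par: parabolic and pos: "\<And>p. H p > 0"
  shows False
proof -
  obtain a where a0: "\<exists>i. a i \<noteq> 0" and Aa: "\<And>p k. (\<Sum>i\<in>UNIV. A k i p * a i) = 0"
    and na: "\<And>p. (\<Sum>i\<in>UNIV. \<nu> p $ i * a i) = 0"
    by (rule parabolic_flat_direction[OF assms]) (assumption | blast)+
  define N where "N = (\<Sum>i\<in>UNIV. a i * a i)"
  have N: "N > 0"
    using a0 sum_nonneg_eq_0_iff[of UNIV "\<lambda>i. a i * a i"] sum_nonneg[of UNIV "\<lambda>i. a i * a i"]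
    unfolding N_def by (auto simp: less_le)
  \<comment> \<open>With \<open>4 * s * N = 1\<close> the terms quadratic in \<open>y\<close> in the
    divergence and in the drift cancel, which leaves the positive function \<open>q\<close>.\<close>
  define s where "s = 1 / (4 * N)"
  have s: "s > 0" "4 * s * N = 1" using N by (auto simp: s_def)
  define y where "y p = (\<Sum>i\<in>UNIV. a i * F p $ i)" for p
  have smy: "smk l y" for l unfolding y_def by (intro smk_sum smk_mult smk_const smk_F)
  have dy: "\<delta> k y p = a k" for k p
  proof -
    have "\<delta> k y p = (\<Sum>i\<in>UNIV. ((if k = i then 1 else 0) - \<nu> p $ k * \<nu> p $ i) * a i)"
      unfolding y_def by (simp add: \<delta>_sum \<delta>_cmult smk_mult smk_const smk_F \<delta>_F mult.commute)
    then show ?thesis by (simp add: sum_projection na)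
  qed
  define E where "E p = exp (- s * (y p * y p))" for p
  have smE: "smk l E" for l unfolding E_def by (intro smk_exp smk_mult smk_const smy)
  have dE: "\<delta> k E p = - 2 * s * y p * E p * a k" for k p
  proof -
    have sm: "smk (Suc 0) (\<lambda>p. - s * (y p * y p))" by (intro smk_mult smk_const smy)
    have "\<delta> k E p = E p * \<delta> k (\<lambda>p. - s * (y p * y p)) p"
      unfolding \<delta>_def E_def using grad_chain[OF sm smk_exp[OF sm] DERIV_exp] by simp
    also have "\<delta> k (\<lambda>p. - s * (y p * y p)) p = - 2 * s * y p * a k"
      by (subst \<delta>_cmult) (simp_all add: smk_mult smy \<delta>_mult dy)
    finally show ?thesis by simp
  qed
  define V where "V k p = a k * (2 * s * (H p * H p * (y p * E p)))" for k p
  have smV: "smk l (V k)" for l k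
    unfolding V_def by (intro smk_mult smk_const smk_H smy smE)
  define q where "q p = (1/2) * (H p * H p * E p)" for p
  have "smk 0 q" unfolding q_def by (intro smk_mult smk_const smk_H smE)
  then have q_cont: "continuous_on UNIV q" by (rule smk_continuous)
  have Epos: "E p > 0" for p by (simp add: E_def)
  \<comment> \<open>By \<open>h_eq\<close> the gradient of \<open>H\<close> lies in the image of
    \<open>A\<close>, which is orthogonal to the kernel direction \<open>a\<close>.\<close>
  have ha: "(\<Sum>k\<in>UNIV. a k * h k p) = 0" for p
  proof -
    have "(\<Sum>k\<in>UNIV. a k * h k p) = - (1/2) * (\<Sum>k\<in>UNIV. \<Sum>j\<in>UNIV. F p $ j * (A j k p * a k))"
      unfolding h_eq sum_distrib_left by (intro sum.cong refl) (simp add: A_symmetric mult_ac)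
    then show ?thesis
      by (subst (asm) sum.swap) (simp add: sum_distrib_left[symmetric] Aa)
  qed
  have q0: "q p = 0" for p
  proof (rule parabolicD[OF par smV, where c = 2])
    show "continuous_on UNIV q" by fact
    show "q p \<ge> 0" for p using Epos[of p] by (simp add: q_def)
    show "(\<Sum>k\<in>UNIV. \<nu> p $ k * V k p) = 0" for p
      using na[of p] by (simp add: V_def sum_distrib_right[symmetric] mult.assoc[symmetric])
    show "(\<Sum>k\<in>UNIV. \<delta> k (V k) p) + (1/2) * (\<Sum>k\<in>UNIV. F p $ k * V k p) = q p" for p
    proof -
      have "\<delta> k (V k) p = (a k * h k p) * (4 * s * H p * y p * E p)
          + (a k * a k) * (2 * s * H p * H p * E p * (1 - 2 * s * (y p * y p)))" for k
        unfolding V_def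
        by (simp add: \<delta>_cmult \<delta>_mult smk_mult smk_const smk_H smy smE dE dy h_def[symmetric] algebra_simps)
      then have "(\<Sum>k\<in>UNIV. \<delta> k (V k) p) = N * (2 * s * H p * H p * E p * (1 - 2 * s * (y p * y p)))"
        by (simp only: sum.distrib sum_distrib_right[symmetric] ha N_def mult_zero_left add_0)
      moreover have "(\<Sum>k\<in>UNIV. F p $ k * V k p) = y p * (2 * s * (H p * H p * (y p * E p)))"
      proof -
        have "F p $ k * V k p = (a k * F p $ k) * (2 * s * (H p * H p * (y p * E p)))" for k
          by (simp add: V_def)
        then show ?thesis by (simp only: sum_distrib_right[symmetric] y_def)
      qed
      moreover have "N * (2 * s * H p * H p * E p * (1 - 2 * s * (y p * y p)))
         = (4 * s * N) * ((1/2) * (H p * H p * E p) - s * (y p * y p) * (H p * H p * E p))"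
        by (simp add: algebra_simps)
      ultimately show ?thesis unfolding s(2) q_def by (simp add: algebra_simps)
    qed
    show "(\<Sum>k\<in>UNIV. (V k p)\<^sup>2) \<le> 2 * q p * S p" for p
    proof -
      have S: "S p = H p * H p"
        using A2_trace[of p] by (simp add: parabolic_A2[OF par pos] sum_distrib_left[symmetric] H_def[symmetric])
      have "(\<Sum>k\<in>UNIV. (V k p)\<^sup>2) = N * (2 * s * (H p * H p * (y p * E p)))\<^sup>2"
      proof -
        have "(V k p)\<^sup>2 = (a k * a k) * (2 * s * (H p * H p * (y p * E p)))\<^sup>2" for k
          by (simp add: V_def power_mult_distrib power2_eq_square)
        then show ?thesis by (simp only: sum_distrib_right[symmetric] N_def)
      qed
      also have "\<dots> = (4 * s * N) * ((s * (y p * y p) * E p) * (H p * H p * (H p * H p) * E p))"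
        by (simp add: power2_eq_square algebra_simps)
      also have "\<dots> \<le> 1 * (1 * (H p * H p * (H p * H p) * E p))"
      proof -
        have "s * (y p * y p) * E p \<le> 1"
        proof -
          have "s * (y p * y p) \<le> exp (s * (y p * y p))"
            using exp_ge_add_one_self[of "s * (y p * y p)"] by linarith
          then show ?thesis by (simp add: E_def exp_minus field_simps)
        qed
        moreover have "H p * H p * (H p * H p) * E p \<ge> 0" using Epos[of p] by simp
        ultimately show ?thesis unfolding s(2) using mult_right_mono by fastforce
      qed
      finally show ?thesis by (simp add: q_def S mult_ac)
    qed
  qed
  fix p :: 'p
  show False using q0[of p] pos[of p] Epos[of p] by (simp add: q_def)
qed

lemma minimal_cone_flat:
  assumes proper: "properly_immersed F" and H0: "\<And>p. H p = 0"
  shows "S p = 0"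
proof -
  define R where "R = norm (F p) + 1"
  have R: "R > 0" "norm (F p) < R" by (auto simp: R_def add_nonneg_pos)
  have hz: "h k q = 0" for k q
    unfolding h_def using H0 by (simp add: \<delta>_zero_on_open[OF smk_H, of UNIV])
  have dh: "\<delta> i (h k) q = 0" for i k q
    using \<delta>_zero_on_open[OF smk_h, of UNIV] hz by blast
  \<comment> \<open>When \<open>H\<close> vanishes identically, the identity
    \<open>A_\<delta>_h\<close> collapses to this radial equation.\<close>
  have x\<sigma>: "(\<Sum>k\<in>UNIV. F q $ k * \<sigma> k q) = - S q" for q
    using A_\<delta>_h[of q] by (simp add: dh H0)
  define N where "N q = (\<Sum>i\<in>UNIV. F q $ i * F q $ i)" for q
  have N_norm: "N q = (norm (F q))\<^sup>2" for q
    by (simp add: N_def power2_norm_eq_inner inner_vec_def)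
  have smN: "smk l N" for l unfolding N_def by (intro smk_sum smk_mult smk_F)
  have dN: "\<delta> k N q = 2 * F q $ k" for k q
  proof -
    have "\<delta> k N q = 2 * (\<Sum>i\<in>UNIV. ((if k = i then 1 else 0) - \<nu> q $ k * \<nu> q $ i) * F q $ i)"
      unfolding N_def by (simp add: \<delta>_sum \<delta>_mult smk_mult smk_F \<delta>_F sum_distrib_left mult.commute)
    also have "\<dots> = 2 * F q $ k - 2 * \<nu> q $ k * (\<Sum>i\<in>UNIV. \<nu> q $ i * F q $ i)"
      by (simp only: sum_projection) simp
    finally show ?thesis using H_eq[of q] H0[of q] by (simp add: mult.commute)
  qed
  \<comment> \<open>The factor vanishes on the bounding sphere, and in the radial derivative the
    terms with \<open>N\<close> cancel: what remains is \<open>- 2 * R * R * S\<close>, which cannot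
    be zero where \<open>S\<close> is positive.\<close>
  define u where "u q = (R * R - N q) * S q" for q
  have smu: "smk l u" for l unfolding u_def by (intro smk_mult smk_diff smk_const smN smk_S)
  have du: "(\<Sum>k\<in>UNIV. F q $ k * \<delta> k u q) = - 2 * R * R * S q" for q
  proof -
    have "\<delta> k u q = (R * R - N q) * (2 * \<sigma> k q) - 2 * F q $ k * S q" for k
      unfolding u_def by (simp add: \<delta>_mult \<delta>_diff smk_diff smk_const smN smk_S dN \<delta>_S)
    then have "(\<Sum>k\<in>UNIV. F q $ k * \<delta> k u q)
      = 2 * (R * R - N q) * (\<Sum>k\<in>UNIV. F q $ k * \<sigma> k q) - 2 * S q * (\<Sum>k\<in>UNIV. F q $ k * F q $ k)"
      by (simp only: sum_distrib_left sum_subtractf[symmetric]) (intro sum.cong refl, simp add: algebra_simps)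
    then show ?thesis by (simp add: x\<sigma> N_def[symmetric] algebra_simps)
  qed
  let ?K = "F -` cball 0 R"
  have "compact ?K" using proper by (simp add: properly_immersed_def)
  moreover have "?K \<noteq> {}" using R less_imp_le[of "norm (F p)" R] by (metis empty_iff mem_cball_0 vimageI)
  ultimately obtain m where m: "m \<in> ?K" "\<And>q. q \<in> ?K \<Longrightarrow> u q \<le> u m"
    using continuous_attains_sup[of ?K u] smk_continuous[OF smu] continuous_on_subset by blast
  have "u m \<le> 0"
  proof (rule ccontr)
    assume "\<not> u m \<le> 0"
    then have um: "u m > 0" by simp
    let ?U = "F -` ball 0 R"
    have "open ?U" by (rule open_vimage[OF open_ball continuous_on_F])
    moreover have "m \<in> ?U"
    proof -
      \<comment> \<open>A positive value keeps the maximum off the sphere of radius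
        \<open>R\<close>, so it is an interior maximum of the hypersurface.\<close>
      have "R * R - N m \<noteq> 0" using um by (auto simp: u_def)
      then have "norm (F m) \<noteq> R" by (auto simp: N_norm power2_eq_square)
      then show ?thesis using m(1) by auto
    qed
    ultimately have "\<delta> k u m = 0" for k
      by (intro \<delta>_zero_at_local_max[OF smu]) (use m(2) in auto)
    then have "S m = 0" using du[of m] R by simp
    then show False using um by (simp add: u_def)
  qed
  moreover have "u p \<le> u m" using m(2) R by simp
  ultimately have "(R * R - N p) * S p \<le> 0" by (simp add: u_def)
  moreover have "R * R - N p > 0"
    unfolding N_norm power2_eq_square using R by (simp add: mult_strict_mono)
  ultimately show ?thesis using S_nonneg[of p] by (simp add: mult_le_0_iff)
qed

lemma minimal_cone_normal_constant:
  assumes "properly_immersed F" "\<And>p. H p = 0"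
  shows "\<nu> p = \<nu> q"
proof -
  have "A i j p = 0" for i j p
  proof -
    have "S p = 0" by (rule minimal_cone_flat[OF assms])
    then show ?thesis unfolding S_def by (simp add: sum_nonneg_eq_0_iff sum_nonneg)
  qed
  then have "\<nu> p $ j = \<nu> q $ j" for j
    by (intro \<delta>_zero_imp_const[OF smk_\<nu>]) (simp add: A_def)
  then show ?thesis by (simp add: vec_eq_iff)
qed

end

section \<open>Minimal cones\<close>

text \<open>A covering argument in elementary form. Convexity of \<open>P\<close> plays the part of
  simple connectedness, properness gives a uniform size of the sections. Openness is required for
  the images of all smaller balls so that a compactness argument may shrink the radius.\<close>

locale local_sections =
  fixes F :: "'p::{t2_space,second_countable_topology} \<Rightarrow> 'b::euclidean_space" and P :: "'b set"
  assumes conn: "connected (UNIV :: 'p set)" and convex_P: "convex P" and into: "\<And>p. F p \<in> P"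
    and proper: "\<And>K. compact K \<Longrightarrow> compact (F -` K)" and cont: "continuous_on UNIV F"
    and local_section: "\<And>p. \<exists>\<epsilon>>0. \<exists>\<tau>. continuous_on (P \<inter> ball (F p) \<epsilon>) \<tau> \<and> \<tau> (F p) = p \<and>
      (\<forall>z\<in>P \<inter> ball (F p) \<epsilon>. F (\<tau> z) = z) \<and> (\<forall>\<eta>. 0 < \<eta> \<longrightarrow> \<eta> \<le> \<epsilon> \<longrightarrow> open (\<tau> ` (P \<inter> ball (F p) \<eta>)))"
begin

definition section_on :: "'b set \<Rightarrow> ('b \<Rightarrow> 'p) \<Rightarrow> bool" where
  "section_on W s \<longleftrightarrow> continuous_on W s \<and> (\<forall>z\<in>W. F (s z) = z)"

lemma section_on_subset: "section_on W s \<Longrightarrow> W' \<subseteq> W \<Longrightarrow> section_on W' s"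
  unfolding section_on_def using continuous_on_subset by blast

lemma local_injective:
  obtains U where "open U" "p \<in> U" "inj_on F U"
proof -
  obtain \<epsilon> \<tau> where *: "\<epsilon> > 0" "\<tau> (F p) = p" "\<forall>z\<in>P \<inter> ball (F p) \<epsilon>. F (\<tau> z) = z"
    "open (\<tau> ` (P \<inter> ball (F p) \<epsilon>))"
    using local_section[of p] by blast
  show ?thesis
  proof (rule that[OF *(4)])
    show "p \<in> \<tau> ` (P \<inter> ball (F p) \<epsilon>)"
      using *(1,2) into[of p] by (metis IntI centre_in_ball imageI)
    show "inj_on F (\<tau> ` (P \<inter> ball (F p) \<epsilon>))"
      using *(3) by (auto simp: inj_on_def)
  qed
qed

text \<open>Unique lifting: the set of agreement is open because \<open>F\<close> is locally
  injective, and its complement is open because the space is Hausdorff.\<close>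

lemma section_unique:
  assumes W: "connected W" "w0 \<in> W" and s: "section_on W s" and s': "section_on W s'"
    and eq: "s w0 = s' w0" and z: "z \<in> W"
  shows "s z = s' z"
proof -
  let ?T = "{z\<in>W. s z = s' z}"
  have c: "continuous_on W s" "continuous_on W s'" using s s' by (auto simp: section_on_def)
  have "openin (top_of_set W) ?T"
  proof (subst openin_subopen, safe)
    fix x assume x: "x \<in> W" "s x = s' x"
    obtain U where U: "open U" "s x \<in> U" "inj_on F U" by (rule local_injective)
    have "openin (top_of_set W) ((W \<inter> s -` U) \<inter> (W \<inter> s' -` U))"
      by (intro openin_Int continuous_openin_preimage_gen c U)
    moreover have "(W \<inter> s -` U) \<inter> (W \<inter> s' -` U) \<subseteq> ?T"
      using s s' U(3) by (auto simp: section_on_def inj_on_def)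
    ultimately show "\<exists>T. openin (top_of_set W) T \<and> x \<in> T \<and> T \<subseteq> ?T"
      using x U(2) by (intro exI[of _ "(W \<inter> s -` U) \<inter> (W \<inter> s' -` U)"]) auto
  qed
  moreover have "openin (top_of_set W) (W - ?T)"
  proof (subst openin_subopen, rule ballI)
    fix x assume "x \<in> W - ?T"
    then have x: "x \<in> W" "s x \<noteq> s' x" by auto
    then obtain U U' where U: "open U" "open U'" "s x \<in> U" "s' x \<in> U'" "U \<inter> U' = {}"
      using hausdorff[of "s x" "s' x"] by blast
    have "openin (top_of_set W) ((W \<inter> s -` U) \<inter> (W \<inter> s' -` U'))"
      by (intro openin_Int continuous_openin_preimage_gen c U)
    then show "\<exists>T. openin (top_of_set W) T \<and> x \<in> T \<and> T \<subseteq> W - ?T"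
      using x(1) U by (intro exI[of _ "(W \<inter> s -` U) \<inter> (W \<inter> s' -` U')"]) auto
  qed
  then have "closedin (top_of_set W) ?T" by (auto simp: closedin_def)
  ultimately have "?T = {} \<or> ?T = W" using W(1) connected_clopen by blast
  then show ?thesis using W(2) eq z by blast
qed

text \<open>A Lebesgue number argument on the compact preimage of the ball. Sections are taken on
  twice the radius used for covering, so that a ball of radius \<open>\<epsilon>\<close> around any
  covered point still lies in the domain of one of them.\<close>

lemma uniform_sections:
  obtains \<epsilon> where "\<epsilon> > 0"
    "\<And>p. F p \<in> cball y0 R \<Longrightarrow> \<exists>\<tau>. section_on (P \<inter> ball (F p) \<epsilon>) \<tau> \<and> \<tau> (F p) = p"
proof -
  have "\<exists>\<epsilon> \<tau>. \<epsilon> > 0 \<and> section_on (P \<inter> ball (F p) (2 * \<epsilon>)) \<tau> \<and> \<tau> (F p) = p \<and>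
      open (\<tau> ` (P \<inter> ball (F p) \<epsilon>))" for p
  proof -
    obtain \<epsilon> \<tau> where *: "\<epsilon> > 0" "continuous_on (P \<inter> ball (F p) \<epsilon>) \<tau>" "\<tau> (F p) = p"
      "\<forall>z\<in>P \<inter> ball (F p) \<epsilon>. F (\<tau> z) = z" "\<forall>\<eta>. 0 < \<eta> \<longrightarrow> \<eta> \<le> \<epsilon> \<longrightarrow> open (\<tau> ` (P \<inter> ball (F p) \<eta>))"
      using local_section[of p] by blast
    then show ?thesis
      by (intro exI[of _ "\<epsilon>/2"] exI[of _ \<tau>]) (auto simp: section_on_def)
  qed
  then obtain \<epsilon> \<tau> where *: "\<And>p. \<epsilon> p > 0" "\<And>p. section_on (P \<inter> ball (F p) (2 * \<epsilon> p)) (\<tau> p)"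
    "\<And>p. \<tau> p (F p) = p" "\<And>p. open (\<tau> p ` (P \<inter> ball (F p) (\<epsilon> p)))"
    by metis
  let ?U = "\<lambda>p. \<tau> p ` (P \<inter> ball (F p) (\<epsilon> p))"
  have mem: "p \<in> ?U p" for p using *(1,3) into by (metis IntI centre_in_ball imageI)
  have "compact (F -` cball y0 R)" using proper by simp
  moreover have "F -` cball y0 R \<subseteq> (\<Union>p\<in>UNIV. ?U p)" using mem by blast
  ultimately obtain D where D: "finite D" "F -` cball y0 R \<subseteq> (\<Union>p\<in>D. ?U p)"
    by (rule compactE_image[OF _ *(4)])
  define e where "e = Min (insert 1 (\<epsilon> ` D))"
  have e: "e > 0" "\<And>p. p \<in> D \<Longrightarrow> e \<le> \<epsilon> p" using D(1) *(1) by (auto simp: e_def)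
  show ?thesis
  proof (rule that[OF e(1)])
    fix q assume "F q \<in> cball y0 R"
    then obtain p where p: "p \<in> D" "q \<in> ?U p" using D(2) by auto
    then obtain z where z: "z \<in> P" "dist (F p) z < \<epsilon> p" "q = \<tau> p z" by auto
    have "F q = z" using z *(2)[of p] *(1)[of p] by (auto simp: section_on_def)
    have "P \<inter> ball (F q) e \<subseteq> P \<inter> ball (F p) (2 * \<epsilon> p)"
    proof safe
      fix x assume "x \<in> ball (F q) e"
      then have "dist (F q) x < \<epsilon> p" using e(2)[OF p(1)] by simp
      then show "x \<in> ball (F p) (2 * \<epsilon> p)"
        using z(2) \<open>F q = z\<close> dist_triangle[of "F p" x "F q"] by simp
    qed
    then show "\<exists>\<tau>. section_on (P \<inter> ball (F q) e) \<tau> \<and> \<tau> (F q) = q"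
      using section_on_subset[OF *(2)[of p]] z(3) \<open>F q = z\<close> by (intro exI[of _ "\<tau> p"]) auto
  qed
qed

text \<open>Sections over neighbouring balls agree on the overlap because they agree at the midpoint of the
  two centres.\<close>

lemma section_extend:
  assumes \<epsilon>: "\<epsilon> > 0" "\<And>p. F p \<in> cball y0 R \<Longrightarrow> \<exists>\<tau>. section_on (P \<inter> ball (F p) \<epsilon>) \<tau> \<and> \<tau> (F p) = p"
    and y0: "y0 \<in> P" and r: "0 < r" "r \<le> R" and s: "section_on (P \<inter> ball y0 r) s"
  shows "\<exists>s'. section_on (P \<inter> ball y0 (r + \<epsilon>)) s' \<and> s' y0 = s y0"
proof -
  let ?B = "P \<inter> ball y0 r"
  have "\<exists>\<tau>. section_on (P \<inter> ball w \<epsilon>) \<tau> \<and> \<tau> w = s w" if "w \<in> ?B" for w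
    using \<epsilon>(2)[of "s w"] s that r by (force simp: section_on_def)
  then obtain \<tau> where \<tau>: "\<And>w. w \<in> ?B \<Longrightarrow> section_on (P \<inter> ball w \<epsilon>) (\<tau> w)" "\<And>w. w \<in> ?B \<Longrightarrow> \<tau> w w = s w"
    by metis
  have con: "connected (P \<inter> (ball a b \<inter> ball c d))" "connected (P \<inter> ball a b)" for a b c d
    using convex_P by (auto intro!: convex_connected convex_Int)
  have \<tau>s: "\<tau> w z = s z" if "w \<in> ?B" "z \<in> ?B" "z \<in> ball w \<epsilon>" for w z
  proof (rule section_unique[OF con(1)[of w \<epsilon> y0 r], of w])
    show "section_on (P \<inter> (ball w \<epsilon> \<inter> ball y0 r)) (\<tau> w)"
      by (rule section_on_subset[OF \<tau>(1)[OF that(1)]]) auto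
    show "section_on (P \<inter> (ball w \<epsilon> \<inter> ball y0 r)) s"
      by (rule section_on_subset[OF s]) auto
  qed (use that \<epsilon>(1) \<tau>(2) in auto)
  have indep: "\<tau> w z = \<tau> w' z" if w: "w \<in> ?B" "w' \<in> ?B" and z: "z \<in> P" "z \<in> ball w \<epsilon>" "z \<in> ball w' \<epsilon>" for w w' z
  proof -
    define m where "m = midpoint w w'"
    have "dist w w' < 2 * \<epsilon>" using z dist_triangle[of w w' z] by (simp add: dist_commute)
    then have m1: "m \<in> ball w \<epsilon>" "m \<in> ball w' \<epsilon>"
      by (auto simp: m_def dist_midpoint)
    have "m \<in> P" "m \<in> ball y0 r"
      using closed_segment_subset[of w P w'] closed_segment_subset[of w "ball y0 r" w'] w convex_P
        midpoint_in_closed_segment[of w w'] unfolding m_def by (blast, auto simp del: mem_ball)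
    then have mB: "m \<in> ?B" by simp
    show ?thesis
    proof (rule section_unique[OF con(1)[of w \<epsilon> w' \<epsilon>], of m])
      show "section_on (P \<inter> (ball w \<epsilon> \<inter> ball w' \<epsilon>)) (\<tau> w)"
        by (rule section_on_subset[OF \<tau>(1)[OF w(1)]]) auto
      show "section_on (P \<inter> (ball w \<epsilon> \<inter> ball w' \<epsilon>)) (\<tau> w')"
        by (rule section_on_subset[OF \<tau>(1)[OF w(2)]]) auto
      show "\<tau> w m = \<tau> w' m" using \<tau>s[OF w(1) mB m1(1)] \<tau>s[OF w(2) mB m1(2)] by simp
    qed (use z m1 \<open>m \<in> P\<close> in auto)
  qed
  have near: "\<exists>w\<in>?B. z \<in> ball w \<epsilon>" if z: "z \<in> P \<inter> ball y0 (r + \<epsilon>)" for z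
  proof (cases "z \<in> ball y0 r")
    case True then show ?thesis using z \<epsilon>(1) by (intro bexI[of _ z]) auto
  next
    case False
    define d where "d = dist y0 z"
    have d: "d \<ge> r" "d < r + \<epsilon>" "d > 0" using False z r by (auto simp: d_def)
    \<comment> \<open>The point of the segment whose distance from \<open>y0\<close> is halfway
      between \<open>max 0 (d - \<epsilon>)\<close> and \<open>r\<close>: it lies in the old ball
      and closer than \<open>\<epsilon>\<close> to \<open>z\<close>.\<close>
    define t where "t = (max 0 (d - \<epsilon>) + r) / 2 / d"
    have td: "t * d = (max 0 (d - \<epsilon>) + r) / 2" using d by (simp add: t_def)
    have t: "0 \<le> t" "t * d < r" "d - t * d < \<epsilon>"
      unfolding td using d r \<epsilon>(1) by (auto simp: t_def max_def field_simps)
    have "t \<le> 1" using t(2) d by (metis less_eq_real_def linorder_not_le mult_le_cancel_right1 order_trans)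
    let ?w = "y0 + t *\<^sub>R (z - y0)"
    have "?w \<in> P"
      using convexD_alt[OF convex_P y0, of z t] z t(1) \<open>t \<le> 1\<close> by (simp add: algebra_simps)
    moreover have "dist y0 ?w = t * d"
      using t(1) by (simp add: d_def dist_norm norm_minus_commute)
    moreover have "dist ?w z = (1 - t) * d"
    proof -
      have "z - ?w = (1 - t) *\<^sub>R (z - y0)" by (simp add: algebra_simps)
      then show ?thesis using \<open>t \<le> 1\<close> by (simp add: d_def dist_norm norm_minus_commute[of ?w] norm_minus_commute[of y0])
    qed
    ultimately show ?thesis using t by (intro bexI[of _ ?w]) (auto simp: left_diff_distrib)
  qed
  define s' where "s' z = \<tau> (SOME w. w \<in> ?B \<and> z \<in> ball w \<epsilon>) z" for z
  have s'_eq: "s' z = \<tau> w z" if "w \<in> ?B" "z \<in> P" "z \<in> ball w \<epsilon>" for w z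
  proof -
    have "(SOME w. w \<in> ?B \<and> z \<in> ball w \<epsilon>) \<in> ?B \<and> z \<in> ball (SOME w. w \<in> ?B \<and> z \<in> ball w \<epsilon>) \<epsilon>"
      by (rule someI[of _ w]) (use that in auto)
    then show ?thesis unfolding s'_def using indep that by blast
  qed
  show ?thesis
  proof (intro exI[of _ s'] conjI)
    show "section_on (P \<inter> ball y0 (r + \<epsilon>)) s'"
      unfolding section_on_def
    proof
      show "continuous_on (P \<inter> ball y0 (r + \<epsilon>)) s'"
        unfolding continuous_on_eq_continuous_within
      proof
        fix z assume z: "z \<in> P \<inter> ball y0 (r + \<epsilon>)"
        then obtain w where w: "w \<in> ?B" "z \<in> ball w \<epsilon>" using near by blast
        have "continuous_on (P \<inter> ball w \<epsilon>) s'"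
          using \<tau>(1)[OF w(1)] s'_eq[OF w(1)] unfolding section_on_def by (auto elim!: continuous_on_eq)
        then have "continuous (at z within P \<inter> ball w \<epsilon>) s'"
          using z w by (simp add: continuous_on_eq_continuous_within)
        moreover have "at z within P \<inter> ball w \<epsilon> = at z within P"
          by (rule at_within_nhd[OF w(2) open_ball]) auto
        moreover have "at z within P \<inter> ball y0 (r + \<epsilon>) = at z within P"
          using z by (intro at_within_nhd[of z "ball y0 (r + \<epsilon>)"]) auto
        ultimately show "continuous (at z within P \<inter> ball y0 (r + \<epsilon>)) s'" by simp
      qed
      show "\<forall>z\<in>P \<inter> ball y0 (r + \<epsilon>). F (s' z) = z"
      proof
        fix z assume z: "z \<in> P \<inter> ball y0 (r + \<epsilon>)"
        then obtain w where w: "w \<in> ?B" "z \<in> ball w \<epsilon>" using near by blast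
        then show "F (s' z) = z" using s'_eq[OF w(1)] \<tau>(1)[OF w(1)] z by (auto simp: section_on_def)
      qed
    qed
    show "s' y0 = s y0"
      using s'_eq[of y0 y0] \<tau>(2)[of y0] y0 r \<epsilon>(1) by simp
  qed
qed

text \<open>The \<open>\<epsilon>\<close> of \<open>uniform_sections\<close> is chosen for the final
  radius \<open>R\<close>, so every extension gains the same amount and finitely many of them
  suffice.\<close>

lemma section_on_ball:
  assumes R: "R > 0"
  shows "\<exists>s. section_on (P \<inter> ball (F q) R) s \<and> s (F q) = q"
proof -
  obtain \<epsilon> where \<epsilon>: "\<epsilon> > 0"
    "\<And>p. F p \<in> cball (F q) R \<Longrightarrow> \<exists>\<tau>. section_on (P \<inter> ball (F p) \<epsilon>) \<tau> \<and> \<tau> (F p) = p"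
    using uniform_sections[of "F q" R] by blast
  have *: "real n * \<epsilon> \<le> R \<Longrightarrow> \<exists>s. section_on (P \<inter> ball (F q) (real n * \<epsilon> + \<epsilon>)) s \<and> s (F q) = q" for n
  proof (induction n)
    case 0
    then show ?case using \<epsilon>(2)[of q] R by auto
  next
    case (Suc n)
    have "real n * \<epsilon> \<le> R" using Suc.prems \<epsilon>(1) by (simp add: algebra_simps)
    then obtain s where s: "section_on (P \<inter> ball (F q) (real n * \<epsilon> + \<epsilon>)) s" "s (F q) = q"
      using Suc.IH by blast
    have "\<exists>s'. section_on (P \<inter> ball (F q) ((real n * \<epsilon> + \<epsilon>) + \<epsilon>)) s' \<and> s' (F q) = s (F q)"
      by (rule section_extend[OF \<epsilon> into _ _ s(1)])
        (use \<epsilon>(1) Suc.prems in \<open>auto simp: algebra_simps add_pos_nonneg\<close>)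
    then show ?case using s(2) by (simp add: algebra_simps)
  qed
  define n where "n = nat \<lfloor>R / \<epsilon>\<rfloor>"
  have n: "real n = of_int \<lfloor>R / \<epsilon>\<rfloor>" using R \<epsilon>(1) by (simp add: n_def)
  have "real n \<le> R / \<epsilon>" "R / \<epsilon> < real n + 1" unfolding n by linarith+
  then have "real n * \<epsilon> \<le> R" "R < real n * \<epsilon> + \<epsilon>" using \<epsilon>(1) by (simp_all add: field_simps)
  then show ?thesis using *[of n] section_on_subset[of _ _ "P \<inter> ball (F q) R"] by fastforce
qed

text \<open>Sections over growing balls agree by uniqueness and define a global continuous section
  \<open>g\<close>. The points with \<open>g (F p) = p\<close> form an open and closed set
  containing \<open>q\<close>, so connectedness makes \<open>g\<close> a two-sided inverse.\<close>

lemma bij_onto: "bij_betw F UNIV P"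
proof -
  fix q :: 'p
  have "\<exists>s. section_on (P \<inter> ball (F q) (real n + 1)) s \<and> s (F q) = q" for n :: nat
    by (rule section_on_ball) simp
  then obtain s where s: "\<And>n::nat. section_on (P \<inter> ball (F q) (real n + 1)) (s n)" "\<And>n. s n (F q) = q"
    by metis
  have con: "connected (P \<inter> ball a b)" for a b
    using convex_P by (auto intro!: convex_connected convex_Int)
  have mono: "s n z = s k z" if "n \<le> k" "z \<in> P \<inter> ball (F q) (real n + 1)" for n k z
  proof (rule section_unique[OF con[of "F q" "real n + 1"], of "F q"])
    show "section_on (P \<inter> ball (F q) (real n + 1)) (s k)"
      by (rule section_on_subset[OF s(1)[of k]]) (use that(1) in auto)
  qed (use that s into in auto)
  define g where "g z = s (nat \<lceil>dist (F q) z\<rceil>) z" for z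
  have g_eq: "g z = s n z" if "z \<in> P" "dist (F q) z < real n + 1" for n z
  proof -
    let ?k = "nat \<lceil>dist (F q) z\<rceil>"
    have k: "dist (F q) z < real ?k + 1" by (simp add: of_nat_nat) linarith
    show ?thesis
      using mono[of n ?k z] mono[of ?k n z] that k unfolding g_def by (cases "n \<le> ?k") auto
  qed
  have g: "section_on P g"
    unfolding section_on_def
  proof
    show "\<forall>z\<in>P. F (g z) = z"
    proof
      fix z assume z: "z \<in> P"
      obtain n :: nat where n: "dist (F q) z < real n" using reals_Archimedean2 by blast
      then show "F (g z) = z" using g_eq[OF z, of n] s(1)[of n] z by (auto simp: section_on_def)
    qed
    show "continuous_on P g"
      unfolding continuous_on_eq_continuous_within
    proof
      fix z assume z: "z \<in> P"
      obtain n :: nat where n: "dist (F q) z < real n" using reals_Archimedean2 by blast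
      have "continuous_on (P \<inter> ball (F q) (real n + 1)) g"
        using s(1)[of n] g_eq[of _ n] unfolding section_on_def by (auto elim!: continuous_on_eq)
      then have "continuous (at z within P \<inter> ball (F q) (real n + 1)) g"
        using z n by (simp add: continuous_on_eq_continuous_within)
      moreover have "at z within P \<inter> ball (F q) (real n + 1) = at z within P"
        using n by (intro at_within_nhd[of z "ball (F q) (real n + 1)"]) auto
      ultimately show "continuous (at z within P) g" by simp
    qed
  qed
  have cg: "continuous_on UNIV (\<lambda>p. g (F p))"
    by (rule continuous_on_compose2[OF _ cont]) (use g into in \<open>auto simp: section_on_def\<close>)
  let ?T = "{p. g (F p) = p}"
  have "closed ?T" by (rule closed_Collect_eq[OF cg continuous_on_id])
  moreover have "open ?T"
  proof (subst open_subopen, safe)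
    fix p assume p: "g (F p) = p"
    obtain U where U: "open U" "p \<in> U" "inj_on F U" by (rule local_injective)
    have o: "open ((\<lambda>p. g (F p)) -` U)" by (rule open_vimage[OF U(1) cg])
    have "U \<inter> (\<lambda>p. g (F p)) -` U \<subseteq> ?T"
      using U(3) g into by (auto simp: section_on_def inj_on_def)
    then show "\<exists>T. open T \<and> p \<in> T \<and> T \<subseteq> ?T"
      using U p o by (intro exI[of _ "U \<inter> (\<lambda>p. g (F p)) -` U"]) auto
  qed
  moreover have "q \<in> ?T" using g_eq[of "F q" 0] s(2) into by simp
  ultimately have "?T = UNIV" using conn
    by (metis (no_types, lifting) closed_closedin connected_clopen empty_iff open_openin subtopology_UNIV)
  then have "g (F p) = p" for p by blast
  then show ?thesis
    using g into by (intro bij_betw_byWitness[where f' = g]) (auto simp: section_on_def)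
qed

end

context hypersurface
begin

text \<open>A linear left inverse \<open>g\<close> of the differential at one point turns the
  immersion into a self-map of the parameter space, to which the inverse function theorem applies.
  Since the normal is constant, the image stays in the hyperplane, on which \<open>g\<close> is
  injective; inverting \<open>g\<close> after the immersion therefore inverts the immersion.\<close>

lemma local_section_of_immersion:
  assumes const: "\<And>p. \<nu> p = n0" and P: "\<And>p. n0 \<bullet> F p = 0"
  shows "\<exists>\<epsilon>>0. \<exists>\<tau>. continuous_on ({x. n0 \<bullet> x = 0} \<inter> ball (F p) \<epsilon>) \<tau> \<and> \<tau> (F p) = p \<and>
      (\<forall>z\<in>{x. n0 \<bullet> x = 0} \<inter> ball (F p) \<epsilon>. F (\<tau> z) = z) \<and>
      (\<forall>\<eta>. 0 < \<eta> \<longrightarrow> \<eta> \<le> \<epsilon> \<longrightarrow> open (\<tau> ` ({x. n0 \<bullet> x = 0} \<inter> ball (F p) \<eta>)))"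
proof -
  let ?P = "{x. n0 \<bullet> x = 0}"
  obtain V f w where f: "(V, f) \<in> \<A>" "w \<in> V" "f w = p" using atlas_cover .
  note L = dF_linear[OF f(1,2)]
  obtain g where g: "linear g" "g \<circ> dF f w = id"
    using linear_injective_left_inverse[OF L dF_inj[OF f(1,2)]] by blast
  have g': "g (dF f w a) = a" for a using g(2) by (metis comp_apply id_apply)
  have bg: "bounded_linear g" using g(1) linear_conv_bounded_linear by blast
  have range: "\<exists>a. x = dF f w a" if "x \<in> ?P" for x
    by (rule tangent_range[OF f(1,2), of x]) (use that const in \<open>auto simp: inner_commute\<close>)
  have g_inj: "x = y" if "x \<in> ?P" "y \<in> ?P" "g x = g y" for x y
    using range[OF that(1)] range[OF that(2)] that(3) g' by auto
  define \<phi> where "\<phi> z = g (F (f z))" for z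
  define \<phi>' where "\<phi>' z = Blinfun (\<lambda>a. g (dF f z a))" for z
  have bl: "bounded_linear (\<lambda>a. g (dF f z a))" if "z \<in> V" for z
    using bounded_linear_compose[OF bg] has_derivative_bounded_linear[OF dF_has_derivative[OF f(1) that]] by blast
  have \<phi>': "blinfun_apply (\<phi>' z) a = g (dF f z a)" if "z \<in> V" for z a
    unfolding \<phi>'_def using bounded_linear_Blinfun_apply[OF bl[OF that]] by simp
  have d\<phi>: "(\<phi> has_derivative blinfun_apply (\<phi>' z)) (at z)" if "z \<in> V" for z
  proof -
    have "blinfun_apply (\<phi>' z) = (\<lambda>a. g (dF f z a))" by (auto simp: \<phi>' that)
    then show ?thesis
      unfolding \<phi>_def using bounded_linear.has_derivative[OF bg dF_has_derivative[OF f(1) that]] by (simp add: o_def)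
  qed
  have c\<phi>': "continuous_on V \<phi>'"
  proof (rule continuous_on_blinfun_componentwise)
    fix i :: "real^'n" assume "i \<in> Basis"
    have "continuous_on V (\<lambda>z. g (dF f z i))"
      using bounded_linear.continuous_on[OF bg Ck_on_imp_continuous_on[OF dF_smooth[OF f(1)]]] .
    then show "continuous_on V (\<lambda>z. blinfun_apply (\<phi>' z) i)"
      by (rule continuous_on_eq) (simp add: \<phi>')
  qed
  have inv: "id_blinfun o\<^sub>L \<phi>' w = id_blinfun"
    by (rule blinfun_eqI) (simp add: \<phi>' f(2) g')
  obtain U W k k' where U: "open U" "U \<subseteq> V" "w \<in> U" "open W" "\<phi> w \<in> W" "homeomorphism U W \<phi> k"
    by (rule inverse_function_theorem[OF chart_open[OF f(1)] d\<phi> c\<phi>' f(2) inv]) blast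
  have "open (g -` W)" by (rule open_vimage[OF U(4) linear_continuous_on[OF bg]])
  moreover have "F p \<in> g -` W" using U(5) f(3) by (simp add: \<phi>_def)
  ultimately obtain \<epsilon> where \<epsilon>: "\<epsilon> > 0" "ball (F p) \<epsilon> \<subseteq> g -` W" using openE by blast
  define \<tau> where "\<tau> z = f (k (g z))" for z
  have kW: "k y \<in> U" "\<phi> (k y) = y" if "y \<in> W" for y
    using U(6) that by (auto simp: homeomorphism_def)
  have kU: "k (\<phi> z) = z" "\<phi> z \<in> W" if "z \<in> U" for z
    using U(6) that by (auto simp: homeomorphism_def)
  have F\<tau>: "F (\<tau> z) = z" if "z \<in> ?P \<inter> ball (F p) \<epsilon>" for z
  proof (rule g_inj)
    show "g (F (\<tau> z)) = g z" using kW[of "g z"] \<epsilon>(2) that by (auto simp: \<tau>_def \<phi>_def)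
  qed (use that P in auto)
  have img: "\<tau> ` (?P \<inter> ball (F p) \<eta>) = f ` (U \<inter> (\<lambda>z. F (f z)) -` ball (F p) \<eta>)" if "\<eta> \<le> \<epsilon>" for \<eta>
  proof (intro equalityI subsetI)
    fix q assume "q \<in> \<tau> ` (?P \<inter> ball (F p) \<eta>)"
    then obtain z where z: "z \<in> ?P \<inter> ball (F p) \<eta>" "q = \<tau> z" by blast
    then have "z \<in> ?P \<inter> ball (F p) \<epsilon>" using that by auto
    then show "q \<in> f ` (U \<inter> (\<lambda>z. F (f z)) -` ball (F p) \<eta>)"
      using z F\<tau>[of z] kW[of "g z"] \<epsilon>(2) by (auto simp: \<tau>_def)
  next
    fix q assume "q \<in> f ` (U \<inter> (\<lambda>z. F (f z)) -` ball (F p) \<eta>)"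
    then obtain z where z: "z \<in> U" "F (f z) \<in> ball (F p) \<eta>" "q = f z" by blast
    then have "\<tau> (F (f z)) = q" using kU[OF z(1)] by (simp add: \<tau>_def \<phi>_def)
    then show "q \<in> \<tau> ` (?P \<inter> ball (F p) \<eta>)" using z P by (intro image_eqI[of _ _ "F (f z)"]) auto
  qed
  show ?thesis
  proof (intro exI[of _ \<epsilon>] exI[of _ \<tau>] conjI allI impI ballI \<epsilon>(1))
    have "continuous_on W k" using U(6) by (simp add: homeomorphism_def)
    then have "continuous_on (?P \<inter> ball (F p) \<epsilon>) (\<lambda>z. k (g z))"
      by (rule continuous_on_compose2[OF _ linear_continuous_on[OF bg]]) (use \<epsilon>(2) in auto)
    then show "continuous_on (?P \<inter> ball (F p) \<epsilon>) \<tau>"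
      unfolding \<tau>_def using kW(1) \<epsilon>(2) U(2)
      by (intro continuous_on_compose2[OF chart_cont[OF f(1)]]) auto
    show "\<tau> (F p) = p" using kU(1)[OF U(3)] f(3) by (simp add: \<tau>_def \<phi>_def)
    show "F (\<tau> z) = z" if "z \<in> ?P \<inter> ball (F p) \<epsilon>" for z by (rule F\<tau>[OF that])
    show "open (\<tau> ` (?P \<inter> ball (F p) \<eta>))" if "0 < \<eta>" "\<eta> \<le> \<epsilon>" for \<eta>
    proof -
      have "continuous_on U (\<lambda>z. F (f z))"
        using Ck_on_imp_continuous_on[OF F_smooth[OF f(1)]] continuous_on_subset[OF _ U(2)] by (auto simp: o_def)
      then have "open (U \<inter> (\<lambda>z. F (f z)) -` ball (F p) \<eta>)"
        by (rule continuous_open_preimage[OF _ U(1) open_ball])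
      then show ?thesis unfolding img[OF that(2)] using U(2) by (intro chart_image_open[OF f(1)]) auto
    qed
  qed
qed

end

context expander
begin

text \<open>With \<open>H\<close> zero the expander equation says that position and normal are
  orthogonal. A constant normal thus confines the image to a hyperplane through the origin, and the
  section argument shows that it is covered exactly once.\<close>

lemma minimal_cone_hyperplane:
  assumes proper: "properly_immersed F" and H0: "\<And>p. H p = 0"
  shows "\<exists>a. a \<noteq> 0 \<and> bij_betw F UNIV {x. a \<bullet> x = 0}"
proof -
  fix p0 :: 'p
  define n0 where "n0 = \<nu> p0"
  have const: "\<nu> p = n0" for p
    unfolding n0_def by (rule minimal_cone_normal_constant[OF assms])
  have P: "n0 \<bullet> F p = 0" for p
    using H_eq[of p] H0[of p] const[of p] by (simp add: inner_vec_def mult.commute)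
  interpret local_sections F "{x. n0 \<bullet> x = 0}"
  proof
    show "connected (UNIV :: 'p set)" using manifold by (simp add: connected_manifold_def)
    show "convex {x. n0 \<bullet> x = 0}" by (rule convex_hyperplane)
    show "compact (F -` K)" if "compact K" for K using proper that by (simp add: properly_immersed_def)
    show "continuous_on UNIV F" by (rule continuous_on_F)
  qed (use P local_section_of_immersion[OF const P] in auto)
  have "n0 \<noteq> 0" using norm_normal[of p0] by (metis n0_def norm_zero zero_neq_one)
  then show ?thesis using bij_onto by blast
qed

end

section \<open>The strong maximum principle\<close>

lemma second_derivative_nonneg_at_local_min:
  fixes \<phi> :: "real \<Rightarrow> real"
  assumes r: "r > 0" and d: "\<And>t. \<bar>t\<bar> < r \<Longrightarrow> (\<phi> has_real_derivative \<phi>' t) (at t)"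
    and d2: "(\<phi>' has_real_derivative c) (at 0)" and min: "\<And>t. \<bar>t\<bar> < r \<Longrightarrow> \<phi> 0 \<le> \<phi> t"
  shows "c \<ge> 0"
proof (rule ccontr)
  assume "\<not> c \<ge> 0"
  then have c: "c < 0" by simp
  have z: "\<phi>' 0 = 0"
    by (rule DERIV_local_min[OF d r]) (use r min in auto)
  obtain s where s: "s > 0" "\<And>h. 0 < h \<Longrightarrow> h < s \<Longrightarrow> \<phi>' (0 + h) < \<phi>' 0"
    using DERIV_neg_dec_right[OF d2 c] by blast
  define t where "t = min r s / 2"
  have t: "0 < t" "t < r" "t < s" using r s(1) by (auto simp: t_def)
  have "\<exists>\<theta>. 0 < \<theta> \<and> \<theta> < t \<and> \<phi> t - \<phi> 0 = (t - 0) * \<phi>' \<theta>"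
    by (rule MVT2[OF t(1)]) (use d t in auto)
  then obtain \<theta> where \<theta>: "0 < \<theta>" "\<theta> < t" "\<phi> t - \<phi> 0 = t * \<phi>' \<theta>" by auto
  have "\<phi>' \<theta> < 0" using s(2)[of \<theta>] \<theta> t z by simp
  then have "t * \<phi>' \<theta> < 0" using t(1) by (simp add: mult_pos_neg)
  then show False using \<theta>(3) min[of t] t by simp
qed

context hypersurface
begin

text \<open>At a critical point \<open>hessian_chart\<close> reduces to the second derivative along
  straight lines in the chart. Both contractions with the normal vanish, so each ambient diagonal
  entry is the value of the form on the projection of a coordinate vector.\<close>

lemma laplacian_nonneg_at_local_min:
  assumes u: "smk (Suc (Suc 0)) u" and U: "open U" "p \<in> U" "\<And>q. q \<in> U \<Longrightarrow> u p \<le> u q"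
  shows "\<delta> i u p = 0" and "(\<Sum>i\<in>UNIV. \<delta> i (\<delta> i u) p) \<ge> 0"
proof -
  have u1: "smk (Suc 0) u" and du: "smk (Suc 0) (\<delta> j u)" for j
    using smk_SucD[OF u] smk_\<delta>[OF u] by auto
  have "\<delta> i (\<lambda>p. - u p) p = 0" for i
    by (rule \<delta>_zero_at_local_max[OF smk_minus[OF u1] U(1,2)]) (use U(3) in auto)
  then have d0: "\<delta> i u p = 0" for i using \<delta>_minus[OF u1] by simp
  then show "\<delta> i u p = 0" by blast
  have g0: "grad u p = 0" using d0 by (simp add: \<delta>_def vec_eq_iff)
  obtain V f w where f: "(V, f) \<in> \<A>" "w \<in> V" "f w = p" using atlas_cover .
  define M where "M i j = \<delta> i (\<delta> j u) p" for i j
  define B where "B x y = (\<Sum>i\<in>UNIV. \<Sum>j\<in>UNIV. M i j * x $ i * y $ j)" for x y :: "real^'m"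
  have Btan: "B (dF f w a) (dF f w a) \<ge> 0" for a
  proof -
    have "open (V \<inter> f -` U)"
      by (rule continuous_open_preimage[OF chart_cont[OF f(1)] chart_open[OF f(1)] U(1)])
    then obtain r0 where r0: "r0 > 0" "ball w r0 \<subseteq> V \<inter> f -` U" using f U(2) openE[of "V \<inter> f -` U" w] by auto
    define r where "r = r0 / (norm a + 1)"
    have r: "r > 0" using r0 by (simp add: r_def add_nonneg_pos)
    have ball: "w + t *\<^sub>R a \<in> ball w r0" if "\<bar>t\<bar> < r" for t
    proof -
      have "\<bar>t\<bar> * norm a \<le> \<bar>t\<bar> * (norm a + 1)" by (simp add: mult_left_mono)
      also have "\<dots> < r * (norm a + 1)" using that by (intro mult_strict_right_mono) (auto simp: add_nonneg_pos)
      also have "\<dots> = r0" unfolding r_def by (simp add: add_nonneg_eq_0_iff)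
      finally show ?thesis by (simp add: dist_norm)
    qed
    define \<phi> where "\<phi> t = u (f (w + t *\<^sub>R a))" for t
    define u' where "u' z = frechet_derivative (\<lambda>w. u (f w)) (at z) a" for z
    have "(\<phi> has_real_derivative u' (w + t *\<^sub>R a)) (at t)" if "\<bar>t\<bar> < r" for t
    proof -
      have z: "w + t *\<^sub>R a \<in> V" using ball[OF that] r0 by auto
      let ?D = "frechet_derivative (\<lambda>w. u (f w)) (at (w + t *\<^sub>R a))"
      have D: "((\<lambda>w. u (f w)) has_derivative ?D) (at (w + t *\<^sub>R a))"
        using Ck_on_has_derivative[OF smkD[OF u1 f(1)] z] .
      have "(\<phi> has_derivative (\<lambda>s. ?D (s *\<^sub>R a))) (at t)"
        unfolding \<phi>_def by (rule has_derivative_compose[where f = "\<lambda>t. w + t *\<^sub>R a" and g = "\<lambda>w. u (f w)" and x = t, OF _ D]) (auto intro!: derivative_eq_intros)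
      moreover have "?D (s *\<^sub>R a) = u' (w + t *\<^sub>R a) * s" for s
        using has_derivative_linear[OF D] by (simp add: linear_cmul u'_def)
      ultimately show ?thesis by (simp add: has_field_derivative_def)
    qed
    moreover have "((\<lambda>t. u' (w + t *\<^sub>R a)) has_real_derivative frechet_derivative u' (at w) a) (at 0)"
    proof -
      have "Ck_on (Suc 0) V u'" using smkD[OF u f(1)] unfolding u'_def by simp
      then have D: "(u' has_derivative frechet_derivative u' (at w)) (at (w + 0 *\<^sub>R a))"
        using Ck_on_has_derivative[OF \<open>Ck_on (Suc 0) V u'\<close> f(2)] by simp
      have "((\<lambda>t. u' (w + t *\<^sub>R a)) has_derivative (\<lambda>s. frechet_derivative u' (at w) (s *\<^sub>R a))) (at 0)"
        by (rule has_derivative_compose[where f = "\<lambda>t. w + t *\<^sub>R a" and g = u' and x = 0, OF _ D]) (auto intro!: derivative_eq_intros)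
      moreover have "frechet_derivative u' (at w) (s *\<^sub>R a) = frechet_derivative u' (at w) a * s" for s
        using has_derivative_linear[OF D] by (simp add: linear_cmul)
      ultimately show ?thesis by (simp add: has_field_derivative_def)
    qed
    moreover have "\<phi> 0 \<le> \<phi> t" if "\<bar>t\<bar> < r" for t
      using ball[OF that] r0 U(3) f(3) by (auto simp: \<phi>_def)
    ultimately have "frechet_derivative u' (at w) a \<ge> 0"
      by (intro second_derivative_nonneg_at_local_min[OF r, of \<phi> "\<lambda>t. u' (w + t *\<^sub>R a)"])
    then show ?thesis
      using hessian_chart[OF u f(1,2), of a a] g0 f(3) by (simp add: B_def M_def u'_def[abs_def])
  qed
  have left: "(\<Sum>i\<in>UNIV. \<nu> p $ i * M i j) = 0" for j
    unfolding M_def by (rule normal_\<delta>[OF du])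
  have right: "(\<Sum>j\<in>UNIV. \<nu> p $ j * M i j) = 0" for i
  proof -
    have "\<delta> i (\<lambda>p. \<Sum>j\<in>UNIV. \<nu> p $ j * \<delta> j u p) p = (\<Sum>j\<in>UNIV. \<nu> p $ j * M i j)"
      by (simp add: \<delta>_sum \<delta>_mult smk_mult smk_\<nu> du d0 M_def)
    then show ?thesis using normal_\<delta>[OF u1] by simp
  qed
  have "M k k \<ge> 0" for k
  proof -
    define P where "P = axis k 1 - \<nu> p $ k *\<^sub>R \<nu> p"
    have P: "P $ i = (if k = i then 1 else 0) - \<nu> p $ k * \<nu> p $ i" for i
      by (simp add: P_def axis_def)
    have "P \<bullet> \<nu> (f w) = 0"
      using f(3) by (simp add: P_def inner_diff_left inner_axis inner_commute[of "axis k 1"])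
    then obtain a where a: "P = dF f w a" using tangent_range[OF f(1,2)] by blast
    have "(\<Sum>j\<in>UNIV. P $ j * M i j) = M i k" for i
      by (simp add: P sum_projection right)
    then have "(\<Sum>j\<in>UNIV. M i j * P $ j) = M i k" for i by (simp add: mult.commute)
    then have "B P P = (\<Sum>i\<in>UNIV. P $ i * M i k)"
      by (simp add: B_def mult_ac sum_distrib_left[symmetric])
    also have "\<dots> = M k k"
      by (simp add: P sum_projection left)
    finally have "B P P = M k k" by (simp add: left)
    then show ?thesis using Btan[of a] a by simp
  qed
  then show "(\<Sum>i\<in>UNIV. \<delta> i (\<delta> i u) p) \<ge> 0"
    unfolding M_def by (intro sum_nonneg) auto
qed

text \<open>The first estimate needs control only of the finitely many basis directions, each within
  \<open>\<epsilon> / (n + 1)\<close>. The second is the mean value inequality for the difference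
  between the immersion and its linear part at \<open>w\<close>.\<close>

lemma chart_close:
  assumes f: "(V, f) \<in> \<A>" "w \<in> V" and \<epsilon>: "\<epsilon> > 0"
  obtains r where "r > 0" "cball w r \<subseteq> V"
    "\<And>z a. z \<in> cball w r \<Longrightarrow> norm (dF f z a - dF f w a) \<le> \<epsilon> * norm a"
    "\<And>z y. z \<in> cball w r \<Longrightarrow> y \<in> cball w r \<Longrightarrow>
      norm (F (f z) - F (f y) - dF f w (z - y)) \<le> \<epsilon> * norm (z - y)"
proof -
  define e where "e = \<epsilon> / (real CARD('n) + 1)"
  have e: "e > 0" using \<epsilon> by (simp add: e_def)
  have "\<exists>r>0. \<forall>z. dist z w < r \<longrightarrow> norm (dF f z (axis i 1) - dF f w (axis i 1)) < e" for i
  proof -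
    have "continuous_on V (\<lambda>z. dF f z (axis i 1))"
      using Ck_on_imp_continuous_on[OF dF_smooth[OF f(1)]] .
    then have "isCont (\<lambda>z. dF f z (axis i 1)) w"
      using f chart_open continuous_on_eq_continuous_at by blast
    then show ?thesis using e unfolding continuous_at_eps_delta by (simp add: dist_norm)
  qed
  then obtain \<rho> where \<rho>: "\<And>i. \<rho> i > 0"
    "\<And>i z. dist z w < \<rho> i \<Longrightarrow> norm (dF f z (axis i 1) - dF f w (axis i 1)) < e" by metis
  obtain r0 where r0: "r0 > 0" "cball w r0 \<subseteq> V" using chart_open[OF f(1)] f(2) open_contains_cball by metis
  define r where "r = Min (insert r0 (range \<rho>)) / 2"
  have "Min (insert r0 (range \<rho>)) > 0" using r0 \<rho> by simp
  then have r: "r > 0" "r < \<rho> i" "r \<le> r0" for i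
  proof -
    have "Min (insert r0 (range \<rho>)) \<le> \<rho> i" "Min (insert r0 (range \<rho>)) \<le> r0"
      by (auto simp del: Min_insert intro!: Min_le)
    then show "r > 0" "r < \<rho> i" "r \<le> r0" using \<open>Min (insert r0 (range \<rho>)) > 0\<close> using \<rho>(1)[of i] unfolding r_def by linarith+
  qed
  have cV: "cball w r \<subseteq> V" using r r0 by (auto simp: subset_iff)
  have close: "norm (dF f z a - dF f w a) \<le> \<epsilon> * norm a" if z: "z \<in> cball w r" for z a
  proof -
    have zV: "z \<in> V" using z cV by auto
    have "dF f z a - dF f w a = (\<Sum>i\<in>UNIV. a $ i *\<^sub>R (dF f z (axis i 1) - dF f w (axis i 1)))"
      unfolding linear_eq_sum_axis[OF dF_linear[OF f(1) zV], of a] linear_eq_sum_axis[OF dF_linear[OF f], of a]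
      by (simp add: scaleR_diff_right sum_subtractf)
    also have "norm \<dots> \<le> (\<Sum>i\<in>(UNIV::'n set). norm a * e)"
    proof (rule sum_norm_le)
      fix i :: 'n
      have "dist z w < \<rho> i" using z r(2)[of i] by (simp add: dist_commute)
      then have "norm (dF f z (axis i 1) - dF f w (axis i 1)) \<le> e" using \<rho>(2) by (simp add: less_imp_le)
      then show "norm (a $ i *\<^sub>R (dF f z (axis i 1) - dF f w (axis i 1))) \<le> norm a * e"
        using component_le_norm_cart[of a i] e by (simp add: mult_mono)
    qed
    also have "\<dots> \<le> \<epsilon> * norm a"
      using \<epsilon> by (simp add: e_def field_simps)
    finally show ?thesis .
  qed
  have incr: "norm (F (f z) - F (f y) - dF f w (z - y)) \<le> \<epsilon> * norm (z - y)"
    if z: "z \<in> cball w r" "y \<in> cball w r" for z y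
  proof -
    have "norm ((F (f z) - dF f w z) - (F (f y) - dF f w y)) \<le> \<epsilon> * norm (z - y)"
    proof (rule differentiable_bound[OF convex_cball _ _ z(1,2)])
      fix x assume x: "x \<in> cball w r"
      then have xV: "x \<in> V" using cV by auto
      have "((\<lambda>z. F (f z)) has_derivative dF f x) (at x within cball w r)"
        using dF_has_derivative[OF f(1) xV] by (auto simp: o_def intro: has_derivative_at_withinI)
      moreover have "(dF f w has_derivative dF f w) (at x within cball w r)"
        using dF_linear[OF f] by (simp add: linear_imp_has_derivative)
      ultimately show "((\<lambda>z. F (f z) - dF f w z) has_derivative (\<lambda>a. dF f x a - dF f w a)) (at x within cball w r)"
        by (rule has_derivative_diff)
      show "onorm (\<lambda>a. dF f x a - dF f w a) \<le> \<epsilon>"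
        by (rule onorm_le) (rule close[OF x])
    qed
    then show ?thesis using dF_linear[OF f] by (simp add: linear_diff algebra_simps)
  qed
  show ?thesis by (rule that[OF r(1) cV close incr])
qed

end

context expander
begin

text \<open>The drift Laplacian: the weighted divergence of the gradient, see
  \<open>divergence_weighted\<close>.\<close>

definition LL :: "('p \<Rightarrow> real) \<Rightarrow> 'p \<Rightarrow> real" where
  "LL u p = (\<Sum>k\<in>UNIV. \<delta> k (\<delta> k u) p) + (1/2) * (\<Sum>k\<in>UNIV. F p $ k * \<delta> k u p)"

lemma LL_local_min:
  assumes "smk (Suc (Suc 0)) u" "open U" "p \<in> U" "\<And>q. q \<in> U \<Longrightarrow> u p \<le> u q"
  shows "LL u p \<ge> 0"
  using laplacian_nonneg_at_local_min[OF assms] by (simp add: LL_def)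

lemma LL_H: "LL H p = - (1/2 + S p) * H p"
  using laplacian_H[of p] by (simp add: LL_def h_def[symmetric])

lemma LL_diff:
  assumes "sm u" "sm v"
  shows "LL (\<lambda>p. u p - c * v p) p = LL u p - c * LL v p"
proof -
  have d: "\<delta> k (\<lambda>p. u p - c * v p) = (\<lambda>p. \<delta> k u p - c * \<delta> k v p)" for k
    by (rule ext) (simp add: \<delta>_diff \<delta>_cmult smk_mult smk_const assms)
  have "\<delta> k (\<delta> k (\<lambda>p. u p - c * v p)) p = \<delta> k (\<delta> k u) p - c * \<delta> k (\<delta> k v) p" for k
    unfolding d by (simp add: \<delta>_diff \<delta>_cmult smk_mult smk_const smk_\<delta> assms)
  then have "(\<Sum>k\<in>UNIV. \<delta> k (\<delta> k (\<lambda>p. u p - c * v p)) p)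
     = (\<Sum>k\<in>UNIV. \<delta> k (\<delta> k u) p) - c * (\<Sum>k\<in>UNIV. \<delta> k (\<delta> k v) p)"
    by (simp add: sum_subtractf sum_distrib_left)
  moreover have "(\<Sum>k\<in>UNIV. F p $ k * \<delta> k (\<lambda>p. u p - c * v p) p)
     = (\<Sum>k\<in>UNIV. F p $ k * \<delta> k u p) - c * (\<Sum>k\<in>UNIV. F p $ k * \<delta> k v p)"
    by (simp add: d right_diff_distrib sum_subtractf sum_distrib_left mult_ac)
  ultimately show ?thesis by (simp add: LL_def algebra_simps)
qed

text \<open>The chain rule. For large \<open>\<alpha>\<close> the quadratic term dominates, so that
  the exponential is a strict subsolution wherever the gradient of \<open>G\<close> is bounded away
  from zero.\<close>

lemma LL_exp:
  assumes G: "sm G"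
  shows "LL (\<lambda>p. exp (- \<alpha> * G p)) p
    = exp (- \<alpha> * G p) * (\<alpha> * \<alpha> * (\<Sum>k\<in>UNIV. \<delta> k G p * \<delta> k G p) - \<alpha> * LL G p)"
proof -
  let ?v = "\<lambda>p. exp (- \<alpha> * G p)"
  have smv: "sm ?v" by (intro allI smk_exp smk_mult smk_const G[rule_format])
  have sm1: "smk (Suc 0) (\<lambda>p. - \<alpha> * G p)" using G by (intro smk_mult smk_const) auto
  have d: "\<delta> k ?v = (\<lambda>p. - \<alpha> * (?v p * \<delta> k G p))" for k
  proof
    fix p
    have "\<delta> k ?v p = ?v p * \<delta> k (\<lambda>p. - \<alpha> * G p) p"
      unfolding \<delta>_def using grad_chain[OF sm1 smk_exp[OF sm1] DERIV_exp] by simp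
    also have "\<delta> k (\<lambda>p. - \<alpha> * G p) p = - \<alpha> * \<delta> k G p"
      using G by (intro \<delta>_cmult) auto
    finally show "\<delta> k ?v p = - \<alpha> * (?v p * \<delta> k G p)" by simp
  qed
  have "\<delta> k (\<delta> k ?v) p = ?v p * (\<alpha> * \<alpha> * (\<delta> k G p * \<delta> k G p)) - ?v p * \<alpha> * \<delta> k (\<delta> k G) p" for k
  proof -
    have "\<delta> k (\<delta> k ?v) p = - \<alpha> * \<delta> k (\<lambda>p. ?v p * \<delta> k G p) p"
      unfolding d using smv G by (intro \<delta>_cmult smk_mult smk_\<delta>) auto
    also have "\<delta> k (\<lambda>p. ?v p * \<delta> k G p) p = \<delta> k ?v p * \<delta> k G p + ?v p * \<delta> k (\<delta> k G) p"
      using smv G by (intro \<delta>_mult smk_\<delta>) auto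
    finally show ?thesis unfolding d by (simp add: algebra_simps)
  qed
  then have "(\<Sum>k\<in>UNIV. \<delta> k (\<delta> k ?v) p)
     = ?v p * (\<alpha> * \<alpha> * (\<Sum>k\<in>UNIV. \<delta> k G p * \<delta> k G p)) - ?v p * \<alpha> * (\<Sum>k\<in>UNIV. \<delta> k (\<delta> k G) p)"
    by (simp add: sum_subtractf sum_distrib_left)
  moreover have "(\<Sum>k\<in>UNIV. F p $ k * \<delta> k ?v p) = - \<alpha> * ?v p * (\<Sum>k\<in>UNIV. F p $ k * \<delta> k G p)"
    unfolding d by (simp add: sum_distrib_left mult_ac sum_negf)
  ultimately show ?thesis by (simp add: LL_def algebra_simps)
qed

text \<open>Hopf's barrier argument, with the barrier built from the ambient distance to a nearby point.\<close>

lemma zero_set_H_open: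
  assumes nonneg: "\<And>p. H p \<ge> 0" and z0: "H p0 = 0"
  shows "\<exists>U. open U \<and> p0 \<in> U \<and> (\<forall>q\<in>U. H q = 0)"
proof -
  obtain V f w where f: "(V, f) \<in> \<A>" "w \<in> V" "f w = p0" using atlas_cover .
  note L = dF_linear[OF f(1,2)]
  obtain \<kappa> where \<kappa>: "\<kappa> > 0" "\<And>a. norm (dF f w a) \<ge> \<kappa> * norm a"
    using linear_inj_bounded_below_pos[OF L dF_inj[OF f(1,2)]] by (metis mult.commute)
  obtain \<Lambda> where \<Lambda>: "\<Lambda> > 0" "\<And>a. norm (dF f w a) \<le> \<Lambda> * norm a"
    using linear_bounded_pos[OF L] by (metis mult.commute)
  obtain r where r: "r > 0" "cball w r \<subseteq> V"
    "\<And>z a. z \<in> cball w r \<Longrightarrow> norm (dF f z a - dF f w a) \<le> \<kappa> / 8 * norm a"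
    "\<And>z y. z \<in> cball w r \<Longrightarrow> y \<in> cball w r \<Longrightarrow>
      norm (F (f z) - F (f y) - dF f w (z - y)) \<le> \<kappa> / 8 * norm (z - y)"
    using chart_close[OF f(1,2), of "\<kappa> / 8"] \<kappa>(1) by (metis divide_pos_pos zero_less_numeral)
  have lower: "norm (F (f z) - F (f y)) \<ge> 7/8 * \<kappa> * norm (z - y)" if "z \<in> cball w r" "y \<in> cball w r" for z y
    using r(4)[OF that] \<kappa>(2)[of "z - y"] norm_triangle_ineq3[of "F (f z) - F (f y)" "dF f w (z - y)"] by linarith
  have upper: "norm (F (f z) - F (f y)) \<le> (\<Lambda> + \<kappa>) * norm (z - y)" if "z \<in> cball w r" "y \<in> cball w r" for z y
  proof -
    have "norm (F (f z) - F (f y)) \<le> \<kappa> / 8 * norm (z - y) + \<Lambda> * norm (z - y)"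
      using r(4)[OF that] \<Lambda>(2)[of "z - y"] norm_triangle_ineq3[of "F (f z) - F (f y)" "dF f w (z - y)"] by linarith
    also have "\<dots> \<le> \<kappa> * norm (z - y) + \<Lambda> * norm (z - y)" using \<kappa>(1) by (simp add: mult_right_mono)
    finally show ?thesis by (simp add: algebra_simps)
  qed
  \<comment> \<open>Nearby chords are almost tangent. This keeps the tangential gradient of the
    squared ambient distance away from zero: its square is at least 3 times that squared
    distance.\<close>
  have normal_part: "\<bar>\<nu> (f z) \<bullet> (F (f z) - F (f y))\<bar> \<le> 1/2 * norm (F (f z) - F (f y))"
    if z: "z \<in> cball w r" "y \<in> cball w r" for z y
  proof -
    have zV: "z \<in> V" using z r(2) by auto
    let ?d = "F (f z) - F (f y)"
    have "\<nu> (f z) \<bullet> ?d = \<nu> (f z) \<bullet> (?d - dF f z (z - y))"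
      using normal_orth[OF f(1) zV] by (simp add: inner_diff_right)
    then have "\<bar>\<nu> (f z) \<bullet> ?d\<bar> \<le> norm (?d - dF f z (z - y))"
      using Cauchy_Schwarz_ineq2[of "\<nu> (f z)" "?d - dF f z (z - y)"] by simp
    also have "\<dots> \<le> norm (?d - dF f w (z - y)) + norm (dF f z (z - y) - dF f w (z - y))"
    proof -
      have eq: "?d - dF f z (z - y) = (?d - dF f w (z - y)) - (dF f z (z - y) - dF f w (z - y))" by simp
      show ?thesis by (subst eq) (rule norm_triangle_ineq4)
    qed
    also have "\<dots> \<le> \<kappa> / 8 * norm (z - y) + \<kappa> / 8 * norm (z - y)"
      using r(3)[OF z(1)] r(4)[OF z] by (intro add_mono)
    also have "\<dots> \<le> 1/2 * norm ?d" using lower[OF z] \<kappa>(1) norm_ge_zero[of "z - y"] mult_nonneg_nonneg[of \<kappa> "norm (z - y)"] by linarith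
    finally show ?thesis .
  qed
  \<comment> \<open>Small enough that, for \<open>u1\<close> within \<open>r1\<close> of
    \<open>w\<close>, the image of the sphere of radius \<open>r\<close> is farther from the image
    of \<open>u1\<close> than the image of \<open>w\<close> is.\<close>
  define r1 where "r1 = \<kappa> * r / (4 * (\<Lambda> + 2 * \<kappa>))"
  have r1: "r1 > 0" "r1 < r" "(\<Lambda> + 2 * \<kappa>) * r1 = \<kappa> * r / 4"
    using \<kappa>(1) \<Lambda>(1) r(1) by (auto simp: r1_def field_simps intro!: add_pos_pos mult_pos_pos)
  have claim: "H (f u1) = 0" if u1: "u1 \<in> ball w r1" for u1
  proof (rule ccontr)
    assume "H (f u1) \<noteq> 0"
    then have pos: "H (f u1) > 0" using nonneg[of "f u1"] by simp
    have u1r: "u1 \<in> cball w r" using u1 r1 by auto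
    have wr: "w \<in> cball w r" using r(1) by simp
    define c where "c = F (f u1)"
    define G where "G p = (\<Sum>i\<in>UNIV. (F p $ i - c $ i) * (F p $ i - c $ i))" for p
    have G_norm: "G p = (norm (F p - c))\<^sup>2" for p
      by (simp add: G_def power2_norm_eq_inner inner_vec_def)
    have smG: "sm G" unfolding G_def by (intro allI smk_sum smk_mult smk_diff smk_F smk_const)
    have dG: "\<delta> k G p = 2 * ((F p $ k - c $ k) - \<nu> p $ k * (\<nu> p \<bullet> (F p - c)))" for k p
    proof -
      have "\<delta> k G p = 2 * (\<Sum>i\<in>UNIV. ((if k = i then 1 else 0) - \<nu> p $ k * \<nu> p $ i) * (F p $ i - c $ i))"
        unfolding G_def
        by (simp add: \<delta>_sum \<delta>_mult \<delta>_diff smk_mult smk_diff smk_const smk_F \<delta>_F sum_distrib_left mult.commute)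
      then show ?thesis by (simp only: sum_projection) (simp add: inner_vec_def)
    qed
    have gradG: "(\<Sum>k\<in>UNIV. \<delta> k G p * \<delta> k G p) = 4 * (G p - (\<nu> p \<bullet> (F p - c))\<^sup>2)" for p
    proof -
      let ?b = "\<nu> p \<bullet> (F p - c)"
      have "(\<Sum>k\<in>UNIV. \<delta> k G p * \<delta> k G p) = (\<Sum>k\<in>UNIV. 4 * ((F p $ k - c $ k) * (F p $ k - c $ k))
          - 8 * ?b * (\<nu> p $ k * (F p $ k - c $ k)) + 4 * ?b * ?b * (\<nu> p $ k * \<nu> p $ k))"
        by (intro sum.cong refl) (simp add: dG algebra_simps)
      also have "\<dots> = 4 * G p - 8 * ?b * (\<Sum>k\<in>UNIV. \<nu> p $ k * (F p $ k - c $ k)) + 4 * ?b * ?b * (\<Sum>k\<in>UNIV. \<nu> p $ k * \<nu> p $ k)"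
        by (simp only: sum.distrib sum_subtractf sum_distrib_left[symmetric] G_def)
      also have "(\<Sum>k\<in>UNIV. \<nu> p $ k * (F p $ k - c $ k)) = ?b" by (simp add: inner_vec_def)
      finally show ?thesis by (simp add: normal_sq power2_eq_square)
    qed
    define \<rho> where "\<rho> = norm (F (f w) - c)"
    have "f u1 \<noteq> f w" using pos z0 f(3) by auto
    then have "u1 \<noteq> w" by auto
    have "\<rho> > 0"
      using lower[OF wr u1r] \<kappa>(1) \<open>u1 \<noteq> w\<close> unfolding \<rho>_def c_def
      by (smt (verit, best) divide_pos_pos mult_pos_pos right_minus_eq zero_less_norm_iff)
    have \<rho>_le: "\<rho> \<le> (\<Lambda> + \<kappa>) * r1"
    proof -
      have "\<rho> \<le> (\<Lambda> + \<kappa>) * norm (w - u1)" unfolding \<rho>_def c_def by (rule upper[OF wr u1r])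
      also have "\<dots> \<le> (\<Lambda> + \<kappa>) * r1" using u1 \<Lambda>(1) \<kappa>(1) by (intro mult_left_mono) (auto simp: dist_norm)
      finally show ?thesis .
    qed
    have "continuous_on V (\<lambda>z. H (f z))" using Ck_on_imp_continuous_on[OF smkD[OF smk_H f(1)]] .
    then have contH: "continuous_on (cball w r) (\<lambda>z. H (f z))" using continuous_on_subset r(2) by blast
    have "continuous_on V (\<lambda>z. F (f z))" using Ck_on_imp_continuous_on[OF F_smooth[OF f(1)]] by (simp add: o_def)
    then have contF: "continuous_on (cball w r) (\<lambda>z. F (f z))" using continuous_on_subset r(2) by blast
    obtain \<eta> where \<eta>: "\<eta> > 0" "\<And>z. z \<in> cball w r \<Longrightarrow> dist z u1 < \<eta> \<Longrightarrow> H (f z) > 0"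
    proof -
      obtain d where "d > 0" "\<forall>z\<in>cball w r. dist z u1 < d \<longrightarrow> dist (H (f z)) (H (f u1)) < H (f u1)"
        using contH u1r pos unfolding continuous_on_iff by blast
      then show ?thesis using that[of d] by (force simp: dist_real_def abs_if split: if_splits)
    qed
    \<comment> \<open>The first bound puts \<open>w\<close> into the region \<open>K\<close>; the
      second keeps the removed neighbourhood of the centre inside the set where \<open>H\<close> is
      positive.\<close>
    define \<sigma>0 where "\<sigma>0 = min (\<rho> / 2) (7/16 * \<kappa> * \<eta>)"
    have \<sigma>0: "\<sigma>0 > 0" "\<sigma>0 < \<rho>" "\<sigma>0 < 7/8 * \<kappa> * \<eta>" using \<open>\<rho> > 0\<close> \<kappa>(1) \<eta>(1) mult_pos_pos[OF \<kappa>(1) \<eta>(1)] by (auto simp: \<sigma>0_def min_def)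
    have near: "H (f z) > 0" if z: "z \<in> cball w r" "norm (F (f z) - c) \<le> \<sigma>0" for z
    proof (rule \<eta>(2)[OF z(1)])
      have "7/8 * \<kappa> * norm (z - u1) < 7/8 * \<kappa> * \<eta>"
        using lower[OF z(1) u1r] z(2) \<sigma>0(3) unfolding c_def by linarith
      then show "dist z u1 < \<eta>" using \<kappa>(1) by (simp add: dist_norm)
    qed
    define K where "K = {z \<in> cball w r. \<sigma>0 \<le> norm (F (f z) - c)}"
    have "compact K"
    proof -
      have "continuous_on (cball w r) (\<lambda>z. norm (F (f z) - c))" by (intro continuous_intros contF)
      then have "closed (cball w r \<inter> (\<lambda>z. norm (F (f z) - c)) -` {\<sigma>0..})"
        by (intro continuous_closed_preimage) auto
      moreover have "K = cball w r \<inter> (cball w r \<inter> (\<lambda>z. norm (F (f z) - c)) -` {\<sigma>0..})" by (auto simp: K_def)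
      ultimately show ?thesis by (metis compact_Int_closed compact_cball)
    qed
    have "w \<in> K" using r(1) \<sigma>0 by (simp add: K_def \<rho>_def)
    have KV: "K \<subseteq> V" using r(2) by (auto simp: K_def)
    have smLG: "smk 0 (LL G)" unfolding LL_def using smG by (intro smk_add smk_mult smk_sum smk_\<delta> smk_const smk_F) auto
    have "continuous_on K (\<lambda>z. LL G (f z))"
      using Ck_on_imp_continuous_on[OF smkD[OF smLG f(1)]] KV continuous_on_subset by blast
    then obtain zM where zM: "zM \<in> K" "\<And>z. z \<in> K \<Longrightarrow> LL G (f z) \<le> LL G (f zM)"
      using continuous_attains_sup[OF \<open>compact K\<close>] \<open>w \<in> K\<close> by blast
    define M where "M = \<bar>LL G (f zM)\<bar> + 1"
    have M: "M > 0" "LL G (f z) < M" if "z \<in> K" for z using zM(2)[OF that] by (auto simp: M_def)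
    define \<gamma> where "\<gamma> = 3 * \<sigma>0\<^sup>2"
    have \<gamma>: "\<gamma> > 0" using \<sigma>0 by (simp add: \<gamma>_def)
    have gradG_ge: "(\<Sum>k\<in>UNIV. \<delta> k G (f z) * \<delta> k G (f z)) \<ge> \<gamma>" if "z \<in> K" for z
    proof -
      have zr: "z \<in> cball w r" and z\<sigma>: "\<sigma>0 \<le> norm (F (f z) - c)" using that by (auto simp: K_def)
      have "(\<nu> (f z) \<bullet> (F (f z) - c))\<^sup>2 \<le> (1/2 * norm (F (f z) - c))\<^sup>2"
        using normal_part[OF zr u1r] unfolding c_def by (metis power2_abs power_mono abs_ge_zero)
      then have "(\<nu> (f z) \<bullet> (F (f z) - c))\<^sup>2 \<le> 1/4 * G (f z)" by (simp add: G_norm power_mult_distrib power_divide)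
      moreover have "\<sigma>0\<^sup>2 \<le> G (f z)" unfolding G_norm using z\<sigma> \<sigma>0(1) by (intro power_mono) auto
      ultimately show ?thesis unfolding gradG \<gamma>_def by simp
    qed
    \<comment> \<open>With \<open>\<alpha> * \<gamma> = M\<close> the quadratic term of
      \<open>LL_exp\<close> exceeds the term with \<open>LL G\<close>, so \<open>v\<close> is a
      strict subsolution on \<open>K\<close>.\<close>
    define \<alpha> where "\<alpha> = M / \<gamma>"
    have \<alpha>: "\<alpha> > 0" "\<alpha> * \<gamma> = M" using M(1)[OF \<open>w \<in> K\<close>] \<gamma> by (auto simp: \<alpha>_def)
    define v where "v p = exp (- \<alpha> * G p)" for p
    have smv: "sm v" unfolding v_def by (intro allI smk_exp smk_mult smk_const smG[rule_format])
    have LLv: "LL v (f z) > 0" if "z \<in> K" for z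
    proof -
      have "\<alpha> * (\<alpha> * \<gamma>) \<le> \<alpha> * (\<alpha> * (\<Sum>k\<in>UNIV. \<delta> k G (f z) * \<delta> k G (f z)))"
        using gradG_ge[OF that] \<alpha>(1) by (intro mult_left_mono) auto
      moreover have "\<alpha> * LL G (f z) < \<alpha> * M" using M(2)[OF that] \<alpha>(1) by simp
      ultimately have "\<alpha> * \<alpha> * (\<Sum>k\<in>UNIV. \<delta> k G (f z) * \<delta> k G (f z)) - \<alpha> * LL G (f z) > 0"
        using \<alpha>(2) by (simp add: mult.assoc)
      then show ?thesis unfolding v_def LL_exp[OF smG] by (intro mult_pos_pos) auto
    qed
    define v\<rho> where "v\<rho> = exp (- \<alpha> * \<rho>\<^sup>2)"
    have v_less: "v p < v\<rho>" if "norm (F p - c) > \<rho>" for p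
    proof -
      have "\<rho>\<^sup>2 < (norm (F p - c))\<^sup>2" using that \<open>\<rho> > 0\<close> by (intro power_strict_mono) auto
      then show ?thesis using \<alpha>(1) by (simp add: v_def v\<rho>_def G_norm)
    qed
    have v_le1: "v p - v\<rho> < 1" for p
    proof -
      have "v p \<le> 1" using \<alpha>(1) by (simp add: v_def G_norm)
      moreover have "v\<rho> > 0" by (simp add: v\<rho>_def)
      ultimately show ?thesis by linarith
    qed
    define K' where "K' = {z \<in> cball w r. norm (F (f z) - c) = \<sigma>0}"
    have "compact K'"
    proof -
      have "continuous_on (cball w r) (\<lambda>z. norm (F (f z) - c))" by (intro continuous_intros contF)
      then have "closed (cball w r \<inter> (\<lambda>z. norm (F (f z) - c)) -` {\<sigma>0})"
        by (intro continuous_closed_preimage) auto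
      moreover have "K' = cball w r \<inter> (cball w r \<inter> (\<lambda>z. norm (F (f z) - c)) -` {\<sigma>0})" by (auto simp: K'_def)
      ultimately show ?thesis by (metis compact_Int_closed compact_cball)
    qed
    have "\<exists>m>0. \<forall>z\<in>K'. H (f z) \<ge> m"
    proof (cases "K' = {}")
      case False
      have "continuous_on K' (\<lambda>z. H (f z))" using contH by (rule continuous_on_subset) (auto simp: K'_def)
      then obtain z0 where "z0 \<in> K'" "\<And>z. z \<in> K' \<Longrightarrow> H (f z0) \<le> H (f z)"
        using continuous_attains_inf[OF \<open>compact K'\<close> False] by blast
      then show ?thesis using near[of z0] by (intro exI[of _ "H (f z0)"]) (auto simp: K'_def)
    qed (auto intro: exI[of _ 1])
    then obtain m where m: "m > 0" "\<And>z. z \<in> K' \<Longrightarrow> H (f z) \<ge> m" by blast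
    \<comment> \<open>The value at \<open>w\<close> is \<open>- m * v\<rho>\<close>. On the inner
      boundary \<open>u\<close> is larger because \<open>H\<close> is at least \<open>m\<close>
      there, on the outer one because \<open>v\<close> is below \<open>v\<rho>\<close> and
      \<open>H\<close> is nonnegative. So the minimum is interior, where \<open>LL u\<close> must be
      nonnegative; but \<open>LL H\<close> is at most 0 and \<open>LL v\<close> is positive.\<close>
    define u where "u p = H p - m * v p" for p
    have smu: "sm u" unfolding u_def using smv by (auto intro!: smk_diff smk_mult smk_const smk_H)
    have "continuous_on V (\<lambda>z. u (f z))" using Ck_on_imp_continuous_on[OF smkD[OF smu[rule_format] f(1)]] .
    then have "continuous_on K (\<lambda>z. u (f z))" using KV continuous_on_subset by blast
    then obtain z where z: "z \<in> K" "\<And>y. y \<in> K \<Longrightarrow> u (f z) \<le> u (f y)"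
      using continuous_attains_inf[OF \<open>compact K\<close>] \<open>w \<in> K\<close> by blast
    have uw: "u (f w) = - m * v\<rho>"
      using z0 f(3) by (simp add: u_def v_def v\<rho>_def G_norm \<rho>_def)
    have zr: "z \<in> cball w r" using z(1) by (simp add: K_def)
    have int1: "norm (F (f z) - c) > \<sigma>0"
    proof (rule ccontr)
      assume "\<not> norm (F (f z) - c) > \<sigma>0"
      then have "z \<in> K'" using z(1) by (auto simp: K_def K'_def)
      then have "u (f z) \<ge> m - m * v (f z)" using m(2) by (simp add: u_def)
      moreover have "m * (v (f z) - v\<rho>) < m * 1" using v_le1 m(1) by (intro mult_strict_left_mono)
      ultimately have "u (f z) > - m * v\<rho>" by (simp add: algebra_simps)
      then show False using z(2)[OF \<open>w \<in> K\<close>] uw by simp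
    qed
    have int2: "z \<in> ball w r"
    proof (rule ccontr)
      assume "z \<notin> ball w r"
      then have zw: "norm (z - w) = r" using zr by (simp add: dist_norm norm_minus_commute)
      have "norm (z - u1) \<ge> r - r1"
        using zw u1 norm_triangle_ineq[of "z - u1" "u1 - w"] by (simp add: dist_norm norm_minus_commute)
      then have "7/8 * \<kappa> * (r - r1) \<le> norm (F (f z) - c)"
        using lower[OF zr u1r] \<kappa>(1) mult_left_mono[of "r - r1" "norm (z - u1)" "7/8 * \<kappa>"] unfolding c_def by linarith
      moreover have "(\<Lambda> + \<kappa>) * r1 < 7/8 * \<kappa> * (r - r1)"
        using r1(3) mult_pos_pos[OF \<kappa>(1) r1(1)] mult_pos_pos[OF \<kappa>(1) r(1)] by (simp add: algebra_simps)
      ultimately have "norm (F (f z) - c) > \<rho>" using \<rho>_le by linarith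
      then have "m * v (f z) < m * v\<rho>" using v_less m(1) by simp
      then have "u (f z) > - m * v\<rho>" using nonneg[of "f z"] by (simp add: u_def)
      then show False using z(2)[OF \<open>w \<in> K\<close>] uw by simp
    qed
    let ?Z = "ball w r \<inter> (\<lambda>z. F (f z)) -` {x. norm (x - c) > \<sigma>0}"
    have "continuous_on (ball w r) (\<lambda>z. F (f z))" using contF by (rule continuous_on_subset) auto
    moreover have "open {x. norm (x - c) > \<sigma>0}" by (intro open_Collect_less continuous_intros)
    ultimately have "open ?Z" by (intro continuous_open_preimage) auto
    then have "open (f ` ?Z)" using r(2) by (intro chart_image_open[OF f(1)]) auto
    then have "LL u (f z) \<ge> 0"
      by (rule LL_local_min[OF smu[rule_format]])
        (use int1 int2 z(2) in \<open>auto simp: K_def\<close>)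
    moreover have "LL u (f z) = LL H (f z) - m * LL v (f z)"
      unfolding u_def using LL_diff[of H v] smk_H smv by blast
    moreover have "LL H (f z) \<le> 0"
      unfolding LL_H using S_nonneg[of "f z"] nonneg[of "f z"] by (simp add: mult_nonpos_nonneg)
    moreover have "m * LL v (f z) > 0" using LLv[OF z(1)] m(1) by simp
    ultimately show False by linarith
  qed
  show ?thesis
  proof (intro exI[of _ "f ` ball w r1"] conjI)
    have "ball w r1 \<subseteq> V" using r1(2) r(2) by (auto simp: subset_iff)
    then show "open (f ` ball w r1)" by (intro chart_image_open[OF f(1)]) auto
    show "p0 \<in> f ` ball w r1" using f(3) r1(1) by auto
    show "\<forall>q\<in>f ` ball w r1. H q = 0" using claim by auto
  qed
qed

lemma H_dichotomy:
  assumes nonneg: "\<And>p. H p \<ge> 0"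
  shows "(\<forall>p. H p = 0) \<or> (\<forall>p. H p > 0)"
proof -
  let ?T = "{p. H p = 0}"
  have "open ?T"
  proof (subst open_subopen, rule ballI)
    fix p assume "p \<in> ?T"
    then show "\<exists>T. open T \<and> p \<in> T \<and> T \<subseteq> ?T" using zero_set_H_open[OF nonneg, of p] by blast
  qed
  moreover have "closed ?T" using smk_continuous[OF smk_H] by (intro closed_Collect_eq) auto
  moreover have "connected (UNIV :: 'p set)" using manifold by (simp add: connected_manifold_def)
  ultimately have "?T = {} \<or> ?T = UNIV"
    by (metis (no_types, lifting) closed_closedin connected_clopen open_openin subtopology_UNIV)
  then show ?thesis using nonneg by (metis (mono_tags, lifting) UNIV_I empty_Collect_eq less_eq_real_def mem_Collect_eq)
qed

end

section \<open>Orthonormal frames\<close>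

context hypersurface
begin

lemma dF_field_smooth:
  assumes f: "(V, f) \<in> \<A>" and W: "open W" "W \<subseteq> V" and E: "Ck_on k W E"
  shows "Ck_on k W (\<lambda>w. dF f w (E w))"
proof (rule Ck_on_eqI[OF W(1)])
  show "Ck_on k W (\<lambda>w. \<Sum>b\<in>UNIV. E w $ b *\<^sub>R dF f w (axis b 1))"
    by (intro Ck_on_sum Ck_on_scaleR Ck_on_vec_nth W(1) E Ck_on_subset[OF dF_smooth[OF f] W(2)])
  show "dF f w (E w) = (\<Sum>b\<in>UNIV. E w $ b *\<^sub>R dF f w (axis b 1))" if "w \<in> W" for w
    using linear_eq_sum_axis[OF dF_linear[OF f]] that W(2) by blast
qed

text \<open>Gram--Schmidt orthonormalization with respect to the induced metric, one vector at a time.\<close>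

lemma partial_frame_exists:
  fixes I :: "'n set"
  assumes f: "(V, f) \<in> \<A>" "u \<in> V"
  shows "finite I \<Longrightarrow> \<exists>W E. open W \<and> W \<subseteq> V \<and> u \<in> W \<and> (\<forall>i\<in>I. smooth_on W (E i)) \<and>
    (\<forall>w\<in>W. \<forall>i\<in>I. \<forall>j\<in>I. dF f w (E i w) \<bullet> dF f w (E j w) = (if i = j then 1 else 0))"
proof (induction I rule: finite_induct)
  case empty
  show ?case using f chart_open[OF f(1)] by (intro exI[of _ V]) auto
next
  case (insert k I)
  then obtain W E where W: "open W" "W \<subseteq> V" "u \<in> W" and E: "\<And>i. i \<in> I \<Longrightarrow> smooth_on W (E i)"
    and orth: "\<And>w i j. w \<in> W \<Longrightarrow> i \<in> I \<Longrightarrow> j \<in> I \<Longrightarrow> dF f w (E i w) \<bullet> dF f w (E j w) = (if i = j then 1 else 0)"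
    by metis
  have "dim ((\<lambda>i. E i u) ` I) \<le> card ((\<lambda>i. E i u) ` I)" by (intro dim_le_card') (simp add: insert.hyps)
  also have "\<dots> \<le> card I" by (rule card_image_le[OF insert.hyps(1)])
  also have "\<dots> < CARD('n)"
    using insert.hyps by (intro psubset_card_mono) auto
  finally have "span ((\<lambda>i. E i u) ` I) \<noteq> UNIV"
    using dim_eq_full[of "(\<lambda>i. E i u) ` I"] by simp
  then obtain a where a: "a \<notin> span ((\<lambda>i. E i u) ` I)" by blast
  define a' where "a' w = a - (\<Sum>i\<in>I. (dF f w a \<bullet> dF f w (E i w)) *\<^sub>R E i w)" for w
  have Esm: "Ck_on l W (E i)" if "i \<in> I" for l i using E[OF that] by (simp add: smooth_on_def)
  have dFE: "Ck_on l W (\<lambda>w. dF f w (E i w))" if "i \<in> I" for l i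
    by (rule dF_field_smooth[OF f(1) W(1,2) Esm[OF that]])
  have a'sm: "Ck_on l W a'" for l
    unfolding a'_def
    by (intro Ck_on_diff Ck_on_sum Ck_on_scaleR Ck_on_inner Ck_on_const W(1) dFE Esm Ck_on_subset[OF dF_smooth[OF f(1)] W(2)])
  define g where "g w = dF f w (a' w) \<bullet> dF f w (a' w)" for w
  have gsm: "Ck_on l W g" for l
    unfolding g_def by (intro Ck_on_inner W(1) dF_field_smooth[OF f(1) W(1,2)] a'sm)
  \<comment> \<open>The new vector has positive length at \<open>u\<close> and hence only near it,
    so the domain may shrink with every vector added.\<close>
  define W' where "W' = W \<inter> g -` {0<..}"
  have "a' u \<noteq> 0"
  proof
    assume "a' u = 0"
    then have "a = (\<Sum>i\<in>I. (dF f u a \<bullet> dF f u (E i u)) *\<^sub>R E i u)" by (simp add: a'_def)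
    also have "\<dots> \<in> span ((\<lambda>i. E i u) ` I)" by (intro span_sum span_scale span_base) auto
    finally show False using a by simp
  qed
  then have "dF f u (a' u) \<noteq> 0"
    using dF_inj[OF f] linear_0[OF dF_linear[OF f]] by (metis injD)
  then have uW': "u \<in> W'" using W(3) by (simp add: W'_def g_def)
  have W': "open W'" "W' \<subseteq> W" unfolding W'_def
    using continuous_open_preimage[OF Ck_on_imp_continuous_on[OF gsm] W(1) open_greaterThan] by auto
  define E' where "E' i w = (if i = k then inverse (sqrt (g w)) *\<^sub>R a' w else E i w)" for i w
  have kI: "k \<notin> I" by (rule insert.hyps)
  have orth_a: "dF f w (a' w) \<bullet> dF f w (E j w) = 0" if w: "w \<in> W" and j: "j \<in> I" for w j
  proof -
    have L: "linear (dF f w)" using dF_linear[OF f(1)] w W(2) by blast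
    have "dF f w (a' w) \<bullet> dF f w (E j w)
      = dF f w a \<bullet> dF f w (E j w) - (\<Sum>i\<in>I. (dF f w a \<bullet> dF f w (E i w)) * (dF f w (E i w) \<bullet> dF f w (E j w)))"
      by (simp add: a'_def linear_diff[OF L] linear_sum[OF L] linear_cmul[OF L] inner_diff_left inner_sum_left)
    also have "(\<Sum>i\<in>I. (dF f w a \<bullet> dF f w (E i w)) * (dF f w (E i w) \<bullet> dF f w (E j w)))
      = (\<Sum>i\<in>I. if i = j then dF f w a \<bullet> dF f w (E i w) else 0)"
      by (intro sum.cong refl) (simp add: orth[OF w _ j])
    also have "\<dots> = dF f w a \<bullet> dF f w (E j w)" using j insert.hyps(1) by simp
    finally show ?thesis by (simp only: diff_self)
  qed
  have "dF f w (E' i w) \<bullet> dF f w (E' j w) = (if i = j then 1 else 0)"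
    if w: "w \<in> W'" and ij: "i \<in> insert k I" "j \<in> insert k I" for w i j
  proof -
    have wW: "w \<in> W" and gw: "g w > 0" using w by (auto simp: W'_def)
    have L: "linear (dF f w)" using dF_linear[OF f(1)] wW W(2) by blast
    have dk: "dF f w (E' k w) = inverse (sqrt (g w)) *\<^sub>R dF f w (a' w)"
      by (simp add: E'_def linear_cmul[OF L])
    have "dF f w (E' k w) \<bullet> dF f w (E' k w) = 1"
      unfolding dk using gw by (simp add: g_def[symmetric] field_simps)
    moreover have "dF f w (E' k w) \<bullet> dF f w (E' j w) = 0" "dF f w (E' j w) \<bullet> dF f w (E' k w) = 0" if "j \<in> I" for j
      using orth_a[OF wW that] kI that unfolding dk by (auto simp: E'_def inner_commute)
    moreover have "dF f w (E' i w) \<bullet> dF f w (E' j w) = (if i = j then 1 else 0)" if "i \<in> I" "j \<in> I" for i j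
      using orth[OF wW that] kI that by (auto simp: E'_def)
    ultimately show ?thesis using ij kI by auto
  qed
  moreover have "smooth_on W' (E' i)" if i: "i \<in> insert k I" for i
  proof (cases "i = k")
    case True
    have "Ck_on l W' (\<lambda>w. inverse (sqrt (g w)) *\<^sub>R a' w)" for l
      by (intro Ck_on_scaleR Ck_on_rsqrt_comp W'(1) Ck_on_subset[OF gsm W'(2)] Ck_on_subset[OF a'sm W'(2)])
        (simp add: W'_def)
    then show ?thesis using True by (simp add: smooth_on_def E'_def[abs_def])
  next
    case False
    then show ?thesis using i Ck_on_subset[OF Esm W'(2)] by (simp add: smooth_on_def E'_def[abs_def])
  qed
  ultimately show ?case
    using W' W(2) uW' by (intro exI[of _ W'] exI[of _ E']) blast
qed

lemma frame_exists: "\<exists>f E u. orthonormal_frame_at \<A> F p f E u"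
proof -
  obtain V f u where f: "(V, f) \<in> \<A>" "u \<in> V" "f u = p" using atlas_cover .
  obtain W and E :: "'n \<Rightarrow> real^'n \<Rightarrow> real^'n" where "open W \<and> W \<subseteq> V \<and> u \<in> W \<and> (\<forall>i\<in>UNIV. smooth_on W (E i)) \<and>
    (\<forall>w\<in>W. \<forall>i\<in>UNIV. \<forall>j\<in>UNIV. dF f w (E i w) \<bullet> dF f w (E j w) = (if i = j then 1 else 0))"
    using partial_frame_exists[OF f(1,2) finite_class.finite_UNIV] by (elim exE) (rule that)
  then have "orthonormal_frame_at \<A> F p f E u"
    unfolding orthonormal_frame_at_def tangent_field_def using f
    by (intro conjI exI[of _ V] exI[of _ W]) auto
  then show ?thesis by blast
qed

text \<open>Differentiating the orthogonality of normal and tangent field trades the derivative of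
  the field for that of the normal. The right side depends on the fields only through their values
  at \<open>u\<close>, which is what the definitions by \<open>THE\<close> rely on.\<close>

lemma normal_derivative_eq:
  assumes f: "(V, f) \<in> \<A>" and W: "open W" "W \<subseteq> V" "u \<in> W" and E': "smooth_on W E'"
  shows "normal_derivative F \<nu> f E E' u =
    - (\<Sum>k\<in>UNIV. \<Sum>l\<in>UNIV. A k l (f u) * tangent_field F f E u $ k * tangent_field F f E' u $ l) *\<^sub>R \<nu> (f u)"
proof -
  have uV: "u \<in> V" using W by auto
  have "Ck_on (Suc 0) W (tangent_field F f E')"
    unfolding tangent_field_def using E' by (intro dF_field_smooth[OF f W(1,2)]) (simp add: smooth_on_def)
  then have dT: "(tangent_field F f E' has_derivative frechet_derivative (tangent_field F f E') (at u)) (at u)"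
    using Ck_on_has_derivative W(3) by blast
  have dT_l: "((\<lambda>w. tangent_field F f E' w $ l) has_derivative (\<lambda>a. frechet_derivative (tangent_field F f E') (at u) a $ l)) (at u)" for l
    using bounded_linear.has_derivative[OF bounded_linear_vec_nth dT] .
  have d\<nu>: "((\<lambda>w. \<nu> (f w) $ l) has_derivative (\<lambda>a. \<Sum>k\<in>UNIV. A k l (f u) * dF f u a $ k)) (at u)" for l
    using has_derivative_chart[OF smk_\<nu> f uV, of l] by (simp add: inner_vec_def A_def \<delta>_def)
  have "((\<lambda>w. \<Sum>l\<in>UNIV. \<nu> (f w) $ l * tangent_field F f E' w $ l) has_derivative
     (\<lambda>a. \<Sum>l\<in>UNIV. \<nu> (f u) $ l * frechet_derivative (tangent_field F f E') (at u) a $ l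
       + (\<Sum>k\<in>UNIV. A k l (f u) * dF f u a $ k) * tangent_field F f E' u $ l)) (at u)"
    by (intro has_derivative_sum has_derivative_mult d\<nu> dT_l)
  moreover have "((\<lambda>w. \<Sum>l\<in>UNIV. \<nu> (f w) $ l * tangent_field F f E' w $ l) has_derivative (\<lambda>_. 0)) (at u)"
    by (rule has_derivative_transform_within_open[OF _ W(1,3), of "\<lambda>_. 0"])
      (use normal_orth[OF f] W(2) in \<open>auto simp: tangent_field_def inner_vec_def\<close>)
  ultimately have "(\<lambda>a. \<Sum>l\<in>UNIV. \<nu> (f u) $ l * frechet_derivative (tangent_field F f E') (at u) a $ l
       + (\<Sum>k\<in>UNIV. A k l (f u) * dF f u a $ k) * tangent_field F f E' u $ l) = (\<lambda>_. 0)"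
    by (rule has_derivative_unique)
  from fun_cong[OF this, of "E u"]
  have "frechet_derivative (tangent_field F f E') (at u) (E u) \<bullet> \<nu> (f u)
     = - (\<Sum>l\<in>UNIV. (\<Sum>k\<in>UNIV. A k l (f u) * dF f u (E u) $ k) * tangent_field F f E' u $ l)"
    by (simp add: sum.distrib inner_vec_def mult.commute)
  also have "(\<Sum>l\<in>UNIV. (\<Sum>k\<in>UNIV. A k l (f u) * dF f u (E u) $ k) * tangent_field F f E' u $ l)
     = (\<Sum>k\<in>UNIV. \<Sum>l\<in>UNIV. A k l (f u) * tangent_field F f E u $ k * tangent_field F f E' u $ l)"
    by (subst sum.swap) (simp add: sum_distrib_right tangent_field_def)
  finally show ?thesis by (simp add: normal_derivative_def)
qed

text \<open>By dimension the vectors span the tangent space; the remainder of the expansion lies in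
  this span and is orthogonal to it.\<close>

lemma tangent_orthonormal_expansion:
  fixes e :: "'n \<Rightarrow> real^'m"
  assumes n: "\<And>i. e i \<bullet> \<nu> p = 0" and orth: "\<And>i j. e i \<bullet> e j = (if i = j then 1 else 0)"
    and v: "v \<bullet> \<nu> p = 0"
  shows "v = (\<Sum>i\<in>UNIV. (v \<bullet> e i) *\<^sub>R e i)"
proof -
  let ?T = "{x. \<nu> p \<bullet> x = 0}"
  have inj: "inj e" using orth by (metis injI zero_neq_one)
  have "pairwise orthogonal (range e)"
    using orth by (auto simp: pairwise_def orthogonal_def)
  moreover have "0 \<notin> range e" using orth by (metis imageE inner_zero_left zero_neq_one)
  ultimately have ind: "independent (range e)" by (intro pairwise_orthogonal_independent)
  have dimT: "dim ?T = CARD('n)"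
  proof -
    have "\<nu> p \<noteq> 0" using norm_normal[of p] by (metis norm_zero zero_neq_one)
    then have "dim ?T = DIM(real^'m) - 1" by (rule dim_hyperplane)
    then show ?thesis using card_m by simp
  qed
  have "?T \<subseteq> span (range e)"
    by (rule card_ge_dim_independent[OF _ ind]) (use n dimT card_image[OF inj] in \<open>auto simp: inner_commute\<close>)
  moreover have "v \<in> ?T" using v by (simp add: inner_commute)
  ultimately have "v \<in> span (range e)" by (rule subsetD)
  let ?d = "v - (\<Sum>i\<in>UNIV. (v \<bullet> e i) *\<^sub>R e i)"
  have "?d \<in> span (range e)"
    by (intro span_diff[OF \<open>v \<in> span (range e)\<close>] span_sum span_scale span_base) auto
  moreover have "orthogonal ?d x" if x: "x \<in> range e" for x
  proof -
    obtain j where "x = e j" using x by blast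
    have "(\<Sum>i\<in>UNIV. (v \<bullet> e i) * (e i \<bullet> e j)) = (\<Sum>i\<in>UNIV. if i = j then v \<bullet> e i else 0)"
      by (intro sum.cong refl) (simp add: orth)
    then show ?thesis unfolding \<open>x = e j\<close> orthogonal_def by (simp add: inner_diff_left inner_sum_left)
  qed
  ultimately have "orthogonal ?d ?d" by (rule orthogonal_to_span)
  then show ?thesis by (simp add: orthogonal_self)
qed

lemma tangent_parseval:
  fixes e :: "'n \<Rightarrow> real^'m"
  assumes "\<And>i. e i \<bullet> \<nu> p = 0" "\<And>i j. e i \<bullet> e j = (if i = j then 1 else 0)" "v \<bullet> \<nu> p = 0"
  shows "(\<Sum>i\<in>UNIV. (v \<bullet> e i) * (w \<bullet> e i)) = v \<bullet> w"
proof -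
  have "v \<bullet> w = (\<Sum>i\<in>UNIV. (v \<bullet> e i) *\<^sub>R e i) \<bullet> w"
    using tangent_orthonormal_expansion[OF assms] by simp
  then show ?thesis by (simp add: inner_sum_left inner_commute[of w])
qed

text \<open>The rows of \<open>A\<close>, and their combinations with the components of a frame
  vector, are tangent, so Parseval's identity converts each sum over the frame into a sum over
  ambient coordinates.\<close>

lemma frame_traces:
  fixes e :: "'n \<Rightarrow> real^'m"
  assumes n: "\<And>i. e i \<bullet> \<nu> p = 0" and orth: "\<And>i j. e i \<bullet> e j = (if i = j then 1 else 0)"
  defines "B \<equiv> \<lambda>x y. \<Sum>k\<in>UNIV. \<Sum>l\<in>UNIV. A k l p * x $ k * y $ l"
  shows "(\<Sum>i\<in>UNIV. B (e i) (e i)) = (\<Sum>i\<in>UNIV. A i i p)"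
    and "(\<Sum>i\<in>UNIV. \<Sum>j\<in>UNIV. (B (e i) (e j))\<^sup>2) = (\<Sum>i\<in>UNIV. \<Sum>j\<in>UNIV. A i j p * A i j p)"
proof -
  define a where "a k = (\<chi> l. A k l p)" for k
  have a_n: "a k \<bullet> \<nu> p = 0" for k
    using normal_A_right[of k p] by (simp add: a_def inner_vec_def)
  have B_a: "B x y = (\<Sum>k\<in>UNIV. x $ k * (a k \<bullet> y))" for x y
    unfolding B_def by (intro sum.cong refl) (simp add: a_def inner_vec_def sum_distrib_left mult_ac)
  have "(\<Sum>i\<in>UNIV. B (e i) (e i)) = (\<Sum>k\<in>UNIV. \<Sum>i\<in>UNIV. (a k \<bullet> e i) * (axis k 1 \<bullet> e i))"
    unfolding B_a by (subst sum.swap) (simp add: inner_axis' mult.commute)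
  also have "\<dots> = (\<Sum>k\<in>UNIV. a k \<bullet> axis k 1)"
    by (intro sum.cong refl tangent_parseval[OF n orth a_n])
  finally show "(\<Sum>i\<in>UNIV. B (e i) (e i)) = (\<Sum>i\<in>UNIV. A i i p)" by (simp add: inner_axis a_def)
  define b where "b i = (\<Sum>k\<in>UNIV. e i $ k *\<^sub>R a k)" for i
  have b_n: "b i \<bullet> \<nu> p = 0" for i by (simp add: b_def inner_sum_left a_n)
  have B_b: "B (e i) y = b i \<bullet> y" for i y by (simp add: B_a b_def inner_sum_left)
  have b_l: "b i $ l = a l \<bullet> e i" for i l
    unfolding b_def a_def inner_vec_def by (simp add: A_symmetric[of l] mult.commute)
  have "(\<Sum>j\<in>UNIV. (B (e i) (e j))\<^sup>2) = b i \<bullet> b i" for i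
    unfolding B_b power2_eq_square by (rule tangent_parseval[OF n orth b_n])
  then have "(\<Sum>i\<in>UNIV. \<Sum>j\<in>UNIV. (B (e i) (e j))\<^sup>2) = (\<Sum>i\<in>UNIV. \<Sum>l\<in>UNIV. (a l \<bullet> e i) * (a l \<bullet> e i))"
    by (simp add: inner_vec_def[of "b _"] b_l)
  also have "\<dots> = (\<Sum>l\<in>UNIV. \<Sum>i\<in>UNIV. (a l \<bullet> e i) * (a l \<bullet> e i))" by (rule sum.swap)
  also have "\<dots> = (\<Sum>l\<in>UNIV. a l \<bullet> a l)"
    by (intro sum.cong refl tangent_parseval[OF n orth a_n])
  finally show "(\<Sum>i\<in>UNIV. \<Sum>j\<in>UNIV. (B (e i) (e j))\<^sup>2) = (\<Sum>i\<in>UNIV. \<Sum>j\<in>UNIV. A i j p * A i j p)"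
    by (simp add: inner_vec_def a_def)
qed

lemma frame_values:
  assumes "orthonormal_frame_at \<A> F p f E u"
  shows "(\<Sum>i\<in>UNIV. normal_derivative F \<nu> f (E i) (E i) u) = - (\<Sum>i\<in>UNIV. A i i p) *\<^sub>R \<nu> p"
    and "(\<Sum>i\<in>UNIV. \<Sum>j\<in>UNIV. (norm (normal_derivative F \<nu> f (E i) (E j) u))\<^sup>2)
      = (\<Sum>i\<in>UNIV. \<Sum>j\<in>UNIV. A i j p * A i j p)"
proof -
  obtain V W where f: "(V, f) \<in> \<A>" "f u = p" and W: "open W" "W \<subseteq> V" "u \<in> W"
    and E: "\<And>i. smooth_on W (E i)"
    and orth: "\<And>w i j. w \<in> W \<Longrightarrow> tangent_field F f (E i) w \<bullet> tangent_field F f (E j) w = (if i = j then 1 else 0)"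
    using assms unfolding orthonormal_frame_at_def by blast
  define e where "e i = tangent_field F f (E i) u" for i
  have n: "e i \<bullet> \<nu> p = 0" for i
    using normal_orth[OF f(1), of u] W f(2) by (auto simp: e_def tangent_field_def inner_commute)
  have o: "e i \<bullet> e j = (if i = j then 1 else 0)" for i j using orth[OF W(3)] by (simp add: e_def)
  note nd = normal_derivative_eq[OF f(1) W E, unfolded f(2), folded e_def]
  show "(\<Sum>i\<in>UNIV. normal_derivative F \<nu> f (E i) (E i) u) = - (\<Sum>i\<in>UNIV. A i i p) *\<^sub>R \<nu> p"
    unfolding frame_traces(1)[OF n o, symmetric]
    by (simp add: normal_derivative_eq[OF f(1) W E, unfolded f(2)] e_def scaleR_sum_left sum_negf)
  show "(\<Sum>i\<in>UNIV. \<Sum>j\<in>UNIV. (norm (normal_derivative F \<nu> f (E i) (E j) u))\<^sup>2)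
      = (\<Sum>i\<in>UNIV. \<Sum>j\<in>UNIV. A i j p * A i j p)"
    unfolding frame_traces(2)[OF n o, symmetric]
    by (simp add: normal_derivative_eq[OF f(1) W E, unfolded f(2)] e_def)
qed

text \<open>\<open>THE\<close> is discharged by existence of a frame and by
  \<open>frame_values\<close>, whose right side does not mention the frame.\<close>

lemma mean_curvature_eq: "mean_curvature \<A> F \<nu> p = (\<Sum>i\<in>UNIV. A i i p)"
proof -
  have "mean_curvature_vector \<A> F \<nu> p = - (\<Sum>i\<in>UNIV. A i i p) *\<^sub>R \<nu> p"
    unfolding mean_curvature_vector_def
  proof (rule the_equality)
    obtain f E u where "orthonormal_frame_at \<A> F p f E u" using frame_exists by blast
    then show "\<exists>f E u. orthonormal_frame_at \<A> F p f E u \<and>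
        - (\<Sum>i\<in>UNIV. A i i p) *\<^sub>R \<nu> p = (\<Sum>i\<in>UNIV. normal_derivative F \<nu> f (E i) (E i) u)"
      using frame_values(1)[symmetric] by blast
  qed (auto simp: frame_values(1))
  then show ?thesis by (simp add: mean_curvature_def)
qed

lemma second_fundamental_form_norm2_eq:
  "second_fundamental_form_norm2 \<A> F \<nu> p = (\<Sum>i\<in>UNIV. \<Sum>j\<in>UNIV. A i j p * A i j p)"
  unfolding second_fundamental_form_norm2_def
proof (rule the_equality)
  obtain f E u where "orthonormal_frame_at \<A> F p f E u" using frame_exists by blast
  then show "\<exists>f E u. orthonormal_frame_at \<A> F p f E u \<and> (\<Sum>i\<in>UNIV. \<Sum>j\<in>UNIV. A i j p * A i j p)
      = (\<Sum>i\<in>UNIV. \<Sum>j\<in>UNIV. (norm (normal_derivative F \<nu> f (E i) (E j) u))\<^sup>2)"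
    using frame_values(2)[symmetric] by blast
qed (auto simp: frame_values(2))

end

lemma expander_of_self_expander:
  fixes \<A> :: "('n::finite, 'p::{t2_space,second_countable_topology}) atlas" and F \<nu> :: "'p \<Rightarrow> real ^ 'm"
  assumes "self_expander \<A> F \<nu>"
  shows "expander \<A> F \<nu>"
proof -
  have *: "CARD('m) = CARD('n) + 1" "connected_manifold \<A>" "immersion \<A> F" "unit_normal_field \<A> F \<nu>"
    "\<And>p. mean_curvature \<A> F \<nu> p = - (1/2) * (F p \<bullet> \<nu> p)"
    using assms by (auto simp: self_expander_def)
  interpret hypersurface \<A> F \<nu> by (unfold_locales) (use * in auto)
  show ?thesis by unfold_locales (use *(5) mean_curvature_eq in simp)
qed

section \<open>The volume element\<close>

text \<open>The library's change of variables theorem needs a well-ordered index type; this type is such a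
  copy of an arbitrary finite index type.\<close>

typedef ('a::finite) ord_copy = "{..<CARD('a)} :: nat set"
  by (rule exI[of _ 0]) simp

instantiation ord_copy :: (finite) linorder
begin
definition less_eq_ord_copy :: "'a ord_copy \<Rightarrow> 'a ord_copy \<Rightarrow> bool" where
  "less_eq_ord_copy x y \<longleftrightarrow> Rep_ord_copy x \<le> Rep_ord_copy y"
definition less_ord_copy :: "'a ord_copy \<Rightarrow> 'a ord_copy \<Rightarrow> bool" where
  "less_ord_copy x y \<longleftrightarrow> Rep_ord_copy x < Rep_ord_copy y"
instance
  by standard (auto simp: less_eq_ord_copy_def less_ord_copy_def Rep_ord_copy_inject)
end

instance ord_copy :: (finite) wellorder
proof
  fix P :: "'a ord_copy \<Rightarrow> bool" and a :: "'a ord_copy"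
  assume step: "\<And>x. (\<And>y. y < x \<Longrightarrow> P y) \<Longrightarrow> P x"
  show "P a"
    by (induction a rule: measure_induct_rule[of Rep_ord_copy]) (auto intro: step simp: less_ord_copy_def)
qed

lemma card_ord_copy: "card (UNIV :: 'a::finite ord_copy set) = CARD('a)"
  using type_definition.card[OF type_definition_ord_copy] by simp

instance ord_copy :: (finite) finite
proof
  show "finite (UNIV :: 'a ord_copy set)"
    by (rule card_ge_0_finite) (simp add: card_ord_copy)
qed

lemma ord_copy_bij: obtains \<pi> :: "'a::finite ord_copy \<Rightarrow> 'a" where "bij \<pi>"
  using finite_same_card_bij[of "UNIV :: 'a ord_copy set" "UNIV :: 'a set"] card_ord_copy by auto

text \<open>Conjugation by a bijection carries transpositions to transpositions, so the parity of a
  permutation survives a change of the index type, as \<open>det_reindex\<close> requires.\<close>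

lemma swapidseq_conj:
  assumes "bij (\<pi> :: 'b \<Rightarrow> 'a)" "swapidseq n p"
  shows "swapidseq n (inv \<pi> \<circ> p \<circ> \<pi>)"
  using assms(2)
proof (induction rule: swapidseq.induct)
  case id
  have "inv \<pi> \<circ> id \<circ> \<pi> = id" using assms(1) by (auto simp: fun_eq_iff bij_is_inj)
  then show ?case using swapidseq.id by metis
next
  case (comp_Suc n p a b)
  have "inv \<pi> \<circ> (Transposition.transpose a b \<circ> p) \<circ> \<pi>
      = Transposition.transpose (inv \<pi> a) (inv \<pi> b) \<circ> (inv \<pi> \<circ> p \<circ> \<pi>)"
  proof
    fix x
    have "\<pi> (inv \<pi> y) = y" for y using assms(1) by (simp add: bij_is_surj surj_f_inv_f)
    then have "inv \<pi> y = inv \<pi> z \<longleftrightarrow> y = z" for y z by metis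
    then show "(inv \<pi> \<circ> (Transposition.transpose a b \<circ> p) \<circ> \<pi>) x
      = (Transposition.transpose (inv \<pi> a) (inv \<pi> b) \<circ> (inv \<pi> \<circ> p \<circ> \<pi>)) x"
      by (simp add: Transposition.transpose_def)
  qed
  moreover have "inv \<pi> a \<noteq> inv \<pi> b"
    using comp_Suc(2) assms(1) by (metis bij_inv_eq_iff)
  ultimately show ?case using comp_Suc by (metis swapidseq.comp_Suc)
qed

lemma sign_conj:
  assumes "bij (\<pi> :: 'b::finite \<Rightarrow> 'a::finite)" "p permutes UNIV"
  shows "sign (inv \<pi> \<circ> p \<circ> \<pi>) = sign p"
proof -
  obtain n where n: "swapidseq n p"
    using assms(2) permutation_permutes[of p] by (auto simp: permutation_def)
  have "evenperm (inv \<pi> \<circ> p \<circ> \<pi>) = even n"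
    by (rule evenperm_unique[OF swapidseq_conj[OF assms(1) n]]) simp
  moreover have "evenperm p = even n" by (rule evenperm_unique[OF n]) simp
  ultimately show ?thesis by (simp add: sign_def)
qed

lemma det_reindex:
  fixes \<pi> :: "'b::finite \<Rightarrow> 'a::finite" and M :: "real^'a^'a"
  assumes \<pi>: "bij \<pi>"
  shows "det (\<chi> i j. M $ \<pi> i $ \<pi> j) = det M"
proof -
  have inv: "\<pi> (inv \<pi> y) = y" "inv \<pi> (\<pi> x) = x" for x y
    using \<pi> by (auto simp: bij_is_surj surj_f_inv_f bij_is_inj)
  let ?c = "\<lambda>p. inv \<pi> \<circ> p \<circ> \<pi>"
  have perm: "?c p permutes UNIV" if "p permutes UNIV" for p
    using bij_comp[OF bij_comp[OF \<pi> permutes_bij[OF that]] bij_imp_bij_inv[OF \<pi>]]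
    by (intro bij_imp_permutes) (simp_all add: o_assoc)
  have "det (\<chi> i j. M $ \<pi> i $ \<pi> j) = (\<Sum>q\<in>{q. q permutes (UNIV::'b set)}. of_int (sign q) * (\<Prod>i\<in>UNIV. M $ \<pi> i $ \<pi> (q i)))"
    by (simp add: det_def)
  also have "\<dots> = (\<Sum>p\<in>{p. p permutes (UNIV::'a set)}. of_int (sign (?c p)) * (\<Prod>i\<in>UNIV. M $ \<pi> i $ \<pi> (?c p i)))"
  proof (rule sum.reindex_bij_witness[of _ ?c "\<lambda>q. \<pi> \<circ> q \<circ> inv \<pi>"])
    fix q assume "q \<in> {q. q permutes (UNIV::'b set)}"
    then show "\<pi> \<circ> q \<circ> inv \<pi> \<in> {p. p permutes (UNIV::'a set)}"
      using bij_comp[OF bij_comp[OF bij_imp_bij_inv[OF \<pi>] permutes_bij[of q]] \<pi>]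
      by (auto simp: o_assoc intro!: bij_imp_permutes)
    show "?c (\<pi> \<circ> q \<circ> inv \<pi>) = q" by (auto simp: inv fun_eq_iff)
    then show "of_int (sign (?c (\<pi> \<circ> q \<circ> inv \<pi>))) * (\<Prod>i\<in>UNIV. M $ \<pi> i $ \<pi> (?c (\<pi> \<circ> q \<circ> inv \<pi>) i))
       = of_int (sign q) * (\<Prod>i\<in>UNIV. M $ \<pi> i $ \<pi> (q i))" by simp
  next
    fix p assume "p \<in> {p. p permutes (UNIV::'a set)}"
    then show "?c p \<in> {q. q permutes (UNIV::'b set)}" using perm by simp
    show "\<pi> \<circ> ?c p \<circ> inv \<pi> = p" by (auto simp: inv fun_eq_iff)
  qed
  also have "\<dots> = (\<Sum>p\<in>{p. p permutes (UNIV::'a set)}. of_int (sign p) * (\<Prod>i\<in>UNIV. M $ i $ p i))"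
  proof (rule sum.cong[OF refl])
    fix p assume p: "p \<in> {p. p permutes (UNIV::'a set)}"
    have "(\<Prod>i\<in>UNIV. M $ \<pi> i $ \<pi> (?c p i)) = (\<Prod>i\<in>UNIV. M $ \<pi> i $ p (\<pi> i))" by (simp add: inv)
    also have "\<dots> = (\<Prod>i\<in>UNIV. M $ i $ p i)"
      using prod.reindex_bij_betw[of \<pi> UNIV UNIV "\<lambda>i. M $ i $ p i"] \<pi> by simp
    finally show "of_int (sign (?c p)) * (\<Prod>i\<in>UNIV. M $ \<pi> i $ \<pi> (?c p i))
       = of_int (sign p) * (\<Prod>i\<in>UNIV. M $ i $ p i)"
      using sign_conj[OF \<pi>] p by simp
  qed
  finally show ?thesis by (simp add: det_def)
qed

section \<open>Change of variables for arbitrary finite index types\<close>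

definition reindex :: "('b \<Rightarrow> 'a) \<Rightarrow> real^'a \<Rightarrow> real^'b" where
  "reindex \<pi> x = (\<chi> i. x $ \<pi> i)"

lemma linear_reindex: "linear (reindex \<pi>)"
  by (rule linearI) (simp_all add: reindex_def vec_eq_iff)

lemma bounded_linear_reindex:
  "bounded_linear (reindex (\<pi> :: 'b::finite \<Rightarrow> 'a::finite))"
  using linear_reindex linear_conv_bounded_linear by blast

lemma reindex_inverse:
  assumes "bij \<pi>" shows "reindex (inv \<pi>) (reindex \<pi> x) = x" "reindex \<pi> (reindex (inv \<pi>) y) = y"
  using assms by (simp_all add: reindex_def vec_eq_iff bij_is_surj surj_f_inv_f bij_is_inj)

lemma prod_Basis_cart: "(\<Prod>b\<in>Basis. (x::real^'a) \<bullet> b) = (\<Prod>j\<in>UNIV. x $ j)"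
proof -
  have "(Basis :: (real^'a) set) = range (\<lambda>j. axis j 1)" by (auto simp: Basis_vec_def)
  moreover have "inj (\<lambda>j. axis j 1 :: real^'a)" by (simp add: inj_on_def axis_eq_axis)
  ultimately have "(\<Prod>b\<in>Basis. x \<bullet> b) = (\<Prod>j\<in>UNIV. x \<bullet> axis j 1)"
    using prod.reindex[of "\<lambda>j. axis j (1::real)" UNIV "\<lambda>b. x \<bullet> b"] by (simp only: o_def)
  then show ?thesis by (simp only: inner_axis) simp
qed

text \<open>Permuting the coordinates maps boxes to boxes with the same product of side lengths, and
  boxes determine Lebesgue measure.\<close>

lemma lborel_reindex:
  fixes \<pi> :: "'b::finite \<Rightarrow> 'a::finite"
  assumes \<pi>: "bij \<pi>"
  shows "distr lborel borel (reindex \<pi>) = lborel"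
proof (rule lborel_eqI[symmetric])
  have m: "reindex \<pi> \<in> borel \<rightarrow>\<^sub>M borel"
    by (intro borel_measurable_continuous_onI linear_continuous_on bounded_linear_reindex)
  fix l u :: "real^'b" assume le: "\<And>b. b \<in> Basis \<Longrightarrow> l \<bullet> b \<le> u \<bullet> b"
  have le': "l $ i \<le> u $ i" for i using le[of "axis i 1"] by (simp add: inner_axis)
  have ip: "\<pi> (inv \<pi> y) = y" "inv \<pi> (\<pi> x) = x" for x y
    using \<pi> by (auto simp: bij_is_surj surj_f_inv_f bij_is_inj)
  have "reindex \<pi> -` box l u = box (reindex (inv \<pi>) l) (reindex (inv \<pi>) u)"
    by (auto simp: reindex_def mem_box_cart) (metis ip)+
  then have "emeasure (distr lborel borel (reindex \<pi>)) (box l u)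
      = emeasure lborel (box (reindex (inv \<pi>) l) (reindex (inv \<pi>) u))"
    using m by (simp add: emeasure_distr)
  also have "\<dots> = ennreal (\<Prod>b\<in>Basis. (reindex (inv \<pi>) u - reindex (inv \<pi>) l) \<bullet> b)"
    using le' by (intro emeasure_lborel_box) (auto simp: Basis_vec_def inner_axis reindex_def)
  also have "(\<Prod>b\<in>Basis. (reindex (inv \<pi>) u - reindex (inv \<pi>) l) \<bullet> b) = (\<Prod>j\<in>UNIV. u $ inv \<pi> j - l $ inv \<pi> j)"
    by (simp add: prod_Basis_cart reindex_def del: inner_diff_left)
  also have "\<dots> = (\<Prod>i\<in>UNIV. u $ i - l $ i)"
    using prod.reindex_bij_betw[of "inv \<pi>" UNIV UNIV "\<lambda>i. u $ i - l $ i"] bij_imp_bij_inv[OF \<pi>] by simp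
  also have "\<dots> = (\<Prod>b\<in>Basis. (u - l) \<bullet> b)"
    by (simp add: prod_Basis_cart del: inner_diff_left)
  finally show "emeasure (distr lborel borel (reindex \<pi>)) (box l u) = ennreal (\<Prod>b\<in>Basis. (u - l) \<bullet> b)" .
qed simp

lemma emeasure_image_wellorder:
  fixes \<phi> :: "real^'n::{finite,wellorder} \<Rightarrow> real^'n::_"
  assumes S: "S \<in> sets borel" and d: "\<And>x. x \<in> S \<Longrightarrow> (\<phi> has_derivative \<phi>' x) (at x)"
    and inj: "inj_on \<phi> S" and img: "\<phi> ` S \<in> sets borel"
    and meas: "(\<lambda>x. indicator S x * \<bar>det (matrix (\<phi>' x))\<bar>) \<in> borel_measurable borel"
  shows "emeasure lborel (\<phi> ` S) = (\<integral>\<^sup>+x\<in>S. ennreal \<bar>det (matrix (\<phi>' x))\<bar> \<partial>lborel)"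
proof -
  let ?J = "\<lambda>x. \<bar>det (matrix (\<phi>' x))\<bar>"
  have SL: "S \<in> sets lebesgue" using S by simp
  have dw: "(\<phi> has_derivative \<phi>' x) (at x within S)" if "x \<in> S" for x
    using d[OF that] by (rule has_derivative_at_withinI)
  note main = has_measure_differentiable_image[OF SL dw inj]
  have eme: "emeasure lebesgue (\<phi> ` S) = emeasure lborel (\<phi> ` S)" using img by simp
  show ?thesis
  proof (cases "emeasure lborel (\<phi> ` S) < \<infinity>")
    case True
    then have lm: "\<phi> ` S \<in> lmeasurable" using img eme by (simp add: fmeasurable_def)
    then have "(?J has_integral measure lebesgue (\<phi> ` S)) S" using main by blast
    then have "(\<integral>\<^sup>+x\<in>S. ennreal (?J x) \<partial>lborel) = ennreal (measure lebesgue (\<phi> ` S))"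
      by (intro nn_integral_has_integral_lebesgue') auto
    then show ?thesis using emeasure_eq_ennreal_measure[of lborel "\<phi> ` S"] True img by simp
  next
    \<comment> \<open>Finiteness of the integral would make the Jacobian integrable and the image of
      finite measure; so both sides are infinite together.\<close>
    case False
    have "\<not> (\<integral>\<^sup>+x\<in>S. ennreal (?J x) \<partial>lborel) < \<infinity>"
    proof
      assume fin: "(\<integral>\<^sup>+x\<in>S. ennreal (?J x) \<partial>lborel) < \<infinity>"
      have "(\<integral>\<^sup>+x. ennreal (indicator S x * ?J x) \<partial>lborel) < \<infinity>"
        using fin by (simp add: ennreal_mult'' ennreal_indicator mult.commute)
      then have "(\<lambda>x. indicator S x * ?J x) integrable_on UNIV"
        by (intro nn_integral_integrable_on meas) auto
      then have "?J integrable_on S"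
        by (simp add: indicator_def of_bool_def if_distrib[of "\<lambda>x. x * _"] integrable_restrict_UNIV cong: if_cong)
      then obtain m where "(?J has_integral m) S" by blast
      then have "\<phi> ` S \<in> lmeasurable" using main by blast
      then show False using False eme by (simp add: fmeasurable_def)
    qed
    then show ?thesis using False by (simp add: not_less top_unique)
  qed
qed

lemma matrix_reindex:
  fixes \<pi> :: "'b::finite \<Rightarrow> 'a::finite" and L :: "real^'a \<Rightarrow> real^'a"
  assumes "bij \<pi>"
  shows "matrix (\<lambda>y. reindex \<pi> (L (reindex (inv \<pi>) y))) = (\<chi> i j. matrix L $ \<pi> i $ \<pi> j)"
proof -
  have "reindex (inv \<pi>) (axis j 1) = axis (\<pi> j) (1::real)" for j
    using assms by (auto simp: reindex_def axis_def vec_eq_iff bij_inv_eq_iff[symmetric] bij_is_inj bij_is_surj surj_f_inv_f)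
  then show ?thesis by (simp add: matrix_def reindex_def vec_eq_iff)
qed

text \<open>Conjugation with \<open>reindex\<close> reduces to the well-ordered copy of the index
  type; neither the measure nor the Jacobian determinant changes.\<close>

lemma emeasure_differentiable_image:
  fixes \<phi> :: "real^'n::finite \<Rightarrow> real^'n"
  assumes S: "S \<in> sets borel" and d: "\<And>x. x \<in> S \<Longrightarrow> (\<phi> has_derivative \<phi>' x) (at x)"
    and inj: "inj_on \<phi> S" and img: "\<phi> ` S \<in> sets borel"
    and meas: "(\<lambda>x. indicator S x * \<bar>det (matrix (\<phi>' x))\<bar>) \<in> borel_measurable borel"
  shows "emeasure lborel (\<phi> ` S) = (\<integral>\<^sup>+x\<in>S. ennreal \<bar>det (matrix (\<phi>' x))\<bar> \<partial>lborel)"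
proof -
  obtain \<pi> :: "'n ord_copy \<Rightarrow> 'n" where \<pi>: "bij \<pi>" by (rule ord_copy_bij)
  let ?R = "reindex \<pi>" and ?R' = "reindex (inv \<pi>)"
  note inv [simp] = reindex_inverse[OF \<pi>]
  have mR: "?R \<in> borel \<rightarrow>\<^sub>M borel" and mR': "?R' \<in> borel \<rightarrow>\<^sub>M borel"
    by (intro borel_measurable_continuous_onI linear_continuous_on bounded_linear_reindex)+
  have img_R: "?R ` B = ?R' -` B" for B
    by (auto intro: image_eqI[of _ _ "?R' _"])
  have borel_img: "?R ` B \<in> sets borel" if "B \<in> sets borel" for B
    unfolding img_R using measurable_sets_borel[OF mR' that] .
  have em: "emeasure lborel (?R ` B) = emeasure lborel B" if "B \<in> sets borel" for B
  proof -
    have "emeasure lborel (?R ` B) = emeasure (distr lborel borel ?R) (?R ` B)" by (simp add: lborel_reindex[OF \<pi>])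
    also have "\<dots> = emeasure lborel (?R -` (?R ` B))"
      using mR borel_img[OF that] by (simp add: emeasure_distr)
    also have "?R -` (?R ` B) = B" unfolding img_R by auto
    finally show ?thesis .
  qed
  define \<psi> where "\<psi> y = ?R (\<phi> (?R' y))" for y
  define \<psi>' where "\<psi>' y = (\<lambda>v. ?R (\<phi>' (?R' y) (?R' v)))" for y
  have det: "det (matrix (\<psi>' y)) = det (matrix (\<phi>' (?R' y)))" for y
    unfolding \<psi>'_def matrix_reindex[OF \<pi>] by (rule det_reindex[OF \<pi>])
  have \<psi>_img: "\<psi> ` (?R ` S) = ?R ` (\<phi> ` S)" by (simp add: \<psi>_def image_image)
  have "emeasure lborel (\<psi> ` (?R ` S)) = (\<integral>\<^sup>+y\<in>?R ` S. ennreal \<bar>det (matrix (\<psi>' y))\<bar> \<partial>lborel)"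
  proof (rule emeasure_image_wellorder)
    show "?R ` S \<in> sets borel" by (rule borel_img[OF S])
    show "\<psi> ` (?R ` S) \<in> sets borel" unfolding \<psi>_img by (rule borel_img[OF img])
    show "(\<psi> has_derivative \<psi>' y) (at y)" if y: "y \<in> ?R ` S" for y
    proof -
      have yS: "?R' y \<in> S" using y by auto
      have "(?R' has_derivative ?R') (at y)"
        by (rule bounded_linear_imp_has_derivative[OF bounded_linear_reindex])
      from has_derivative_compose[OF this d[OF yS]]
      show ?thesis unfolding \<psi>_def \<psi>'_def
        by (rule bounded_linear.has_derivative[OF bounded_linear_reindex])
    qed
    show "inj_on \<psi> (?R ` S)"
    proof (rule inj_onI)
      fix y y' assume *: "y \<in> ?R ` S" "y' \<in> ?R ` S" "\<psi> y = \<psi> y'"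
      then have "?R' (\<psi> y) = ?R' (\<psi> y')" by simp
      then have "\<phi> (?R' y) = \<phi> (?R' y')" by (simp add: \<psi>_def)
      then have "?R' y = ?R' y'" using inj * by (auto dest: inj_onD)
      then have "?R (?R' y) = ?R (?R' y')" by (rule arg_cong)
      then show "y = y'" by simp
    qed
    have "(\<lambda>y. indicator (?R ` S) y * \<bar>det (matrix (\<psi>' y))\<bar>)
        = (\<lambda>y. indicator S (?R' y) * \<bar>det (matrix (\<phi>' (?R' y)))\<bar>)"
      unfolding det img_R by (auto simp: indicator_def)
    then show "(\<lambda>y. indicator (?R ` S) y * \<bar>det (matrix (\<psi>' y))\<bar>) \<in> borel_measurable borel"
      using measurable_compose[OF mR' meas] by simp
  qed
  also have "\<dots> = (\<integral>\<^sup>+y. ennreal (indicator S (?R' y) * \<bar>det (matrix (\<phi>' (?R' y)))\<bar>) \<partial>distr lborel borel ?R)"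
    unfolding lborel_reindex[OF \<pi>] img_R det by (intro nn_integral_cong) (auto simp: indicator_def)
  also have "\<dots> = (\<integral>\<^sup>+x. ennreal (indicator S x * \<bar>det (matrix (\<phi>' x))\<bar>) \<partial>lborel)"
  proof -
    have "(\<lambda>y. ennreal (indicator S (?R' y) * \<bar>det (matrix (\<phi>' (?R' y)))\<bar>)) \<in> borel_measurable borel"
      using measurable_compose[OF mR' meas] by measurable
    then show ?thesis using mR by (subst nn_integral_distr) auto
  qed
  also have "\<dots> = (\<integral>\<^sup>+x\<in>S. ennreal \<bar>det (matrix (\<phi>' x))\<bar> \<partial>lborel)"
    by (intro nn_integral_cong) (auto simp: indicator_def)
  finally show ?thesis unfolding \<psi>_img em[OF img] .
qed

text \<open>The push-forward of the Jacobian density and the restriction of Lebesgue measure to the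
  image agree on Borel sets, hence as measures, hence on all nonnegative integrands. Multiplying
  \<open>\<phi>\<close> by the indicator of \<open>D\<close> makes it Borel on the whole
  space.\<close>

lemma nn_integral_change_of_variables:
  fixes \<phi> :: "real^'n::finite \<Rightarrow> real^'n"
  assumes D: "open D" and d: "\<And>x. x \<in> D \<Longrightarrow> (\<phi> has_derivative \<phi>' x) (at x)"
    and inj: "inj_on \<phi> D" and img: "\<And>B. B \<in> sets borel \<Longrightarrow> B \<subseteq> D \<Longrightarrow> \<phi> ` B \<in> sets borel"
    and meas: "continuous_on D (\<lambda>x. det (matrix (\<phi>' x)))"
    and G: "G \<in> borel_measurable borel"
  shows "(\<integral>\<^sup>+y\<in>\<phi> ` D. G y \<partial>lborel) = (\<integral>\<^sup>+x\<in>D. G (\<phi> x) * ennreal \<bar>det (matrix (\<phi>' x))\<bar> \<partial>lborel)"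
proof -
  let ?J = "\<lambda>x. ennreal \<bar>det (matrix (\<phi>' x))\<bar> * indicator D x"
  have DB: "D \<in> sets borel" using D by simp
  define \<phi>0 where "\<phi>0 x = indicator D x *\<^sub>R \<phi> x" for x
  have "continuous_on D \<phi>" using d by (meson continuous_at_imp_continuous_on has_derivative_continuous)
  then have m\<phi>: "\<phi>0 \<in> borel \<rightarrow>\<^sub>M borel"
    unfolding \<phi>0_def by (rule borel_measurable_continuous_on_indicator[OF DB])
  have mJr: "(\<lambda>x. indicator D x * \<bar>det (matrix (\<phi>' x))\<bar>) \<in> borel_measurable borel"
    using borel_measurable_continuous_on_indicator[OF DB continuous_on_rabs[OF meas]] by simp
  have mJ: "?J \<in> borel_measurable borel"
  proof -
    have "?J = (\<lambda>x. ennreal (indicator D x * \<bar>det (matrix (\<phi>' x))\<bar>))" by (auto simp: indicator_def)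
    then show ?thesis using mJr by simp
  qed
  have \<phi>D: "\<phi> ` D \<in> sets borel" by (rule img[OF DB order_refl])
  have eq: "distr (density lborel ?J) borel \<phi>0 = density lborel (indicator (\<phi> ` D))"
  proof (rule measure_eqI)
    fix B assume "B \<in> sets (distr (density lborel ?J) borel \<phi>0)"
    then have B: "B \<in> sets borel" by simp
    have pre: "\<phi>0 -` B \<in> sets borel" using measurable_sets_borel[OF m\<phi> B] .
    let ?S = "D \<inter> \<phi>0 -` B"
    have S: "?S \<in> sets borel" using DB pre by auto
    have "emeasure (distr (density lborel ?J) borel \<phi>0) B = (\<integral>\<^sup>+x. ?J x * indicator (\<phi>0 -` B) x \<partial>lborel)"
      using m\<phi> B pre mJ by (simp add: emeasure_distr emeasure_density)
    also have "\<dots> = (\<integral>\<^sup>+x\<in>?S. ennreal \<bar>det (matrix (\<phi>' x))\<bar> \<partial>lborel)"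
      by (intro nn_integral_cong) (auto simp: indicator_def)
    also have "\<dots> = emeasure lborel (\<phi> ` ?S)"
    proof (rule emeasure_differentiable_image[symmetric])
      show "(\<phi> has_derivative \<phi>' x) (at x)" if "x \<in> ?S" for x using d that by blast
      show "inj_on \<phi> ?S" using inj by (rule inj_on_subset) auto
      show "\<phi> ` ?S \<in> sets borel" by (rule img[OF S]) auto
      have "(\<lambda>x. indicator ?S x * \<bar>det (matrix (\<phi>' x))\<bar>) = (\<lambda>x. indicator (\<phi>0 -` B) x * (indicator D x * \<bar>det (matrix (\<phi>' x))\<bar>))"
        by (auto simp: indicator_def)
      then show "(\<lambda>x. indicator ?S x * \<bar>det (matrix (\<phi>' x))\<bar>) \<in> borel_measurable borel"
        using borel_measurable_times[OF borel_measurable_indicator[of "\<phi>0 -` B" borel] mJr] pre by simp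
    qed (rule S)
    also have "\<phi> ` ?S = \<phi> ` D \<inter> B" by (auto simp: \<phi>0_def)
    also have "emeasure lborel (\<phi> ` D \<inter> B) = emeasure (density lborel (indicator (\<phi> ` D))) B"
      using \<phi>D B by (simp add: emeasure_density indicator_inter_arith[symmetric])
    finally show "emeasure (distr (density lborel ?J) borel \<phi>0) B = emeasure (density lborel (indicator (\<phi> ` D))) B" .
  qed simp
  have "(\<integral>\<^sup>+y\<in>\<phi> ` D. G y \<partial>lborel) = (\<integral>\<^sup>+y. G y \<partial>density lborel (indicator (\<phi> ` D)))"
    using \<phi>D G by (subst nn_integral_density) (auto simp: mult.commute)
  also have "\<dots> = (\<integral>\<^sup>+x. ?J x * G (\<phi>0 x) \<partial>lborel)"
    unfolding eq[symmetric] using m\<phi> G mJ by (subst nn_integral_distr, simp, simp) (subst nn_integral_density, auto)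
  also have "\<dots> = (\<integral>\<^sup>+x\<in>D. G (\<phi> x) * ennreal \<bar>det (matrix (\<phi>' x))\<bar> \<partial>lborel)"
    by (intro nn_integral_cong) (auto simp: indicator_def \<phi>0_def mult.commute)
  finally show ?thesis .
qed

context hypersurface
begin

section \<open>The volume density and its behaviour under a change of chart\<close>

definition vol :: "(real^'n \<Rightarrow> 'p) \<Rightarrow> real^'n \<Rightarrow> real" where
  "vol f w = sqrt (det (induced_metric F f w))"

lemma metric_mult_vec:
  assumes "(V, f) \<in> \<A>" "w \<in> V"
  shows "x \<bullet> (induced_metric F f w *v x) = dF f w x \<bullet> dF f w x"
proof -
  note L = dF_linear[OF assms]
  have "dF f w x \<bullet> dF f w x = (\<Sum>i\<in>UNIV. x $ i *\<^sub>R dF f w (axis i 1)) \<bullet> (\<Sum>j\<in>UNIV. x $ j *\<^sub>R dF f w (axis j 1))"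
    using linear_eq_sum_axis[OF L, of x] by simp
  also have "\<dots> = x \<bullet> (induced_metric F f w *v x)"
    by (simp add: inner_sum_left inner_sum_right induced_metric_def matrix_vector_mult_def inner_vec_def[of x] sum_distrib_left mult_ac inner_commute)
  finally show ?thesis by simp
qed

text \<open>The determinant does not vanish along the segment from the identity to the metric.\<close>

lemma metric_det_pos:
  assumes f: "(V, f) \<in> \<A>" "w \<in> V" shows "det (induced_metric F f w) > 0"
proof (rule ccontr)
  let ?G = "induced_metric F f w"
  define M where "M t = (1 - t) *\<^sub>R mat 1 + t *\<^sub>R ?G" for t :: real
  have Mv: "M t *v x = (1 - t) *\<^sub>R x + t *\<^sub>R (?G *v x)" for t x
    by (simp add: M_def matrix_vector_mult_add_rdistrib scaleR_matrix_vector_assoc[symmetric])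
  have nz: "det (M t) \<noteq> 0" if t: "0 \<le> t" "t \<le> 1" for t
  proof -
    have "x = 0" if "M t *v x = 0" for x
    proof (rule ccontr)
      assume x: "x \<noteq> 0"
      have "x \<bullet> (M t *v x) = (1 - t) * (x \<bullet> x) + t * (dF f w x \<bullet> dF f w x)"
        by (simp add: Mv inner_add_right metric_mult_vec[OF f])
      moreover have "dF f w x \<noteq> 0" using x dF_inj[OF f] linear_0[OF dF_linear[OF f]] by (metis injD)
      ultimately have "(1 - t) * (x \<bullet> x) + t * (dF f w x \<bullet> dF f w x) = 0" "x \<bullet> x > 0" "dF f w x \<bullet> dF f w x > 0"
        using that x by auto
      then show False using t
        by (cases "t = 0") (auto simp: add_nonneg_eq_0_iff less_imp_le)
    qed
    then show ?thesis
      by (metis invertible_det_nz invertible_left_inverse matrix_left_invertible_ker)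
  qed
  assume "\<not> det ?G > 0"
  then have "det (M 1) \<le> 0" by (simp add: M_def)
  moreover have "det (M 0) = 1" by (simp add: M_def)
  moreover have "continuous_on {0..1} (\<lambda>t. det (M t))"
    unfolding det_def M_def by (intro continuous_intros)
  ultimately obtain t where "0 \<le> t" "t \<le> 1" "det (M t) = 0"
    using IVT2'[of "\<lambda>t. det (M t)" 1 0 0] by auto
  then show False using nz by blast
qed

lemma vol_pos: "(V, f) \<in> \<A> \<Longrightarrow> w \<in> V \<Longrightarrow> vol f w > 0"
  using metric_det_pos by (simp add: vol_def)

lemma vol_smooth: "(V, f) \<in> \<A> \<Longrightarrow> Ck_on k V (vol f)"
  unfolding vol_def[abs_def]
  by (intro Ck_on_sqrt_comp Ck_on_det metric_smooth metric_det_pos chart_open)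

lemma dF_transition:
  assumes f: "(V, f) \<in> \<A>" and g: "(W, g) \<in> \<A>" and z: "z \<in> W" "g z \<in> f ` V"
  defines "\<psi> \<equiv> inv_into V f \<circ> g"
  shows "dF g z a = dF f (\<psi> z) (frechet_derivative \<psi> (at z) a)"
proof -
  define D where "D = W \<inter> g -` (f ` V)"
  note tr = transition[OF f g, folded D_def \<psi>_def]
  have zD: "z \<in> D" using z by (simp add: D_def)
  have d\<psi>: "\<psi> differentiable at z" using Ck_on_imp_differentiable[OF tr(2) zD] .
  have "dF g z a = frechet_derivative ((F \<circ> f) \<circ> \<psi>) (at z) a"
    by (rule frechet_derivative_cong_open[OF tr(1) zD, THEN fun_cong]) (simp add: tr)
  also have "\<dots> = dF f (\<psi> z) (frechet_derivative \<psi> (at z) a)"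
    using frechet_derivative_compose'[OF d\<psi>, of "F \<circ> f" a] dF_has_derivative[OF f tr(3)[OF zD]]
    by (auto simp: differentiable_def)
  finally show ?thesis .
qed

text \<open>The Gram matrix transforms by congruence with the Jacobian matrix of the transition map,
  so its determinant acquires the square of the Jacobian.\<close>

lemma vol_transition:
  assumes f: "(V, f) \<in> \<A>" and g: "(W, g) \<in> \<A>" and z: "z \<in> W" "g z \<in> f ` V"
  defines "\<psi> \<equiv> inv_into V f \<circ> g"
  shows "vol g z = \<bar>det (matrix (frechet_derivative \<psi> (at z)))\<bar> * vol f (\<psi> z)"
proof -
  define D where "D = W \<inter> g -` (f ` V)"
  note tr = transition[OF f g, folded D_def \<psi>_def]
  have zD: "z \<in> D" using z by (simp add: D_def)
  let ?M = "matrix (frechet_derivative \<psi> (at z))" and ?G = "induced_metric F f (\<psi> z)"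
  note L = dF_linear[OF f tr(3)[OF zD]]
  have "induced_metric F g z = transpose ?M ** ?G ** ?M"
  proof -
    have "induced_metric F g z $ i $ j = (transpose ?M ** ?G ** ?M) $ i $ j" for i j
    proof -
      have "dF g z (axis i 1) = (\<Sum>a\<in>UNIV. ?M $ a $ i *\<^sub>R dF f (\<psi> z) (axis a 1))" for i
        unfolding dF_transition[OF f g z, folded \<psi>_def]
        by (subst linear_eq_sum_axis[OF L]) (simp add: matrix_def)
      then have "induced_metric F g z $ i $ j
        = (\<Sum>a\<in>UNIV. \<Sum>b\<in>UNIV. ?M $ a $ i * (?M $ b $ j * ?G $ a $ b))"
        by (simp only: induced_metric_def vec_lambda_beta inner_sum_left inner_sum_right inner_scaleR_left inner_scaleR_right sum_distrib_left)
          (subst sum.swap, simp add: mult.left_commute)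
      also have "\<dots> = (\<Sum>b\<in>UNIV. \<Sum>a\<in>UNIV. ?M $ a $ i * (?M $ b $ j * ?G $ a $ b))" by (rule sum.swap)
      also have "\<dots> = (transpose ?M ** ?G ** ?M) $ i $ j"
        by (simp add: matrix_matrix_mult_def transpose_def sum_distrib_left sum_distrib_right mult_ac)
      finally show ?thesis .
    qed
    then show ?thesis by (simp add: vec_eq_iff)
  qed
  then have "det (induced_metric F g z) = (det ?M)\<^sup>2 * det ?G"
    by (simp add: det_mul det_transpose power2_eq_square)
  then show ?thesis by (simp add: vol_def real_sqrt_mult)
qed

text \<open>The parametrization made constant off its domain, so that it can be treated as a Borel
  map on the whole parameter space.\<close>

definition chart_map :: "(real^'n) set \<Rightarrow> (real^'n \<Rightarrow> 'p) \<Rightarrow> real^'n \<Rightarrow> 'p" where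
  "chart_map V f w = (if w \<in> V then f w else undefined)"

lemma borel_measurable_if_open:
  fixes f :: "'a::topological_space \<Rightarrow> 'b::topological_space"
  assumes "open V" "continuous_on V f"
  shows "(\<lambda>x. if x \<in> V then f x else c) \<in> borel \<rightarrow>\<^sub>M borel"
proof (rule borel_measurableI)
  fix T :: "'b set" assume "open T"
  then have "open (V \<inter> f -` T)" by (rule continuous_open_preimage[OF assms(2,1)])
  moreover have "(\<lambda>x. if x \<in> V then f x else c) -` T \<inter> space borel = (V \<inter> f -` T) \<union> (if c \<in> T then - V else {})"
    by (auto split: if_splits)
  ultimately show "(\<lambda>x. if x \<in> V then f x else c) -` T \<inter> space borel \<in> sets borel"
    using assms(1) by auto
qed

lemma chart_map_measurable: "(V, f) \<in> \<A> \<Longrightarrow> chart_map V f \<in> borel \<rightarrow>\<^sub>M borel"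
  unfolding chart_map_def[abs_def] by (intro borel_measurable_if_open chart_open chart_cont)

lemma chart_image_borel:
  assumes f: "(V, f) \<in> \<A>" and S: "S \<in> sets borel" "S \<subseteq> V"
  shows "f ` S \<in> sets borel"
proof -
  let ?g = "\<lambda>p. if p \<in> f ` V then inv_into V f p else undefined"
  have "?g \<in> borel \<rightarrow>\<^sub>M borel"
    by (intro borel_measurable_if_open chart_open_image[OF f] chart_inv_cont[OF f])
  then have "?g -` S \<in> sets borel" using S(1) by (rule measurable_sets_borel)
  moreover have "f ` S = f ` V \<inter> ?g -` S"
    using S(2) inv_into_f_f[OF chart_inj[OF f]] by (auto simp: subset_iff intro: image_eqI)
  ultimately show ?thesis using chart_open_image[OF f] by auto
qed

lemma vol_indicator_measurable: "(V, f) \<in> \<A> \<Longrightarrow> (\<lambda>w. indicator V w * vol f w) \<in> borel_measurable borel"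
  using borel_measurable_continuous_on_indicator[OF _ Ck_on_imp_continuous_on[OF vol_smooth]] chart_open by auto

text \<open>Two charts measure a common piece equally: the Jacobian of the change of variables is
  the factor in \<open>vol_transition\<close>. This is the consistency behind the existence of the
  volume.\<close>

lemma vol_integral_transition:
  assumes f: "(V, f) \<in> \<A>" and g: "(W, g) \<in> \<A>" and S: "S \<in> sets borel" "S \<subseteq> V" "f ` S \<subseteq> g ` W"
  shows "(\<integral>\<^sup>+z\<in>{z\<in>W. g z \<in> f ` S}. ennreal (vol g z) \<partial>lborel) = (\<integral>\<^sup>+w\<in>S. ennreal (vol f w) \<partial>lborel)"
proof -
  define D \<psi> where "D = W \<inter> g -` (f ` V)" and "\<psi> = inv_into V f \<circ> g"
  note tr = transition[OF f g, folded D_def \<psi>_def]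
  have \<psi>_img: "\<psi> ` B = V \<inter> f -` (g ` B)" if "B \<subseteq> D" for B
  proof (intro equalityI subsetI)
    fix w assume "w \<in> \<psi> ` B"
    then show "w \<in> V \<inter> f -` (g ` B)" using that tr(3,4) by fastforce
  next
    fix w assume "w \<in> V \<inter> f -` (g ` B)"
    then obtain z where z: "w \<in> V" "z \<in> B" "f w = g z" by auto
    then have "\<psi> z = w" using inv_into_f_f[OF chart_inj[OF f] z(1)] by (simp add: \<psi>_def)
    then show "w \<in> \<psi> ` B" using z(2) by blast
  qed
  let ?G = "\<lambda>w. ennreal (indicator V w * vol f w) * indicator S w"
  have "(\<integral>\<^sup>+w\<in>\<psi> ` D. ?G w \<partial>lborel)
    = (\<integral>\<^sup>+z\<in>D. ?G (\<psi> z) * ennreal \<bar>det (matrix (frechet_derivative \<psi> (at z)))\<bar> \<partial>lborel)"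
  proof (rule nn_integral_change_of_variables)
    show "open D" by (rule tr(1))
    show "(\<psi> has_derivative frechet_derivative \<psi> (at x)) (at x)" if "x \<in> D" for x
      using Ck_on_has_derivative[OF tr(2) that] .
    show "inj_on \<psi> D"
    proof (rule inj_onI)
      fix x y assume *: "x \<in> D" "y \<in> D" "\<psi> x = \<psi> y"
      have "g x = g y"
        using tr(4)[OF *(1)] tr(4)[OF *(2)] unfolding *(3) by (rule trans[OF sym])
      moreover have "x \<in> W" "y \<in> W" using *(1,2) unfolding D_def by blast+
      ultimately show "x = y" by (rule inj_onD[OF chart_inj[OF g]])
    qed
    show "\<psi> ` B \<in> sets borel" if "B \<in> sets borel" "B \<subseteq> D" for B
    proof -
      have "g ` B \<in> sets borel" by (rule chart_image_borel[OF g that(1)]) (use that(2) in \<open>auto simp: D_def\<close>)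
      then have "chart_map V f -` (g ` B) \<in> sets borel" by (rule measurable_sets_borel[OF chart_map_measurable[OF f]])
      moreover have "V \<inter> f -` (g ` B) = V \<inter> chart_map V f -` (g ` B)" by (auto simp: chart_map_def)
      ultimately show ?thesis unfolding \<psi>_img[OF that(2)] using chart_open[OF f] by auto
    qed
    show "continuous_on D (\<lambda>x. det (matrix (frechet_derivative \<psi> (at x))))"
    proof (rule Ck_on_imp_continuous_on[of 0], rule Ck_on_det[OF tr(1)])
      fix i j
      have "Ck_on 0 D (\<lambda>x. frechet_derivative \<psi> (at x) (axis j 1))" using tr(2)[of "Suc 0"] by simp
      then show "Ck_on 0 D (\<lambda>x. matrix (frechet_derivative \<psi> (at x)) $ i $ j)"
        unfolding matrix_def by (simp add: Ck_on_vec_nth[OF tr(1)] del: Ck_on.simps)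
    qed
    show "?G \<in> borel_measurable borel"
      using vol_indicator_measurable[OF f] S(1) by measurable
  qed
  moreover have "(\<integral>\<^sup>+w\<in>\<psi> ` D. ?G w \<partial>lborel) = (\<integral>\<^sup>+w\<in>S. ennreal (vol f w) \<partial>lborel)"
  proof (intro nn_integral_cong)
    fix w
    have "w \<in> \<psi> ` D" if w: "w \<in> S"
    proof -
      have "w \<in> V" using S(2) w by blast
      obtain z where z: "z \<in> W" "f w = g z" using S(3) w by blast
      then have "z \<in> D" unfolding D_def using \<open>w \<in> V\<close> by (auto intro: rev_image_eqI[of w])
      then have "w \<in> V \<inter> f -` (g ` D)" using z \<open>w \<in> V\<close> by auto
      then show ?thesis using \<psi>_img[of D] by simp
    qed
    then show "?G w * indicator (\<psi> ` D) w = ennreal (vol f w) * indicator S w"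
      using S(2) by (auto simp: indicator_def)
  qed
  moreover have "(\<integral>\<^sup>+z\<in>D. ?G (\<psi> z) * ennreal \<bar>det (matrix (frechet_derivative \<psi> (at z)))\<bar> \<partial>lborel)
      = (\<integral>\<^sup>+z\<in>{z\<in>W. g z \<in> f ` S}. ennreal (vol g z) \<partial>lborel)"
  proof (intro nn_integral_cong)
    fix z
    show "?G (\<psi> z) * ennreal \<bar>det (matrix (frechet_derivative \<psi> (at z)))\<bar> * indicator D z
        = ennreal (vol g z) * indicator {z \<in> W. g z \<in> f ` S} z"
    proof (cases "z \<in> D")
      case True
      then have zz: "z \<in> W" "g z \<in> f ` V" by (auto simp: D_def)
      have iff: "\<psi> z \<in> S \<longleftrightarrow> g z \<in> f ` S"
        using inj_on_image_mem_iff[OF chart_inj[OF f] tr(3)[OF True] S(2)] tr(4)[OF True] by simp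
      have "ennreal (vol g z) = ennreal (vol f (\<psi> z)) * ennreal \<bar>det (matrix (frechet_derivative \<psi> (at z)))\<bar>"
        unfolding vol_transition[OF f g zz, folded \<psi>_def] by (subst mult.commute) (simp add: ennreal_mult'')
      then show ?thesis
        using iff tr(3)[OF True] zz(1) True by (simp add: indicator_def)
    next
      case False
      then show ?thesis using S(2) by (auto simp: indicator_def D_def)
    qed
  qed
  ultimately show ?thesis by simp
qed

text \<open>The Lindelof property of a second countable space; countability allows the pieces of the
  manifold to be summed as measures.\<close>

lemma countable_atlas:
  obtains V :: "nat \<Rightarrow> (real^'n) set" and f :: "nat \<Rightarrow> real^'n \<Rightarrow> 'p"
  where "\<And>k. (V k, f k) \<in> \<A>" "(\<Union>k. f k ` V k) = UNIV"
proof -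
  let ?F = "(\<lambda>(V, f). f ` V) ` \<A>"
  have "\<And>S. S \<in> ?F \<Longrightarrow> openin (top_of_set UNIV) S" using chart_open_image by auto
  then obtain F' where F': "F' \<subseteq> ?F" "countable F'" "\<Union>F' = \<Union>?F" by (rule Lindelof_openin)
  have cov: "\<Union>F' = UNIV" using F'(3) manifold by (simp add: connected_manifold_def smooth_atlas_def)
  then have ne: "F' \<noteq> {}" by auto
  define c where "c = from_nat_into F'"
  have "c k \<in> ?F" for k using from_nat_into[OF ne] F'(1) by (auto simp: c_def)
  then have "\<exists>V f. (V, f) \<in> \<A> \<and> c k = f ` V" for k by fastforce
  then obtain V f where *: "\<And>k. (V k, f k) \<in> \<A>" "\<And>k. c k = f k ` V k" by metis
  have "(\<Union>k. f k ` V k) = \<Union>F'"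
    using range_from_nat_into[OF ne F'(2)] by (simp add: *(2)[symmetric] c_def)
  then show ?thesis using that[of V f] *(1) cov by simp
qed

definition is_volume :: "'p measure \<Rightarrow> bool" where
  "is_volume \<sigma> \<longleftrightarrow> sets \<sigma> = sets borel \<and> (\<forall>(V, f)\<in>\<A>. \<forall>S\<in>sets borel. S \<subseteq> V \<longrightarrow>
     emeasure \<sigma> (f ` S) = (\<integral>\<^sup>+u\<in>S. ennreal (sqrt (det (induced_metric F f u))) \<partial>lborel))"

lemma is_volumeD:
  "is_volume \<sigma> \<Longrightarrow> (V, f) \<in> \<A> \<Longrightarrow> S \<in> sets borel \<Longrightarrow> S \<subseteq> V \<Longrightarrow>
     emeasure \<sigma> (f ` S) = (\<integral>\<^sup>+u\<in>S. ennreal (sqrt (det (induced_metric F f u))) \<partial>lborel)"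
  by (auto simp: is_volume_def)

lemma chart_preimage_borel:
  assumes f: "(V, f) \<in> \<A>" and B: "B \<in> sets borel"
  shows "{w\<in>V. f w \<in> B} \<in> sets borel"
proof -
  have "chart_map V f -` B \<in> sets borel" by (rule measurable_sets_borel[OF chart_map_measurable[OF f] B])
  moreover have "{w\<in>V. f w \<in> B} = V \<inter> chart_map V f -` B" by (auto simp: chart_map_def)
  ultimately show ?thesis using chart_open[OF f] by auto
qed

text \<open>Countably many chart images are made disjoint and the chart densities are pushed forward
  from each piece. That the result is right in every other chart follows piece by piece from
  \<open>vol_integral_transition\<close>.\<close>

lemma volume_exists: "\<exists>\<sigma>. is_volume \<sigma>"
proof -
  obtain V f where f: "\<And>k::nat. (V k, f k) \<in> \<A>" and cov: "(\<Union>k. f k ` V k) = UNIV"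
    using countable_atlas by blast
  define P where "P = disjointed (\<lambda>k. f k ` V k)"
  have PB: "P k \<in> sets borel" for k
    unfolding P_def disjointed_def using chart_open_image[OF f] by auto
  have Psub: "P k \<subseteq> f k ` V k" for k unfolding P_def by (rule disjointed_subset)
  have Pcov: "(\<Union>k. P k) = UNIV" unfolding P_def UN_disjointed_eq by (rule cov)
  have Pdisj: "disjoint_family P" unfolding P_def by (rule disjoint_family_disjointed)
  define Q where "Q k = {w\<in>V k. f k w \<in> P k}" for k
  have QB: "Q k \<in> sets borel" for k unfolding Q_def by (rule chart_preimage_borel[OF f PB])
  define wt where "wt = (\<lambda>(k, u). ennreal (indicator (V k) u * vol (f k) u) * indicator (Q k) u)"
  define \<Phi> where "\<Phi> = (\<lambda>(k, u). chart_map (V k) (f k) u)"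
  \<comment> \<open>The disjoint union of the parameter spaces, realised as a product with counting
    measure on the chart indices, so that a single push-forward collects all pieces.\<close>
  define N where "N = (count_space (UNIV::nat set) \<Otimes>\<^sub>M (lborel :: (real^'n) measure))"
  define \<sigma> where "\<sigma> = distr (density N wt) borel \<Phi>"
  have mwt: "wt \<in> borel_measurable N" unfolding N_def wt_def
    using vol_indicator_measurable[OF f] QB by (intro measurable_pair_measure_countable1) auto
  have m\<Phi>: "\<Phi> \<in> N \<rightarrow>\<^sub>M borel" unfolding N_def \<Phi>_def
    using chart_map_measurable[OF f] by (intro measurable_pair_measure_countable1) auto
  have em: "emeasure \<sigma> B = (\<Sum>k. \<integral>\<^sup>+u\<in>{w\<in>V k. f k w \<in> P k \<inter> B}. ennreal (vol (f k) u) \<partial>lborel)" if B: "B \<in> sets borel" for B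
  proof -
    have pre: "\<Phi> -` B \<inter> space N \<in> sets N" using measurable_sets[OF m\<Phi> B] .
    have "emeasure \<sigma> B = (\<integral>\<^sup>+x. wt x * indicator (\<Phi> -` B \<inter> space N) x \<partial>N)"
      unfolding \<sigma>_def using m\<Phi> B pre mwt by (simp add: emeasure_distr emeasure_density)
    also have "\<dots> = (\<integral>\<^sup>+k. \<integral>\<^sup>+u. wt (k, u) * indicator (\<Phi> -` B \<inter> space N) (k, u) \<partial>lborel \<partial>count_space UNIV)"
      unfolding N_def by (rule lborel.nn_integral_fst[symmetric]) (use mwt pre in \<open>auto simp: N_def\<close>)
    also have "\<dots> = (\<Sum>k. \<integral>\<^sup>+u. wt (k, u) * indicator (\<Phi> -` B \<inter> space N) (k, u) \<partial>lborel)"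
      by (rule nn_integral_count_space_nat)
    also have "(\<lambda>k. \<integral>\<^sup>+u. wt (k, u) * indicator (\<Phi> -` B \<inter> space N) (k, u) \<partial>lborel)
       = (\<lambda>k. \<integral>\<^sup>+u\<in>{w\<in>V k. f k w \<in> P k \<inter> B}. ennreal (vol (f k) u) \<partial>lborel)"
      by (intro ext nn_integral_cong)
        (auto simp: wt_def \<Phi>_def Q_def N_def space_pair_measure chart_map_def indicator_def)
    finally show ?thesis .
  qed
  have "emeasure \<sigma> (g ` S) = (\<integral>\<^sup>+u\<in>S. ennreal (vol g u) \<partial>lborel)"
    if g: "(W, g) \<in> \<A>" and S: "S \<in> sets borel" "S \<subseteq> W" for W g S
  proof -
    define Sk where "Sk k = S \<inter> {w\<in>W. g w \<in> P k}" for k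
    have SkB: "Sk k \<in> sets borel" for k using S(1) chart_preimage_borel[OF g PB] by (auto simp: Sk_def)
    have eq: "{w\<in>V k. f k w \<in> P k \<inter> g ` S} = {w\<in>V k. f k w \<in> g ` Sk k}" for k
      using S(2) chart_inj[OF g] by (auto simp: Sk_def)
    have "(\<integral>\<^sup>+u\<in>{w\<in>V k. f k w \<in> P k \<inter> g ` S}. ennreal (vol (f k) u) \<partial>lborel) = (\<integral>\<^sup>+u\<in>Sk k. ennreal (vol g u) \<partial>lborel)" for k
      unfolding eq by (rule vol_integral_transition[OF g f SkB]) (use S(2) Psub[of k] in \<open>auto simp: Sk_def\<close>)
    then have "emeasure \<sigma> (g ` S) = (\<Sum>k. \<integral>\<^sup>+u\<in>Sk k. ennreal (vol g u) \<partial>lborel)"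
      using em[OF chart_image_borel[OF g S]] by simp
    also have "\<dots> = (\<Sum>k. \<integral>\<^sup>+u. ennreal (indicator W u * vol g u) * indicator (Sk k) u \<partial>lborel)"
      by (intro suminf_cong nn_integral_cong) (auto simp: Sk_def indicator_def)
    also have "\<dots> = (\<integral>\<^sup>+u. (\<Sum>k. ennreal (indicator W u * vol g u) * indicator (Sk k) u) \<partial>lborel)"
      using vol_indicator_measurable[OF g] SkB by (intro nn_integral_suminf[symmetric]) auto
    also have "\<dots> = (\<integral>\<^sup>+u\<in>S. ennreal (vol g u) \<partial>lborel)"
    proof (intro nn_integral_cong)
      fix u
      have dis: "disjoint_family Sk" using Pdisj by (auto simp: disjoint_family_on_def Sk_def)
      have US: "(\<Union>k. Sk k) = S"
      proof -
        have "\<exists>k. g u \<in> P k" for u using Pcov by blast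
        then show ?thesis using S(2) unfolding Sk_def by blast
      qed
      have "(\<Sum>k. indicator (Sk k) u :: ennreal) = indicator S u"
        using suminf_indicator[OF dis, of u] US by simp
      then show "(\<Sum>k. ennreal (indicator W u * vol g u) * indicator (Sk k) u) = ennreal (vol g u) * indicator S u"
        using S(2) by (auto simp: ennreal_suminf_cmult indicator_def)
    qed
    finally show ?thesis .
  qed
  then have "is_volume \<sigma>" unfolding is_volume_def vol_def[symmetric] by (auto simp: \<sigma>_def)
  then show ?thesis by blast
qed

lemma volume_unique:
  assumes "is_volume \<sigma>" "is_volume \<sigma>'" shows "\<sigma> = \<sigma>'"
proof (rule measure_eqI)
  show "sets \<sigma> = sets \<sigma>'" using assms by (simp add: is_volume_def)
  fix B assume "B \<in> sets \<sigma>"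
  then have B: "B \<in> sets borel" using assms by (simp add: is_volume_def)
  obtain V f where f: "\<And>k::nat. (V k, f k) \<in> \<A>" and cov: "(\<Union>k. f k ` V k) = UNIV"
    using countable_atlas by blast
  define P where "P = disjointed (\<lambda>k. f k ` V k)"
  have PB: "P k \<in> sets borel" for k
    unfolding P_def disjointed_def using chart_open_image[OF f] by auto
  have Psub: "P k \<subseteq> f k ` V k" for k unfolding P_def by (rule disjointed_subset)
  have Pcov: "(\<Union>k. P k) = UNIV" unfolding P_def UN_disjointed_eq by (rule cov)
  have Pdisj: "disjoint_family P" unfolding P_def by (rule disjoint_family_disjointed)
  have img: "B \<inter> P k = f k ` {w\<in>V k. f k w \<in> B \<inter> P k}" for k using Psub[of k] by auto
  have meas: "{w\<in>V k. f k w \<in> B \<inter> P k} \<in> sets borel" for k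
    by (rule chart_preimage_borel[OF f]) (use B PB in auto)
  have em: "emeasure \<tau> B = (\<Sum>k. \<integral>\<^sup>+u\<in>{w\<in>V k. f k w \<in> B \<inter> P k}. ennreal (sqrt (det (induced_metric F (f k) u))) \<partial>lborel)"
    if \<tau>: "is_volume \<tau>" for \<tau>
  proof -
    have s: "sets \<tau> = sets borel" using \<tau> by (simp add: is_volume_def)
    have "emeasure \<tau> B = emeasure \<tau> (\<Union>k. B \<inter> P k)" using Pcov by (simp flip: Int_UN_distrib)
    also have "\<dots> = (\<Sum>k. emeasure \<tau> (B \<inter> P k))"
      using B PB Pdisj by (intro suminf_emeasure[symmetric]) (auto simp: s disjoint_family_on_def)
    also have "\<dots> = (\<Sum>k. \<integral>\<^sup>+u\<in>{w\<in>V k. f k w \<in> B \<inter> P k}. ennreal (sqrt (det (induced_metric F (f k) u))) \<partial>lborel)"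
    proof (rule suminf_cong)
      fix k
      have "emeasure \<tau> (f k ` {w\<in>V k. f k w \<in> B \<inter> P k})
          = (\<integral>\<^sup>+u\<in>{w\<in>V k. f k w \<in> B \<inter> P k}. ennreal (sqrt (det (induced_metric F (f k) u))) \<partial>lborel)"
        by (rule is_volumeD[OF \<tau> f meas]) auto
      then show "emeasure \<tau> (B \<inter> P k) = (\<integral>\<^sup>+u\<in>{w\<in>V k. f k w \<in> B \<inter> P k}. ennreal (sqrt (det (induced_metric F (f k) u))) \<partial>lborel)"
        by (rule trans[OF arg_cong[OF img[of k], of "emeasure \<tau>"]])
    qed
    finally show ?thesis .
  qed
  show "emeasure \<sigma> B = emeasure \<sigma>' B" unfolding em[OF assms(1)] em[OF assms(2)] ..
qed

abbreviation "d\<sigma> \<equiv> volume_element \<A> F"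

lemma volume_is_volume: "is_volume d\<sigma>"
proof -
  have "\<exists>!\<sigma>. is_volume \<sigma>" using volume_exists volume_unique by blast
  then show ?thesis unfolding volume_element_def is_volume_def[symmetric] by (rule theI')
qed

lemma sets_volume [simp, measurable_cong]: "sets d\<sigma> = sets borel"
  using volume_is_volume by (simp add: is_volume_def)

lemma space_volume [simp]: "space d\<sigma> = UNIV"
  using sets_eq_imp_space_eq[OF sets_volume] by simp

lemma emeasure_volume_chart:
  "(V, f) \<in> \<A> \<Longrightarrow> S \<in> sets borel \<Longrightarrow> S \<subseteq> V \<Longrightarrow> emeasure d\<sigma> (f ` S) = (\<integral>\<^sup>+u\<in>S. ennreal (vol f u) \<partial>lborel)"
  using volume_is_volume by (auto simp: is_volume_def vol_def)

text \<open>Upgrades the defining property of the volume from sets to an equality of measures, from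
  which the formula for Bochner integrals follows.\<close>

lemma volume_chart_distr:
  assumes f: "(V, f) \<in> \<A>"
  shows "density d\<sigma> (indicator (f ` V)) = distr (density lborel (\<lambda>w. ennreal (indicator V w * vol f w))) borel (chart_map V f)"
proof (rule measure_eqI)
  fix B assume "B \<in> sets (density d\<sigma> (indicator (f ` V)))"
  then have B: "B \<in> sets borel" by simp
  have fV: "f ` V \<in> sets borel" using chart_open_image[OF f] by simp
  let ?S = "{w\<in>V. f w \<in> B}"
  have "emeasure (density d\<sigma> (indicator (f ` V))) B = emeasure d\<sigma> (f ` V \<inter> B)"
    using B fV by (simp add: emeasure_density indicator_inter_arith[symmetric])
  also have "f ` V \<inter> B = f ` ?S" by auto
  also have "emeasure d\<sigma> (f ` ?S) = (\<integral>\<^sup>+w\<in>?S. ennreal (vol f w) \<partial>lborel)"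
    by (rule emeasure_volume_chart[OF f chart_preimage_borel[OF f B]]) auto
  also have "\<dots> = (\<integral>\<^sup>+w. ennreal (indicator V w * vol f w) * indicator (chart_map V f -` B) w \<partial>lborel)"
    by (intro nn_integral_cong) (auto simp: indicator_def chart_map_def)
  also have "\<dots> = emeasure (distr (density lborel (\<lambda>w. ennreal (indicator V w * vol f w))) borel (chart_map V f)) B"
    using chart_map_measurable[OF f] B measurable_sets_borel[OF chart_map_measurable[OF f] B] vol_indicator_measurable[OF f]
    by (simp add: emeasure_distr emeasure_density)
  finally show "emeasure (density d\<sigma> (indicator (f ` V))) B
    = emeasure (distr (density lborel (\<lambda>w. ennreal (indicator V w * vol f w))) borel (chart_map V f)) B" .
qed simp

lemma integral_volume_chart:
  fixes u :: "'p \<Rightarrow> real"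
  assumes f: "(V, f) \<in> \<A>" and u: "u \<in> borel_measurable borel" and supp: "\<And>p. p \<notin> f ` V \<Longrightarrow> u p = 0"
  shows "integral\<^sup>L d\<sigma> u = (\<integral>w. indicator V w * (vol f w * u (f w)) \<partial>lborel)"
proof -
  have fV: "f ` V \<in> sets borel" using chart_open_image[OF f] by simp
  have "integral\<^sup>L d\<sigma> u = (\<integral>p. indicator (f ` V) p *\<^sub>R u p \<partial>d\<sigma>)"
    by (intro Bochner_Integration.integral_cong refl) (use supp in \<open>auto simp: indicator_def\<close>)
  also have "\<dots> = integral\<^sup>L (density d\<sigma> (\<lambda>p. ennreal (indicator (f ` V) p))) u"
    using fV u by (intro integral_density[symmetric]) auto
  also have "(\<lambda>p. ennreal (indicator (f ` V) p)) = indicator (f ` V)" by (auto simp: indicator_def)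
  also have "integral\<^sup>L (density d\<sigma> (indicator (f ` V))) u
     = (\<integral>w. u (chart_map V f w) \<partial>density lborel (\<lambda>w. ennreal (indicator V w * vol f w)))"
    unfolding volume_chart_distr[OF f] using chart_map_measurable[OF f] u by (intro integral_distr) auto
  also have "\<dots> = (\<integral>w. (indicator V w * vol f w) *\<^sub>R u (chart_map V f w) \<partial>lborel)"
    using vol_indicator_measurable[OF f] chart_map_measurable[OF f] u vol_pos[OF f]
    by (intro integral_density) (auto simp: indicator_def less_imp_le intro!: AE_I2)
  also have "\<dots> = (\<integral>w. indicator V w * (vol f w * u (f w)) \<partial>lborel)"
    by (intro Bochner_Integration.integral_cong refl) (auto simp: indicator_def chart_map_def)
  finally show ?thesis .
qed

text \<open>Finitely many closed chart balls cover the set, and on each of them the continuous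
  density is bounded.\<close>

lemma emeasure_volume_compact:
  assumes K: "compact K" shows "emeasure d\<sigma> K < \<infinity>"
proof -
  have "\<exists>V f w r. (V, f) \<in> \<A> \<and> w \<in> V \<and> f w = p \<and> r > 0 \<and> cball w r \<subseteq> V" for p
  proof -
    obtain V f w where f: "(V, f) \<in> \<A>" "w \<in> V" "f w = p" using atlas_cover .
    then show ?thesis using chart_open[OF f(1)] open_contains_cball by metis
  qed
  then obtain V f w r where *: "\<And>p. (V p, f p) \<in> \<A>" "\<And>p. f p (w p) = p" "\<And>p. r p > (0::real)" "\<And>p. cball (w p) (r p) \<subseteq> V p"
    by metis
  let ?U = "\<lambda>p. f p ` ball (w p) (r p)"
  have sub: "ball (w p) (r p) \<subseteq> V p" for p using *(4)[of p] ball_subset_cball by blast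
  have "open (?U p)" for p by (rule chart_image_open[OF *(1) open_ball sub])
  moreover have "K \<subseteq> (\<Union>p\<in>UNIV. ?U p)"
  proof
    fix p assume "p \<in> K"
    have "f p (w p) \<in> ?U p" by (rule imageI) (simp add: *(3))
    then show "p \<in> (\<Union>p\<in>UNIV. ?U p)" using *(2)[of p] by auto
  qed
  ultimately obtain D where D: "finite D" "K \<subseteq> (\<Union>p\<in>D. ?U p)"
    by (rule compactE_image[OF K])
  have fin: "emeasure d\<sigma> (f p ` cball (w p) (r p)) < \<infinity>" for p
  proof -
    have "continuous_on (cball (w p) (r p)) (vol (f p))"
      using continuous_on_subset[OF Ck_on_imp_continuous_on[OF vol_smooth[OF *(1)]] *(4)] .
    then have "compact (vol (f p) ` cball (w p) (r p))" by (intro compact_continuous_image compact_cball)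
    then obtain M where M: "\<And>u. u \<in> cball (w p) (r p) \<Longrightarrow> vol (f p) u \<le> M"
      using bounded_imp_bdd_above compact_imp_bounded unfolding bdd_above_def by (metis imageI)
    have "emeasure d\<sigma> (f p ` cball (w p) (r p)) = (\<integral>\<^sup>+u\<in>cball (w p) (r p). ennreal (vol (f p) u) \<partial>lborel)"
      by (rule emeasure_volume_chart[OF *(1) _ *(4)]) simp
    also have "\<dots> \<le> (\<integral>\<^sup>+u. ennreal M * indicator (cball (w p) (r p)) u \<partial>lborel)"
      using M by (intro nn_integral_mono) (auto simp: indicator_def ennreal_leI)
    also have "\<dots> = ennreal M * emeasure lborel (cball (w p) (r p))"
      by (simp add: nn_integral_cmult_indicator)
    also have "\<dots> < \<infinity>" using emeasure_lborel_cball_finite[of "w p" "r p"] by (simp add: ennreal_mult_less_top)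
    finally show ?thesis .
  qed
  have cb: "f p ` cball (w p) (r p) \<in> sets borel" for p by (rule chart_image_borel[OF *(1) _ *(4)]) simp
  have "emeasure d\<sigma> K \<le> emeasure d\<sigma> (\<Union>p\<in>D. f p ` cball (w p) (r p))"
    using D cb by (intro emeasure_mono) (auto, force)
  also have "\<dots> \<le> (\<Sum>p\<in>D. emeasure d\<sigma> (f p ` cball (w p) (r p)))"
    using D(1) cb by (intro emeasure_subadditive_finite) auto
  also have "\<dots> < \<infinity>" using D(1) fin by (induction D rule: finite_induct) (auto simp: less_top[symmetric])
  finally show ?thesis .
qed

lemma integrable_compact_support:
  fixes u :: "'p \<Rightarrow> real"
  assumes K: "compact K" and u: "u \<in> borel_measurable borel" and supp: "\<And>p. p \<notin> K \<Longrightarrow> u p = 0"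
    and bound: "\<And>p. p \<in> K \<Longrightarrow> \<bar>u p\<bar> \<le> B"
  shows "integrable d\<sigma> u"
proof -
  have KB: "K \<in> sets borel" using compact_imp_closed[OF K] by simp
  have "integrable d\<sigma> (\<lambda>p. indicator K p *\<^sub>R u p)"
  proof (rule Bochner_Integration.integrable_bound)
    show "integrable d\<sigma> (\<lambda>p. B * indicator K p)"
      using emeasure_volume_compact[OF K] KB by (intro integrable_mult_right integrable_real_indicator) auto
    have "(\<lambda>p. indicator K p * u p) \<in> borel_measurable borel"
      by (intro borel_measurable_times borel_measurable_indicator KB u)
    then show "(\<lambda>p. indicator K p *\<^sub>R u p) \<in> borel_measurable d\<sigma>"
      by (simp add: measurable_cong_sets[OF sets_volume refl])
    show "AE p in d\<sigma>. norm (indicator K p *\<^sub>R u p) \<le> norm (B * indicator K p)"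
      using bound by (intro AE_I2) (force simp: indicator_def)
  qed
  moreover have "(\<lambda>p. indicator K p *\<^sub>R u p) = u" using supp by (auto simp: indicator_def fun_eq_iff)
  ultimately show ?thesis by simp
qed

end

section \<open>The intrinsic distance\<close>

lemma C1_compose_Ck:
  fixes \<phi> :: "real^'a \<Rightarrow> 'b::real_normed_vector" and c :: "real \<Rightarrow> real^'a"
  assumes \<phi>: "Ck_on (Suc 0) D \<phi>" and c: "c C1_differentiable_on T" and cD: "c ` T \<subseteq> D"
  shows "(\<lambda>x. \<phi> (c x)) C1_differentiable_on T"
    and "x \<in> T \<Longrightarrow> ((\<lambda>x. \<phi> (c x)) has_vector_derivative frechet_derivative \<phi> (at (c x)) (vector_derivative c (at x))) (at x)"
proof -
  let ?D = "\<lambda>x. frechet_derivative \<phi> (at (c x)) (vector_derivative c (at x))"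
  have der: "((\<lambda>x. \<phi> (c x)) has_vector_derivative ?D x) (at x)" if x: "x \<in> T" for x
  proof -
    have d\<phi>: "(\<phi> has_derivative frechet_derivative \<phi> (at (c x))) (at (c x))"
      using Ck_on_has_derivative[OF \<phi>] cD x by blast
    have dc: "(c has_vector_derivative vector_derivative c (at x)) (at x)"
      using c x by (simp add: C1_differentiable_on_eq vector_derivative_works)
    have "((\<lambda>x. \<phi> (c x)) has_derivative (\<lambda>t. frechet_derivative \<phi> (at (c x)) (t *\<^sub>R vector_derivative c (at x)))) (at x)"
      using has_derivative_compose[OF dc[unfolded has_vector_derivative_def] d\<phi>] .
    then show ?thesis
      using has_derivative_linear[OF d\<phi>] by (simp add: has_vector_derivative_def linear_cmul)
  qed
  then show "x \<in> T \<Longrightarrow> ((\<lambda>x. \<phi> (c x)) has_vector_derivative ?D x) (at x)" by blast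
  have cc: "continuous_on T c" by (rule C1_differentiable_imp_continuous_on[OF c])
  have cc': "continuous_on T (\<lambda>x. vector_derivative c (at x))" using c by (simp add: C1_differentiable_on_eq)
  have "continuous_on T (\<lambda>x. \<Sum>i\<in>UNIV. vector_derivative c (at x) $ i *\<^sub>R frechet_derivative \<phi> (at (c x)) (axis i 1))"
  proof (intro continuous_on_sum continuous_on_scaleR)
    fix i
    show "continuous_on T (\<lambda>x. vector_derivative c (at x) $ i)"
      using cc' by (rule continuous_on_component)
    have "continuous_on D (\<lambda>y. frechet_derivative \<phi> (at y) (axis i 1))" using \<phi> by simp
    then show "continuous_on T (\<lambda>x. frechet_derivative \<phi> (at (c x)) (axis i 1))"
      using cc cD by (rule continuous_on_compose2)
  qed
  then have "continuous_on T ?D"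
  proof (rule continuous_on_eq)
    fix x assume "x \<in> T"
    then have "linear (frechet_derivative \<phi> (at (c x)))"
      using Ck_on_has_derivative[OF \<phi>] cD has_derivative_linear by blast
    then show "(\<Sum>i\<in>UNIV. vector_derivative c (at x) $ i *\<^sub>R frechet_derivative \<phi> (at (c x)) (axis i 1)) = ?D x"
      by (rule linear_eq_sum_axis[symmetric])
  qed
  then show "(\<lambda>x. \<phi> (c x)) C1_differentiable_on T"
    unfolding C1_differentiable_on_def by (intro exI[of _ ?D] conjI ballI der)
qed

lemma piecewise_C1_cong_open:
  assumes g: "g piecewise_C1_differentiable_on {a..b}" and U: "open U" "{a..b} \<subseteq> U"
    and eq: "\<And>x. x \<in> U \<Longrightarrow> g x = k x"
  shows "k piecewise_C1_differentiable_on {a..b}"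
proof -
  obtain S D where S: "continuous_on {a..b} g" "finite S" "continuous_on ({a..b} - S) D"
    "\<And>x. x \<in> {a..b} - S \<Longrightarrow> (g has_vector_derivative D x) (at x)"
    using g unfolding piecewise_C1_differentiable_on_def C1_differentiable_on_def by blast
  have "(k has_vector_derivative D x) (at x)" if "x \<in> {a..b} - S" for x
    by (rule has_vector_derivative_transform_within_open[OF S(4)[OF that] U(1)]) (use U(2) eq that in auto)
  moreover have "continuous_on {a..b} k" using S(1) by (rule continuous_on_eq) (use U(2) eq in blast)
  ultimately show ?thesis
    using S(2,3) unfolding piecewise_C1_differentiable_on_def C1_differentiable_on_def by blast
qed

context hypersurface
begin

lemma piecewise_curve_local:
  assumes \<gamma>: "piecewise_C1_curve \<A> \<gamma>" and t: "t \<in> {0..1}"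
  obtains \<epsilon> S where "\<epsilon> > 0" "finite S"
    "(\<lambda>x. F (\<gamma> x)) C1_differentiable_on ({t - \<epsilon><..<t + \<epsilon>} \<inter> {0<..<1} - S)"
proof -
  have cont: "continuous_on {0..1} \<gamma>" using \<gamma> by (simp add: piecewise_C1_curve_def path_def)
  obtain V f w where f: "(V, f) \<in> \<A>" "w \<in> V" "f w = \<gamma> t" using atlas_cover .
  have "openin (top_of_set {0..1}) ({0..1} \<inter> \<gamma> -` (f ` V))"
    using continuous_openin_preimage_gen[OF cont chart_open_image[OF f(1)]] .
  moreover have "t \<in> {0..1} \<inter> \<gamma> -` (f ` V)" using t f(3) by (auto intro!: image_eqI[OF _ f(2)])
  ultimately obtain e where e: "e > 0" "\<And>x. x \<in> {0..1} \<Longrightarrow> dist x t < e \<Longrightarrow> \<gamma> x \<in> f ` V"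
    unfolding openin_euclidean_subtopology_iff by blast
  define a b where "a = max 0 (t - e/2)" and "b = min 1 (t + e/2)"
  have ab: "{a..b} \<subseteq> {0..1}" "\<gamma> ` {a..b} \<subseteq> f ` V"
    using e t by (auto simp: a_def b_def dist_real_def abs_if intro!: e(2))
  let ?c = "inv_into V f \<circ> \<gamma>"
  have "?c piecewise_C1_differentiable_on {a..b}"
    using \<gamma> f(1) ab unfolding piecewise_C1_curve_def by blast
  then obtain S where S: "finite S" "?c C1_differentiable_on ({a..b} - S)"
    by (auto simp: piecewise_C1_differentiable_on_def)
  let ?T = "{t - e/2<..<t + e/2} \<inter> {0<..<1} - S"
  have TS: "?T \<subseteq> {a..b} - S" by (auto simp: a_def b_def)
  have c: "?c C1_differentiable_on ?T" using C1_differentiable_on_subset[OF S(2) TS] .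
  have cV: "?c ` ?T \<subseteq> V" using TS ab(2) by (force simp: inv_into_into)
  have C1: "(\<lambda>x. (F \<circ> f) (?c x)) C1_differentiable_on ?T"
    by (rule C1_compose_Ck(1)[OF F_smooth[OF f(1)] c cV])
  have eq: "(F \<circ> f) (?c x) = F (\<gamma> x)" if "x \<in> {t - e/2<..<t + e/2} \<inter> {0<..<1}" for x
  proof -
    have "x \<in> {a..b}" using that by (auto simp: a_def b_def)
    then have "\<gamma> x \<in> f ` V" using ab(2) by blast
    then show ?thesis by (simp add: f_inv_into_f)
  qed
  have "(\<lambda>x. F (\<gamma> x)) C1_differentiable_on ?T"
  proof -
    obtain D where D: "\<And>x. x \<in> ?T \<Longrightarrow> ((\<lambda>x. (F \<circ> f) (?c x)) has_vector_derivative D x) (at x)" "continuous_on ?T D"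
      using C1 unfolding C1_differentiable_on_def by blast
    have "((\<lambda>x. F (\<gamma> x)) has_vector_derivative D x) (at x)" if x: "x \<in> ?T" for x
      by (rule has_vector_derivative_transform_within_open[OF D(1)[OF x], of "{t - e/2<..<t + e/2} \<inter> {0<..<1}"])
        (use x eq in auto)
    then show ?thesis unfolding C1_differentiable_on_def using D(2) by blast
  qed
  then show ?thesis using that[of "e/2" S] e(1) S(1) by simp
qed

text \<open>The definition of a curve gives regularity only while it stays in one chart; compactness
  of the unit interval collects the finitely many exceptional points. The end points are among them
  because derivatives are two-sided.\<close>

lemma piecewise_curve_C1:
  assumes \<gamma>: "piecewise_C1_curve \<A> \<gamma>"
  obtains S D where "finite S" "{0, 1} \<subseteq> S" "continuous_on ({0..1} - S) D"
    "\<And>x. x \<in> {0..1} - S \<Longrightarrow> ((\<lambda>x. F (\<gamma> x)) has_vector_derivative D x) (at x)"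
proof -
  have "\<exists>\<epsilon> S. t \<in> {0..1} \<longrightarrow> \<epsilon> > 0 \<and> finite S \<and>
    (\<lambda>x. F (\<gamma> x)) C1_differentiable_on ({t - \<epsilon><..<t + \<epsilon>} \<inter> {0<..<1} - S)" for t
    using piecewise_curve_local[OF \<gamma>, of t] by metis
  then obtain \<epsilon> S where *: "\<And>t. t \<in> {0..1} \<Longrightarrow> \<epsilon> t > 0 \<and> finite (S t) \<and>
    (\<lambda>x. F (\<gamma> x)) C1_differentiable_on ({t - \<epsilon> t<..<t + \<epsilon> t} \<inter> {0<..<1} - S t)" by metis
  let ?O = "\<lambda>t. {t - \<epsilon> t<..<t + \<epsilon> t}"
  have cov: "{0..1} \<subseteq> (\<Union>t\<in>{0..1}. ?O t)" using * by force
  obtain K where K: "K \<subseteq> {0..1}" "finite K" "{0..1} \<subseteq> (\<Union>t\<in>K. ?O t)"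
    by (rule compactE_image[OF compact_Icc _ cov]) auto
  define S' where "S' = {0, 1} \<union> (\<Union>t\<in>K. S t)"
  have S': "finite S'" "{0, 1} \<subseteq> S'" using K * by (auto simp: S'_def)
  define D where "D x = vector_derivative (\<lambda>x. F (\<gamma> x)) (at x)" for x
  have loc: "\<exists>t. x \<in> ?O t \<and> (\<lambda>x. F (\<gamma> x)) C1_differentiable_on (?O t \<inter> {0<..<1} - S t) \<and> S t \<subseteq> S' \<and> x \<in> {0<..<1}"
    if x: "x \<in> {0..1} - S'" for x
  proof -
    obtain t where "t \<in> K" "x \<in> ?O t" using K(3) x by blast
    moreover have "x \<in> {0<..<1}" using x S'(2) by (auto simp: less_le)
    ultimately show ?thesis using * K(1) by (intro exI[of _ t]) (auto simp: S'_def)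
  qed
  have "((\<lambda>x. F (\<gamma> x)) has_vector_derivative D x) (at x)" if x: "x \<in> {0..1} - S'" for x
    using loc[OF x] x unfolding D_def C1_differentiable_on_eq by (auto simp: vector_derivative_works)
  moreover have "continuous_on ({0..1} - S') D"
    unfolding continuous_on_eq_continuous_within
  proof
    fix x assume x: "x \<in> {0..1} - S'"
    obtain t where t: "x \<in> ?O t" "(\<lambda>x. F (\<gamma> x)) C1_differentiable_on (?O t \<inter> {0<..<1} - S t)" "S t \<subseteq> S'" "x \<in> {0<..<1}"
      using loc[OF x] by blast
    have "continuous_on (?O t \<inter> {0<..<1} - S') D"
      using t(2,3) unfolding C1_differentiable_on_eq D_def by (auto elim: continuous_on_subset)
    then have "continuous (at x within (?O t \<inter> {0<..<1} - S')) D"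
      using x t by (simp add: continuous_on_eq_continuous_within)
    moreover have "at x within (?O t \<inter> {0<..<1} - S') = at x within ({0..1} - S')"
      by (rule at_within_nhd[of x "?O t \<inter> {0<..<1}"]) (use t in auto)
    ultimately show "continuous (at x within ({0..1} - S')) D" by simp
  qed
  ultimately show ?thesis using that[OF S'] by blast
qed

lemma curve_length_eq:
  assumes "finite S" "{0, 1} \<subseteq> S" and D: "\<And>x. x \<in> {0..1} - S \<Longrightarrow> ((\<lambda>x. F (\<gamma> x)) has_vector_derivative D x) (at x)"
  shows "curve_length F \<gamma> = (\<integral>\<^sup>+t. ennreal (indicator ({0..1} - S) t * norm (D t)) \<partial>lborel)"
  unfolding curve_length_def
proof (rule nn_integral_cong_AE)
  have "AE t in lborel. t \<notin> S" using assms(1) by (intro AE_not_in finite_imp_null_set_lborel)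
  then show "AE t in lborel. ennreal (norm (vector_derivative (F \<circ> \<gamma>) (at t))) * indicator {0..1} t
      = ennreal (indicator ({0..1} - S) t * norm (D t))"
  proof (rule AE_mp, intro AE_I2 impI)
    fix t assume "t \<notin> S"
    show "ennreal (norm (vector_derivative (F \<circ> \<gamma>) (at t))) * indicator {0..1} t
      = ennreal (indicator ({0..1} - S) t * norm (D t))"
    proof (cases "t \<in> {0..1}")
      case True
      then show ?thesis using vector_derivative_at[OF D[of t]] \<open>t \<notin> S\<close> by (simp add: o_def)
    qed auto
  qed
qed

lemma curve_derivative_measurable:
  fixes D :: "real \<Rightarrow> real^'m"
  assumes "finite S" "continuous_on ({0..1} - S) D"
  shows "(\<lambda>t. indicator ({0..1} - S) t *\<^sub>R D t) \<in> borel_measurable borel"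
    and "(\<lambda>t. indicator ({0..1} - S) t * norm (D t)) \<in> borel_measurable borel"
proof -
  have "S \<in> sets borel" using finite_imp_closed[OF assms(1)] by simp
  then have "{0..1} - S \<in> sets borel" by (intro sets.Diff) auto
  then show "(\<lambda>t. indicator ({0..1} - S) t *\<^sub>R D t) \<in> borel_measurable borel"
    and "(\<lambda>t. indicator ({0..1} - S) t * norm (D t)) \<in> borel_measurable borel"
    using borel_measurable_continuous_on_indicator[of "{0..1} - S" D] assms(2)
      borel_measurable_continuous_on_indicator[of "{0..1} - S" "\<lambda>t. norm (D t)"] continuous_on_norm[OF assms(2)] by auto
qed

text \<open>A chord is no longer than the curve. For infinite length nothing is to be shown; finite
  length makes the velocity integrable although it may be unbounded near break points. Through this
  bound properness controls intrinsic balls, whose images are bounded.\<close>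

lemma displacement_le_length:
  assumes \<gamma>: "piecewise_C1_curve \<A> \<gamma>"
  shows "ennreal (norm (F (\<gamma> 1) - F (\<gamma> 0))) \<le> curve_length F \<gamma>"
proof -
  obtain S D where S: "finite S" "{0, 1} \<subseteq> S" "continuous_on ({0..1} - S) D"
    "\<And>x. x \<in> {0..1} - S \<Longrightarrow> ((\<lambda>x. F (\<gamma> x)) has_vector_derivative D x) (at x)"
    using piecewise_curve_C1[OF \<gamma>] by blast
  define E where "E t = indicator ({0..1} - S) t *\<^sub>R D t" for t
  have mE: "E \<in> borel_measurable borel" unfolding E_def by (rule curve_derivative_measurable[OF S(1,3)])
  have len: "curve_length F \<gamma> = (\<integral>\<^sup>+t. ennreal (norm (E t)) \<partial>lborel)"
    using curve_length_eq[OF S(1,2,4)] by (simp add: E_def)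
  show ?thesis
  proof (cases "curve_length F \<gamma> = \<infinity>")
    case False
    then have int: "integrable lborel E"
      using mE len by (intro integrableI_bounded) (auto simp: less_top)
    have "continuous_on {0..1} \<gamma>" using \<gamma> by (simp add: piecewise_C1_curve_def path_def)
    then have cF: "continuous_on {0..1} (\<lambda>x. F (\<gamma> x))"
      by (rule continuous_on_compose2[OF continuous_on_F]) auto
    have "(E has_integral (F (\<gamma> 1) - F (\<gamma> 0))) {0..1}"
      by (rule fundamental_theorem_of_calculus_strong[OF S(1) _ _ cF]) (use S(4) in \<open>auto simp: E_def\<close>)
    then have "((\<lambda>t. if t \<in> {0..1} then E t else 0) has_integral (F (\<gamma> 1) - F (\<gamma> 0))) UNIV"
      by (simp only: has_integral_restrict_UNIV)
    moreover have "(\<lambda>t. if t \<in> {0..1} then E t else 0) = E" by (auto simp: E_def fun_eq_iff)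
    ultimately have "(E has_integral (F (\<gamma> 1) - F (\<gamma> 0))) UNIV" by simp
    moreover have "(E has_integral (integral\<^sup>L lborel E)) UNIV" by (rule has_integral_integral_lborel[OF int])
    ultimately have "F (\<gamma> 1) - F (\<gamma> 0) = integral\<^sup>L lborel E" by (rule has_integral_unique)
    then have "norm (F (\<gamma> 1) - F (\<gamma> 0)) \<le> (\<integral>t. norm (E t) \<partial>lborel)" by simp
    also have "ennreal \<dots> = curve_length F \<gamma>"
      unfolding len using int by (intro nn_integral_eq_integral[symmetric]) auto
    finally show ?thesis by (metis ennreal_leI)
  qed simp
qed

section \<open>The intrinsic distance and its Lipschitz bound\<close>

definition curves :: "'p \<Rightarrow> 'p \<Rightarrow> (real \<Rightarrow> 'p) set" where
  "curves p q = {\<gamma>. piecewise_C1_curve \<A> \<gamma> \<and> pathstart \<gamma> = p \<and> pathfinish \<gamma> = q}"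

text \<open>The distance before \<open>enn2real\<close>. That function sends infinity to 0, so
  finiteness has to be settled on this level first.\<close>

definition edist :: "'p \<Rightarrow> 'p \<Rightarrow> ennreal" where
  "edist p q = (INF \<gamma>\<in>curves p q. curve_length F \<gamma>)"

lemma displacement_le_edist: "ennreal (norm (F q - F p)) \<le> edist p q"
  unfolding edist_def
  by (rule INF_greatest) (use displacement_le_length in \<open>auto simp: curves_def pathstart_def pathfinish_def\<close>)

lemma edist_self: "edist p p = 0"
proof -
  have c: "(\<lambda>_. p) \<in> curves p p"
  proof -
    have "piecewise_C1_curve \<A> (\<lambda>_. p)"
      unfolding piecewise_C1_curve_def
      by (auto simp: path_def o_def piecewise_C1_differentiable_const)
    then show ?thesis by (simp add: curves_def pathstart_def pathfinish_def)
  qed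
  have "curve_length F (\<lambda>_. p) = 0"
    unfolding curve_length_def by (simp add: o_def vector_derivative_const_at)
  then have "edist p p \<le> 0" unfolding edist_def using INF_lower[OF c, of "curve_length F"] by simp
  then show ?thesis by simp
qed

lemma chart_segment_curve:
  assumes f: "(V, f) \<in> \<A>" and g: "(W, g) \<in> \<A>" and seg: "closed_segment u u' \<subseteq> V"
    and ab: "{a..b} \<subseteq> {0..1}" "(\<lambda>t. f (linepath u u' t)) ` {a..b} \<subseteq> g ` W"
  shows "(inv_into W g \<circ> (\<lambda>t. f (linepath u u' t))) piecewise_C1_differentiable_on {a..b}"
proof -
  define D \<psi> where "D = V \<inter> f -` (g ` W)" and "\<psi> = inv_into W g \<circ> f"
  note tr = transition[OF g f, folded D_def \<psi>_def]
  have lin: "linepath u u' C1_differentiable_on {a..b}"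
    unfolding C1_differentiable_on_def
    by (intro exI[of _ "\<lambda>_. u' - u"] conjI ballI has_vector_derivative_linepath_within continuous_on_const)
  have "linepath u u' ` {a..b} \<subseteq> D"
  proof
    fix x assume "x \<in> linepath u u' ` {a..b}"
    then obtain t where t: "t \<in> {a..b}" "x = linepath u u' t" by blast
    then have "t \<in> {0..1}" using ab(1) by blast
    then have "x \<in> V" unfolding t(2) using seg linepath_in_path by blast
    then show "x \<in> D" using ab(2) t by (auto simp: D_def)
  qed
  then have "(\<lambda>t. \<psi> (linepath u u' t)) C1_differentiable_on {a..b}"
    by (intro C1_compose_Ck(1)[OF tr(2) lin])
  then show ?thesis
    by (intro C1_differentiable_imp_piecewise) (simp add: \<psi>_def o_def)
qed

text \<open>Append the chart segment to an arbitrary competitor; the length of the join is at most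
  the sum, and the infimum over competitors gives the claim.\<close>

lemma edist_segment:
  assumes f: "(V, f) \<in> \<A>" and seg: "closed_segment u u' \<subseteq> V"
    and M: "\<And>z. z \<in> closed_segment u u' \<Longrightarrow> norm (dF f z (u' - u)) \<le> M"
  shows "edist p (f u') \<le> edist p (f u) + ennreal M"
proof -
  let ?s = "\<lambda>t. f (linepath u u' t)"
  have "edist p (f u') \<le> curve_length F \<gamma> + ennreal M" if \<gamma>: "\<gamma> \<in> curves p (f u)" for \<gamma>
  proof -
    have pc: "piecewise_C1_curve \<A> \<gamma>" and st: "pathstart \<gamma> = p" "pathfinish \<gamma> = f u"
      using \<gamma> by (auto simp: curves_def)
    have path\<gamma>: "path \<gamma>" using pc by (simp add: piecewise_C1_curve_def)
    have "continuous_on {0..1} ?s"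
      by (rule continuous_on_compose2[OF chart_cont[OF f] continuous_on_linepath]) (use seg linepath_in_path in blast)
    then have path_s: "path ?s" by (simp add: path_def)
    have s01: "?s 0 = f u" "?s 1 = f u'" by (simp_all add: linepath_def)
    define \<gamma>' where "\<gamma>' = \<gamma> +++ ?s"
    have \<gamma>'_eq: "\<gamma>' = (\<lambda>x. if x \<le> 1/2 then \<gamma> (2 * x) else ?s (2 * x - 1))" by (auto simp: \<gamma>'_def joinpaths_def)
    have "path \<gamma>'" unfolding \<gamma>'_def
      using path\<gamma> path_s st s01 by (intro path_join_imp) (auto simp: pathstart_def pathfinish_def)
    \<comment> \<open>Regularity must be checked in every chart and on every subinterval; the
      subinterval is divided at the junction \<open>1/2\<close>, and each half is an affine
      reparametrization of one of the two curves.\<close>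
    moreover have "(inv_into W g \<circ> \<gamma>') piecewise_C1_differentiable_on {a..b}"
      if g: "(W, g) \<in> \<A>" and ab: "{a..b} \<subseteq> {0..1}" "\<gamma>' ` {a..b} \<subseteq> g ` W" for W g a b
    proof -
      have left: "(\<lambda>x. (inv_into W g \<circ> \<gamma>) (2 * x)) piecewise_C1_differentiable_on {a'..b'}"
        if "{a'..b'} \<subseteq> {a..b}" "b' \<le> 1/2" for a' b'
      proof -
        have "(inv_into W g \<circ> \<gamma>) piecewise_C1_differentiable_on {2*a'..2*b'}"
        proof (cases "a' \<le> b'")
          case True
          have "\<gamma> ` {2*a'..2*b'} \<subseteq> g ` W"
          proof
            fix y assume "y \<in> \<gamma> ` {2*a'..2*b'}"
            then obtain x where x: "x \<in> {2*a'..2*b'}" "y = \<gamma> x" by blast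
            then have "x/2 \<in> {a'..b'}" by simp
            then have "x/2 \<in> {a..b}" "x/2 \<le> 1/2" using that by (blast, simp)
            moreover have "\<gamma>' (x/2) = y" using x(2) \<open>x/2 \<le> 1/2\<close> by (simp add: \<gamma>'_eq)
            ultimately show "y \<in> g ` W" using ab(2) by blast
          qed
          moreover have "{2*a'..2*b'} \<subseteq> {0..1}" using that ab(1) True by force
          ultimately show ?thesis using pc g unfolding piecewise_C1_curve_def by blast
        qed (auto simp: piecewise_C1_differentiable_on_def intro: exI[of _ "{}"])
        moreover have "(\<lambda>x. 2 * x + 0) ` {a'..b'} = {2*a'..2*b'}"
          using image_affinity_atLeastAtMost[of 2 0 a' b'] by auto
        ultimately have "((inv_into W g \<circ> \<gamma>) \<circ> (\<lambda>x. 2 *\<^sub>R x + 0)) piecewise_C1_differentiable_on {a'..b'}"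
          by (intro piecewise_C1_differentiable_affine) simp
        then show ?thesis by (simp add: o_def)
      qed
      have right: "(\<lambda>x. (inv_into W g \<circ> ?s) (2 * x - 1)) piecewise_C1_differentiable_on {a'..b'}"
        if "{a'..b'} \<subseteq> {a..b}" "1/2 \<le> a'" for a' b'
      proof -
        have "(inv_into W g \<circ> ?s) piecewise_C1_differentiable_on {2*a'-1..2*b'-1}"
        proof (cases "a' \<le> b'")
          case True
          show ?thesis
          proof (rule chart_segment_curve[OF f g seg])
            show "{2*a'-1..2*b'-1} \<subseteq> {0..1}" using that ab(1) True by force
            show "?s ` {2*a'-1..2*b'-1} \<subseteq> g ` W"
            proof
              fix y assume "y \<in> ?s ` {2*a'-1..2*b'-1}"
              then obtain x where x: "x \<in> {2*a'-1..2*b'-1}" "y = ?s x" by blast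
              then have h: "(x+1)/2 \<in> {a..b}" "(x+1)/2 \<ge> 1/2" using that True by auto
              have "\<gamma>' ((x+1)/2) = y"
              proof (cases "x = 0")
                case True
                then show ?thesis using x(2) s01(1) st(2) by (simp add: \<gamma>'_eq pathfinish_def)
              next
                case False
                then have "\<not> (x+1)/2 \<le> 1/2" using h by simp
                moreover have "2 * ((x+1)/2) - 1 = x" by (simp add: field_simps)
                ultimately show ?thesis unfolding x(2) \<gamma>'_eq by presburger
              qed
              then show "y \<in> g ` W" using ab(2) h(1) by blast
            qed
          qed
        qed (auto simp: piecewise_C1_differentiable_on_def intro: exI[of _ "{}"])
        moreover have "(\<lambda>x. 2 * x + (-1)) ` {a'..b'} = {2*a'-1..2*b'-1}"
          using image_affinity_atLeastAtMost[of 2 "-1" a' b'] by auto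
        ultimately have "((inv_into W g \<circ> ?s) \<circ> (\<lambda>x. 2 *\<^sub>R x + (-1))) piecewise_C1_differentiable_on {a'..b'}"
          by (intro piecewise_C1_differentiable_affine) simp
        then show ?thesis by (simp add: o_def)
      qed
      have cases_eq: "inv_into W g \<circ> \<gamma>' = (\<lambda>x. if x \<le> 1/2 then (inv_into W g \<circ> \<gamma>) (2 * x) else (inv_into W g \<circ> ?s) (2 * x - 1))"
        by (auto simp: \<gamma>'_eq)
      consider "a \<le> 1/2" "1/2 \<le> b" | "b < 1/2" | "1/2 < a" by linarith
      then show ?thesis
      proof cases
        case 1
        show ?thesis unfolding cases_eq
          by (rule piecewise_C1_differentiable_cases)
            (use 1 left[of a "1/2"] right[of "1/2" b] s01(1) st(2) in \<open>auto simp: pathfinish_def\<close>)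
      next
        case 2
        show ?thesis
          by (rule piecewise_C1_cong_open[OF left, of a b "{..<1/2}"]) (use 2 in \<open>auto simp: \<gamma>'_eq\<close>)
      next
        case 3
        show ?thesis
          by (rule piecewise_C1_cong_open[OF right, of a b "{1/2<..}"]) (use 3 in \<open>auto simp: \<gamma>'_eq\<close>)
      qed
    qed
    ultimately have pc': "piecewise_C1_curve \<A> \<gamma>'" unfolding piecewise_C1_curve_def by blast
    have "pathstart \<gamma>' = p" "pathfinish \<gamma>' = f u'"
      using st s01 by (auto simp: \<gamma>'_eq pathstart_def pathfinish_def)
    then have mem: "\<gamma>' \<in> curves p (f u')" using pc' by (simp add: curves_def)
    obtain S D where S: "finite S" "{0, 1} \<subseteq> S" "continuous_on ({0..1} - S) D"
      "\<And>x. x \<in> {0..1} - S \<Longrightarrow> ((\<lambda>x. F (\<gamma> x)) has_vector_derivative D x) (at x)"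
      using piecewise_curve_C1[OF pc] by blast
    define G where "G t = indicator ({0..1} - S) t * norm (D t)" for t
    have mG: "G \<in> borel_measurable borel" unfolding G_def by (rule curve_derivative_measurable[OF S(1,3)])
    have len: "curve_length F \<gamma> = (\<integral>\<^sup>+t. ennreal (G t) \<partial>lborel)"
      using curve_length_eq[OF S(1,2,4)] by (simp add: G_def)
    \<comment> \<open>Each half is run at double speed on half the time. The affine substitution
      undoes this for the first curve, and the segment contributes at most \<open>2 * M\<close> on
      an interval of length \<open>1/2\<close>.\<close>
    have "curve_length F \<gamma>' \<le> (\<integral>\<^sup>+t. 2 * ennreal (G (0 + 2 * t)) + ennreal (2 * M) * indicator {1/2..1} t \<partial>lborel)"
      unfolding curve_length_def
    proof (rule nn_integral_mono_AE)
      let ?S = "insert (1/2) ((\<lambda>x. x/2) ` S \<union> (\<lambda>x. (x+1)/2) ` {0,1})"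
      have "AE t in lborel. t \<notin> ?S" using S(1) by (intro AE_not_in finite_imp_null_set_lborel) auto
      then show "AE t in lborel. ennreal (norm (vector_derivative (F \<circ> \<gamma>') (at t))) * indicator {0..1} t
          \<le> 2 * ennreal (G (0 + 2 * t)) + ennreal (2 * M) * indicator {1/2..1} t"
      proof (rule AE_mp, intro AE_I2 impI)
        fix t assume t: "t \<notin> ?S"
        show "ennreal (norm (vector_derivative (F \<circ> \<gamma>') (at t))) * indicator {0..1} t
          \<le> 2 * ennreal (G (0 + 2 * t)) + ennreal (2 * M) * indicator {1/2..1} t"
        proof (cases "t \<in> {0..1}")
          case True
          show ?thesis
          proof (cases "t < 1/2")
            case lt: True
            have "2 * t \<notin> S" using t imageI[of "2 * t" S "\<lambda>x. x/2"] by auto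
            then have 2: "2 * t \<in> {0..1} - S" using True lt by simp
            have "((\<lambda>x::real. 2 * x) has_vector_derivative 2) (at t)"
              by (auto intro!: derivative_eq_intros)
            then have "((\<lambda>x. F (\<gamma> (2 * x))) has_vector_derivative 2 *\<^sub>R D (2 * t)) (at t)"
              using vector_diff_chain_at[of "\<lambda>x. 2 * x" 2 t "\<lambda>x. F (\<gamma> x)" "D (2 * t)"] S(4)[OF 2]
              by (simp add: o_def)
            then have "((F \<circ> \<gamma>') has_vector_derivative 2 *\<^sub>R D (2 * t)) (at t)"
              by (rule has_vector_derivative_transform_within_open[of _ _ _ "{..<1/2}"]) (use lt in \<open>auto simp: \<gamma>'_eq\<close>)
            then have "vector_derivative (F \<circ> \<gamma>') (at t) = 2 *\<^sub>R D (2 * t)" by (rule vector_derivative_at)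
            then show ?thesis using 2 True by (simp add: G_def ennreal_mult' add_increasing2)
          next
            case False
            then have gt: "t > 1/2" using t by (auto simp: less_le)
            let ?z = "linepath u u' (2 * t - 1)"
            have z: "?z \<in> closed_segment u u'" using gt True by (intro linepath_in_path) auto
            have "((\<lambda>x. linepath u u' (2 * x - 1)) has_vector_derivative 2 *\<^sub>R (u' - u)) (at t)"
              unfolding linepath_def by (auto intro!: derivative_eq_intros simp: algebra_simps scaleR_2)
            moreover have "((F \<circ> f) has_derivative dF f ?z) (at ?z)"
              using dF_has_derivative[OF f] z seg by blast
            ultimately have "((\<lambda>x. (F \<circ> f) (linepath u u' (2 * x - 1))) has_derivative (\<lambda>s. dF f ?z (s *\<^sub>R 2 *\<^sub>R (u' - u)))) (at t)"
              unfolding has_vector_derivative_def by (rule has_derivative_compose)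
            moreover have "dF f ?z (s *\<^sub>R 2 *\<^sub>R (u' - u)) = s *\<^sub>R 2 *\<^sub>R dF f ?z (u' - u)" for s
              using dF_linear[OF f] z seg by (simp add: linear_cmul subset_iff)
            ultimately have "((\<lambda>x. F (?s (2 * x - 1))) has_vector_derivative 2 *\<^sub>R dF f ?z (u' - u)) (at t)"
              by (simp add: has_vector_derivative_def)
            then have "((F \<circ> \<gamma>') has_vector_derivative 2 *\<^sub>R dF f ?z (u' - u)) (at t)"
              by (rule has_vector_derivative_transform_within_open[of _ _ _ "{1/2<..}"]) (use gt in \<open>auto simp: \<gamma>'_eq\<close>)
            then have "vector_derivative (F \<circ> \<gamma>') (at t) = 2 *\<^sub>R dF f ?z (u' - u)" by (rule vector_derivative_at)
            then have "norm (vector_derivative (F \<circ> \<gamma>') (at t)) \<le> 2 * M" using M[OF z] by simp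
            then show ?thesis using True gt by (simp add: ennreal_leI add_increasing)
          qed
        qed auto
      qed
    qed
    also have "\<dots> = 2 * (\<integral>\<^sup>+t. ennreal (G (0 + 2 * t)) \<partial>lborel) + ennreal (2 * M) * emeasure lborel {1/2..1::real}"
    proof -
      have m: "(\<lambda>t. ennreal (G (0 + 2 * t))) \<in> borel_measurable lborel" using mG by measurable
      then show ?thesis by (subst nn_integral_add) (auto simp: nn_integral_cmult nn_integral_cmult_indicator)
    qed
    also have "2 * (\<integral>\<^sup>+t. ennreal (G (0 + 2 * t)) \<partial>lborel) = curve_length F \<gamma>"
      unfolding len using mG by (subst nn_integral_real_affine[of _ 2 0]) auto
    also have "ennreal (2 * M) * emeasure lborel {1/2..1::real} = ennreal M"
    proof -
      have "ennreal (2 * M) * ennreal (1 - 1/2) = ennreal (2 * M * (1 - 1/2))"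
        by (rule ennreal_mult''[symmetric]) simp
      then show ?thesis by (subst emeasure_lborel_Icc) simp_all
    qed
    finally show ?thesis
      unfolding edist_def using INF_lower[OF mem, of "curve_length F"] by (meson order_trans)
  qed
  then have "edist p (f u') - ennreal M \<le> curve_length F \<gamma>" if "\<gamma> \<in> curves p (f u)" for \<gamma>
    using that by (simp add: ennreal_minus_le_iff add.commute)
  then have "edist p (f u') - ennreal M \<le> edist p (f u)"
    unfolding edist_def[of p "f u"] by (rule INF_greatest)
  then show ?thesis by (simp add: ennreal_minus_le_iff add.commute)
qed

lemma chart_ball_bounded:
  assumes f: "(V, f) \<in> \<A>" "w \<in> V"
  obtains r M where "r > 0" "ball w r \<subseteq> V" "\<And>z a. z \<in> ball w r \<Longrightarrow> norm (dF f z a) \<le> M * norm a" "M > 0"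
proof -
  obtain r where r: "r > 0" "cball w r \<subseteq> V" "\<And>z a. z \<in> cball w r \<Longrightarrow> norm (dF f z a - dF f w a) \<le> 1 * norm a"
    by (rule chart_close[OF f zero_less_one]) (rule that)
  obtain B where B: "B > 0" "\<And>a. norm (dF f w a) \<le> norm a * B"
    using linear_bounded_pos[OF dF_linear[OF f]] by (metis mult.commute)
  show ?thesis
  proof (rule that[of r "B + 1"])
    show "ball w r \<subseteq> V" using r(2) by (auto simp: subset_iff)
    show "norm (dF f z a) \<le> (B + 1) * norm a" if "z \<in> ball w r" for z a
    proof -
      have "norm (dF f z a - dF f w a) \<le> norm a" using r(3)[of z a] that by simp
      then show ?thesis using B(2)[of a] norm_triangle_ineq3[of "dF f z a" "dF f w a"] by (simp add: algebra_simps)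
    qed
  qed (use r(1) B(1) in auto)
qed

lemma edist_chart_ball:
  assumes f: "(V, f) \<in> \<A>" "w \<in> V"
  obtains r where "r > 0" "ball w r \<subseteq> V"
    "\<And>u u' p. u \<in> ball w r \<Longrightarrow> u' \<in> ball w r \<Longrightarrow> edist p (f u) < \<infinity> \<Longrightarrow> edist p (f u') < \<infinity>"
proof -
  obtain r M where r: "r > 0" "ball w r \<subseteq> V" "\<And>z a. z \<in> ball w r \<Longrightarrow> norm (dF f z a) \<le> M * norm a" "M > 0"
    using chart_ball_bounded[OF f] by blast
  show ?thesis
  proof (rule that[OF r(1,2)])
    fix u u' p assume u: "u \<in> ball w r" "u' \<in> ball w r" and fin: "edist p (f u) < \<infinity>"
    have seg: "closed_segment u u' \<subseteq> ball w r" using u by (intro closed_segment_subset convex_ball)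
    have "edist p (f u') \<le> edist p (f u) + ennreal (M * norm (u' - u))"
      by (rule edist_segment[OF f(1)]) (use seg r in auto)
    also have "\<dots> < \<infinity>" using fin by simp
    finally show "edist p (f u') < \<infinity>" .
  qed
qed

text \<open>Inside a small chart ball finiteness passes from one point to all others, so the points
  at finite distance form an open and closed set containing \<open>p\<close>.\<close>

lemma edist_finite: "edist p q < \<infinity>"
proof -
  let ?T = "{q. edist p q < \<infinity>}"
  have nb: "\<exists>U. open U \<and> q \<in> U \<and> (U \<subseteq> ?T \<or> U \<subseteq> - ?T)" for q
  proof -
    obtain V f w where f: "(V, f) \<in> \<A>" "w \<in> V" "f w = q" using atlas_cover .
    obtain r where r: "r > 0" "ball w r \<subseteq> V"
      "\<And>u u' p. u \<in> ball w r \<Longrightarrow> u' \<in> ball w r \<Longrightarrow> edist p (f u) < \<infinity> \<Longrightarrow> edist p (f u') < \<infinity>"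
      using edist_chart_ball[OF f(1,2)] by blast
    have "open (f ` ball w r)" by (rule chart_image_open[OF f(1) open_ball r(2)])
    moreover have "q \<in> f ` ball w r" using f(3) r(1) by auto
    moreover have "f ` ball w r \<subseteq> ?T \<or> f ` ball w r \<subseteq> - ?T"
    proof (cases "\<exists>u\<in>ball w r. edist p (f u) < \<infinity>")
      case True
      then show ?thesis using r(3) by blast
    qed auto
    ultimately show ?thesis by blast
  qed
  have "open ?T"
  proof (subst open_subopen, rule ballI)
    fix q assume "q \<in> ?T"
    then show "\<exists>U. open U \<and> q \<in> U \<and> U \<subseteq> ?T" using nb[of q] by blast
  qed
  moreover have "open (- ?T)"
  proof (subst open_subopen, rule ballI)
    fix q assume "q \<in> - ?T"
    then show "\<exists>U. open U \<and> q \<in> U \<and> U \<subseteq> - ?T" using nb[of q] by blast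
  qed
  then have "closed ?T" by (simp add: closed_def)
  moreover have "p \<in> ?T" by (simp add: edist_self)
  moreover have "connected (UNIV :: 'p set)" using manifold by (simp add: connected_manifold_def)
  ultimately have "?T = UNIV"
    by (metis (no_types, lifting) closed_closedin connected_clopen empty_iff open_openin subtopology_UNIV)
  then show ?thesis by blast
qed

abbreviation "gdist \<equiv> geodesic_dist \<A> F"

lemma gdist_edist: "ennreal (gdist p q) = edist p q"
  using edist_finite[of p q] by (simp add: geodesic_dist_def edist_def curves_def)

lemma gdist_nonneg: "gdist p q \<ge> 0" by (simp add: geodesic_dist_def)

lemma displacement_le_gdist: "norm (F q - F p) \<le> gdist p q"
  using displacement_le_edist[of q p] gdist_nonneg[of p q] by (simp add: gdist_edist[symmetric])

text \<open>The whole regularity of the distance that is used later, its continuity included, comes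
  from this Lipschitz estimate in charts.\<close>

lemma gdist_segment:
  assumes f: "(V, f) \<in> \<A>" and seg: "closed_segment u u' \<subseteq> V"
    and M: "\<And>z. z \<in> closed_segment u u' \<Longrightarrow> norm (dF f z (u' - u)) \<le> M"
  shows "\<bar>gdist p (f u') - gdist p (f u)\<bar> \<le> M"
proof -
  have M0: "M \<ge> 0" using M[of u] norm_ge_zero order_trans by (metis ends_in_segment(1))
  have one: "gdist p (f b) \<le> gdist p (f a) + M"
    if "closed_segment a b \<subseteq> V" "\<And>z. z \<in> closed_segment a b \<Longrightarrow> norm (dF f z (b - a)) \<le> M" for a b
    using edist_segment[OF f that, of p] M0 gdist_nonneg[of p]
    by (simp add: gdist_edist[symmetric] flip: ennreal_plus)
  have "norm (dF f z (u - u')) \<le> M" if "z \<in> closed_segment u' u" for z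
  proof -
    have z: "z \<in> closed_segment u u'" using that by (simp add: closed_segment_commute)
    then have "linear (dF f z)" using dF_linear[OF f] seg by blast
    then have "norm (dF f z (u - u')) = norm (dF f z (u' - u))" by (simp add: linear_diff norm_minus_commute)
    then show ?thesis using M[OF z] by simp
  qed
  then show ?thesis using one[OF seg M] one[of u' u] seg by (simp add: closed_segment_commute)
qed

lemma continuous_on_gdist: "continuous_on UNIV (gdist p)"
proof (rule continuous_at_imp_continuous_on, rule ballI)
  fix q
  obtain V f w where f: "(V, f) \<in> \<A>" "w \<in> V" "f w = q" using atlas_cover .
  obtain r M where r: "r > 0" "ball w r \<subseteq> V" "\<And>z a. z \<in> ball w r \<Longrightarrow> norm (dF f z a) \<le> M * norm a" "M > 0"
    using chart_ball_bounded[OF f(1,2)] by blast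
  have lip: "\<bar>gdist p (f u') - gdist p (f u)\<bar> \<le> M * norm (u' - u)" if "u \<in> ball w r" "u' \<in> ball w r" for u u'
  proof (rule gdist_segment[OF f(1)])
    have seg: "closed_segment u u' \<subseteq> ball w r" using that by (intro closed_segment_subset convex_ball)
    then show "closed_segment u u' \<subseteq> V" using r(2) by blast
    show "norm (dF f z (u' - u)) \<le> M * norm (u' - u)" if "z \<in> closed_segment u u'" for z
      using r(3) seg that by blast
  qed
  have "continuous_on (ball w r) (\<lambda>u. gdist p (f u))"
  proof (rule continuous_onI)
    fix u and e :: real assume u: "u \<in> ball w r" and e: "e > 0"
    show "\<exists>d>0. \<forall>u'\<in>ball w r. dist u' u < d \<longrightarrow> dist (gdist p (f u')) (gdist p (f u)) \<le> e"
    proof (intro exI[of _ "e / M"] conjI ballI impI)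
      show "e / M > 0" using e r(4) by simp
      fix u' assume u': "u' \<in> ball w r" "dist u' u < e / M"
      have "M * norm (u' - u) \<le> e" using u'(2) r(4) by (simp add: dist_norm field_simps less_imp_le)
      then show "dist (gdist p (f u')) (gdist p (f u)) \<le> e"
        using lip[OF u u'(1)] by (simp add: dist_real_def)
    qed
  qed
  moreover have sub: "f ` ball w r \<subseteq> f ` V" using r(2) by blast
  ultimately have "continuous_on (f ` ball w r) (\<lambda>q. gdist p (f (inv_into V f q)))"
    by (rule continuous_on_compose2[OF _ continuous_on_subset[OF chart_inv_cont[OF f(1)]]])
      (use r(2) inv_into_f_f[OF chart_inj[OF f(1)]] in \<open>auto simp: subset_iff\<close>)
  then have "continuous_on (f ` ball w r) (gdist p)"
    by (rule continuous_on_eq) (use sub in \<open>auto simp: f_inv_into_f subset_iff\<close>)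
  moreover have "open (f ` ball w r)" by (rule chart_image_open[OF f(1) open_ball r(2)])
  moreover have "q \<in> f ` ball w r" using f(3) r(1) by auto
  ultimately show "continuous (at q) (gdist p)" using continuous_on_eq_continuous_at by blast
qed

end

section \<open>Divergence and integration by parts\<close>

text \<open>Jacobi's formula. Differentiation replaces one row at a time; the left inverse writes
  the new row as a combination of the rows of \<open>M x\<close>, and multilinearity extracts a
  single coefficient.\<close>

lemma has_derivative_det:
  fixes M :: "'a::real_normed_vector \<Rightarrow> real^'n^'n" and B :: "real^'n^'n"
  assumes M: "\<And>i j. ((\<lambda>x. M x $ i $ j) has_derivative D i j) (at x)" and inv: "B ** M x = mat 1"
  shows "((\<lambda>x. det (M x)) has_derivative (\<lambda>v. det (M x) * (\<Sum>i\<in>UNIV. \<Sum>j\<in>UNIV. B $ j $ i * D i j v))) (at x)"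
proof -
  let ?P = "{p. p permutes (UNIV :: 'n set)}"
  have "((\<lambda>x. det (M x)) has_derivative (\<lambda>v. \<Sum>p\<in>?P. of_int (sign p) *
      (\<Sum>i\<in>UNIV. D i (p i) v * (\<Prod>j\<in>UNIV - {i}. M x $ j $ p j)))) (at x)"
    unfolding det_def by (intro has_derivative_sum has_derivative_mult_right has_derivative_prod M)
  moreover have "(\<Sum>p\<in>?P. of_int (sign p) * (\<Sum>i\<in>UNIV. D i (p i) v * (\<Prod>j\<in>UNIV - {i}. M x $ j $ p j)))
    = det (M x) * (\<Sum>i\<in>UNIV. \<Sum>j\<in>UNIV. B $ j $ i * D i j v)" for v
  proof -
    define R where "R i = (\<chi> k. if k = i then (\<chi> l. D i l v) else M x $ k)" for i
    have "(\<Sum>p\<in>?P. of_int (sign p) * (\<Sum>i\<in>UNIV. D i (p i) v * (\<Prod>j\<in>UNIV - {i}. M x $ j $ p j)))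
      = (\<Sum>i\<in>UNIV. \<Sum>p\<in>?P. of_int (sign p) * (D i (p i) v * (\<Prod>j\<in>UNIV - {i}. M x $ j $ p j)))"
      unfolding sum_distrib_left by (rule sum.swap)
    also have "\<dots> = (\<Sum>i\<in>UNIV. det (R i))"
    proof (rule sum.cong[OF refl])
      fix i
      have "D i (p i) v * (\<Prod>j\<in>UNIV - {i}. M x $ j $ p j) = (\<Prod>j\<in>UNIV. R i $ j $ p j)" for p
      proof -
        have "(\<Prod>j\<in>UNIV. R i $ j $ p j) = R i $ i $ p i * (\<Prod>j\<in>UNIV - {i}. R i $ j $ p j)"
          by (rule prod.remove) auto
        also have "(\<Prod>j\<in>UNIV - {i}. R i $ j $ p j) = (\<Prod>j\<in>UNIV - {i}. M x $ j $ p j)"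
          by (rule prod.cong) (auto simp: R_def)
        finally show ?thesis by (simp add: R_def)
      qed
      then show "(\<Sum>p\<in>?P. of_int (sign p) * (D i (p i) v * (\<Prod>j\<in>UNIV - {i}. M x $ j $ p j))) = det (R i)"
        by (simp add: det_def)
    qed
    also have "\<dots> = (\<Sum>i\<in>UNIV. (\<Sum>j\<in>UNIV. B $ j $ i * D i j v) * det (M x))"
    proof (rule sum.cong[OF refl])
      fix i
      define c where "c = (\<chi> k. \<Sum>j\<in>UNIV. D i j v * B $ j $ k)"
      have "(\<Sum>k\<in>UNIV. c $ k *s row k (M x)) $ l = D i l v" for l
      proof -
        have "(\<Sum>k\<in>UNIV. c $ k *s row k (M x)) $ l = (\<Sum>k\<in>UNIV. \<Sum>j\<in>UNIV. D i j v * (B $ j $ k * M x $ k $ l))"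
          by (simp add: c_def row_def sum_distrib_right mult.assoc)
        also have "\<dots> = (\<Sum>j\<in>UNIV. D i j v * (B ** M x) $ j $ l)"
          by (subst sum.swap) (simp add: matrix_matrix_mult_def sum_distrib_left)
        also have "\<dots> = D i l v" unfolding inv by (simp add: mat_def if_distrib[of "\<lambda>t. _ * t"] cong: if_cong)
        finally show ?thesis .
      qed
      then have "R i = (\<chi> k. if k = i then \<Sum>k\<in>UNIV. c $ k *s row k (M x) else row k (M x))"
        by (simp add: R_def row_def vec_eq_iff)
      then have "det (R i) = c $ i * det (M x)" using cramer_lemma_transpose[of i c "M x"] by simp
      then show "det (R i) = (\<Sum>j\<in>UNIV. B $ j $ i * D i j v) * det (M x)"
        by (simp add: c_def mult.commute)
    qed
    finally show ?thesis by (simp add: sum_distrib_right[symmetric] sum_distrib_left[symmetric] mult.commute)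
  qed
  ultimately show ?thesis by simp
qed

context hypersurface
begin

lemma metric_inv_symmetric:
  assumes "(V, f) \<in> \<A>" "w \<in> V"
  shows "metric_inv f w $ a $ b = metric_inv f w $ b $ a"
proof -
  let ?B = "metric_inv f w" and ?G = "induced_metric F f w"
  have G: "transpose ?G = ?G" by (simp add: transpose_def induced_metric_def vec_eq_iff inner_commute)
  have BG: "?B ** ?G = mat 1" by (rule metric_inv_mult[OF assms])
  then have "?G ** transpose ?B = mat 1" by (metis G matrix_transpose_mul transpose_mat)
  then have "transpose ?B = ?B" using BG by (metis matrix_mul_assoc matrix_mul_lid matrix_mul_rid)
  then have "transpose ?B $ b $ a = ?B $ b $ a" by simp
  then show ?thesis by (simp add: transpose_def)
qed

text \<open>Jacobi's formula for the Gram matrix. By symmetry of the inverse metric the two halves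
  of each derivative contribute equally, which absorbs the factor \<open>1/2\<close> of the square
  root.\<close>

lemma vol_derivative:
  assumes f: "(V, f) \<in> \<A>" "w \<in> V"
  shows "(vol f has_derivative (\<lambda>v. vol f w * (\<Sum>a\<in>UNIV. \<Sum>b\<in>UNIV. metric_inv f w $ a $ b *
    (frechet_derivative (\<lambda>u. dF f u (axis a 1)) (at w) v \<bullet> dF f w (axis b 1))))) (at w)"
proof -
  define T where "T a u = dF f u (axis a 1)" for a u
  define T' where "T' a = frechet_derivative (T a) (at w)" for a
  have T: "(T a has_derivative T' a) (at w)" for a
    unfolding T'_def T_def[abs_def] by (rule Ck_on_has_derivative[OF dF_smooth[OF f(1)] f(2)])
  let ?B = "metric_inv f w" and ?G = "induced_metric F f"
  have G: "((\<lambda>u. ?G u $ a $ b) has_derivative (\<lambda>v. T a w \<bullet> T' b v + T' a v \<bullet> T b w)) (at w)" for a b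
    unfolding induced_metric_def vec_lambda_beta T_def[symmetric] by (rule has_derivative_inner[OF T T])
  note det = has_derivative_det[OF G metric_inv_mult[OF f]]
  have eq: "(\<Sum>i\<in>UNIV. \<Sum>j\<in>UNIV. ?B $ j $ i * (T i w \<bullet> T' j v + T' i v \<bullet> T j w))
    = 2 * (\<Sum>a\<in>UNIV. \<Sum>b\<in>UNIV. ?B $ a $ b * (T' a v \<bullet> T b w))" for v
  proof -
    have "(\<Sum>i\<in>UNIV. \<Sum>j\<in>UNIV. ?B $ j $ i * (T i w \<bullet> T' j v))
        = (\<Sum>a\<in>UNIV. \<Sum>b\<in>UNIV. ?B $ a $ b * (T' a v \<bullet> T b w))"
      by (subst sum.swap) (simp add: inner_commute)
    moreover have "(\<Sum>i\<in>UNIV. \<Sum>j\<in>UNIV. ?B $ j $ i * (T' i v \<bullet> T j w))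
        = (\<Sum>a\<in>UNIV. \<Sum>b\<in>UNIV. ?B $ a $ b * (T' a v \<bullet> T b w))"
      by (intro sum.cong refl) (simp add: metric_inv_symmetric[OF f])
    ultimately show ?thesis by (simp add: distrib_left sum.distrib)
  qed
  have pos: "det (?G w) > 0" by (rule metric_det_pos[OF f])
  have "(vol f has_derivative (\<lambda>v. (det (?G w) * (\<Sum>i\<in>UNIV. \<Sum>j\<in>UNIV. ?B $ j $ i * (T i w \<bullet> T' j v + T' i v \<bullet> T j w))) * (inverse (sqrt (det (?G w))) / 2))) (at w)"
    unfolding vol_def[abs_def]
    using has_derivative_real_sqrt[OF pos det] by (simp add: field_simps)
  then have d: "(vol f has_derivative (\<lambda>v. (det (?G w) * (2 * (\<Sum>a\<in>UNIV. \<Sum>b\<in>UNIV. ?B $ a $ b * (T' a v \<bullet> T b w)))) * (inverse (sqrt (det (?G w))) / 2))) (at w)"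
    unfolding eq .
  have "(det (?G w) * (2 * X)) * (inverse (sqrt (det (?G w))) / 2) = vol f w * X" for X
    unfolding vol_def using pos real_sqrt_mult_self[of "det (?G w)"]
    by (simp add: field_simps)
  with d have "(vol f has_derivative (\<lambda>v. vol f w * (\<Sum>a\<in>UNIV. \<Sum>b\<in>UNIV. ?B $ a $ b * (T' a v \<bullet> T b w)))) (at w)"
    by (simp only:)
  then show ?thesis by (simp add: T'_def T_def[abs_def])
qed

text \<open>The contravariant components of the field in the chart: pair with the coordinate
  vectors, then raise the index with \<open>metric_inv\<close>.\<close>

definition coord :: "('m \<Rightarrow> 'p \<Rightarrow> real) \<Rightarrow> (real^'n \<Rightarrow> 'p) \<Rightarrow> real^'n \<Rightarrow> real^'n" where
  "coord W f u = (\<chi> a. \<Sum>b\<in>UNIV. metric_inv f u $ a $ b * ((\<chi> i. W i (f u)) \<bullet> dF f u (axis b 1)))"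

lemma coord_smooth:
  assumes f: "(V, f) \<in> \<A>" and W: "\<And>i. smk k (W i)"
  shows "Ck_on k V (\<lambda>u. coord W f u $ a)"
  unfolding coord_def vec_lambda_beta
  by (intro Ck_on_sum Ck_on_mult Ck_on_inner Ck_on_vec_lambda metric_inv_smooth[OF f] dF_smooth[OF f] smkD[OF W f] chart_open[OF f])

lemma dF_coord:
  assumes f: "(V, f) \<in> \<A>" "u \<in> V" and tang: "\<And>p. (\<Sum>i\<in>UNIV. \<nu> p $ i * W i p) = 0"
  shows "dF f u (coord W f u) = (\<chi> i. W i (f u))"
proof -
  let ?W = "\<chi> i. W i (f u)"
  note L = dF_linear[OF f]
  have "?W \<bullet> \<nu> (f u) = 0" using tang[of "f u"] by (simp add: inner_vec_def mult.commute)
  then obtain c where c: "?W = dF f u c" using tangent_range[OF f] by blast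
  have "coord W f u $ a = c $ a" for a
  proof -
    have "?W \<bullet> dF f u (axis b 1) = (\<Sum>k\<in>UNIV. induced_metric F f u $ b $ k * c $ k)" for b
      unfolding c by (subst linear_eq_sum_axis[OF L]) (simp add: inner_sum_left inner_commute[of _ "dF f u (axis b 1)"] inner_sum_right induced_metric_def mult.commute)
    then have "coord W f u $ a = (\<Sum>b\<in>UNIV. \<Sum>k\<in>UNIV. metric_inv f u $ a $ b * (induced_metric F f u $ b $ k * c $ k))"
      by (simp add: coord_def sum_distrib_left)
    also have "\<dots> = ((metric_inv f u ** induced_metric F f u) *v c) $ a"
      by (subst sum.swap) (simp add: matrix_matrix_mult_def matrix_vector_mult_def sum_distrib_right mult.assoc)
    finally show ?thesis by (simp add: metric_inv_mult[OF f])
  qed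
  then show ?thesis unfolding c by (metis vec_eq_iff)
qed

text \<open>The classical coordinate formula for the Riemannian divergence; it identifies the
  ambient trace of the tangential derivatives with that divergence. The contracted Christoffel terms
  on the two sides agree by symmetry of the second derivatives of the immersion.\<close>

lemma chart_divergence:
  assumes f: "(V, f) \<in> \<A>" "w \<in> V" and W: "\<And>i. smk (Suc 0) (W i)"
    and tang: "\<And>p. (\<Sum>i\<in>UNIV. \<nu> p $ i * W i p) = 0"
  shows "(\<Sum>a\<in>UNIV. frechet_derivative (\<lambda>u. vol f u * coord W f u $ a) (at w) (axis a 1))
    = vol f w * (\<Sum>i\<in>UNIV. \<delta> i (W i) (f w))"
proof -
  let ?B = "metric_inv f w" and ?G = "induced_metric F f w"
  define T where "T a u = dF f u (axis a 1)" for a u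
  define T' where "T' a = frechet_derivative (T a) (at w)" for a
  define Z where "Z a u = coord W f u $ a" for a u
  define Z' where "Z' a = frechet_derivative (Z a) (at w)" for a
  define WW where "WW u = (\<chi> i. W i (f u))" for u
  have T: "(T a has_derivative T' a) (at w)" for a
    unfolding T'_def T_def[abs_def] by (rule Ck_on_has_derivative[OF dF_smooth[OF f(1)] f(2)])
  have Z: "(Z a has_derivative Z' a) (at w)" for a
    unfolding Z'_def Z_def[abs_def] by (rule Ck_on_has_derivative[OF coord_smooth[OF f(1) W] f(2)])
  have T'_sym: "T' a (axis b 1) = T' b (axis a 1)" for a b
    unfolding T'_def T_def[abs_def] by (rule dF_derivative_symmetric[OF f])
  have WW: "WW u = (\<Sum>c\<in>UNIV. Z c u *\<^sub>R T c u)" if u: "u \<in> V" for u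
    using linear_eq_sum_axis[OF dF_linear[OF f(1) u], of "coord W f u"] dF_coord[OF f(1) u tang]
    by (simp add: WW_def Z_def T_def)
  \<comment> \<open>The contracted Christoffel symbol, which is also the logarithmic derivative of
    the density.\<close>
  define \<Gamma> where "\<Gamma> c = (\<Sum>a\<in>UNIV. \<Sum>b\<in>UNIV. ?B $ a $ b * (T' a (axis c 1) \<bullet> T b w))" for c
  have dvol: "(vol f has_derivative (\<lambda>v. vol f w * (\<Sum>a\<in>UNIV. \<Sum>b\<in>UNIV. ?B $ a $ b * (T' a v \<bullet> T b w)))) (at w)"
    using vol_derivative[OF f] by (simp add: T_def[abs_def] T'_def)
  have lhs: "frechet_derivative (\<lambda>u. vol f u * coord W f u $ a) (at w) (axis a 1)
    = vol f w * (Z' a (axis a 1) + \<Gamma> a * Z a w)" for a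
    unfolding Z_def[symmetric]
    by (subst frechet_derivative_eqI[OF has_derivative_mult[OF dvol Z]]) (simp add: \<Gamma>_def algebra_simps)
  have dW: "((\<lambda>u. W i (f u)) has_derivative (\<lambda>v. \<Sum>c\<in>UNIV. Z c w * T' c v $ i + Z' c v * T c w $ i)) (at w)" for i
  proof -
    have "((\<lambda>u. \<Sum>c\<in>UNIV. Z c u * T c u $ i) has_derivative (\<lambda>v. \<Sum>c\<in>UNIV. Z c w * T' c v $ i + Z' c v * T c w $ i)) (at w)"
      by (intro has_derivative_sum has_derivative_mult Z bounded_linear.has_derivative[OF bounded_linear_vec_nth] T)
    moreover have "(\<Sum>c\<in>UNIV. Z c u * T c u $ i) = W i (f u)" if "u \<in> V" for u
    proof -
      have "WW u $ i = (\<Sum>c\<in>UNIV. Z c u * T c u $ i)" by (simp add: WW[OF that])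
      then show ?thesis by (simp add: WW_def)
    qed
    ultimately show ?thesis
      by (rule has_derivative_transform_within_open[OF _ chart_open[OF f(1)] f(2)])
  qed
  have "\<delta> i (W i) (f w) = (\<Sum>a\<in>UNIV. \<Sum>b\<in>UNIV. ?B $ a $ b * ((\<Sum>c\<in>UNIV. Z c w * T' c (axis a 1) $ i + Z' c (axis a 1) * T c w $ i) * T b w $ i))" for i
  proof -
    have "grad (W i) (f w) = grad_formula (W i) f w" by (rule grad_eqI[OF W is_grad_formula[OF W f]])
    then show ?thesis
      by (simp add: \<delta>_def grad_formula_def frechet_derivative_eqI[OF dW] T_def mult_ac)
  qed
  then have "(\<Sum>i\<in>UNIV. \<delta> i (W i) (f w)) = (\<Sum>a\<in>UNIV. \<Sum>b\<in>UNIV. ?B $ a $ b * (\<Sum>i\<in>UNIV. (\<Sum>c\<in>UNIV. Z c w * T' c (axis a 1) $ i + Z' c (axis a 1) * T c w $ i) * T b w $ i))"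
    unfolding sum_distrib_left by (simp only:) (rule sum_swap3)
  also have "\<dots> = (\<Sum>a\<in>UNIV. \<Sum>b\<in>UNIV. ?B $ a $ b * (\<Sum>c\<in>UNIV. Z c w * (T' c (axis a 1) \<bullet> T b w) + Z' c (axis a 1) * (T c w \<bullet> T b w)))"
  proof (intro sum.cong refl arg_cong[where f = "\<lambda>t. _ * t"])
    fix a b
    show "(\<Sum>i\<in>UNIV. (\<Sum>c\<in>UNIV. Z c w * T' c (axis a 1) $ i + Z' c (axis a 1) * T c w $ i) * T b w $ i)
      = (\<Sum>c\<in>UNIV. Z c w * (T' c (axis a 1) \<bullet> T b w) + Z' c (axis a 1) * (T c w \<bullet> T b w))"
      unfolding sum_distrib_right
      by (subst sum.swap) (simp add: inner_vec_def sum_distrib_left sum.distrib distrib_right mult.assoc)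
  qed
  also have "\<dots> = (\<Sum>a\<in>UNIV. \<Sum>b\<in>UNIV. \<Sum>c\<in>UNIV. Z c w * (?B $ a $ b * (T' a (axis c 1) \<bullet> T b w)))
      + (\<Sum>a\<in>UNIV. \<Sum>b\<in>UNIV. \<Sum>c\<in>UNIV. Z' c (axis a 1) * (?B $ a $ b * (T c w \<bullet> T b w)))"
    unfolding sum.distrib[symmetric] sum_distrib_left
  proof (intro sum.cong refl)
    fix a b c
    show "?B $ a $ b * (Z c w * (T' c (axis a 1) \<bullet> T b w) + Z' c (axis a 1) * (T c w \<bullet> T b w))
      = Z c w * (?B $ a $ b * (T' a (axis c 1) \<bullet> T b w)) + Z' c (axis a 1) * (?B $ a $ b * (T c w \<bullet> T b w))"
      unfolding T'_sym[of c a] by (simp add: algebra_simps)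
  qed
  also have "(\<Sum>a\<in>UNIV. \<Sum>b\<in>UNIV. \<Sum>c\<in>UNIV. Z c w * (?B $ a $ b * (T' a (axis c 1) \<bullet> T b w))) = (\<Sum>c\<in>UNIV. Z c w * \<Gamma> c)"
    unfolding \<Gamma>_def sum_distrib_left by (rule sum_swap3[symmetric])
  also have "(\<Sum>a\<in>UNIV. \<Sum>b\<in>UNIV. \<Sum>c\<in>UNIV. Z' c (axis a 1) * (?B $ a $ b * (T c w \<bullet> T b w)))
      = (\<Sum>a\<in>UNIV. \<Sum>c\<in>UNIV. Z' c (axis a 1) * (?B ** ?G) $ a $ c)"
    by (rule sum.cong[OF refl], subst sum.swap)
      (simp add: matrix_matrix_mult_def sum_distrib_left induced_metric_def T_def inner_commute)
  also have "\<dots> = (\<Sum>a\<in>UNIV. Z' a (axis a 1))"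
    unfolding metric_inv_mult[OF f] by (simp add: mat_def if_distrib[of "\<lambda>t. _ * t"] cong: if_cong)
  finally show ?thesis unfolding lhs by (simp add: sum_distrib_left[symmetric] sum.distrib mult.commute)
qed

end

section \<open>Integration by parts in the parameter space against Lipschitz functions\<close>

lemma integrable_compact_support_lborel:
  fixes g :: "'a::euclidean_space \<Rightarrow> real"
  assumes g: "g \<in> borel_measurable borel" and bd: "\<And>x. \<bar>g x\<bar> \<le> B" and supp: "\<And>x. x \<notin> cball w r \<Longrightarrow> g x = 0"
  shows "integrable lborel g"
proof (rule Bochner_Integration.integrable_bound)
  show "integrable lborel (\<lambda>x. B * indicator (cball w r) x)"
    using emeasure_lborel_cball_finite[of w r] by (intro integrable_mult_right integrable_real_indicator) auto
  show "g \<in> borel_measurable lborel" using g by simp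
  have "\<bar>g x\<bar> \<le> \<bar>B * indicator (cball w r) x\<bar>" for x
    using bd[of x] supp[of x] by (cases "x \<in> cball w r") auto
  then show "AE x in lborel. norm (g x) \<le> norm (B * indicator (cball w r) x)" by simp
qed

lemma lborel_integral_translate:
  fixes g :: "'a::euclidean_space \<Rightarrow> real"
  assumes "g \<in> borel_measurable borel"
  shows "(\<integral>x. g (c + x) \<partial>lborel) = integral\<^sup>L lborel g"
proof -
  have "integral\<^sup>L (distr lborel borel ((+) c)) g = (\<integral>x. g (c + x) \<partial>lborel)"
    by (rule integral_distr) (use assms in auto)
  then show ?thesis by (simp add: lborel_distr_plus)
qed

lemma bounded_of_compact_support:
  fixes g :: "real^'n \<Rightarrow> real"
  assumes g: "continuous_on UNIV g" and supp: "\<And>u. u \<notin> cball w r \<Longrightarrow> g u = 0"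
  shows "\<exists>B>0. \<forall>u. \<bar>g u\<bar> \<le> B"
proof -
  have "bounded (g ` cball w r)"
    by (intro compact_imp_bounded compact_continuous_image continuous_on_subset[OF g] compact_cball) auto
  then obtain B where B: "B > 0" "\<And>u. u \<in> cball w r \<Longrightarrow> \<bar>g u\<bar> \<le> B" unfolding bounded_pos by auto
  have "\<bar>g u\<bar> \<le> B" for u using B supp[of u] by (cases "u \<in> cball w r") auto
  then show ?thesis using B(1) by blast
qed

lemma frechet_derivative_outside:
  fixes y :: "real^'n \<Rightarrow> real"
  assumes supp: "\<And>u. u \<notin> cball w r \<Longrightarrow> y u = 0" and u: "u \<notin> cball w r"
  shows "frechet_derivative y (at u) v = 0"
proof -
  have "frechet_derivative y (at u) = frechet_derivative (\<lambda>_. 0) (at u)"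
    by (rule frechet_derivative_cong_open[of "- cball w r"]) (use assms in auto)
  then show ?thesis by simp
qed

text \<open>The derivative of \<open>y\<close> is replaced by difference quotients, which are moved onto the merely
  Lipschitz function \<open>\<eta>\<close> by translation invariance.\<close>

lemma integration_by_parts_bound:
  fixes y \<eta> b :: "real^'n \<Rightarrow> real"
  assumes y: "Ck_on (Suc 0) UNIV y" and supp: "\<And>u. u \<notin> cball w r \<Longrightarrow> y u = 0"
    and \<eta>: "\<eta> \<in> borel_measurable borel" "\<And>u. \<bar>\<eta> u\<bar> \<le> M"
    and b: "b \<in> borel_measurable borel" "\<And>u. 0 \<le> b u" "\<And>u. b u \<le> L"
    and \<tau>: "\<tau> > 0" and lip: "\<And>u t. u \<in> cball w r \<Longrightarrow> 0 < t \<Longrightarrow> t \<le> \<tau> \<Longrightarrow> \<bar>\<eta> (u - t *\<^sub>R E) - \<eta> u\<bar> \<le> L * t"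
    and slope: "\<And>u \<epsilon>. u \<in> cball w r \<Longrightarrow> \<epsilon> > 0 \<Longrightarrow> \<forall>\<^sub>F t in at_right 0. \<bar>\<eta> (u - t *\<^sub>R E) - \<eta> u\<bar> \<le> (b u + \<epsilon>) * t"
  shows "\<bar>\<integral>u. \<eta> u * frechet_derivative y (at u) E \<partial>lborel\<bar> \<le> (\<integral>u. \<bar>y u\<bar> * b u \<partial>lborel)"
proof -
  define y' where "y' u = frechet_derivative y (at u) E" for u
  have dy: "(y has_derivative frechet_derivative y (at u)) (at u)" for u
    by (rule Ck_on_has_derivative[OF y]) simp
  have cy: "continuous_on UNIV y" by (rule Ck_on_imp_continuous_on[OF y])
  have cy': "continuous_on UNIV y'" using y unfolding y'_def by simp
  have y'0: "y' u = 0" if "u \<notin> cball w r" for u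
    unfolding y'_def by (rule frechet_derivative_outside[OF supp that])
  obtain By where By: "By > 0" "\<And>u. \<bar>y u\<bar> \<le> By" using bounded_of_compact_support[OF cy supp] by blast
  obtain B where B: "B > 0" "\<And>u. \<bar>y' u\<bar> \<le> B" using bounded_of_compact_support[OF cy' y'0] by blast
  have M: "M \<ge> 0" using \<eta>(2)[of w] by linarith
  have L: "L \<ge> 0" using b(2,3)[of w] by linarith
  have along: "((\<lambda>s. y (u + s *\<^sub>R E)) has_real_derivative y' (u + s *\<^sub>R E)) (at s)" for u s
  proof -
    have "((\<lambda>s. u + s *\<^sub>R E) has_derivative (\<lambda>h. h *\<^sub>R E)) (at s)" by (auto intro!: derivative_eq_intros)
    from has_derivative_compose[OF this dy]
    have "((\<lambda>s. y (u + s *\<^sub>R E)) has_derivative (\<lambda>h. frechet_derivative y (at (u + s *\<^sub>R E)) (h *\<^sub>R E))) (at s)" .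
    then show ?thesis
      unfolding has_field_derivative_def y'_def
      by (simp add: linear_cmul[OF has_derivative_linear[OF dy]] mult.commute[of _ "frechet_derivative y (at (u + s *\<^sub>R E)) E"])
  qed
  define t where "t n = \<tau> / real (Suc n)" for n
  have t: "0 < t n" "t n \<le> \<tau>" for n using \<tau> by (auto simp: t_def field_simps)
  have t0: "t \<longlonglongrightarrow> 0" unfolding t_def by real_asymp
  have tr: "filterlim t (at_right 0) sequentially"
    using t0 t(1) less_imp_neq[OF t(1), symmetric] by (simp add: filterlim_at)
  define q where "q n u = (y (u + t n *\<^sub>R E) - y u) / t n" for n u
  have q_lim: "(\<lambda>n. q n u) \<longlonglongrightarrow> y' u" for u
  proof -
    have "((\<lambda>h. (y (u + (0 + h) *\<^sub>R E) - y (u + 0 *\<^sub>R E)) / h) \<longlongrightarrow> y' (u + 0 *\<^sub>R E)) (at 0)"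
      using along[of u 0] unfolding DERIV_def .
    then have "((\<lambda>h. (y (u + h *\<^sub>R E) - y u) / h) \<longlongrightarrow> y' u) (at_right 0)"
      by (simp add: filterlim_at_split)
    then show ?thesis unfolding q_def using tr by (rule filterlim_compose)
  qed
  have q_bound: "\<bar>q n u\<bar> \<le> B" for n u
  proof -
    obtain z where "y (u + t n *\<^sub>R E) - y (u + 0 *\<^sub>R E) = (t n - 0) * y' (u + z *\<^sub>R E)"
      using MVT2[OF t(1)[of n], of "\<lambda>s. y (u + s *\<^sub>R E)" "\<lambda>s. y' (u + s *\<^sub>R E)"] along by blast
    then have "q n u = y' (u + z *\<^sub>R E)" using t(1)[of n] by (simp add: q_def)
    then show ?thesis using B(2) by simp
  qed
  define r' where "r' = \<bar>r\<bar> + \<tau> * norm E"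
  have q_supp: "q n u = 0" if "u \<notin> cball w r'" for n u
  proof -
    have "norm (t n *\<^sub>R E) \<le> \<tau> * norm E" using t[of n] by (simp add: mult_right_mono)
    moreover have "dist w u > r'" using that by simp
    moreover have "dist w u \<le> dist w (u + t n *\<^sub>R E) + norm (t n *\<^sub>R E)"
      using dist_triangle[of w u "u + t n *\<^sub>R E"] by (simp add: dist_norm)
    moreover have "0 \<le> \<tau> * norm E" using \<tau> by simp
    ultimately have "u \<notin> cball w r" "u + t n *\<^sub>R E \<notin> cball w r"
      using t(1)[of n] by (auto simp: r'_def)
    then show ?thesis by (simp add: q_def supp)
  qed
  have my: "y \<in> borel_measurable borel" and my': "y' \<in> borel_measurable borel"
    using cy cy' by (auto intro: borel_measurable_continuous_onI)
  have mq: "q n \<in> borel_measurable borel" for n unfolding q_def using my by measurable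
  have lim1: "(\<lambda>n. \<integral>u. \<eta> u * q n u \<partial>lborel) \<longlonglongrightarrow> (\<integral>u. \<eta> u * y' u \<partial>lborel)"
  proof (rule integral_dominated_convergence[where w = "\<lambda>u. M * B * indicator (cball w r') u"])
    show "integrable lborel (\<lambda>u. M * B * indicator (cball w r') u)"
      using emeasure_lborel_cball_finite[of w r'] by (intro integrable_mult_right integrable_real_indicator) auto
    show "AE u in lborel. (\<lambda>n. \<eta> u * q n u) \<longlonglongrightarrow> \<eta> u * y' u" by (intro AE_I2 tendsto_mult_left q_lim)
    show "AE u in lborel. norm (\<eta> u * q n u) \<le> M * B * indicator (cball w r') u" for n
    proof (intro AE_I2)
      fix u
      show "norm (\<eta> u * q n u) \<le> M * B * indicator (cball w r') u"
      proof (cases "u \<in> cball w r'")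
        case True
        then show ?thesis using mult_mono[OF \<eta>(2)[of u] q_bound[of n u] M] by (simp add: abs_mult)
      qed (simp add: q_supp)
    qed
  qed (use \<eta>(1) mq my' in auto)
  define s where "s n u = \<bar>\<eta> (u - t n *\<^sub>R E) - \<eta> u\<bar> / t n" for n u
  have ms: "s n \<in> borel_measurable borel" for n unfolding s_def using \<eta>(1) by measurable
  have s_le: "s n u \<le> L" if "u \<in> cball w r" for n u
    using lip[OF that t] t(1)[of n] by (simp add: s_def pos_divide_le_eq)
  \<comment> \<open>Only an upper bound is known for the limiting difference quotient. Taking the
    maximum with \<open>b u\<close> forces actual convergence to \<open>b u\<close>, as dominated
    convergence requires.\<close>
  define g where "g n u = \<bar>y u\<bar> * max (b u) (s n u)" for n u
  have g_bound: "\<bar>g n u\<bar> \<le> By * L * indicator (cball w r) u" for n u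
  proof (cases "u \<in> cball w r")
    case True
    have "\<bar>y u\<bar> * max (b u) (s n u) \<le> By * L"
      by (rule mult_mono) (use By L b(2,3)[of u] s_le[OF True, of n] in auto)
    moreover have "g n u \<ge> 0" using b(2)[of u] by (simp add: g_def)
    ultimately show ?thesis using True by (simp add: g_def)
  qed (simp add: g_def supp)
  have mg: "g n \<in> borel_measurable borel" for n unfolding g_def using my b(1) ms by measurable
  have bound: "\<bar>\<integral>u. \<eta> u * q n u \<partial>lborel\<bar> \<le> (\<integral>u. g n u \<partial>lborel)" for n
  proof -
    have int0: "integrable lborel (\<lambda>u. \<eta> u * y u)"
    proof (rule integrable_compact_support_lborel[where B = "M * By" and w = w and r = r])
      show "\<bar>\<eta> u * y u\<bar> \<le> M * By" for u using mult_mono[OF \<eta>(2)[of u] By(2)[of u] M] by (simp add: abs_mult)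
    qed (use \<eta>(1) my supp in auto)
    have int1: "integrable lborel (\<lambda>u. \<eta> (u - t n *\<^sub>R E) * y u)"
    proof (rule integrable_compact_support_lborel[where B = "M * By" and w = w and r = r])
      show "\<bar>\<eta> (u - t n *\<^sub>R E) * y u\<bar> \<le> M * By" for u
        using mult_mono[OF \<eta>(2)[of "u - t n *\<^sub>R E"] By(2)[of u] M] by (simp add: abs_mult)
      show "(\<lambda>u. \<eta> (u - t n *\<^sub>R E) * y u) \<in> borel_measurable borel" using \<eta>(1) my by measurable
    qed (use supp in auto)
    have int2: "integrable lborel (\<lambda>u. \<eta> u * y (u + t n *\<^sub>R E))"
    proof -
      have "(\<lambda>u. \<eta> u * y (u + t n *\<^sub>R E)) = (\<lambda>u. \<eta> u * q n u * t n + \<eta> u * y u)"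
        using t(1)[of n] by (auto simp: q_def fun_eq_iff field_simps)
      moreover have "integrable lborel (\<lambda>u. \<eta> u * q n u)"
      proof (rule integrable_compact_support_lborel[where B = "M * B" and w = w and r = r'])
        show "\<bar>\<eta> u * q n u\<bar> \<le> M * B" for u using mult_mono[OF \<eta>(2)[of u] q_bound[of n u] M] by (simp add: abs_mult)
      qed (use \<eta>(1) mq q_supp in auto)
      ultimately show ?thesis using int0 by simp
    qed
    have "(\<integral>u. \<eta> u * y (u + t n *\<^sub>R E) \<partial>lborel) = (\<integral>u. \<eta> (u - t n *\<^sub>R E) * y u \<partial>lborel)"
    proof -
      have "(\<lambda>u. \<eta> (u - t n *\<^sub>R E) * y u) \<in> borel_measurable borel" using \<eta>(1) my by measurable
      from lborel_integral_translate[OF this, of "t n *\<^sub>R E"] show ?thesis by (simp add: add.commute)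
    qed
    then have "(\<integral>u. \<eta> u * q n u \<partial>lborel) = (\<integral>u. (\<eta> (u - t n *\<^sub>R E) - \<eta> u) * y u \<partial>lborel) / t n"
      using int0 int1 int2 by (simp add: q_def right_diff_distrib left_diff_distrib diff_divide_distrib)
    also have "\<dots> = (\<integral>u. (\<eta> (u - t n *\<^sub>R E) - \<eta> u) / t n * y u \<partial>lborel)" by simp
    also have "\<bar>\<dots>\<bar> \<le> (\<integral>u. \<bar>(\<eta> (u - t n *\<^sub>R E) - \<eta> u) / t n * y u\<bar> \<partial>lborel)"
      by (rule integral_abs_bound)
    also have "\<dots> \<le> (\<integral>u. g n u \<partial>lborel)"
    proof (rule integral_mono)
      show "integrable lborel (\<lambda>u. \<bar>(\<eta> (u - t n *\<^sub>R E) - \<eta> u) / t n * y u\<bar>)"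
        using int0 int1 by (intro integrable_abs) (simp add: left_diff_distrib diff_divide_distrib)
      show "integrable lborel (g n)"
      proof (rule integrable_compact_support_lborel[OF mg[of n], of "By * L" w r])
        show "\<bar>g n u\<bar> \<le> By * L" for u using g_bound[of n u] By(1) L by (cases "u \<in> cball w r") auto
        show "g n u = 0" if "u \<notin> cball w r" for u using supp[OF that] by (simp add: g_def)
      qed
      show "\<bar>(\<eta> (u - t n *\<^sub>R E) - \<eta> u) / t n * y u\<bar> \<le> g n u" for u
      proof -
        have "\<bar>(\<eta> (u - t n *\<^sub>R E) - \<eta> u) / t n * y u\<bar> = \<bar>y u\<bar> * s n u"
          using t(1)[of n] by (simp add: s_def abs_mult)
        also have "\<dots> \<le> g n u" unfolding g_def by (rule mult_left_mono) auto
        finally show ?thesis .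
      qed
    qed
    finally show ?thesis .
  qed
  have lim2: "(\<lambda>n. \<integral>u. g n u \<partial>lborel) \<longlonglongrightarrow> (\<integral>u. \<bar>y u\<bar> * b u \<partial>lborel)"
  proof (rule integral_dominated_convergence[where w = "\<lambda>u. By * L * indicator (cball w r) u"])
    show "integrable lborel (\<lambda>u. By * L * indicator (cball w r) u)"
      using emeasure_lborel_cball_finite[of w r] by (intro integrable_mult_right integrable_real_indicator) auto
    show "AE u in lborel. norm (g n u) \<le> By * L * indicator (cball w r) u" for n
      using g_bound[of n] by simp
    show "AE u in lborel. (\<lambda>n. g n u) \<longlonglongrightarrow> \<bar>y u\<bar> * b u"
    proof (intro AE_I2)
      fix u
      show "(\<lambda>n. g n u) \<longlonglongrightarrow> \<bar>y u\<bar> * b u"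
      proof (cases "u \<in> cball w r")
        case True
        have "(\<lambda>n. max (b u) (s n u)) \<longlonglongrightarrow> b u"
        proof (rule LIMSEQ_I)
          fix \<epsilon> :: real assume \<epsilon>: "\<epsilon> > 0"
          have "\<forall>\<^sub>F n in sequentially. \<bar>\<eta> (u - t n *\<^sub>R E) - \<eta> u\<bar> \<le> (b u + \<epsilon>/2) * t n"
            by (rule eventually_compose_filterlim[OF slope[OF True] tr]) (use \<epsilon> in simp)
          then obtain N where N: "\<And>n. n \<ge> N \<Longrightarrow> \<bar>\<eta> (u - t n *\<^sub>R E) - \<eta> u\<bar> \<le> (b u + \<epsilon>/2) * t n"
            unfolding eventually_sequentially by blast
          have "norm (max (b u) (s n u) - b u) < \<epsilon>" if "n \<ge> N" for n
          proof -
            have "s n u \<le> b u + \<epsilon>/2" using N[OF that] t(1)[of n] by (simp add: s_def pos_divide_le_eq)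
            then show ?thesis using \<epsilon> by (auto simp: max_def)
          qed
          then show "\<exists>N. \<forall>n\<ge>N. norm (max (b u) (s n u) - b u) < \<epsilon>" by blast
        qed
        then show ?thesis unfolding g_def by (rule tendsto_mult_left)
      qed (simp add: g_def supp)
    qed
  qed (use mg my b(1) in auto)
  have "(\<lambda>n. \<bar>\<integral>u. \<eta> u * q n u \<partial>lborel\<bar>) \<longlonglongrightarrow> \<bar>\<integral>u. \<eta> u * y' u \<partial>lborel\<bar>"
    using lim1 by (rule tendsto_rabs)
  then have "\<bar>\<integral>u. \<eta> u * y' u \<partial>lborel\<bar> \<le> (\<integral>u. \<bar>y u\<bar> * b u \<partial>lborel)"
    using lim2 by (rule LIMSEQ_le) (use bound in blast)
  then show ?thesis by (simp add: y'_def)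
qed

text \<open>A cutoff together with a pointwise bound \<open>b\<close> for its local Lipschitz
  constant. After composition with the distance, \<open>b\<close> stands in for the length of the
  gradient without any differentiation of the distance; the single constant \<open>L\<close>
  provides the domination.\<close>

definition upper_slope :: "(real \<Rightarrow> real) \<Rightarrow> (real \<Rightarrow> real) \<Rightarrow> real \<Rightarrow> bool" where
  "upper_slope \<theta> b L \<longleftrightarrow> b \<in> borel_measurable borel \<and> (\<forall>t. \<bar>\<theta> t\<bar> \<le> L \<and> 0 \<le> b t \<and> b t \<le> L) \<and>
     (\<forall>s t. \<bar>\<theta> s - \<theta> t\<bar> \<le> L * \<bar>s - t\<bar>) \<and>
     (\<forall>t. \<forall>\<epsilon>>0. \<forall>\<^sub>F s in nhds t. \<bar>\<theta> s - \<theta> t\<bar> \<le> (b t + \<epsilon>) * \<bar>s - t\<bar>)"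

lemma upper_slopeD:
  assumes "upper_slope \<theta> b L"
  shows "b \<in> borel_measurable borel" "\<bar>\<theta> t\<bar> \<le> L" "0 \<le> b t" "b t \<le> L" "\<bar>\<theta> s - \<theta> t\<bar> \<le> L * \<bar>s - t\<bar>"
    "\<epsilon> > 0 \<Longrightarrow> \<forall>\<^sub>F s in nhds t. \<bar>\<theta> s - \<theta> t\<bar> \<le> (b t + \<epsilon>) * \<bar>s - t\<bar>"
  using assms by (auto simp: upper_slope_def)

lemma upper_slope_continuous:
  assumes "upper_slope \<theta> b L" shows "continuous_on UNIV \<theta>"
proof -
  have "L \<ge> 0" using upper_slopeD(2)[OF assms, of 0] by linarith
  then have "L-lipschitz_on UNIV \<theta>"
    using upper_slopeD(5)[OF assms] by (auto simp: lipschitz_on_def dist_real_def)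
  then show ?thesis by (rule lipschitz_on_continuous_on)
qed

text \<open>The corner of the positive part disappears on squaring. This elementary profile serves
  the bump functions and the denominator of the partition of unity.\<close>

lemma Ck_on_max_square: "Ck_on (Suc 0) UNIV (\<lambda>x::real. (max 0 x)\<^sup>2)"
proof (rule Ck_on_real_deriv[OF open_UNIV, where g' = "\<lambda>x. 2 * max 0 x"])
  show "Ck_on 0 UNIV (\<lambda>x::real. 2 * max 0 x)" by (simp add: continuous_intros)
  fix x :: real
  show "((\<lambda>x. (max 0 x)\<^sup>2) has_real_derivative 2 * max 0 x) (at x)"
  proof (cases "x = 0")
    case True
    have "((\<lambda>h::real. (max 0 (0 + h))\<^sup>2 / h) \<longlongrightarrow> 0) (at 0)"
    proof (rule Lim_null_comparison[where g = "\<lambda>h. \<bar>h\<bar>"])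
      show "\<forall>\<^sub>F h in at 0. norm ((max 0 (0 + h))\<^sup>2 / h) \<le> \<bar>h::real\<bar>"
        by (intro always_eventually allI) (auto simp: max_def power2_eq_square)
    qed (auto intro!: tendsto_eq_intros)
    then show ?thesis using True by (simp add: DERIV_def)
  next
    case False
    then consider "x > 0" | "x < 0" by linarith
    then show ?thesis
    proof cases
      case 1
      have "((\<lambda>x. x\<^sup>2) has_real_derivative 2 * max 0 x) (at x)" using 1 by (auto intro!: derivative_eq_intros)
      then show ?thesis by (rule has_field_derivative_transform_within_open[of _ _ _ "{0<..}"]) (use 1 in auto)
    next
      case 2
      have "((\<lambda>x. 0) has_real_derivative 2 * max 0 x) (at x)" using 2 by simp
      then show ?thesis by (rule has_field_derivative_transform_within_open[of _ _ _ "{..<0}"]) (use 2 in auto)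
    qed
  qed
qed

section \<open>The divergence inequality inside one chart\<close>

context hypersurface
begin

text \<open>Constant directions that are orthonormal at \<open>w\<close> only. Constancy matters
  because the difference quotients are translations of the parameter space.\<close>

lemma chart_frame:
  assumes f: "(V, f) \<in> \<A>" "w \<in> V"
  obtains E :: "'n \<Rightarrow> real^'n" where "\<And>j. norm (dF f w (E j)) = 1"
    "\<And>x. (\<Sum>j\<in>UNIV. (dF f w x \<bullet> dF f w (E j)) *\<^sub>R E j) = x"
proof -
  have fin: "finite (UNIV :: 'n set)" by simp
  obtain W and E :: "'n \<Rightarrow> real^'n \<Rightarrow> real^'n" where "w \<in> W"
    and *: "\<forall>u\<in>W. \<forall>i\<in>UNIV. \<forall>j\<in>UNIV. dF f u (E i u) \<bullet> dF f u (E j u) = (if i = j then 1 else 0)"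
    using partial_frame_exists[OF f fin] by (elim exE conjE)
  then have E: "dF f w (E i w) \<bullet> dF f w (E j w) = (if i = j then 1 else 0)" for i j by simp
  note L = dF_linear[OF f]
  have "norm (dF f w (E j w)) = 1" for j using E[of j j] by (simp add: norm_eq_sqrt_inner)
  moreover have "(\<Sum>j\<in>UNIV. (dF f w x \<bullet> dF f w (E j w)) *\<^sub>R E j w) = x" for x
  proof -
    have "dF f w x = (\<Sum>j\<in>UNIV. (dF f w x \<bullet> dF f w (E j w)) *\<^sub>R dF f w (E j w))"
      by (rule tangent_orthonormal_expansion[of _ "f w"]) (use E normal_orth[OF f] in \<open>auto simp: inner_commute\<close>)
    also have "\<dots> = dF f w (\<Sum>j\<in>UNIV. (dF f w x \<bullet> dF f w (E j w)) *\<^sub>R E j w)"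
      by (simp add: linear_sum[OF L] linear_cmul[OF L])
    finally have eq: "dF f w x = dF f w (\<Sum>j\<in>UNIV. (dF f w x \<bullet> dF f w (E j w)) *\<^sub>R E j w)" .
    show ?thesis by (rule injD[OF dF_inj[OF f] eq[symmetric]])
  qed
  ultimately show ?thesis using that[of "\<lambda>j. E j w"] by blast
qed

lemma gdist_measurable [measurable]: "gdist p \<in> borel_measurable borel"
  by (rule borel_measurable_continuous_onI[OF continuous_on_gdist])

lemma \<delta>_zero_outside:
  assumes W: "smk (Suc 0) u" and K: "compact K" and supp: "\<And>q. q \<notin> K \<Longrightarrow> u q = 0" and q: "q \<notin> K"
  shows "\<delta> i u q = 0"
proof -
  have "grad u q = grad (\<lambda>_. 0) q"
    by (rule grad_cong_open[of u "\<lambda>_. 0" "- K"]) (use W smk_const compact_imp_closed[OF K] supp q in \<open>auto simp: open_Compl\<close>)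
  then show ?thesis by (simp add: \<delta>_def)
qed

text \<open>In the chart the divergence is a flat divergence, resolved along the constant directions
  of \<open>chart_frame\<close>. Comparing the metric with its value at \<open>w\<close> costs a
  factor 2 in the slope of the distance and a factor 2 in the components of the field; summation
  over directions gives the constant.\<close>

lemma chart_inequality:
  assumes f: "(V, f) \<in> \<A>" "w \<in> V" and s: "cball w s \<subseteq> V"
    and near: "\<And>z a. z \<in> cball w s \<Longrightarrow> norm (dF f z a) \<le> 2 * norm (dF f w a)"
      "\<And>z a. z \<in> cball w s \<Longrightarrow> norm (dF f w a) \<le> 2 * norm (dF f z a)"
    and r: "r < s"
    and W: "\<And>i. smk (Suc 0) (W i)" and tang: "\<And>p. (\<Sum>i\<in>UNIV. \<nu> p $ i * W i p) = 0"
    and supp: "\<And>i q. q \<notin> f ` cball w r \<Longrightarrow> W i q = 0"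
    and \<theta>: "upper_slope \<theta> b L"
  shows "\<bar>\<integral>q. \<theta> (gdist o' q) * (\<Sum>i\<in>UNIV. \<delta> i (W i) q) \<partial>d\<sigma>\<bar>
    \<le> 4 * real CARD('n) * (\<integral>q. b (gdist o' q) * norm (\<chi> i. W i q) \<partial>d\<sigma>)"
proof -
  note \<theta>D = upper_slopeD[OF \<theta>]
  have L: "L \<ge> 0" using \<theta>D(2)[of 0] by linarith
  have V: "open V" by (rule chart_open[OF f(1)])
  have rs: "cball w r \<subseteq> cball w s" using r by auto
  then have rV: "cball w r \<subseteq> V" using s by blast
  let ?K = "f ` cball w r"
  have K: "compact ?K"
    by (intro compact_continuous_image compact_cball continuous_on_subset[OF chart_cont[OF f(1)] rV])
  obtain E :: "'n \<Rightarrow> real^'n" where E: "\<And>j. norm (dF f w (E j)) = 1" "\<And>x. (\<Sum>j\<in>UNIV. (dF f w x \<bullet> dF f w (E j)) *\<^sub>R E j) = x"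
    using chart_frame[OF f] by blast
  \<comment> \<open>Extension by zero is smooth on the whole parameter space because the field is
    supported in a smaller closed ball.\<close>
  define Y where "Y a u = (if u \<in> V then vol f u * coord W f u $ a else 0)" for a u
  have coord0: "coord W f u = 0" if "u \<in> V" "u \<notin> cball w r" for u
  proof -
    have "f u \<notin> ?K" using inj_on_image_mem_iff[OF chart_inj[OF f(1)] that(1) rV] that(2) by simp
    then have z: "(\<chi> i. W i (f u)) = 0" using supp by (simp add: vec_eq_iff)
    show ?thesis unfolding coord_def z by (simp add: vec_eq_iff)
  qed
  have Y0: "Y a u = 0" if "u \<notin> cball w r" for a u using coord0[OF _ that] by (simp add: Y_def)
  have Y_smooth: "Ck_on (Suc 0) UNIV (Y a)" for a
  proof (rule Ck_on_local)
    fix u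
    have "Ck_on (Suc 0) V (Y a)"
      by (rule Ck_on_eqI[OF V Ck_on_mult[OF V vol_smooth[OF f(1)] coord_smooth[where W = W and a = a, OF f(1) W]]]) (simp add: Y_def)
    moreover have "Ck_on (Suc 0) (- cball w r) (Y a)"
      by (rule Ck_on_eqI[OF _ Ck_on_const[of _ _ 0]]) (use Y0 in auto)
    moreover have "u \<in> V \<or> u \<in> - cball w r" using rV by blast
    ultimately show "\<exists>U. open U \<and> u \<in> U \<and> Ck_on (Suc 0) (U \<inter> UNIV) (Y a)"
      using V open_Compl[OF closed_cball[of w r]] unfolding Int_UNIV_right by blast
  qed
  define c where "c a j = dF f w (axis a 1) \<bullet> dF f w (E j)" for a j
  \<comment> \<open>The component of the density-weighted field along \<open>E j\<close>, measured
    in the metric at \<open>w\<close>. The directional derivatives of these components add up to the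
    flat divergence.\<close>
  define y where "y j u = (\<Sum>a\<in>UNIV. c a j * Y a u)" for j u
  have y_smooth: "Ck_on (Suc 0) UNIV (y j)" for j
    unfolding y_def by (intro Ck_on_sum Ck_on_mult Ck_on_const Y_smooth open_UNIV)
  have y0: "y j u = 0" if "u \<notin> cball w r" for j u using Y0[OF that] by (simp add: y_def)
  have dY: "(Y a has_derivative frechet_derivative (Y a) (at u)) (at u)" for a u
    by (rule Ck_on_has_derivative[OF Y_smooth]) simp
  have cE: "(\<Sum>j\<in>UNIV. c a j * E j $ k) = (if k = a then 1 else 0)" for a k
  proof -
    have "(\<Sum>j\<in>UNIV. (dF f w (axis a 1) \<bullet> dF f w (E j)) *\<^sub>R E j) $ k = axis a 1 $ k" by (simp only: E(2))
    then show ?thesis by (simp add: c_def axis_def)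
  qed
  let ?D = "\<lambda>j u. frechet_derivative (y j) (at u) (E j)"
  have sum_y: "(\<Sum>j\<in>UNIV. ?D j u) = (\<Sum>a\<in>UNIV. frechet_derivative (Y a) (at u) (axis a 1))" for u
  proof -
    have "?D j u = (\<Sum>a\<in>UNIV. \<Sum>k\<in>UNIV. (c a j * E j $ k) * frechet_derivative (Y a) (at u) (axis k 1))" for j
    proof -
      have "(y j has_derivative (\<lambda>v. \<Sum>a\<in>UNIV. c a j * frechet_derivative (Y a) (at u) v)) (at u)"
        unfolding y_def[abs_def] by (intro has_derivative_sum has_derivative_mult_right dY)
      then have "?D j u = (\<Sum>a\<in>UNIV. c a j * frechet_derivative (Y a) (at u) (E j))"
        by (rule frechet_derivative_eqI)
      also have "\<dots> = (\<Sum>a\<in>UNIV. \<Sum>k\<in>UNIV. (c a j * E j $ k) * frechet_derivative (Y a) (at u) (axis k 1))"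
        by (subst linear_eq_sum_axis[OF has_derivative_linear[OF dY]]) (simp add: sum_distrib_left mult.assoc)
      finally show ?thesis .
    qed
    then have "(\<Sum>j\<in>UNIV. ?D j u) = (\<Sum>j\<in>UNIV. \<Sum>a\<in>UNIV. \<Sum>k\<in>UNIV. (c a j * E j $ k) * frechet_derivative (Y a) (at u) (axis k 1))"
      by (simp only:)
    also have "\<dots> = (\<Sum>a\<in>UNIV. \<Sum>k\<in>UNIV. \<Sum>j\<in>UNIV. (c a j * E j $ k) * frechet_derivative (Y a) (at u) (axis k 1))"
      by (rule sum_swap3)
    also have "\<dots> = (\<Sum>a\<in>UNIV. \<Sum>k\<in>UNIV. (if k = a then 1 else 0) * frechet_derivative (Y a) (at u) (axis k 1))"
      by (simp only: sum_distrib_right[symmetric] cE)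
    also have "\<dots> = (\<Sum>a\<in>UNIV. frechet_derivative (Y a) (at u) (axis a 1))"
      by (simp add: if_distrib[of "\<lambda>t. t * _"] cong: if_cong)
    finally show ?thesis .
  qed
  define \<eta> where "\<eta> u = (if u \<in> V then \<theta> (gdist o' (f u)) else 0)" for u
  define \<beta> where "\<beta> u = (if u \<in> V then 2 * b (gdist o' (f u)) else 0)" for u
  have c\<theta>: "continuous_on UNIV (\<lambda>q. \<theta> (gdist o' q))"
    by (rule continuous_on_compose2[OF upper_slope_continuous[OF \<theta>] continuous_on_gdist]) auto
  have c\<theta>f: "continuous_on V (\<lambda>u. \<theta> (gdist o' (f u)))"
    by (rule continuous_on_compose2[OF c\<theta> chart_cont[OF f(1)]]) auto
  have m\<eta>: "\<eta> \<in> borel_measurable borel"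
    unfolding \<eta>_def[abs_def] by (rule borel_measurable_if_open[OF V c\<theta>f])
  have mb: "(\<lambda>q. b (gdist o' q)) \<in> borel_measurable borel"
    using measurable_compose[OF gdist_measurable \<theta>D(1)] .
  have m\<beta>: "\<beta> \<in> borel_measurable borel"
  proof -
    have "(\<lambda>u. indicator V u * (2 * b (gdist o' (chart_map V f u)))) \<in> borel_measurable borel"
      using measurable_compose[OF chart_map_measurable[OF f(1)] mb] V by simp
    moreover have "\<beta> = (\<lambda>u. indicator V u * (2 * b (gdist o' (chart_map V f u))))"
      by (auto simp: \<beta>_def chart_map_def fun_eq_iff)
    ultimately show ?thesis by simp
  qed
  have div0: "\<delta> i (W i) q = 0" if "q \<notin> ?K" for i q
    by (rule \<delta>_zero_outside[OF W K supp that]) auto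
  have div_cont: "continuous_on UNIV (\<lambda>q. \<Sum>i\<in>UNIV. \<delta> i (W i) q)"
    by (intro smk_continuous[of 0] smk_sum smk_\<delta> W)
  have lhs: "(\<integral>q. \<theta> (gdist o' q) * (\<Sum>i\<in>UNIV. \<delta> i (W i) q) \<partial>d\<sigma>)
    = (\<integral>u. \<eta> u * (\<Sum>j\<in>UNIV. ?D j u) \<partial>lborel)"
  proof -
    have "(\<integral>q. \<theta> (gdist o' q) * (\<Sum>i\<in>UNIV. \<delta> i (W i) q) \<partial>d\<sigma>)
      = (\<integral>u. indicator V u * (vol f u * (\<theta> (gdist o' (f u)) * (\<Sum>i\<in>UNIV. \<delta> i (W i) (f u)))) \<partial>lborel)"
    proof (rule integral_volume_chart[OF f(1)])
      show "(\<lambda>q. \<theta> (gdist o' q) * (\<Sum>i\<in>UNIV. \<delta> i (W i) q)) \<in> borel_measurable borel"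
        by (intro borel_measurable_continuous_onI continuous_on_mult c\<theta> div_cont)
      show "\<theta> (gdist o' q) * (\<Sum>i\<in>UNIV. \<delta> i (W i) q) = 0" if "q \<notin> f ` V" for q
      proof -
        have "q \<notin> ?K" using that rV by blast
        then show ?thesis using div0 by simp
      qed
    qed
    also have "\<dots> = (\<integral>u. \<eta> u * (\<Sum>j\<in>UNIV. ?D j u) \<partial>lborel)"
    proof (rule Bochner_Integration.integral_cong[OF refl])
      fix u
      show "indicator V u * (vol f u * (\<theta> (gdist o' (f u)) * (\<Sum>i\<in>UNIV. \<delta> i (W i) (f u))))
        = \<eta> u * (\<Sum>j\<in>UNIV. ?D j u)"
      proof (cases "u \<in> V")
        case True
        have "frechet_derivative (Y a) (at u) = frechet_derivative (\<lambda>u. vol f u * coord W f u $ a) (at u)" for a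
          by (rule frechet_derivative_cong_open[OF V True]) (simp add: Y_def)
        then show ?thesis
          using chart_divergence[OF f(1) True W tang] True by (simp add: sum_y \<eta>_def)
      qed (simp add: \<eta>_def)
    qed
    finally show ?thesis .
  qed
  define WW where "WW q = (\<chi> i. W i q)" for q
  have cWW: "continuous_on UNIV WW"
    unfolding WW_def by (intro continuous_on_vec_lambda smk_continuous[OF W])
  define G where "G u = indicator V u * (vol f u * (4 * b (gdist o' (f u)) * norm (WW (f u))))" for u
  have G0: "G u \<ge> 0" for u using vol_pos[OF f(1), of u] \<theta>D(3) by (auto simp: G_def indicator_def less_imp_le)
  have vW_cont: "continuous_on V (\<lambda>u. vol f u * norm (WW (f u)))"
    by (intro continuous_on_mult continuous_on_norm Ck_on_imp_continuous_on[OF vol_smooth[OF f(1)]]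
        continuous_on_compose2[OF cWW chart_cont[OF f(1)]]) auto
  have G_eq: "(\<integral>q. 4 * b (gdist o' q) * norm (WW q) \<partial>d\<sigma>) = (\<integral>u. G u \<partial>lborel)"
    unfolding G_def
  proof (rule integral_volume_chart[OF f(1)])
    have "(\<lambda>q. norm (WW q)) \<in> borel_measurable borel" by (intro borel_measurable_continuous_onI continuous_on_norm cWW)
    then show "(\<lambda>q. 4 * b (gdist o' q) * norm (WW q)) \<in> borel_measurable borel" using mb by simp
    show "4 * b (gdist o' q) * norm (WW q) = 0" if "q \<notin> f ` V" for q
    proof -
      have "q \<notin> ?K" using that rV by blast
      then have "WW q = 0" using supp by (simp add: WW_def vec_eq_iff)
      then show ?thesis by simp
    qed
  qed
  have G_int: "integrable lborel G"
  proof -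
    have "bounded ((\<lambda>u. vol f u * norm (WW (f u))) ` cball w r)"
      by (intro compact_imp_bounded compact_continuous_image compact_cball continuous_on_subset[OF vW_cont rV])
    then obtain B where B: "B > 0" "\<And>u. u \<in> cball w r \<Longrightarrow> \<bar>vol f u * norm (WW (f u))\<bar> \<le> B" unfolding bounded_pos by auto
    have Gz: "G u = 0" if "u \<notin> cball w r" for u
    proof (cases "u \<in> V")
      case True
      then have "f u \<notin> ?K" using inj_on_image_mem_iff[OF chart_inj[OF f(1)] True rV] that by simp
      then have "WW (f u) = 0" using supp by (simp add: WW_def vec_eq_iff)
      then show ?thesis by (simp add: G_def)
    qed (simp add: G_def)
    show ?thesis
    proof (rule integrable_compact_support_lborel[where B = "4 * L * B" and w = w and r = r])
      have "G = (\<lambda>u. (if u \<in> V then vol f u * norm (WW (f u)) else 0) * (2 * \<beta> u))"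
        by (auto simp: G_def \<beta>_def fun_eq_iff)
      then show "G \<in> borel_measurable borel"
        using borel_measurable_if_open[OF V vW_cont, of 0] m\<beta> by simp
      show "\<bar>G u\<bar> \<le> 4 * L * B" for u
      proof (cases "u \<in> cball w r")
        case True
        then have "G u = (4 * b (gdist o' (f u))) * (vol f u * norm (WW (f u)))" using rV by (auto simp: G_def)
        moreover have "\<bar>(4 * b (gdist o' (f u))) * (vol f u * norm (WW (f u)))\<bar> \<le> (4 * L) * B"
          unfolding abs_mult[of "4 * b (gdist o' (f u))"]
          by (rule mult_mono) (use B(2)[OF True] \<theta>D(3,4) L in auto)
        ultimately show ?thesis by simp
      qed (use Gz B(1) L in auto)
    qed (use Gz in auto)
  qed
  have each: "\<bar>\<integral>u. \<eta> u * ?D j u \<partial>lborel\<bar> \<le> (\<integral>u. G u \<partial>lborel)" for j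
  proof -
    \<comment> \<open>The gap between the two radii leaves room for translations up to
      \<open>\<tau>\<close>, along which the metric comparison remains valid.\<close>
    define \<tau> where "\<tau> = (s - r) / (norm (E j) + 1)"
    have \<tau>: "\<tau> > 0" "\<tau> * norm (E j) \<le> s - r"
    proof -
      show "\<tau> > 0" using r by (simp add: \<tau>_def add_nonneg_pos)
      have "norm (E j) + 1 > 0" by (simp add: add_nonneg_pos)
      then have "norm (E j) / (norm (E j) + 1) \<le> 1" by (simp add: pos_divide_le_eq)
      from mult_left_mono[OF this, of "s - r"] show "\<tau> * norm (E j) \<le> s - r" using r by (simp add: \<tau>_def)
    qed
    have move: "u - t *\<^sub>R E j \<in> V" "\<bar>gdist o' (f (u - t *\<^sub>R E j)) - gdist o' (f u)\<bar> \<le> 2 * t"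
      if u: "u \<in> cball w r" and t: "0 < t" "t \<le> \<tau>" for u t
    proof -
      have "norm (t *\<^sub>R E j) \<le> s - r" using mult_right_mono[OF t(2), of "norm (E j)"] \<tau>(2) t(1) by simp
      then have u': "u - t *\<^sub>R E j \<in> cball w s"
        using u norm_triangle_ineq4[of "u - w" "t *\<^sub>R E j"] by (simp add: dist_norm norm_minus_commute algebra_simps)
      then show "u - t *\<^sub>R E j \<in> V" using s by blast
      have seg: "closed_segment u (u - t *\<^sub>R E j) \<subseteq> cball w s"
        using u u' rs by (intro closed_segment_subset convex_cball) auto
      show "\<bar>gdist o' (f (u - t *\<^sub>R E j)) - gdist o' (f u)\<bar> \<le> 2 * t"
      proof (rule gdist_segment[OF f(1)])
        show "closed_segment u (u - t *\<^sub>R E j) \<subseteq> V" using seg s by blast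
        fix z assume "z \<in> closed_segment u (u - t *\<^sub>R E j)"
        then have z: "z \<in> cball w s" using seg by blast
        have "dF f z ((- t) *\<^sub>R E j) = (- t) *\<^sub>R dF f z (E j)"
          using linear_cmul[OF dF_linear[OF f(1)]] z s by blast
        then have "norm (dF f z (u - t *\<^sub>R E j - u)) = t * norm (dF f z (E j))" using t(1) by simp
        also have "\<dots> \<le> t * 2" using near(1)[OF z, of "E j"] E(1) t(1) by (intro mult_left_mono) auto
        finally show "norm (dF f z (u - t *\<^sub>R E j - u)) \<le> 2 * t" by (simp add: mult.commute)
      qed
    qed
    have "\<bar>\<integral>u. \<eta> u * ?D j u \<partial>lborel\<bar> \<le> (\<integral>u. \<bar>y j u\<bar> * \<beta> u \<partial>lborel)"
    proof (rule integration_by_parts_bound[OF y_smooth y0 m\<eta> _ m\<beta> _ _ \<tau>(1)])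
      show "\<bar>\<eta> u\<bar> \<le> L" for u using \<theta>D(2) L by (simp add: \<eta>_def)
      show "0 \<le> \<beta> u" for u using \<theta>D(3) by (simp add: \<beta>_def)
      show "\<beta> u \<le> 2 * L" for u using \<theta>D(4) L by (simp add: \<beta>_def)
      show "\<bar>\<eta> (u - t *\<^sub>R E j) - \<eta> u\<bar> \<le> 2 * L * t" if u: "u \<in> cball w r" and t: "0 < t" "t \<le> \<tau>" for u t
      proof -
        have "\<bar>\<eta> (u - t *\<^sub>R E j) - \<eta> u\<bar> = \<bar>\<theta> (gdist o' (f (u - t *\<^sub>R E j))) - \<theta> (gdist o' (f u))\<bar>"
          using move(1)[OF u t] u rV by (auto simp: \<eta>_def)
        also have "\<dots> \<le> L * \<bar>gdist o' (f (u - t *\<^sub>R E j)) - gdist o' (f u)\<bar>" by (rule \<theta>D(5))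
        also have "\<dots> \<le> L * (2 * t)" by (rule mult_left_mono[OF move(2)[OF u t] L])
        finally show ?thesis by simp
      qed
      show "\<forall>\<^sub>F t in at_right 0. \<bar>\<eta> (u - t *\<^sub>R E j) - \<eta> u\<bar> \<le> (\<beta> u + \<epsilon>) * t"
        if u: "u \<in> cball w r" and \<epsilon>: "\<epsilon> > 0" for u \<epsilon>
      proof -
        let ?d = "gdist o' (f u)"
        have "\<forall>\<^sub>F x in nhds ?d. \<bar>\<theta> x - \<theta> ?d\<bar> \<le> (b ?d + \<epsilon>/2) * \<bar>x - ?d\<bar>"
          by (rule \<theta>D(6)) (use \<epsilon> in simp)
        then obtain \<rho> where \<rho>: "\<rho> > 0" "\<And>x. dist x ?d < \<rho> \<Longrightarrow> \<bar>\<theta> x - \<theta> ?d\<bar> \<le> (b ?d + \<epsilon>/2) * \<bar>x - ?d\<bar>"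
          unfolding eventually_nhds_metric by blast
        have "\<bar>\<eta> (u - t *\<^sub>R E j) - \<eta> u\<bar> \<le> (\<beta> u + \<epsilon>) * t" if t: "0 < t" "t < min \<tau> (\<rho>/2)" for t
        proof -
          have t': "t \<le> \<tau>" using t by simp
          let ?x = "gdist o' (f (u - t *\<^sub>R E j))"
          have x: "\<bar>?x - ?d\<bar> \<le> 2 * t" by (rule move(2)[OF u t(1) t'])
          have "\<bar>\<eta> (u - t *\<^sub>R E j) - \<eta> u\<bar> = \<bar>\<theta> ?x - \<theta> ?d\<bar>"
            using move(1)[OF u t(1) t'] u rV by (auto simp: \<eta>_def)
          also have "\<dots> \<le> (b ?d + \<epsilon>/2) * \<bar>?x - ?d\<bar>"
            by (rule \<rho>(2)) (use x t in \<open>simp add: dist_real_def\<close>)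
          also have "\<dots> \<le> (b ?d + \<epsilon>/2) * (2 * t)"
            using x \<theta>D(3)[of ?d] \<epsilon> by (intro mult_left_mono) auto
          also have "\<dots> = (\<beta> u + \<epsilon>) * t" using u rV by (auto simp: \<beta>_def algebra_simps)
          finally show ?thesis .
        qed
        then show ?thesis
          unfolding eventually_at_right_field by (intro exI[of _ "min \<tau> (\<rho>/2)"]) (use \<tau>(1) \<rho>(1) in auto)
      qed
    qed
    also have "\<dots> \<le> (\<integral>u. G u \<partial>lborel)"
    proof (rule integral_mono'[OF G_int])
      show "\<bar>y j u\<bar> * \<beta> u \<le> G u" for u
      proof (cases "u \<in> cball w r")
        case True
        then have u: "u \<in> V" "u \<in> cball w s" using rV rs by auto
        have "y j u = vol f u * (dF f w (coord W f u) \<bullet> dF f w (E j))"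
          by (subst linear_eq_sum_axis[OF dF_linear[OF f]])
            (simp add: y_def Y_def u c_def inner_sum_left sum_distrib_left mult_ac)
        then have "\<bar>y j u\<bar> = vol f u * \<bar>dF f w (coord W f u) \<bullet> dF f w (E j)\<bar>"
          using vol_pos[OF f(1) u(1)] by (simp add: abs_mult)
        also have "\<dots> \<le> vol f u * (2 * norm (WW (f u)))"
        proof (rule mult_left_mono)
          have "\<bar>dF f w (coord W f u) \<bullet> dF f w (E j)\<bar> \<le> norm (dF f w (coord W f u)) * norm (dF f w (E j))"
            by (rule Cauchy_Schwarz_ineq2)
          also have "\<dots> \<le> 2 * norm (dF f u (coord W f u))" using near(2)[OF u(2)] E(1) by simp
          finally show "\<bar>dF f w (coord W f u) \<bullet> dF f w (E j)\<bar> \<le> 2 * norm (WW (f u))"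
            using dF_coord[OF f(1) u(1) tang] by (simp add: WW_def)
        qed (use vol_pos[OF f(1) u(1)] in simp)
        finally have "\<bar>y j u\<bar> * \<beta> u \<le> vol f u * (2 * norm (WW (f u))) * \<beta> u"
          by (rule mult_right_mono) (use \<theta>D(3) in \<open>simp add: \<beta>_def\<close>)
        then show ?thesis using u by (simp add: G_def \<beta>_def mult_ac)
      qed (use y0 G0 in auto)
    qed (rule G0)
    finally show ?thesis .
  qed
  have int: "integrable lborel (\<lambda>u. \<eta> u * ?D j u)" for j
  proof -
    have cont: "continuous_on UNIV (?D j)" using y_smooth[of j] by simp
    have z: "?D j u = 0" if "u \<notin> cball w r" for u by (rule frechet_derivative_outside[OF y0 that])
    obtain B where B: "B > 0" "\<And>u. \<bar>?D j u\<bar> \<le> B" using bounded_of_compact_support[OF cont z] by blast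
    show ?thesis
    proof (rule integrable_compact_support_lborel[where B = "L * B" and w = w and r = r])
      show "(\<lambda>u. \<eta> u * ?D j u) \<in> borel_measurable borel"
        using m\<eta> borel_measurable_continuous_onI[OF cont] by simp
      have "\<bar>\<eta> u\<bar> \<le> L" for u using \<theta>D(2) L by (simp add: \<eta>_def)
      then show "\<bar>\<eta> u * ?D j u\<bar> \<le> L * B" for u
        unfolding abs_mult using B(2) L by (intro mult_mono) auto
    qed (use z in auto)
  qed
  have "\<bar>\<integral>q. \<theta> (gdist o' q) * (\<Sum>i\<in>UNIV. \<delta> i (W i) q) \<partial>d\<sigma>\<bar>
      = \<bar>\<Sum>j\<in>UNIV. \<integral>u. \<eta> u * ?D j u \<partial>lborel\<bar>"
  proof -
    have "(\<integral>u. \<eta> u * (\<Sum>j\<in>UNIV. ?D j u) \<partial>lborel)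
      = (\<Sum>j\<in>UNIV. \<integral>u. \<eta> u * ?D j u \<partial>lborel)"
      unfolding sum_distrib_left by (rule Bochner_Integration.integral_sum) (rule int)
    then show ?thesis unfolding lhs by (simp only:)
  qed
  also have "\<dots> \<le> (\<Sum>j\<in>UNIV. \<bar>\<integral>u. \<eta> u * ?D j u \<partial>lborel\<bar>)" by (rule sum_abs)
  also have "\<dots> \<le> (\<Sum>j\<in>(UNIV :: 'n set). \<integral>u. G u \<partial>lborel)" by (rule sum_mono[OF each])
  also have "\<dots> = 4 * real CARD('n) * (\<integral>q. b (gdist o' q) * norm (\<chi> i. W i q) \<partial>d\<sigma>)"
    unfolding G_eq[symmetric] WW_def mult.assoc by simp
  finally show ?thesis .
qed

end

section \<open>Dyadic cutoffs and the divergent sum\<close>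

definition ramp :: "nat \<Rightarrow> real \<Rightarrow> real" where
  "ramp k t = max 0 (min 1 (3 - 2 * t / 2 ^ k))"

text \<open>The region on which \<open>ramp\<close> falls from 1 to 0. Ending at \<open>3/2\<close>
  times the power, short of the next power of 2, keeps different closed shells disjoint.\<close>

abbreviation shell :: "nat \<Rightarrow> real set" where
  "shell k \<equiv> {2 ^ k..3/2 * 2 ^ k}"

lemma ramp_bounds: "0 \<le> ramp k t" "ramp k t \<le> 1" by (auto simp: ramp_def)

lemma ramp_inside: "t \<le> 2 ^ k \<Longrightarrow> ramp k t = 1"
  by (simp add: ramp_def field_simps)

lemma ramp_outside: "3/2 * 2 ^ k \<le> t \<Longrightarrow> ramp k t = 0"
proof -
  assume "3/2 * 2 ^ k \<le> t"
  then have "3 \<le> 2 * t / 2 ^ k" by (simp add: le_divide_eq)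
  then show ?thesis by (simp add: ramp_def)
qed

lemma ramp_lipschitz: "\<bar>ramp k s - ramp k t\<bar> \<le> 2 / 2 ^ k * \<bar>s - t\<bar>"
proof -
  have "\<bar>ramp k s - ramp k t\<bar> \<le> \<bar>(3 - 2 * s / 2 ^ k) - (3 - 2 * t / 2 ^ k)\<bar>"
    unfolding ramp_def by (auto simp: max_def min_def)
  also have "(3 - 2 * s / 2 ^ k) - (3 - 2 * t / 2 ^ k) = 2 / 2 ^ k * (t - s)" by (simp add: right_diff_distrib)
  also have "\<bar>2 / 2 ^ k * (t - s)\<bar> = 2 / 2 ^ k * \<bar>s - t\<bar>"
    unfolding abs_mult by (simp add: abs_minus_commute)
  finally show ?thesis .
qed

lemma ramp_slope: "\<forall>\<^sub>F s in nhds t. \<bar>ramp k s - ramp k t\<bar> \<le> 2 / 2 ^ k * indicator (shell k) t * \<bar>s - t\<bar>"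
proof -
  consider "t \<in> shell k" | "t < 2 ^ k" | "t > 3/2 * 2 ^ k" by force
  then show ?thesis
  proof cases
    case 1
    then show ?thesis using ramp_lipschitz[of k _ t] by simp
  next
    case 2
    have "\<forall>\<^sub>F s in nhds t. s \<in> {..<2 ^ k}" by (rule eventually_nhds_in_open) (use 2 in auto)
    then show ?thesis by eventually_elim (use 2 in \<open>simp add: ramp_inside\<close>)
  next
    case 3
    have "\<forall>\<^sub>F s in nhds t. s \<in> {3/2 * 2 ^ k<..}" by (rule eventually_nhds_in_open) (use 3 in auto)
    then show ?thesis by eventually_elim (use 3 in \<open>simp add: ramp_outside\<close>)
  qed
qed

lemma shell_disjoint:
  assumes "t \<in> shell j" "t \<in> shell k" shows "j = k"
proof -
  have "\<not> j < k" if "t \<in> shell j" "t \<in> shell k" for j k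
  proof
    assume "j < k"
    then have "(2::real) ^ Suc j \<le> 2 ^ k" by (intro power_increasing) auto
    moreover have "(2::real) ^ j > 0" by simp
    moreover have "t \<le> 3/2 * 2 ^ j" "2 ^ k \<le> t" using that by simp_all
    ultimately show False unfolding power_Suc by linarith
  qed
  then show ?thesis using assms by (meson linorder_neqE_nat)
qed

text \<open>For weights of total 1 this is 1 near the centre and loses the amount \<open>a k\<close>
  on the shell \<open>k\<close>; the weights are left free for the optimisation of the
  energy.\<close>

definition cut :: "(nat \<Rightarrow> real) \<Rightarrow> nat set \<Rightarrow> real \<Rightarrow> real" where
  "cut a I t = (\<Sum>k\<in>I. a k * ramp k t)"

definition cut_slope :: "(nat \<Rightarrow> real) \<Rightarrow> nat set \<Rightarrow> real \<Rightarrow> real" where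
  "cut_slope a I t = (\<Sum>k\<in>I. a k * (2 / 2 ^ k) * indicator (shell k) t)"

text \<open>The shells are disjoint, so no mixed products survive. The energy thereby decouples into
  separate contributions of the shells.\<close>

lemma cut_slope_square:
  assumes I: "finite I"
  shows "(cut_slope a I t)\<^sup>2 = (\<Sum>k\<in>I. (a k * (2 / 2 ^ k))\<^sup>2 * indicator (shell k) t)"
proof -
  have "(cut_slope a I t)\<^sup>2 = (\<Sum>k\<in>I. \<Sum>j\<in>I. (a k * (2 / 2 ^ k) * indicator (shell k) t) * (a j * (2 / 2 ^ j) * indicator (shell j) t))"
    by (simp only: cut_slope_def power2_eq_square sum_product)
  also have "\<dots> = (\<Sum>k\<in>I. \<Sum>j\<in>I. if k = j then (a k * (2 / 2 ^ k))\<^sup>2 * indicator (shell k) t else 0)"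
  proof (intro sum.cong refl)
    fix k j
    show "(a k * (2 / 2 ^ k) * indicator (shell k) t) * (a j * (2 / 2 ^ j) * indicator (shell j) t)
      = (if k = j then (a k * (2 / 2 ^ k))\<^sup>2 * indicator (shell k) t else 0)"
    proof (cases "k = j")
      case True
      then show ?thesis by (cases "t \<in> shell k") (simp_all add: power2_eq_square)
    next
      case False
      then have "indicat_real (shell k) t = 0 \<or> indicat_real (shell j) t = 0"
        using shell_disjoint by (metis indicator_simps(2))
      then show ?thesis using False by (elim disjE) simp_all
    qed
  qed
  also have "\<dots> = (\<Sum>k\<in>I. (a k * (2 / 2 ^ k))\<^sup>2 * indicator (shell k) t)" using I by simp
  finally show ?thesis .
qed

lemma cut_slope_measurable: "cut_slope a I \<in> borel_measurable borel"
  unfolding cut_slope_def[abs_def] by measurable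

lemma cut_facts:
  assumes a: "\<And>k. a k \<ge> 0" and sum1: "(\<Sum>k\<in>I. a k) = 1"
  shows "0 \<le> cut a I t" "cut a I t \<le> 1" "0 \<le> cut_slope a I t"
    and "(\<And>k. k \<in> I \<Longrightarrow> K \<le> k) \<Longrightarrow> t \<le> 2 ^ K \<Longrightarrow> cut a I t = 1"
    and "(\<And>k. k \<in> I \<Longrightarrow> k < N) \<Longrightarrow> 2 ^ N \<le> t \<Longrightarrow> cut a I t = 0 \<and> cut_slope a I t = 0"
proof -
  show "0 \<le> cut a I t" unfolding cut_def by (intro sum_nonneg mult_nonneg_nonneg a ramp_bounds)
  have "cut a I t \<le> (\<Sum>k\<in>I. a k * 1)" unfolding cut_def by (intro sum_mono mult_left_mono a ramp_bounds)
  then show "cut a I t \<le> 1" using sum1 by simp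
  show "0 \<le> cut_slope a I t" unfolding cut_slope_def by (intro sum_nonneg mult_nonneg_nonneg a) auto
  show "cut a I t = 1" if K: "\<And>k. k \<in> I \<Longrightarrow> K \<le> k" "t \<le> 2 ^ K"
  proof -
    have "ramp k t = 1" if "k \<in> I" for k
      by (rule ramp_inside, rule order_trans[OF K(2)], rule power_increasing[OF K(1)[OF that]]) simp
    then show ?thesis using sum1 by (simp add: cut_def)
  qed
  show "cut a I t = 0 \<and> cut_slope a I t = 0" if N: "\<And>k. k \<in> I \<Longrightarrow> k < N" "2 ^ N \<le> t"
  proof -
    have t: "t > 3/2 * 2 ^ k" if "k \<in> I" for k
    proof -
      have "(2::real) ^ Suc k \<le> 2 ^ N" using N(1)[OF that] by (intro power_increasing) auto
      moreover have "(2::real) ^ k > 0" by simp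
      ultimately show ?thesis using N(2) unfolding power_Suc by linarith
    qed
    have "cut a I t = 0" unfolding cut_def using t by (intro sum.neutral ballI) (simp add: ramp_outside less_imp_le)
    moreover have "cut_slope a I t = 0" unfolding cut_slope_def using t by (intro sum.neutral ballI) (force simp: indicator_def)
    ultimately show ?thesis by blast
  qed
qed

lemma cut_square_slope:
  assumes I: "finite I" and a: "\<And>k. a k \<ge> 0" and sum1: "(\<Sum>k\<in>I. a k) = 1"
  shows "\<exists>L. upper_slope (\<lambda>t. (cut a I t)\<^sup>2) (\<lambda>t. 2 * cut a I t * cut_slope a I t) L"
proof -
  define \<Lambda> where "\<Lambda> = (\<Sum>k\<in>I. a k * (2 / 2 ^ k))"
  have \<Lambda>: "\<Lambda> \<ge> 0" unfolding \<Lambda>_def by (intro sum_nonneg mult_nonneg_nonneg a) auto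
  note cf = cut_facts[OF a sum1]
  have lip: "\<bar>cut a I s - cut a I t\<bar> \<le> \<Lambda> * \<bar>s - t\<bar>" for s t
  proof -
    have "\<bar>cut a I s - cut a I t\<bar> = \<bar>\<Sum>k\<in>I. a k * (ramp k s - ramp k t)\<bar>"
      by (simp add: cut_def sum_subtractf right_diff_distrib)
    also have "\<dots> \<le> (\<Sum>k\<in>I. \<bar>a k * (ramp k s - ramp k t)\<bar>)" by (rule sum_abs)
    also have "\<dots> \<le> (\<Sum>k\<in>I. a k * (2 / 2 ^ k * \<bar>s - t\<bar>))"
      by (intro sum_mono) (simp only: abs_mult abs_of_nonneg[OF a] mult_left_mono[OF ramp_lipschitz a])
    finally show ?thesis by (simp add: \<Lambda>_def sum_distrib_right mult.assoc)
  qed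
  have slope: "\<forall>\<^sub>F s in nhds t. \<bar>cut a I s - cut a I t\<bar> \<le> cut_slope a I t * \<bar>s - t\<bar>" for t
  proof -
    have "\<forall>\<^sub>F s in nhds t. \<forall>k\<in>I. \<bar>ramp k s - ramp k t\<bar> \<le> 2 / 2 ^ k * indicator (shell k) t * \<bar>s - t\<bar>"
      using I ramp_slope by (intro eventually_ball_finite) auto
    then show ?thesis
    proof eventually_elim
      case (elim s)
      have "\<bar>cut a I s - cut a I t\<bar> = \<bar>\<Sum>k\<in>I. a k * (ramp k s - ramp k t)\<bar>"
        by (simp add: cut_def sum_subtractf right_diff_distrib)
      also have "\<dots> \<le> (\<Sum>k\<in>I. \<bar>a k * (ramp k s - ramp k t)\<bar>)" by (rule sum_abs)
      also have "\<dots> \<le> (\<Sum>k\<in>I. a k * (2 / 2 ^ k * indicator (shell k) t * \<bar>s - t\<bar>))"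
      proof (rule sum_mono)
        fix k assume "k \<in> I"
        with elim have "\<bar>ramp k s - ramp k t\<bar> \<le> 2 / 2 ^ k * indicator (shell k) t * \<bar>s - t\<bar>" by blast
        then show "\<bar>a k * (ramp k s - ramp k t)\<bar> \<le> a k * (2 / 2 ^ k * indicator (shell k) t * \<bar>s - t\<bar>)"
          unfolding abs_mult abs_of_nonneg[OF a] by (rule mult_left_mono[OF _ a])
      qed
      finally show ?case by (simp add: cut_slope_def sum_distrib_right mult.assoc)
    qed
  qed
  have slope_le: "cut_slope a I t \<le> \<Lambda>" for t
    unfolding cut_slope_def \<Lambda>_def using a by (intro sum_mono) (simp add: indicator_def)
  have cont: "continuous_on UNIV (cut a I)"
    unfolding cut_def[abs_def] ramp_def[abs_def] by (intro continuous_intros) auto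
  have sq: "\<bar>(cut a I s)\<^sup>2 - (cut a I t)\<^sup>2\<bar> = \<bar>cut a I s - cut a I t\<bar> * (cut a I s + cut a I t)" for s t
    using cf(1)[of s] cf(1)[of t] by (simp add: power2_eq_square square_diff_square_factored abs_mult)
  have "upper_slope (\<lambda>t. (cut a I t)\<^sup>2) (\<lambda>t. 2 * cut a I t * cut_slope a I t) (1 + 2 * \<Lambda>)"
    unfolding upper_slope_def
  proof (intro conjI allI impI)
    show "(\<lambda>t. 2 * cut a I t * cut_slope a I t) \<in> borel_measurable borel"
      using borel_measurable_continuous_onI[OF cont] cut_slope_measurable by measurable
    fix t
    have "(cut a I t)\<^sup>2 \<le> 1" using cf(1,2)[of t] by (simp add: power_le_one)
    then show "\<bar>(cut a I t)\<^sup>2\<bar> \<le> 1 + 2 * \<Lambda>" using \<Lambda> by simp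
    show "0 \<le> 2 * cut a I t * cut_slope a I t" using cf(1,3)[of t] by simp
    have "cut a I t * cut_slope a I t \<le> 1 * \<Lambda>"
      by (rule mult_mono) (use cf(1,2,3)[of t] slope_le \<Lambda> in auto)
    then show "2 * cut a I t * cut_slope a I t \<le> 1 + 2 * \<Lambda>" by simp
    fix s
    have "\<bar>cut a I s - cut a I t\<bar> * (cut a I s + cut a I t) \<le> (\<Lambda> * \<bar>s - t\<bar>) * 2"
      by (rule mult_mono) (use lip cf(1,2)[of s] cf(1,2)[of t] \<Lambda> in auto)
    moreover have "\<Lambda> * \<bar>s - t\<bar> * 2 \<le> (1 + 2 * \<Lambda>) * \<bar>s - t\<bar>" by (simp add: algebra_simps)
    ultimately show "\<bar>(cut a I s)\<^sup>2 - (cut a I t)\<^sup>2\<bar> \<le> (1 + 2 * \<Lambda>) * \<bar>s - t\<bar>" unfolding sq by linarith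
  next
    fix t \<epsilon> :: real assume \<epsilon>: "\<epsilon> > 0"
    \<comment> \<open>The square has the expected slope up to an error of at most
      \<open>\<Lambda> * \<Lambda> * \<bar>s - t\<bar>\<close> in the coefficient; this radius makes
      the error at most \<open>\<epsilon>\<close>.\<close>
    have near: "\<forall>\<^sub>F s in nhds t. s \<in> ball t (\<epsilon> / (\<Lambda> * \<Lambda> + 1))"
      by (rule eventually_nhds_in_open) (use \<epsilon> \<Lambda> in \<open>auto simp: add_nonneg_pos\<close>)
    from slope[of t] near
    show "\<forall>\<^sub>F s in nhds t. \<bar>(cut a I s)\<^sup>2 - (cut a I t)\<^sup>2\<bar> \<le> (2 * cut a I t * cut_slope a I t + \<epsilon>) * \<bar>s - t\<bar>"
    proof eventually_elim
      case (elim s)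
      have "\<bar>s - t\<bar> * (\<Lambda> * \<Lambda> + 1) \<le> \<epsilon>"
        using elim(2) \<Lambda> by (simp add: dist_real_def abs_minus_commute pos_less_divide_eq add_nonneg_pos less_imp_le)
      then have small: "\<Lambda> * (\<Lambda> * \<bar>s - t\<bar>) \<le> \<epsilon>" by (simp add: algebra_simps)
      have "cut a I s + cut a I t \<le> 2 * cut a I t + \<Lambda> * \<bar>s - t\<bar>" using lip[of s t] by linarith
      then have "\<bar>cut a I s - cut a I t\<bar> * (cut a I s + cut a I t)
          \<le> (cut_slope a I t * \<bar>s - t\<bar>) * (2 * cut a I t + \<Lambda> * \<bar>s - t\<bar>)"
        using elim(1) cf(1)[of s] cf(1,3)[of t] by (intro mult_mono) auto
      also have "\<dots> = (2 * cut a I t * cut_slope a I t + cut_slope a I t * (\<Lambda> * \<bar>s - t\<bar>)) * \<bar>s - t\<bar>"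
        by (simp add: algebra_simps)
      also have "\<dots> \<le> (2 * cut a I t * cut_slope a I t + \<epsilon>) * \<bar>s - t\<bar>"
      proof (rule mult_right_mono)
        have "cut_slope a I t * (\<Lambda> * \<bar>s - t\<bar>) \<le> \<Lambda> * (\<Lambda> * \<bar>s - t\<bar>)"
          by (rule mult_right_mono[OF slope_le]) (use \<Lambda> in simp)
        then show "2 * cut a I t * cut_slope a I t + cut_slope a I t * (\<Lambda> * \<bar>s - t\<bar>) \<le> 2 * cut a I t * cut_slope a I t + \<epsilon>"
          using small by linarith
      qed simp
      finally show ?case unfolding sq .
    qed
  qed
  then show ?thesis by blast
qed

text \<open>Cauchy condensation. On the interval from \<open>r k\<close> to \<open>r (Suc k)\<close>
  the integrand is at most its value at the left end, so the integral there is at most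
  \<open>r k * r k / g (r k)\<close>, which is 4 times the summand. Bounded sums would make the
  integral finite.\<close>

lemma dyadic_sum_unbounded:
  fixes g :: "real \<Rightarrow> real"
  assumes \<delta>: "\<delta> > 0" and g: "\<And>t. t \<ge> \<delta> \<Longrightarrow> g t > 0" and anti: "antimono_on {\<delta>..} (\<lambda>t. t / g t)"
    and inf: "(\<integral>\<^sup>+t\<in>{\<delta>..}. ennreal (t / g t) \<partial>lborel) = \<infinity>" and K: "\<delta> \<le> 2 ^ K"
  shows "\<exists>n. B < (\<Sum>k<n. 4 ^ (K + k) / g (2 ^ (K + k + 1)))"
proof (rule ccontr)
  assume "\<not> ?thesis"
  then have B: "(\<Sum>k<n. 4 ^ (K + k) / g (2 ^ (K + k + 1))) \<le> B" for n by (simp add: not_less)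
  define r where "r k = (2::real) ^ (K + k + 1)" for k
  have r: "\<delta> \<le> r k" for k
  proof -
    have "(2::real) ^ K \<le> r k" unfolding r_def by (intro power_increasing) auto
    then show ?thesis using K by linarith
  qed
  have antiD: "t / g t \<le> s / g s" if "\<delta> \<le> s" "s \<le> t" for s t
    using monotone_onD[OF anti, of s t] that by simp
  define T where "T k t = ennreal (r k / g (r k)) * indicator {r k..r (Suc k)} t" for k t
  have "(\<integral>\<^sup>+t\<in>{\<delta>..}. ennreal (t / g t) \<partial>lborel) \<le> (\<integral>\<^sup>+t. ennreal (\<delta> / g \<delta>) * indicator {\<delta>..r 0} t + (\<Sum>k. T k t) \<partial>lborel)"
  proof (rule nn_integral_mono)
    fix t
    show "ennreal (t / g t) * indicator {\<delta>..} t \<le> ennreal (\<delta> / g \<delta>) * indicator {\<delta>..r 0} t + (\<Sum>k. T k t)"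
    proof (cases "t \<in> {\<delta>..r 0}")
      case True
      then have "ennreal (t / g t) \<le> ennreal (\<delta> / g \<delta>)" by (intro ennreal_leI antiD) auto
      then show ?thesis using True by (simp add: add_increasing2)
    next
      case False
      show ?thesis
      proof (cases "t \<ge> \<delta>")
        case True
        then have t: "t > r 0" using False by simp
        \<comment> \<open>The least power of 2 that is not below \<open>t\<close> places
          \<open>t\<close> in a single dyadic interval.\<close>
        obtain m where m: "t \<le> 2 ^ m" "\<And>j. j < m \<Longrightarrow> \<not> t \<le> 2 ^ j"
        proof -
          obtain m where "t < 2 ^ m" using real_arch_pow[of 2 t] by auto
          then have ex: "\<exists>m. t \<le> 2 ^ m" by (auto intro: less_imp_le)
          show ?thesis by (rule that[of "LEAST m. t \<le> 2 ^ m"]) (use LeastI_ex[OF ex] not_less_Least in auto)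
        qed
        have "m > K + 1"
        proof (rule ccontr)
          assume "\<not> m > K + 1"
          then have "(2::real) ^ m \<le> 2 ^ (K + 1)" by (intro power_increasing) auto
          then show False using t m(1) by (simp add: r_def)
        qed
        then obtain k where k: "m = K + k + 2" using less_iff_Suc_add[of "K + 1" m] by auto
        have "t \<ge> r k" using m(2)[of "K + k + 1"] k by (simp add: r_def)
        moreover have "t \<le> r (Suc k)" using m(1) k by (simp add: r_def)
        ultimately have "ennreal (t / g t) \<le> T k t"
          using antiD[OF r[of k]] by (simp add: T_def ennreal_leI)
        also have "\<dots> = sum (\<lambda>k. T k t) {k}" by simp
        also have "\<dots> \<le> (\<Sum>k. T k t)" by (rule sum_le_suminf) auto
        finally show ?thesis using True by (simp add: add_increasing)
      qed simp
    qed
  qed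
  also have "\<dots> = ennreal (\<delta> / g \<delta>) * emeasure lborel {\<delta>..r 0} + (\<Sum>k. \<integral>\<^sup>+t. T k t \<partial>lborel)"
    by (subst nn_integral_add) (auto simp: nn_integral_suminf nn_integral_cmult_indicator T_def[abs_def])
  also have "(\<Sum>k. \<integral>\<^sup>+t. T k t \<partial>lborel) \<le> ennreal (4 * B)"
  proof (rule suminf_le_const)
    fix n
    have "(\<integral>\<^sup>+t. T k t \<partial>lborel) = ennreal (4 * (4 ^ (K + k) / g (2 ^ (K + k + 1))))" for k
    proof -
      have rr: "r (Suc k) - r k = r k" "r k \<le> r (Suc k)" by (simp_all add: r_def)
      have "(\<integral>\<^sup>+t. T k t \<partial>lborel) = ennreal (r k / g (r k)) * ennreal (r k)"
        unfolding T_def using rr by (simp add: nn_integral_cmult_indicator)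
      also have "\<dots> = ennreal (r k / g (r k) * r k)"
        using \<delta> r[of k] by (intro ennreal_mult''[symmetric]) simp
      also have "r k / g (r k) * r k = 4 * (4 ^ (K + k) / g (2 ^ (K + k + 1)))"
      proof -
        have "r k * r k = (2 * 2) ^ (K + k + 1)" unfolding r_def by (rule power_mult_distrib[symmetric])
        also have "\<dots> = 4 * 4 ^ (K + k)" by simp
        finally have "r k * r k = 4 * 4 ^ (K + k)" .
        then show ?thesis by (simp add: r_def)
      qed
      finally show ?thesis .
    qed
    then have "(\<Sum>k<n. \<integral>\<^sup>+t. T k t \<partial>lborel) = ennreal (\<Sum>k<n. 4 * (4 ^ (K + k) / g (2 ^ (K + k + 1))))"
    proof (simp only:, intro sum_ennreal)
      fix k
      have "g (2 ^ (K + k + 1)) > 0" using g r[of k] unfolding r_def by blast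
      then show "0 \<le> 4 * (4 ^ (K + k) / g (2 ^ (K + k + 1)))" by simp
    qed
    also have "\<dots> \<le> ennreal (4 * B)"
      unfolding sum_distrib_left[symmetric] using B[of n] by (intro ennreal_leI) linarith
    finally show "(\<Sum>k<n. \<integral>\<^sup>+t. T k t \<partial>lborel) \<le> ennreal (4 * B)" .
  qed auto
  finally show False
    using inf emeasure_lborel_Icc[OF r[of 0]] by (auto simp: top_unique ennreal_mult_eq_top_iff ennreal_add_eq_top)
qed

section \<open>From charts to the whole hypersurface\<close>

context hypersurface
begin

text \<open>Near \<open>w\<close> the differential deviates from the one at \<open>w\<close> by at
  most half of the lower bound of the latter; this gives the factor 2 in both directions.\<close>

lemma good_chart:
  obtains V f w s where "(V, f) \<in> \<A>" "w \<in> V" "f w = p" "s > 0" "cball w s \<subseteq> V"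
    "\<And>z a. z \<in> cball w s \<Longrightarrow> norm (dF f z a) \<le> 2 * norm (dF f w a)"
    "\<And>z a. z \<in> cball w s \<Longrightarrow> norm (dF f w a) \<le> 2 * norm (dF f z a)"
proof -
  obtain V f w where f: "(V, f) \<in> \<A>" "w \<in> V" "f w = p" using atlas_cover .
  obtain \<kappa> where \<kappa>: "\<kappa> > 0" "\<And>a. \<kappa> * norm a \<le> norm (dF f w a)"
    using linear_inj_bounded_below_pos[OF dF_linear[OF f(1,2)] dF_inj[OF f(1,2)]] by (metis mult.commute)
  have \<kappa>2: "\<kappa> / 2 > 0" using \<kappa>(1) by simp
  obtain s where s: "s > 0" "cball w s \<subseteq> V" "\<And>z a. z \<in> cball w s \<Longrightarrow> norm (dF f z a - dF f w a) \<le> \<kappa> / 2 * norm a"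
    by (rule chart_close[OF f(1,2) \<kappa>2]) (rule that)
  have close: "norm (dF f z a - dF f w a) \<le> norm (dF f w a) / 2" if "z \<in> cball w s" for z a
    using s(3)[OF that, of a] \<kappa>(2)[of a] by simp
  show ?thesis
  proof (rule that[OF f s(1,2)])
    fix z a assume z: "z \<in> cball w s"
    show "norm (dF f z a) \<le> 2 * norm (dF f w a)"
      using close[OF z, of a] norm_triangle_ineq2[of "dF f z a" "dF f w a"] norm_ge_zero[of "dF f w a"] by linarith
    show "norm (dF f w a) \<le> 2 * norm (dF f z a)"
      using close[OF z, of a] norm_triangle_ineq3[of "dF f z a" "dF f w a"] by linarith
  qed
qed

lemma chart_bump:
  assumes f: "(V, f) \<in> \<A>" and s: "s > 0" "cball w s \<subseteq> V"
  obtains \<zeta> where "smk (Suc 0) \<zeta>" "\<And>q. \<zeta> q \<ge> 0" "\<And>q. q \<in> f ` ball w s \<Longrightarrow> \<zeta> q > 0"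
    "\<And>q. q \<notin> f ` cball w s \<Longrightarrow> \<zeta> q = 0"
proof -
  define \<beta> where "\<beta> u = (max 0 (s\<^sup>2 - (u - w) \<bullet> (u - w)))\<^sup>2" for u
  define \<zeta> where "\<zeta> q = (if q \<in> f ` V then \<beta> (inv_into V f q) else 0)" for q
  have in_cball: "(u - w) \<bullet> (u - w) \<le> s\<^sup>2 \<longleftrightarrow> u \<in> cball w s" "(u - w) \<bullet> (u - w) < s\<^sup>2 \<longleftrightarrow> u \<in> ball w s" for u
  proof -
    have eq: "(u - w) \<bullet> (u - w) = (dist w u)\<^sup>2" by (simp add: dist_norm power2_norm_eq_inner[symmetric] norm_minus_commute)
    show "(u - w) \<bullet> (u - w) \<le> s\<^sup>2 \<longleftrightarrow> u \<in> cball w s"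
      unfolding eq mem_cball using s(1) by (intro power_mono_iff) auto
    have "s\<^sup>2 \<le> (dist w u)\<^sup>2 \<longleftrightarrow> s \<le> dist w u" using s(1) by (intro power_mono_iff) auto
    then show "(u - w) \<bullet> (u - w) < s\<^sup>2 \<longleftrightarrow> u \<in> ball w s"
      unfolding eq mem_ball by linarith
  qed
  have \<zeta>f: "\<zeta> (f u) = \<beta> u" if "u \<in> V" for u
    using that inv_into_f_f[OF chart_inj[OF f] that] by (simp add: \<zeta>_def)
  have \<beta>0: "\<beta> u = 0" if "u \<notin> cball w s" for u
    using in_cball(1)[of u] that by (simp add: \<beta>_def max_def)
  have \<zeta>0: "\<zeta> q = 0" if q: "q \<notin> f ` cball w s" for q
  proof (cases "q \<in> f ` V")
    case True
    then have "inv_into V f q \<notin> cball w s" using q by (metis f_inv_into_f imageI)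
    then show ?thesis using \<beta>0 by (simp add: \<zeta>_def)
  qed (simp add: \<zeta>_def)
  have K: "closed (f ` cball w s)"
    by (intro compact_imp_closed compact_continuous_image compact_cball continuous_on_subset[OF chart_cont[OF f] s(2)])
  have \<beta>_smooth: "Ck_on (Suc 0) V \<beta>"
    unfolding \<beta>_def[abs_def]
    by (intro Ck_on_compose[OF chart_open[OF f] open_UNIV _ Ck_on_max_square] Ck_on_diff Ck_on_const Ck_on_inner
        chart_open[OF f] Ck_on_bounded_linear[OF bounded_linear_ident]) auto
  show ?thesis
  proof (rule that)
    show "smk (Suc 0) \<zeta>"
    proof (rule smk_local)
      fix p
      show "\<exists>V f U. (V, f) \<in> \<A> \<and> open U \<and> U \<subseteq> V \<and> p \<in> f ` U \<and> Ck_on (Suc 0) U (\<lambda>w. \<zeta> (f w))"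
      proof (cases "p \<in> f ` V")
        case True
        have "Ck_on (Suc 0) V (\<lambda>w. \<zeta> (f w))" by (rule Ck_on_eqI[OF chart_open[OF f] \<beta>_smooth \<zeta>f])
        then show ?thesis using f True chart_open[OF f] by blast
      next
        case False
        obtain V' g z where g: "(V', g) \<in> \<A>" "z \<in> V'" "g z = p" using atlas_cover .
        let ?U = "V' \<inter> g -` (- f ` cball w s)"
        have U: "open ?U" by (rule continuous_open_preimage[OF chart_cont[OF g(1)] chart_open[OF g(1)]]) (use K in auto)
        have "Ck_on (Suc 0) ?U (\<lambda>w. \<zeta> (g w))"
          by (rule Ck_on_eqI[OF U Ck_on_const[of _ _ 0]]) (use \<zeta>0 in auto)
        moreover have "p \<notin> f ` cball w s" using False s(2) by blast
        then have "p \<in> g ` ?U" using g by blast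
        ultimately show ?thesis using U g(1) by blast
      qed
    qed
    show "\<zeta> q \<ge> 0" for q by (simp add: \<zeta>_def \<beta>_def)
    show "\<zeta> q > 0" if q: "q \<in> f ` ball w s" for q
    proof -
      obtain u where u: "u \<in> ball w s" "q = f u" using q by blast
      then have "u \<in> V" using s(2) ball_subset_cball by blast
      moreover have "\<beta> u > 0" using u(1) in_cball(2)[of u] by (simp add: \<beta>_def)
      ultimately show ?thesis using \<zeta>f u(2) by simp
    qed
  qed (rule \<zeta>0)
qed

text \<open>Points at intrinsic distance below \<open>R\<close> lie in the preimage of a closed
  Euclidean ball, because chords are no longer than curves; properness makes this preimage
  compact.\<close>

lemma integrable_weight:
  fixes \<theta> :: "real \<Rightarrow> real" and g :: "'p \<Rightarrow> real"
  assumes proper: "properly_immersed F" and \<theta>: "\<theta> \<in> borel_measurable borel" "\<And>t. \<bar>\<theta> t\<bar> \<le> L" "\<And>t. t \<ge> R \<Longrightarrow> \<theta> t = 0"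
    and g: "continuous_on UNIV g"
  shows "integrable d\<sigma> (\<lambda>q. \<theta> (gdist o' q) * g q)"
proof -
  let ?K = "F -` cball (F o') R"
  have K: "compact ?K" using proper by (simp add: properly_immersed_def)
  have "bounded (g ` ?K)" by (intro compact_imp_bounded compact_continuous_image continuous_on_subset[OF g] K) auto
  then obtain B where B: "B > 0" "\<And>q. q \<in> ?K \<Longrightarrow> \<bar>g q\<bar> \<le> B" unfolding bounded_pos by auto
  show ?thesis
  proof (rule integrable_compact_support[OF K])
    show "(\<lambda>q. \<theta> (gdist o' q) * g q) \<in> borel_measurable borel"
      using measurable_compose[OF gdist_measurable \<theta>(1)] borel_measurable_continuous_onI[OF g] by simp
    show "\<theta> (gdist o' q) * g q = 0" if "q \<notin> ?K" for q
    proof -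
      have "R \<le> gdist o' q" using that displacement_le_gdist[of q o'] by (simp add: dist_norm norm_minus_commute)
      then show ?thesis using \<theta>(3) by simp
    qed
    show "\<bar>\<theta> (gdist o' q) * g q\<bar> \<le> L * B" if "q \<in> ?K" for q
      unfolding abs_mult using \<theta>(2)[of "gdist o' q"] B(2)[OF that] by (intro mult_mono) auto
  qed
qed

text \<open>A partition of unity reduces to charts whose metric is within a factor 2 of a constant one, so the
  constant depends on the dimension only.\<close>

lemma divergence_inequality:
  assumes proper: "properly_immersed F" and \<theta>: "upper_slope \<theta> b L"
    and R: "R > 0" "\<And>t. t \<ge> R \<Longrightarrow> \<theta> t = 0" "\<And>t. t \<ge> R \<Longrightarrow> b t = 0"
    and W: "\<And>i. smk (Suc 0) (W i)" and tang: "\<And>p. (\<Sum>i\<in>UNIV. \<nu> p $ i * W i p) = 0"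
  shows "\<bar>\<integral>q. \<theta> (gdist o' q) * (\<Sum>i\<in>UNIV. \<delta> i (W i) q) \<partial>d\<sigma>\<bar>
    \<le> 4 * real CARD('n) * (\<integral>q. b (gdist o' q) * norm (\<chi> i. W i q) \<partial>d\<sigma>)"
proof -
  note \<theta>D = upper_slopeD[OF \<theta>]
  let ?K = "F -` cball (F o') R"
  have K: "compact ?K" using proper by (simp add: properly_immersed_def)
  have "\<exists>V f w s. (V, f) \<in> \<A> \<and> w \<in> V \<and> f w = p \<and> s > 0 \<and> cball w s \<subseteq> V \<and>
    (\<forall>z\<in>cball w s. \<forall>a. norm (dF f z a) \<le> 2 * norm (dF f w a) \<and> norm (dF f w a) \<le> 2 * norm (dF f z a))" for p
    using good_chart[of p] by metis
  then obtain V f w s where *: "\<And>p. (V p, f p) \<in> \<A>" "\<And>p. w p \<in> V p" "\<And>p. f p (w p) = p" "\<And>p. s p > (0::real)"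
    "\<And>p. cball (w p) (s p) \<subseteq> V p"
    "\<And>p z a. z \<in> cball (w p) (s p) \<Longrightarrow> norm (dF (f p) z a) \<le> 2 * norm (dF (f p) (w p) a) \<and> norm (dF (f p) (w p) a) \<le> 2 * norm (dF (f p) z a)"
    by metis
  have half: "s p / 2 > 0" "cball (w p) (s p / 2) \<subseteq> V p" "s p / 2 < s p" for p
    using *(4,5)[of p] by (auto simp: subset_iff)
  have "\<exists>\<zeta>. smk (Suc 0) \<zeta> \<and> (\<forall>q. \<zeta> q \<ge> 0) \<and> (\<forall>q\<in>f p ` ball (w p) (s p / 2). \<zeta> q > 0) \<and> (\<forall>q. q \<notin> f p ` cball (w p) (s p / 2) \<longrightarrow> \<zeta> q = 0)" for p
    using chart_bump[OF *(1) half(1,2), of p] by metis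
  then obtain \<zeta> where \<zeta>: "\<And>p. smk (Suc 0) (\<zeta> p)" "\<And>p q. \<zeta> p q \<ge> 0" "\<And>p q. q \<in> f p ` ball (w p) (s p / 2) \<Longrightarrow> \<zeta> p q > 0"
    "\<And>p q. q \<notin> f p ` cball (w p) (s p / 2) \<Longrightarrow> \<zeta> p q = 0" by metis
  let ?U = "\<lambda>p. f p ` ball (w p) (s p / 2)"
  have sub: "ball (w p) (s p / 2) \<subseteq> V p" for p using half(2)[of p] ball_subset_cball by blast
  have "open (?U p)" for p by (rule chart_image_open[OF *(1) open_ball sub])
  moreover have "?K \<subseteq> (\<Union>p\<in>UNIV. ?U p)"
  proof
    fix p assume "p \<in> ?K"
    have "f p (w p) \<in> ?U p" by (rule imageI) (use *(4)[of p] in simp)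
    then show "p \<in> (\<Union>p\<in>UNIV. ?U p)" using *(3)[of p] by auto
  qed
  ultimately obtain D where D: "finite D" "?K \<subseteq> (\<Union>p\<in>D. ?U p)"
    by (rule compactE_image[OF K])
  define N2 where "N2 q = (\<Sum>i\<in>UNIV. (F q $ i - F o' $ i) * (F q $ i - F o' $ i))" for q
  have N2: "N2 q = (norm (F q - F o'))\<^sup>2" for q
    by (simp add: N2_def power2_norm_eq_inner inner_vec_def)
  \<comment> \<open>Positive outside the Euclidean ball, which makes the denominator
    \<open>T\<close> positive everywhere, and zero inside it, so that the quotients still sum to 1
    where the cutoff lives.\<close>
  define \<phi> where "\<phi> q = (max 0 (N2 q - R\<^sup>2))\<^sup>2" for q
  define T where "T q = (\<Sum>p\<in>D. \<zeta> p q) + \<phi> q" for q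
  have smN2: "smk (Suc 0) N2" unfolding N2_def by (intro smk_sum smk_mult smk_diff smk_F smk_const)
  have sm\<phi>: "smk (Suc 0) \<phi>"
    unfolding smk_def
  proof safe
    fix V f assume f: "(V, f) \<in> \<A>"
    show "Ck_on (Suc 0) V (\<lambda>w. \<phi> (f w))"
      unfolding \<phi>_def
      by (intro Ck_on_compose[OF chart_open[OF f] open_UNIV _ Ck_on_max_square] Ck_on_diff Ck_on_const smkD[OF smN2 f] chart_open[OF f]) auto
  qed
  have smT: "smk (Suc 0) T" unfolding T_def by (intro smk_add smk_sum \<zeta>(1) sm\<phi>)
  have T: "T q > 0" for q
  proof (cases "q \<in> ?K")
    case True
    then obtain p where p: "p \<in> D" "q \<in> ?U p" using D(2) by blast
    have "(\<Sum>p\<in>D. \<zeta> p q) > 0" by (rule sum_pos2[OF D(1) p(1)]) (use \<zeta>(3)[OF p(2)] \<zeta>(2) in auto)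
    moreover have "\<phi> q \<ge> 0" by (simp add: \<phi>_def)
    ultimately show ?thesis by (simp add: T_def)
  next
    case False
    then have "norm (F q - F o') > R" by (simp add: dist_norm norm_minus_commute)
    then have "N2 q > R\<^sup>2" unfolding N2 using R(1) by (intro power_strict_mono) auto
    then have "\<phi> q > 0" by (simp add: \<phi>_def)
    moreover have "(\<Sum>p\<in>D. \<zeta> p q) \<ge> 0" by (intro sum_nonneg \<zeta>(2))
    ultimately show ?thesis by (simp add: T_def)
  qed
  define c where "c p q = \<zeta> p q / T q" for p q
  have smc: "smk (Suc 0) (c p)" for p unfolding c_def using less_imp_neq[OF T, symmetric] by (intro smk_divide \<zeta>(1) smT)
  have c0: "c p q \<ge> 0" for p q unfolding c_def using \<zeta>(2) T by (simp add: less_imp_le)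
  have c1: "(\<Sum>p\<in>D. c p q) = 1" if "norm (F q - F o') < R" for q
  proof -
    have "N2 q \<le> R\<^sup>2" unfolding N2 using that by (intro power_mono) auto
    then have "(\<Sum>p\<in>D. \<zeta> p q) = T q" by (simp add: T_def \<phi>_def)
    then show ?thesis unfolding c_def using T[of q] by (simp add: sum_divide_distrib[symmetric])
  qed
  define W' where "W' p i q = c p q * W i q" for p i q
  have smW': "smk (Suc 0) (W' p i)" for p i unfolding W'_def by (intro smk_mult smc W)
  have tang': "(\<Sum>i\<in>UNIV. \<nu> q $ i * W' p i q) = 0" for p q
    using tang[of q] by (simp add: W'_def mult.left_commute[of _ "c p q"] sum_distrib_left[symmetric])
  have normW': "norm (\<chi> i. W' p i q) = c p q * norm (\<chi> i. W i q)" for p q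
  proof -
    have "(\<chi> i. W' p i q) = c p q *\<^sub>R (\<chi> i. W i q)" by (simp add: W'_def vec_eq_iff)
    then show ?thesis using c0 by simp
  qed
  have each: "\<bar>\<integral>q. \<theta> (gdist o' q) * (\<Sum>i\<in>UNIV. \<delta> i (W' p i) q) \<partial>d\<sigma>\<bar>
    \<le> 4 * real CARD('n) * (\<integral>q. b (gdist o' q) * norm (\<chi> i. W' p i q) \<partial>d\<sigma>)" for p
  proof (rule chart_inequality[OF *(1,2,5) _ _ half(3) smW' tang' _ \<theta>])
    show "W' p i q = 0" if "q \<notin> f p ` cball (w p) (s p / 2)" for i q using \<zeta>(4)[OF that] by (simp add: W'_def c_def)
  qed (use *(6) in blast)+
  have m\<theta>: "\<theta> \<in> borel_measurable borel" by (rule borel_measurable_continuous_onI[OF upper_slope_continuous[OF \<theta>]])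
  have int1: "integrable d\<sigma> (\<lambda>q. \<theta> (gdist o' q) * (\<Sum>i\<in>UNIV. \<delta> i (W' p i) q))" for p
    by (rule integrable_weight[OF proper m\<theta> \<theta>D(2) R(2)]) (auto intro!: smk_continuous[of 0] smk_sum smk_\<delta> smW')
  have int2: "integrable d\<sigma> (\<lambda>q. b (gdist o' q) * norm (\<chi> i. W' p i q))" for p
  proof (rule integrable_weight[OF proper \<theta>D(1) _ R(3)])
    show "\<bar>b t\<bar> \<le> L" for t using \<theta>D(3,4)[of t] by simp
    show "continuous_on UNIV (\<lambda>q. norm (\<chi> i. W' p i q))"
      by (intro continuous_on_norm continuous_on_vec_lambda smk_continuous[OF smW'])
  qed
  have inside: "norm (F q - F o') < R" if "gdist o' q < R" for q
    using displacement_le_gdist[of q o'] that by linarith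
  have openU: "open {q. norm (F q - F o') < R}"
    by (intro open_Collect_less continuous_on_norm continuous_on_diff continuous_on_F continuous_on_const)
  have div: "(\<Sum>p\<in>D. \<Sum>i\<in>UNIV. \<delta> i (W' p i) q) = (\<Sum>i\<in>UNIV. \<delta> i (W i) q)" if q: "norm (F q - F o') < R" for q
  proof -
    have "(\<Sum>p\<in>D. \<delta> i (W' p i) q) = \<delta> i (W i) q" for i
    proof -
      have "(\<Sum>p\<in>D. \<delta> i (W' p i) q) = \<delta> i (\<lambda>q. \<Sum>p\<in>D. W' p i q) q" by (rule \<delta>_sum[symmetric]) (rule smW')
      also have "grad (\<lambda>q. \<Sum>p\<in>D. W' p i q) q = grad (W i) q"
      proof (rule grad_cong_open[OF _ W openU])
        show "smk (Suc 0) (\<lambda>q. \<Sum>p\<in>D. W' p i q)" by (intro smk_sum smW')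
        show "(\<Sum>p\<in>D. W' p i q) = W i q" if "q \<in> {q. norm (F q - F o') < R}" for q
          using c1[of q] that by (simp add: W'_def sum_distrib_right[symmetric])
      qed (use q in simp)
      then have "\<delta> i (\<lambda>q. \<Sum>p\<in>D. W' p i q) q = \<delta> i (W i) q" by (simp add: \<delta>_def)
      finally show ?thesis .
    qed
    then show ?thesis by (subst sum.swap) simp
  qed
  have "\<bar>\<integral>q. \<theta> (gdist o' q) * (\<Sum>i\<in>UNIV. \<delta> i (W i) q) \<partial>d\<sigma>\<bar>
      = \<bar>\<integral>q. (\<Sum>p\<in>D. \<theta> (gdist o' q) * (\<Sum>i\<in>UNIV. \<delta> i (W' p i) q)) \<partial>d\<sigma>\<bar>"
  proof (intro arg_cong[where f = abs] Bochner_Integration.integral_cong refl)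
    fix q
    show "\<theta> (gdist o' q) * (\<Sum>i\<in>UNIV. \<delta> i (W i) q) = (\<Sum>p\<in>D. \<theta> (gdist o' q) * (\<Sum>i\<in>UNIV. \<delta> i (W' p i) q))"
      unfolding sum_distrib_left[of _ _ D, symmetric]
    proof (cases "gdist o' q < R")
      case True
      then show "\<theta> (gdist o' q) * (\<Sum>i\<in>UNIV. \<delta> i (W i) q) = \<theta> (gdist o' q) * (\<Sum>p\<in>D. \<Sum>i\<in>UNIV. \<delta> i (W' p i) q)"
        using div[OF inside] by simp
    next
      case False
      then have "\<theta> (gdist o' q) = 0" using R(2) by simp
      then show "\<theta> (gdist o' q) * (\<Sum>i\<in>UNIV. \<delta> i (W i) q) = \<theta> (gdist o' q) * (\<Sum>p\<in>D. \<Sum>i\<in>UNIV. \<delta> i (W' p i) q)"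
        by simp
    qed
  qed
  also have "\<dots> = \<bar>\<Sum>p\<in>D. \<integral>q. \<theta> (gdist o' q) * (\<Sum>i\<in>UNIV. \<delta> i (W' p i) q) \<partial>d\<sigma>\<bar>"
    by (subst Bochner_Integration.integral_sum[OF int1]) simp
  also have "\<dots> \<le> (\<Sum>p\<in>D. \<bar>\<integral>q. \<theta> (gdist o' q) * (\<Sum>i\<in>UNIV. \<delta> i (W' p i) q) \<partial>d\<sigma>\<bar>)" by (rule sum_abs)
  also have "\<dots> \<le> (\<Sum>p\<in>D. 4 * real CARD('n) * (\<integral>q. b (gdist o' q) * norm (\<chi> i. W' p i q) \<partial>d\<sigma>))"
    by (rule sum_mono[OF each])
  also have "\<dots> = 4 * real CARD('n) * (\<integral>q. (\<Sum>p\<in>D. b (gdist o' q) * norm (\<chi> i. W' p i q)) \<partial>d\<sigma>)"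
    by (subst Bochner_Integration.integral_sum[OF int2]) (simp_all add: sum_distrib_left)
  also have "(\<integral>q. (\<Sum>p\<in>D. b (gdist o' q) * norm (\<chi> i. W' p i q)) \<partial>d\<sigma>) = (\<integral>q. b (gdist o' q) * norm (\<chi> i. W i q) \<partial>d\<sigma>)"
  proof (intro Bochner_Integration.integral_cong refl)
    fix q
    show "(\<Sum>p\<in>D. b (gdist o' q) * norm (\<chi> i. W' p i q)) = b (gdist o' q) * norm (\<chi> i. W i q)"
    proof (cases "gdist o' q < R")
      case True
      have "(\<Sum>p\<in>D. b (gdist o' q) * norm (\<chi> i. W' p i q)) = b (gdist o' q) * ((\<Sum>p\<in>D. c p q) * norm (\<chi> i. W i q))"
        by (simp only: normW' sum_distrib_left sum_distrib_right)
      then show ?thesis using c1[OF inside[OF True]] by simp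
    next
      case False
      then have "b (gdist o' q) = 0" using R(3) by simp
      then show ?thesis by simp
    qed
  qed
  finally show ?thesis .
qed

text \<open>The density is positive in a chart. This is what turns the vanishing of a continuous
  function almost everywhere into vanishing at every point.\<close>

lemma open_positive_volume:
  assumes U: "open U" "p \<in> U" shows "emeasure d\<sigma> U > 0"
proof -
  obtain V f w where f: "(V, f) \<in> \<A>" "w \<in> V" "f w = p" using atlas_cover .
  have "open (V \<inter> f -` U)" by (rule continuous_open_preimage[OF chart_cont[OF f(1)] chart_open[OF f(1)] U(1)])
  moreover have "w \<in> V \<inter> f -` U" using f U(2) by simp
  ultimately obtain r where r: "r > 0" "ball w r \<subseteq> V \<inter> f -` U" using open_contains_ball by blast
  then have rV: "ball w r \<subseteq> V" by blast
  have "emeasure d\<sigma> (f ` ball w r) = (\<integral>\<^sup>+u. ennreal (indicator V u * vol f u) * indicator (ball w r) u \<partial>lborel)"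
    unfolding emeasure_volume_chart[OF f(1) _ rV, simplified]
    by (intro nn_integral_cong) (use rV in \<open>auto simp: indicator_def\<close>)
  also have "\<dots> \<noteq> 0"
  proof
    have m: "(\<lambda>u. ennreal (indicator V u * vol f u) * indicator (ball w r) u) \<in> borel_measurable lborel"
      using vol_indicator_measurable[OF f(1)]
      by (intro borel_measurable_times_ennreal borel_measurable_indicator measurable_compose[OF _ measurable_ennreal]) auto
    assume "(\<integral>\<^sup>+u. ennreal (indicator V u * vol f u) * indicator (ball w r) u \<partial>lborel) = 0"
    then have "AE u in lborel. ennreal (indicator V u * vol f u) * indicator (ball w r) u = 0"
      using nn_integral_0_iff_AE[OF m] by blast
    then have "AE u in lborel. u \<notin> ball w r"
    proof (rule AE_mp, intro AE_I2 impI)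
      fix u assume "ennreal (indicator V u * vol f u) * indicator (ball w r) u = 0"
      then show "u \<notin> ball w r" using vol_pos[OF f(1), of u] rV by (auto simp: indicator_def split: if_splits)
    qed
    then have "emeasure lborel (ball w r) = 0" by (subst (asm) AE_iff_measurable[of "ball w r"]) auto
    then show False using content_ball_pos[OF r(1), of w] by (simp add: measure_def)
  qed
  finally have "emeasure d\<sigma> (f ` ball w r) > 0" by (simp add: zero_less_iff_neq_zero)
  also have "emeasure d\<sigma> (f ` ball w r) \<le> emeasure d\<sigma> U"
    using r(2) U(1) by (intro emeasure_mono) auto
  finally show ?thesis .
qed

end

section \<open>Parabolicity from growth\<close>

context expander
begin

text \<open>Testing the divergence inequality with \<open>\<omega>\<^sup>2\<close>, where \<open>\<omega>\<close> decreases on the dyadic shells with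
  slopes proportional to \<open>2\<^sup>k / h(2\<^sup>k\<^sup>+\<^sup>1)\<close>; the energy of \<open>\<omega>\<close> against \<open>\<bar>A\<bar>\<^sup>2\<close> is then bounded by the
  inverse of the diverging dyadic sum.\<close>

lemma parabolic_of_growth:
  fixes o' :: 'p and g :: "real \<Rightarrow> real" and B :: real
  assumes proper: "properly_immersed F"
    and \<delta>: "d0 > 0" and g: "\<And>t. t \<ge> d0 \<Longrightarrow> g t > 0" and anti: "antimono_on {d0..} (\<lambda>t. t / g t)"
    and inf: "(\<integral>\<^sup>+t\<in>{d0..}. ennreal (t / g t) \<partial>lborel) = \<infinity>" and B: "B > 0"
    and growth: "\<forall>\<^sub>F R in at_top. (\<integral>\<^sup>+q\<in>geodesic_ball \<A> F o' R. ennreal (S q * e q) \<partial>d\<sigma>) < ennreal (B * g R)"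
  shows parabolic
  unfolding parabolic_def
proof (intro allI impI)
  fix V :: "'m \<Rightarrow> 'p \<Rightarrow> real" and q :: "'p \<Rightarrow> real" and c0 p
  assume V: "\<forall>k. smk (Suc 0) (V k)" and tang: "\<forall>p. (\<Sum>k\<in>UNIV. \<nu> p $ k * V k p) = 0"
    and qc: "continuous_on UNIV q" and q0': "\<forall>p. q p \<ge> 0"
    and div: "\<forall>p. (\<Sum>k\<in>UNIV. \<delta> k (V k) p) + (1/2) * (\<Sum>k\<in>UNIV. F p $ k * V k p) = q p"
    and V2': "\<forall>p. (\<Sum>k\<in>UNIV. (V k p)\<^sup>2) \<le> c0 * q p * S p"
  have q0: "q x \<ge> 0" for x using q0' by blast
  define c where "c = max c0 0"
  have c: "c \<ge> 0" by (simp add: c_def)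
  have V2: "(\<Sum>k\<in>UNIV. (V k x)\<^sup>2) \<le> c * q x * S x" for x
  proof -
    have "c0 * (q x * S x) \<le> c * (q x * S x)"
      using q0[of x] S_nonneg[of x] by (intro mult_right_mono) (auto simp: c_def)
    moreover have "(\<Sum>k\<in>UNIV. (V k x)\<^sup>2) \<le> c0 * q x * S x" using V2' by blast
    ultimately show ?thesis unfolding mult.assoc by linarith
  qed
  obtain R0 where R0: "\<And>R. R \<ge> R0 \<Longrightarrow> (\<integral>\<^sup>+x\<in>geodesic_ball \<A> F o' R. ennreal (S x * e x) \<partial>d\<sigma>) < ennreal (B * g R)"
    using growth unfolding eventually_at_top_linorder by blast
  \<comment> \<open>From radius \<open>2 ^ K\<close> on, both the hypotheses on \<open>g\<close> and
    the growth bound are available, and the given point \<open>p\<close> lies where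
    \<open>ramp K\<close> equals 1.\<close>
  obtain K where K: "max (max d0 R0) (gdist o' p) < 2 ^ K" using real_arch_pow[of 2 "max (max d0 R0) (gdist o' p)"] by auto
  \<comment> \<open>On the shell \<open>k\<close> a weight \<open>a k\<close> costs at most a fixed
    multiple of \<open>(a k)^2 * g (2 ^ (k + 1)) / 4 ^ k\<close>. For weights of total 1 the sum of
    these costs is smallest when \<open>a k\<close> is proportional to \<open>D k\<close>, and its
    minimum is the reciprocal of the sum of the \<open>D k\<close>.\<close>
  define D where "D k = 4 ^ k / g (2 ^ (k + 1))" for k :: nat
  have pow_ge: "(2::real) ^ K \<le> 2 ^ k" if "k \<ge> K" for k using that by (intro power_increasing) auto
  have gpos: "g (2 ^ (k + 1)) > 0" if "k \<ge> K" for k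
  proof -
    have "d0 \<le> 2 ^ (k + 1)" using pow_ge[of "k + 1"] that K by simp
    then show ?thesis using g by blast
  qed
  have cont_S: "continuous_on UNIV S" and cont_e: "continuous_on UNIV e"
    using smk_continuous[OF smk_S] smk_continuous[OF smk_e] by blast+
  define W where "W k x = e x * V k x" for k x
  have smW: "smk (Suc 0) (W k)" for k unfolding W_def using V by (intro smk_mult smk_e) blast
  have tangW: "(\<Sum>k\<in>UNIV. \<nu> x $ k * W k x) = 0" for x
    using tang by (simp add: W_def mult.left_commute[of _ "e x"] sum_distrib_left[symmetric])
  have divW: "(\<Sum>k\<in>UNIV. \<delta> k (W k) x) = e x * q x" for x
    unfolding W_def using divergence_weighted[of V x] V tang div by simp
  define v where "v x = norm (\<chi> k. V k x)" for x
  have normW: "norm (\<chi> k. W k x) = e x * v x" for x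
  proof -
    have "(\<chi> k. W k x) = e x *\<^sub>R (\<chi> k. V k x)" by (simp add: W_def vec_eq_iff)
    then show ?thesis using abs_of_pos[OF e_pos[of x]] by (simp add: v_def)
  qed
  have v2: "(v x)\<^sup>2 \<le> c * q x * S x" for x
    using V2[of x] unfolding v_def power2_norm_eq_inner inner_vec_def by (simp add: power2_eq_square)
  have cont_v: "continuous_on UNIV v"
    unfolding v_def using V by (intro continuous_on_norm continuous_on_vec_lambda smk_continuous[of "Suc 0"]) blast
  define m where "m = real CARD('n)"
  have m: "m \<ge> 0" by (simp add: m_def)
  let ?d = "gdist o'"
  have mramp: "ramp j \<in> borel_measurable borel" for j
    unfolding ramp_def[abs_def] by measurable
  \<comment> \<open>A quantity independent of the number \<open>n\<close> of shells that stays below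
    the tested integral for every cutoff; the bounds with growing \<open>n\<close> force it to be
    zero.\<close>
  define I0 where "I0 = (\<integral>x. ramp K (?d x) * (e x * q x) \<partial>d\<sigma>)"
  have int0: "integrable d\<sigma> (\<lambda>x. ramp K (?d x) * (e x * q x))"
  proof (rule integrable_weight[OF proper mramp])
    show "\<bar>ramp K t\<bar> \<le> 1" for t using ramp_bounds[of K t] by simp
    show "ramp K t = 0" if "t \<ge> 3/2 * 2 ^ K" for t by (rule ramp_outside[OF that])
  qed (intro continuous_on_mult cont_e qc)
  have bound: "I0 * (\<Sum>k<n. D (K + 1 + k)) \<le> 256 * m\<^sup>2 * c * B" if n: "(\<Sum>k<n. D (K + 1 + k)) > 0" for n
  proof -
    \<comment> \<open>Starting one step after \<open>K\<close> makes the cutoff equal to 1 up to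
      \<open>2 ^ (K + 1)\<close>, beyond the support of \<open>ramp K\<close>; so
      \<open>ramp K\<close> lies below the square of the cutoff.\<close>
    define I where "I = {K + 1..<K + 1 + n}"
    define N where "N = K + 1 + n"
    define T where "T = (\<Sum>k\<in>I. D k)"
    have TT: "(\<Sum>k<n. D (K + 1 + k)) = T"
      unfolding T_def I_def by (induction n) auto
    have T: "T > 0" using n unfolding TT .
    have I: "finite I" "\<And>k. k \<in> I \<Longrightarrow> K + 1 \<le> k" "\<And>k. k \<in> I \<Longrightarrow> k < N" by (auto simp: I_def N_def)
    define a where "a k = (if k \<in> I then D k / T else 0)" for k
    have Dpos: "D k > 0" if "k \<in> I" for k using gpos[of k] I(2)[OF that] by (simp add: D_def)
    have a: "a k \<ge> 0" for k using Dpos[of k] T by (auto simp: a_def intro: divide_nonneg_pos less_imp_le)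
    have sum1: "(\<Sum>k\<in>I. a k) = 1" using T by (simp add: a_def T_def[symmetric] sum_divide_distrib[symmetric])
    note cf = cut_facts[OF a sum1]
    define \<omega> sl where "\<omega> = cut a I" and "sl = cut_slope a I"
    obtain L where L: "upper_slope (\<lambda>t. (\<omega> t)\<^sup>2) (\<lambda>t. 2 * \<omega> t * sl t) L"
      using cut_square_slope[OF I(1) a sum1] unfolding \<omega>_def sl_def by blast
    note LD = upper_slopeD[OF L]
    have vanish: "\<omega> t = 0" "sl t = 0" if "t \<ge> 2 ^ N" for t
      using cf(5)[of N t] I(3) that by (auto simp: \<omega>_def sl_def)
    have m\<omega>2: "(\<lambda>t. (\<omega> t)\<^sup>2) \<in> borel_measurable borel"
      by (rule borel_measurable_continuous_onI[OF upper_slope_continuous[OF L]])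
    have int\<omega>: "integrable d\<sigma> (\<lambda>x. (\<omega> (?d x))\<^sup>2 * (e x * q x))"
      by (rule integrable_weight[OF proper m\<omega>2 LD(2), where R = "2 ^ N"])
        (auto simp: vanish intro!: continuous_on_mult cont_e qc)
    have int_shell: "integrable d\<sigma> (\<lambda>x. indicator (shell k) (?d x) * (S x * e x))" for k
    proof (rule integrable_weight[OF proper, where \<theta> = "indicator (shell k)" and L = 1 and R = "2 * 2 ^ k"])
      show "indicat_real (shell k) t = 0" if "t \<ge> 2 * 2 ^ k" for t
      proof -
        have "(2::real) ^ k > 0" by simp
        then have "\<not> t \<le> 3/2 * 2 ^ k" using that by linarith
        then show ?thesis by simp
      qed
    qed (auto simp: indicator_def intro: continuous_on_mult cont_e cont_S)
    let ?I = "\<lambda>k. \<integral>x. indicator (shell k) (?d x) * (S x * e x) \<partial>d\<sigma>"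
    \<comment> \<open>The factor \<open>3/2\<close> is below 2, so the closed shell lies in the open
      ball of radius \<open>2 ^ (k + 1)\<close>, to which the growth hypothesis applies.\<close>
    have shell_bound: "?I k \<le> B * g (2 ^ (k + 1))" if k: "k \<ge> K" for k
    proof -
      have pos: "B * g (2 ^ (k + 1)) > 0" using gpos[OF k] B by simp
      have "ennreal (?I k)
          = (\<integral>\<^sup>+x. ennreal (indicator (shell k) (?d x) * (S x * e x)) \<partial>d\<sigma>)"
        using S_nonneg less_imp_le[OF e_pos] by (intro nn_integral_eq_integral[symmetric] int_shell) simp
      also have "\<dots> \<le> (\<integral>\<^sup>+x\<in>geodesic_ball \<A> F o' (2 ^ (k + 1)). ennreal (S x * e x) \<partial>d\<sigma>)"
      proof (rule nn_integral_mono)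
        fix x
        have "x \<in> geodesic_ball \<A> F o' (2 ^ (k + 1))" if "?d x \<in> shell k"
        proof -
          have "?d x \<le> 3/2 * 2 ^ k" "(2::real) ^ k > 0" using that by simp_all
          then have "?d x < 2 * 2 ^ k" by linarith
          then show ?thesis by (simp add: geodesic_ball_def)
        qed
        then have "indicat_real (shell k) (?d x) = 0 \<or>
            indicat_real (shell k) (?d x) = 1 \<and> x \<in> geodesic_ball \<A> F o' (2 ^ (k + 1))"
          by (metis indicator_simps)
        then show "ennreal (indicator (shell k) (?d x) * (S x * e x)) \<le> ennreal (S x * e x) * indicator (geodesic_ball \<A> F o' (2 ^ (k + 1))) x"
          by (elim disjE conjE) simp_all
      qed
      also have "\<dots> < ennreal (B * g (2 ^ (k + 1)))"
        by (rule R0) (use K pow_ge[of "k + 1"] k in simp)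
      finally show ?thesis using ennreal_le_iff[OF less_imp_le[OF pos]] less_imp_le by blast
    qed
    define J where "J = (\<integral>x. (sl (?d x))\<^sup>2 * (S x * e x) \<partial>d\<sigma>)"
    have sl2: "(sl t)\<^sup>2 * y = (\<Sum>k\<in>I. (a k * (2 / 2 ^ k))\<^sup>2 * (indicator (shell k) t * y))" for t y
      unfolding sl_def cut_slope_square[OF I(1)] sum_distrib_right by (simp add: mult.assoc)
    have intJ: "integrable d\<sigma> (\<lambda>x. (sl (?d x))\<^sup>2 * (S x * e x))"
      unfolding sl2 by (intro Bochner_Integration.integrable_sum integrable_mult_right int_shell)
    have J: "J \<le> 4 * B / T"
    proof -
      have "J = (\<Sum>k\<in>I. (a k * (2 / 2 ^ k))\<^sup>2 * ?I k)"
        unfolding J_def sl2 by (subst Bochner_Integration.integral_sum) (rule integrable_mult_right, rule int_shell, simp only: integral_mult_right_zero)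
      also have "\<dots> \<le> (\<Sum>k\<in>I. 4 * B / T\<^sup>2 * D k)"
      proof (rule sum_mono)
        fix k assume k: "k \<in> I"
        have sq: "(a k * (2 / 2 ^ k))\<^sup>2 = 4 * (D k)\<^sup>2 / (T\<^sup>2 * 4 ^ k)"
        proof -
          have "((2::real) ^ k)\<^sup>2 = 4 ^ k" by (simp add: power_mult_distrib[symmetric] power2_eq_square)
          then show ?thesis using k by (simp add: a_def power_mult_distrib power_divide)
        qed
        have "(a k * (2 / 2 ^ k))\<^sup>2 * ?I k \<le> (a k * (2 / 2 ^ k))\<^sup>2 * (B * g (2 ^ (k + 1)))"
          by (rule mult_left_mono[OF shell_bound]) (use I(2)[OF k] in auto)
        also have "\<dots> = 4 * B / T\<^sup>2 * D k * (D k * g (2 ^ (k + 1)) / 4 ^ k)"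
          unfolding sq by (simp add: power2_eq_square)
        also have "D k * g (2 ^ (k + 1)) / 4 ^ k = 1"
          using gpos[of k] I(2)[OF k] by (simp add: D_def)
        finally show "(a k * (2 / 2 ^ k))\<^sup>2 * ?I k \<le> 4 * B / T\<^sup>2 * D k" unfolding mult_1_right .
      qed
      also have "\<dots> = 4 * B / T\<^sup>2 * T" by (simp add: T_def sum_distrib_left)
      also have "\<dots> = 4 * B / T" using T by (simp add: power2_eq_square)
      finally show ?thesis .
    qed
    define Q where "Q = (\<integral>x. (\<omega> (?d x))\<^sup>2 * (e x * q x) \<partial>d\<sigma>)"
    have ineq: "\<bar>\<integral>x. (\<omega> (?d x))\<^sup>2 * (\<Sum>i\<in>UNIV. \<delta> i (W i) x) \<partial>d\<sigma>\<bar>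
      \<le> 4 * real CARD('n) * (\<integral>x. 2 * \<omega> (?d x) * sl (?d x) * norm (\<chi> i. W i x) \<partial>d\<sigma>)"
      by (rule divergence_inequality[OF proper L, of "2 ^ N"]) (simp_all add: vanish smW tangW)
    have int_b: "integrable d\<sigma> (\<lambda>x. 2 * \<omega> (?d x) * sl (?d x) * (e x * v x))"
    proof (rule integrable_weight[OF proper LD(1)])
      show "\<bar>2 * \<omega> t * sl t\<bar> \<le> L" for t using LD(3,4)[of t] by simp
      show "2 * \<omega> t * sl t = 0" if "t \<ge> 2 ^ N" for t using vanish that by simp
    qed (intro continuous_on_mult cont_e cont_v)
    have "Q \<le> 4 * m * (\<integral>x. 2 * \<omega> (?d x) * sl (?d x) * (e x * v x) \<partial>d\<sigma>)"
      using ineq unfolding divW normW Q_def m_def by linarith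
    also have "\<dots> = (\<integral>x. 4 * m * (2 * \<omega> (?d x) * sl (?d x) * (e x * v x)) \<partial>d\<sigma>)"
      by (simp only: integral_mult_right_zero)
    also have "\<dots> \<le> (\<integral>x. 1/2 * ((\<omega> (?d x))\<^sup>2 * (e x * q x)) + 32 * m\<^sup>2 * c * ((sl (?d x))\<^sup>2 * (S x * e x)) \<partial>d\<sigma>)"
    proof (rule integral_mono)
      show "integrable d\<sigma> (\<lambda>x. 4 * m * (2 * \<omega> (?d x) * sl (?d x) * (e x * v x)))"
        by (intro integrable_mult_right int_b)
      show "integrable d\<sigma> (\<lambda>x. 1/2 * ((\<omega> (?d x))\<^sup>2 * (e x * q x)) + 32 * m\<^sup>2 * c * ((sl (?d x))\<^sup>2 * (S x * e x)))"
        by (intro Bochner_Integration.integrable_add integrable_mult_right int\<omega> intJ)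
      fix x
      define w l where "w = \<omega> (?d x)" and "l = sl (?d x)"
      \<comment> \<open>Young's inequality in the form
        \<open>4 * X * Y \<le> (X + Y)\<^sup>2\<close>. \<open>X\<close> is the half of the tested
        integrand to be absorbed on the left; the factor 32 in \<open>Y\<close> is then forced by
        the square of \<open>8 * m\<close>.\<close>
      define X Y where "X = 1/2 * w\<^sup>2 * q x" and "Y = 32 * m\<^sup>2 * l\<^sup>2 * c * S x"
      have XY: "X \<ge> 0" "Y \<ge> 0" using q0 S_nonneg c by (auto simp: X_def Y_def)
      have "(8 * m * w * l * v x)\<^sup>2 = 64 * m\<^sup>2 * w\<^sup>2 * l\<^sup>2 * (v x)\<^sup>2" by (simp add: power_mult_distrib)
      also have "\<dots> \<le> 64 * m\<^sup>2 * w\<^sup>2 * l\<^sup>2 * (c * q x * S x)" by (intro mult_left_mono v2) auto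
      also have "\<dots> = 4 * X * Y" by (simp add: X_def Y_def)
      also have "\<dots> \<le> (X + Y)\<^sup>2"
        using zero_le_power2[of "X - Y"] by (simp add: power2_eq_square algebra_simps)
      finally have "8 * m * w * l * v x \<le> X + Y" by (rule power2_le_imp_le) (use XY in simp)
      then have "e x * (8 * m * w * l * v x) \<le> e x * (X + Y)" by (intro mult_left_mono) (simp_all add: less_imp_le)
      then show "4 * m * (2 * \<omega> (?d x) * sl (?d x) * (e x * v x)) \<le> 1/2 * ((\<omega> (?d x))\<^sup>2 * (e x * q x)) + 32 * m\<^sup>2 * c * ((sl (?d x))\<^sup>2 * (S x * e x))"
        unfolding w_def[symmetric] l_def[symmetric] by (simp add: X_def Y_def algebra_simps)
    qed
    also have "\<dots> = 1/2 * Q + 32 * m\<^sup>2 * c * J"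
      unfolding Q_def J_def
      by (subst Bochner_Integration.integral_add) (rule integrable_mult_right, rule int\<omega>, rule integrable_mult_right, rule intJ, simp only: integral_mult_right_zero)
    finally have "Q \<le> 64 * m\<^sup>2 * c * J" by simp
    also have "\<dots> \<le> 64 * m\<^sup>2 * c * (4 * B / T)" using J c by (intro mult_left_mono) auto
    finally have Q: "Q * T \<le> 256 * m\<^sup>2 * c * B" using T by (simp add: field_simps)
    have "I0 \<le> Q"
      unfolding I0_def Q_def
    proof (rule integral_mono[OF int0 int\<omega>])
      fix x
      have "ramp K (?d x) \<le> (\<omega> (?d x))\<^sup>2"
      proof (cases "?d x \<le> 2 ^ (K + 1)")
        case True
        then have "\<omega> (?d x) = 1" unfolding \<omega>_def by (intro cf(4)[of "K + 1"] I(2))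
        then show ?thesis using ramp_bounds(2) by simp
      next
        case False
        then have "?d x > 2 * 2 ^ K" by simp
        moreover have "(2::real) ^ K > 0" by simp
        ultimately have "3/2 * 2 ^ K \<le> ?d x" by linarith
        then show ?thesis using ramp_outside by simp
      qed
      then show "ramp K (?d x) * (e x * q x) \<le> (\<omega> (?d x))\<^sup>2 * (e x * q x)"
        using q0[of x] less_imp_le[OF e_pos[of x]] by (intro mult_right_mono mult_nonneg_nonneg)
    qed
    then show ?thesis unfolding TT using Q T mult_right_mono[of I0 Q T] by linarith
  qed
  have nonneg: "ramp K (?d x) * (e x * q x) \<ge> 0" for x
    using ramp_bounds(1) q0[of x] less_imp_le[OF e_pos[of x]] by (intro mult_nonneg_nonneg)
  have "I0 = 0"
  proof (rule ccontr)
    assume "I0 \<noteq> 0"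
    moreover have "I0 \<ge> 0" unfolding I0_def by (intro Bochner_Integration.integral_nonneg nonneg)
    ultimately have I0: "I0 > 0" by simp
    have "d0 < 2 ^ K" "(2::real) ^ K \<le> 2 ^ (K + 1)" using K pow_ge[of "K + 1"] by simp_all
    then have K1: "d0 \<le> 2 ^ (K + 1)" by linarith
    obtain n where n: "max 1 (256 * m\<^sup>2 * c * B / I0 + 1) < (\<Sum>k<n. D (K + 1 + k))"
      using dyadic_sum_unbounded[OF \<delta> g anti inf K1] unfolding D_def by blast
    then have "I0 * (\<Sum>k<n. D (K + 1 + k)) \<le> 256 * m\<^sup>2 * c * B" by (intro bound) simp
    moreover have "256 * m\<^sup>2 * c * B / I0 < (\<Sum>k<n. D (K + 1 + k))" using n by simp
    ultimately show False using I0 by (simp add: divide_less_eq mult.commute)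
  qed
  then have ae: "AE x in d\<sigma>. ramp K (?d x) * (e x * q x) = 0"
    using integral_nonneg_eq_0_iff_AE[OF int0] nonneg unfolding I0_def by simp
  show "q p = 0"
  proof (rule ccontr)
    assume "q p \<noteq> 0"
    \<comment> \<open>On this open set the cutoff is 1 and the weight is positive, so a positive
      value of the continuous function \<open>q\<close> at \<open>p\<close> would give positive
      volume to a null set.\<close>
    let ?U = "{x. ?d x < 2 ^ K} \<inter> {x. q x > 0}"
    have U: "open ?U"
      by (intro open_Int open_Collect_less continuous_on_gdist continuous_on_const qc)
    have "p \<in> ?U" using K \<open>q p \<noteq> 0\<close> q0[of p] by simp
    then have pos: "emeasure d\<sigma> ?U > 0" by (rule open_positive_volume[OF U])
    have "AE x in d\<sigma>. x \<notin> ?U"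
      using ae
    proof (rule AE_mp, intro AE_I2 impI)
      fix x assume z: "ramp K (?d x) * (e x * q x) = 0"
      show "x \<notin> ?U"
      proof
        assume "x \<in> ?U"
        then have "ramp K (?d x) = 1" "q x > 0" by (auto intro: ramp_inside)
        then show False using z e_pos[of x] by simp
      qed
    qed
    then have "emeasure d\<sigma> ?U = 0"
      using U by (subst (asm) AE_iff_measurable[of ?U]) auto
    then show False using pos by simp
  qed
qed

end

theorem theorem1p4:
  fixes \<A> :: "('n::finite, 'p::{t2_space,second_countable_topology}) atlas"
    and F \<nu> :: "'p \<Rightarrow> real ^ 'm"
    and p\<^sub>0 :: 'p and h :: "real \<Rightarrow> real" and \<delta> C :: real
  assumes "CARD('n) \<ge> 2"
    and "self_expander \<A> F \<nu>"
    and "complete_hypersurface \<A> F"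
    and "properly_immersed F"
    and "mean_convex \<A> F \<nu>"
    and "\<delta> > 0"
    and "\<And>t. t \<ge> \<delta> \<Longrightarrow> h t > 0"
    and "antimono_on {\<delta>..} (\<lambda>t. t / h t)"
    and "(\<integral>\<^sup>+t\<in>{\<delta>..}. ennreal (t / h t) \<partial>lborel) = \<infinity>"
    and "C > 0"
    and "\<forall>\<^sub>F R in at_top.
           (\<integral>\<^sup>+q\<in>geodesic_ball \<A> F p\<^sub>0 R.
              ennreal (second_fundamental_form_norm2 \<A> F \<nu> q * exp ((norm (F q))\<^sup>2 / 4))
              \<partial>volume_element \<A> F) < ennreal (C * h R)"
  shows "\<exists>a. a \<noteq> 0 \<and> bij_betw F UNIV {x. a \<bullet> x = 0}"
proof -
  interpret X: expander \<A> F \<nu> by (rule expander_of_self_expander[OF assms(2)])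
  have H: "X.H p \<ge> 0" for p
    using assms(5) by (simp add: mean_convex_def X.mean_curvature_eq X.H_def)
  have "X.S q * X.e q = second_fundamental_form_norm2 \<A> F \<nu> q * exp ((norm (F q))\<^sup>2 / 4)" for q
    by (simp add: X.second_fundamental_form_norm2_eq X.S_def X.e_def)
  then have growth: "\<forall>\<^sub>F R in at_top. (\<integral>\<^sup>+q\<in>geodesic_ball \<A> F p\<^sub>0 R. ennreal (X.S q * X.e q) \<partial>volume_element \<A> F) < ennreal (C * h R)"
    using assms(11) by simp
  have par: X.parabolic
    by (rule X.parabolic_of_growth[OF assms(4,6,7,8,9,10) growth])
  have "(\<forall>p. X.H p = 0) \<or> (\<forall>p. X.H p > 0)" using X.H_dichotomy H by blast
  then show ?thesis
  proof
    assume "\<forall>p. X.H p = 0"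
    then show ?thesis using X.minimal_cone_hyperplane[OF assms(4)] by blast
  next
    assume "\<forall>p. X.H p > 0"
    then show ?thesis using X.parabolic_not_pos[OF assms(1) par] by blast
  qed
qed

end
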